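(* Let $P$ be a $d$-dimensional hereditary polyhedral complex embedded in $\mathbb{R}^d$, with $d\ge 2$, and let $r\ge 0$ be an integer. For a finitely generated graded $R$-module $M$, let $a_{d-2}(M)$ denote the coefficient of $k^{d-2}$ in the Hilbert polynomial $HP(M,k)$. Let $\mathcal{P}$ be the set of codimension-$2$ primes associated to $N$. Then $$a_{d-2}(C^r(\hat P)) = (f_d-f_{d-1}^0)\,a_{d-2}(R)+f_{d-1}^0\,a_{d-2}(R(-r-1))+\sum_{Q\in\mathcal{P}}\ \sum_{\psi\in H_1(G_{V(Q)}(P))} a_{d-2}(R/I_\psi).$$
   Context: $P$ is a finite $d$-dimensional polyhedral complex (its faces are convex polytopes) embedded in $\mathbb{R}^d$. The dual graph of a $d$-dimensional polyhedral complex has the $d$-faces as vertices, two being joined by an edge iff they meet in a $(d-1)$-face. The star of a face $\sigma$ is the set of faces $\tau$ such that some face of $P$ contains both $\tau$ and $\sigma$. $P$ is assumed hereditary: for every nonempty face $\sigma$ of $P$ the dual graph of the star of $\sigma$ is connected. $P_d$ is the set of $d$-faces and $f_d=|P_d|$; $P^0_{d-1}$ is the set of interior $(d-1)$-faces (each lies in exactly two $d$-faces) and $f^0_{d-1}=|P^0_{d-1}|$. A facet of a $d$-face is one of its $(d-1)$-faces. Embed $P$ in the hyperplane $x_{d+1}=1$ of $\mathbb{R}^{d+1}$ and let $\hat P$ be the cone over $P$ with vertex at the origin. Let $R=\mathbb{R}[x_1,\dots,x_{d+1}]$. For a $(d-1)$-face $\tau$ of $P$, $l_\tau\in R$ is a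 nonzero homogeneous linear form vanishing on the cone over $\tau$; the linear span of $\tau$ means the hyperplane $V(l_\tau)\subset\mathbb{R}^{d+1}$. $C^r(\hat P)$ is the graded $R$-module of tuples $(f_\sigma)_{\sigma\in P_d}\in R^{f_d}$ such that $l_\tau^{r+1}$ divides $f_{\sigma_1}-f_{\sigma_2}$ whenever $\sigma_1,\sigma_2\in P_d$ share the $(d-1)$-face $\tau$; its degree-$k$ piece has the dimension of the space $C^r_k(P)$ of $C^r$ splines on $P$ of degree at most $k$. $N$ is the cokernel of the graded map $\phi=[\partial_d\mid D]: R^{f_d}\oplus R(-r-1)^{f^0_{d-1}}\to R^{f^0_{d-1}}$, where rows are indexed by $\tau\in P^0_{d-1}$; the row of $\partial_d$ indexed by $\tau$ has its only nonzero entries in the columns of the two $d$-faces containing $\tau$, these entries being $\pm(1,-1)$; and $D$ is the diagonal matrix with entries $l_\tau^{r+1}$. For a codimension-$2$ linear subspace $\xi\subset\mathbb{R}^{d+1}$, $G_\xi(P)$ is the graph whose vertices are those $\sigma\in P_d$ having a facet whose linear span contains $\xi$, two vertices being joined by an edge iff the corresponding $d$-faces share a common $(d-1)$-face whose linear span contains $\xi$ (the edge corresponds to this $(d-1)$-face). The notation $\psi\in H_1(G_\xi(P))$ means that $\psi$ is a connected component of $G_\xi(P)$ homotopic to a circle $S^1$. For such $\psi$, $I_\psi=\langle l_\tau^{r+1}\mid \tau\in P^0_{d-1}\text{ corresponds to an edge of }\psi\rangle\subset R$. For a prime $Q$ generated by two independent linear forms, $V(Q)$ is the codimension-$2$ linear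 subspace it defines; every codimension-$2$ associated prime of $N$ is of this form. $HP(M,k)$ is the polynomial in $k$ equal to $\dim_{\mathbb{R}}M_k$ for $k\gg0$, and $R(-i)$ is $R$ with generator placed in degree $i$. *)

theory Defs
  imports
    "HOL-Analysis.Analysis"
    "HOL-Algebra.QuotRing"
    "HOL-Algebra.Module"
    "HOL-Library.Poly_Mapping"
    "HOL-Library.Extended_Nat"
    "HOL-Computational_Algebra.Polynomial"
begin

section \<open>Polyhedral complexes\<close>

text \<open>
  The ambient space $\mathbb{R}^d$ is the type \<open>real ^ 'n\<close>, so \<open>d = CARD('n)\<close>. Faces of a polytope
  are those of the library relation \<open>face_of\<close>, which counts the empty set as a face.
\<close>

definition polyhedral_complex :: "(real ^ 'n) set set \<Rightarrow> bool" where
  "polyhedral_complex P \<longleftrightarrow>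
     finite P \<and>
     (\<forall>\<sigma>\<in>P. polytope \<sigma>) \<and>
     (\<forall>\<sigma>\<in>P. \<forall>\<tau>. \<tau> face_of \<sigma> \<longrightarrow> \<tau> \<in> P) \<and>
     (\<forall>\<sigma>\<in>P. \<forall>\<tau>\<in>P. \<sigma> \<inter> \<tau> face_of \<sigma> \<and> \<sigma> \<inter> \<tau> face_of \<tau>)"

definition faces :: "int \<Rightarrow> (real ^ 'n) set set \<Rightarrow> (real ^ 'n) set set" where
  "faces k P = {\<sigma> \<in> P. aff_dim \<sigma> = k}"

abbreviation cells :: "(real ^ 'n) set set \<Rightarrow> (real ^ 'n) set set" where
  "cells P \<equiv> faces (int CARD('n)) P"

abbreviation walls :: "(real ^ 'n) set set \<Rightarrow> (real ^ 'n) set set" where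
  "walls P \<equiv> faces (int CARD('n) - 1) P"

text \<open>A wall in $\mathbb{R}^d$ lies in at most two cells; those lying in two are the interior ones.\<close>

definition interior_walls :: "(real ^ 'n) set set \<Rightarrow> (real ^ 'n) set set" where
  "interior_walls P = {\<tau> \<in> walls P. card {\<sigma> \<in> cells P. \<tau> facet_of \<sigma>} = 2}"

definition star :: "(real ^ 'n) set set \<Rightarrow> (real ^ 'n) set \<Rightarrow> (real ^ 'n) set set" where
  "star P \<sigma> = {\<tau> \<in> P. \<exists>\<rho>\<in>P. \<tau> \<subseteq> \<rho> \<and> \<sigma> \<subseteq> \<rho>}"


section \<open>Graphs\<close>

text \<open>
  A graph is a pair of a vertex set and a set of edges, each edge being a set of two distinct
  vertices. The graph without vertices counts as connected, so that a hereditary complex is not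
  required to be pure.
\<close>

type_synonym 'v graph = "'v set \<times> 'v set set"

definition reach :: "'v graph \<Rightarrow> ('v \<times> 'v) set" where
  "reach G = {(u, v). u \<in> fst G \<and> v \<in> fst G \<and> (u, v) \<in> {(a, b). {a, b} \<in> snd G}\<^sup>*}"

definition connected_graph :: "'v graph \<Rightarrow> bool" where
  "connected_graph G \<longleftrightarrow> (\<forall>u\<in>fst G. \<forall>v\<in>fst G. (u, v) \<in> reach G)"

definition components_graph :: "'v graph \<Rightarrow> 'v graph set" where
  "components_graph G = {(C, {e \<in> snd G. e \<subseteq> C}) | C. C \<in> fst G // reach G}"

text \<open>
  Geometric realization by barycentric coordinates, topologized as a subspace of the product
  topology on functions; for finite graphs this is the usual topology.
\<close>

definition realization :: "'v graph \<Rightarrow> ('v \<Rightarrow> real) set" where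
  "realization G =
     {x. (\<forall>v. 0 \<le> x v) \<and>
         {v. x v \<noteq> 0} \<in> {{v} | v. v \<in> fst G} \<union> snd G \<and>
         (\<Sum>v | x v \<noteq> 0. x v) = 1}"

definition circle_components :: "'v graph \<Rightarrow> 'v graph set" where
  "circle_components G =
     {\<psi> \<in> components_graph G. realization \<psi> homotopy_eqv sphere (0::complex) 1}"

definition dual_graph :: "(real ^ 'n) set set \<Rightarrow> (real ^ 'n) set graph" where
  "dual_graph P =
     (cells P,
      {{\<sigma>, \<sigma>'} | \<sigma> \<sigma>'. \<sigma> \<in> cells P \<and> \<sigma>' \<in> cells P \<and> \<sigma> \<noteq> \<sigma>' \<and> \<sigma> \<inter> \<sigma>' \<in> walls P})"

definition hereditary :: "(real ^ 'n) set set \<Rightarrow> bool" where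
  "hereditary P \<longleftrightarrow> (\<forall>\<sigma>\<in>P. \<sigma> \<noteq> {} \<longrightarrow> connected_graph (dual_graph (star P \<sigma>)))"


section \<open>The polynomial ring\<close>

text \<open>
  Real polynomials in the variables of a finite type \<open>'x\<close>. For $\mathbb{R}^{d+1}$ the index type is
  \<open>'n option\<close>, with \<open>None\<close> in the role of the last coordinate $x_{d+1}$.
\<close>

type_synonym 'x mpoly = "('x \<Rightarrow>\<^sub>0 nat) \<Rightarrow>\<^sub>0 real"

definition mconst :: "real \<Rightarrow> 'x mpoly" where
  "mconst c = Poly_Mapping.single 0 c"

definition mpeval :: "('x::finite) mpoly \<Rightarrow> real ^ 'x \<Rightarrow> real" where
  "mpeval p x =
     (\<Sum>m\<in>Poly_Mapping.keys p. Poly_Mapping.lookup p m * (\<Prod>i\<in>UNIV. (x $ i) ^ Poly_Mapping.lookup m i))"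

definition zero_locus :: "('x::finite) mpoly set \<Rightarrow> (real ^ 'x) set" where
  "zero_locus A = {x. \<forall>p\<in>A. mpeval p x = 0}"

text \<open>The forms of degree \<open>k\<close>, including \<open>0\<close>; only \<open>0\<close> if \<open>k\<close> is negative.\<close>

definition forms :: "int \<Rightarrow> ('x::finite) mpoly set" where
  "forms k = {p. \<forall>m\<in>Poly_Mapping.keys p. int (\<Sum>i\<in>UNIV. Poly_Mapping.lookup m i) = k}"

definition poly_ring :: "'x mpoly ring" where
  "poly_ring = \<lparr>carrier = UNIV, mult = (*), one = 1, zero = 0, add = (+)\<rparr>"


section \<open>Graded modules over the polynomial ring\<close>

text \<open>\<open>piece M k\<close> is the homogeneous part of degree \<open>k\<close>.\<close>

record ('a, 'b) gmodule = "('a, 'b) module" +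
  piece :: "int \<Rightarrow> 'b set"

text \<open>
  A module record inherits the fields \<open>mult\<close> and \<open>one\<close> of a ring record; they have no meaning for
  modules and are left undefined.
\<close>

definition ring_gmodule :: "('x::finite mpoly, 'x mpoly) gmodule" where
  "ring_gmodule =
     \<lparr>carrier = UNIV, mult = undefined, one = undefined, zero = 0, add = (+),
      smult = (*), piece = forms\<rparr>"

text \<open>The free module $R^I$, its elements being the functions that vanish outside \<open>I\<close>.\<close>

definition free_gmodule :: "'i set \<Rightarrow> ('x::finite mpoly, 'i \<Rightarrow> 'x mpoly) gmodule" where
  "free_gmodule I =
     \<lparr>carrier = {f. \<forall>i. i \<notin> I \<longrightarrow> f i = 0},
      mult = undefined, one = undefined, zero = (\<lambda>_. 0), add = (\<lambda>f g i. f i + g i),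
      smult = (\<lambda>p f i. p * f i),
      piece = (\<lambda>k. {f. (\<forall>i. i \<notin> I \<longrightarrow> f i = 0) \<and> (\<forall>i\<in>I. f i \<in> forms k)})\<rparr>"

definition sub_gmodule :: "('a, 'b) gmodule \<Rightarrow> 'b set \<Rightarrow> ('a, 'b) gmodule" where
  "sub_gmodule M S = M\<lparr>carrier := S, piece := (\<lambda>k. piece M k \<inter> S)\<rparr>"

definition quot_gmodule :: "('a, 'b) gmodule \<Rightarrow> 'b set \<Rightarrow> ('a, 'b set) gmodule" where
  "quot_gmodule M S =
     \<lparr>carrier = a_rcosets\<^bsub>M\<^esub> S, mult = undefined, one = undefined, zero = S, add = set_add M,
      smult = (\<lambda>p A. \<Union>a\<in>A. S +>\<^bsub>M\<^esub> (p \<odot>\<^bsub>M\<^esub> a)),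
      piece = (\<lambda>k. (\<lambda>a. S +>\<^bsub>M\<^esub> a) ` piece M k)\<rparr>"

text \<open>The twist $M(j)$, with $M(j)_k = M_{j+k}$.\<close>

definition twist :: "('a, 'b) gmodule \<Rightarrow> int \<Rightarrow> ('a, 'b) gmodule" where
  "twist M j = M\<lparr>piece := (\<lambda>k. piece M (j + k))\<rparr>"

text \<open>
  The real vector space dimension of a degree piece, as the size of a finite basis; a real number
  acts through the corresponding constant polynomial.
\<close>

definition real_basis :: "('x mpoly, 'b) gmodule \<Rightarrow> 'b set \<Rightarrow> 'b set \<Rightarrow> bool" where
  "real_basis M V B \<longleftrightarrow>
     B \<subseteq> V \<and>
     (\<forall>v\<in>V. \<exists>!c. c \<in> B \<rightarrow>\<^sub>E (UNIV :: real set) \<and> v = (\<Oplus>\<^bsub>M\<^esub>b\<in>B. mconst (c b) \<odot>\<^bsub>M\<^esub> b))"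

definition hilbert_function :: "('x mpoly, 'b) gmodule \<Rightarrow> int \<Rightarrow> nat" where
  "hilbert_function M k = (THE n. \<exists>B. finite B \<and> card B = n \<and> real_basis M (piece M k) B)"

definition hilbert_poly :: "('x mpoly, 'b) gmodule \<Rightarrow> real poly" where
  "hilbert_poly M =
     (THE p. \<forall>\<^sub>F k in sequentially. poly p (real k) = real (hilbert_function M (int k)))"

definition hilbert_coeff :: "nat \<Rightarrow> ('x mpoly, 'b) gmodule \<Rightarrow> real" where
  "hilbert_coeff i M = poly.coeff (hilbert_poly M) i"

definition associated_primes :: "('a, 'm) ring_scheme \<Rightarrow> ('a, 'b) gmodule \<Rightarrow> 'a set set" where
  "associated_primes R M =
     {Q. primeideal Q R \<and> (\<exists>m\<in>carrier M. Q = {p \<in> carrier R. p \<odot>\<^bsub>M\<^esub> m = \<zero>\<^bsub>M\<^esub>})}"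

text \<open>The codimension (height) of a prime: the supremum of the lengths of prime chains ending there.\<close>

definition prime_codim :: "('a, 'm) ring_scheme \<Rightarrow> 'a set \<Rightarrow> enat" where
  "prime_codim R Q =
     Sup {enat n | n. \<exists>c. (\<forall>i\<le>n. primeideal (c i) R) \<and> (\<forall>i<n. c i \<subset> c (Suc i)) \<and> c n = Q}"


section \<open>Splines\<close>

text \<open>The embedding of $\mathbb{R}^d$ as the hyperplane $x_{d+1} = 1$ of $\mathbb{R}^{d+1}$.\<close>

definition lift1 :: "real ^ 'n \<Rightarrow> real ^ ('n option)" where
  "lift1 x = (\<chi> j. case j of None \<Rightarrow> 1 | Some i \<Rightarrow> x $ i)"

definition cone_over :: "(real ^ 'n) set \<Rightarrow> (real ^ ('n option)) set" where
  "cone_over \<tau> = conic hull (lift1 ` \<tau>)"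

text \<open>\<open>l\<close> is a choice of the forms $l_\tau$. The linear span of \<open>\<tau>\<close> is then \<open>zero_locus {l \<tau>}\<close>.\<close>

definition wall_forms ::
  "(real ^ 'n) set set \<Rightarrow> ((real ^ 'n) set \<Rightarrow> 'n option mpoly) \<Rightarrow> bool" where
  "wall_forms P l \<longleftrightarrow>
     (\<forall>\<tau>\<in>walls P. l \<tau> \<in> forms 1 \<and> l \<tau> \<noteq> 0 \<and> (\<forall>x\<in>cone_over \<tau>. mpeval (l \<tau>) x = 0))"

definition splines ::
  "(real ^ 'n) set set \<Rightarrow> ((real ^ 'n) set \<Rightarrow> 'n option mpoly) \<Rightarrow> nat
    \<Rightarrow> ('n option mpoly, (real ^ 'n) set \<Rightarrow> 'n option mpoly) gmodule" where
  "splines P l r =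
     sub_gmodule (free_gmodule (cells P))
       {f \<in> carrier (free_gmodule (cells P)).
          \<forall>\<sigma>\<in>cells P. \<forall>\<sigma>'\<in>cells P. \<forall>\<tau>\<in>walls P.
            \<tau> facet_of \<sigma> \<and> \<tau> facet_of \<sigma>' \<longrightarrow> l \<tau> ^ (r + 1) dvd f \<sigma> - f \<sigma>'}"

text \<open>
  \<open>bd \<tau> \<sigma>\<close> is the entry of $\partial_d$ in row \<open>\<tau>\<close> and column \<open>\<sigma>\<close>. Which of the two cells carries
  the entry \<open>1\<close> is left open, separately for each row.
\<close>

definition boundary_matrix ::
  "(real ^ 'n) set set \<Rightarrow> ((real ^ 'n) set \<Rightarrow> (real ^ 'n) set \<Rightarrow> 'n option mpoly) \<Rightarrow> bool" where
  "boundary_matrix P bd \<longleftrightarrow>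
     (\<forall>\<tau>\<in>interior_walls P. \<exists>\<sigma> \<sigma>'.
        \<sigma> \<noteq> \<sigma>' \<and> {\<rho> \<in> cells P. \<tau> facet_of \<rho>} = {\<sigma>, \<sigma>'} \<and>
        bd \<tau> \<sigma> = 1 \<and> bd \<tau> \<sigma>' = - 1 \<and> (\<forall>\<rho>\<in>cells P - {\<sigma>, \<sigma>'}. bd \<tau> \<rho> = 0))"

text \<open>The map $\phi = [\partial_d \mid D]$.\<close>

definition spline_map ::
  "(real ^ 'n) set set \<Rightarrow> ((real ^ 'n) set \<Rightarrow> 'n option mpoly)
    \<Rightarrow> ((real ^ 'n) set \<Rightarrow> (real ^ 'n) set \<Rightarrow> 'n option mpoly) \<Rightarrow> nat
    \<Rightarrow> ((real ^ 'n) set \<Rightarrow> 'n option mpoly) \<times> ((real ^ 'n) set \<Rightarrow> 'n option mpoly)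
    \<Rightarrow> (real ^ 'n) set \<Rightarrow> 'n option mpoly" where
  "spline_map P l bd r = (\<lambda>(f, g) \<tau>.
     if \<tau> \<in> interior_walls P then (\<Sum>\<sigma>\<in>cells P. bd \<tau> \<sigma> * f \<sigma>) + l \<tau> ^ (r + 1) * g \<tau> else 0)"

definition coker_N ::
  "(real ^ 'n) set set \<Rightarrow> ((real ^ 'n) set \<Rightarrow> 'n option mpoly)
    \<Rightarrow> ((real ^ 'n) set \<Rightarrow> (real ^ 'n) set \<Rightarrow> 'n option mpoly) \<Rightarrow> nat
    \<Rightarrow> ('n option mpoly, ((real ^ 'n) set \<Rightarrow> 'n option mpoly) set) gmodule" where
  "coker_N P l bd r =
     quot_gmodule (free_gmodule (interior_walls P))
       (spline_map P l bd r `
          (carrier (free_gmodule (cells P)) \<times> carrier (free_gmodule (interior_walls P))))"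

definition span_graph ::
  "(real ^ 'n) set set \<Rightarrow> ((real ^ 'n) set \<Rightarrow> 'n option mpoly) \<Rightarrow> (real ^ ('n option)) set
    \<Rightarrow> (real ^ 'n) set graph" where
  "span_graph P l \<xi> =
     ({\<sigma> \<in> cells P. \<exists>\<tau>\<in>walls P. \<tau> facet_of \<sigma> \<and> \<xi> \<subseteq> zero_locus {l \<tau>}},
      {{\<sigma>, \<sigma>'} | \<sigma> \<sigma>'. \<sigma> \<in> cells P \<and> \<sigma>' \<in> cells P \<and> \<sigma> \<noteq> \<sigma>' \<and>
         (\<exists>\<tau>\<in>walls P. \<tau> facet_of \<sigma> \<and> \<tau> facet_of \<sigma>' \<and> \<xi> \<subseteq> zero_locus {l \<tau>})})"

text \<open>The ideal $I_\psi$ of a subgraph \<open>\<psi>\<close> of \<open>span_graph P l \<xi>\<close>.\<close>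

definition edge_ideal ::
  "(real ^ 'n) set set \<Rightarrow> ((real ^ 'n) set \<Rightarrow> 'n option mpoly) \<Rightarrow> nat
    \<Rightarrow> (real ^ ('n option)) set \<Rightarrow> (real ^ 'n) set graph \<Rightarrow> 'n option mpoly set" where
  "edge_ideal P l r \<xi> \<psi> =
     Idl\<^bsub>poly_ring\<^esub> {l \<tau> ^ (r + 1) | \<tau>. \<tau> \<in> interior_walls P \<and> \<xi> \<subseteq> zero_locus {l \<tau>} \<and>
       (\<exists>\<sigma> \<sigma>'. {\<sigma>, \<sigma>'} \<in> snd \<psi> \<and> \<sigma> \<noteq> \<sigma>' \<and> \<tau> facet_of \<sigma> \<and> \<tau> facet_of \<sigma>')}"

end

theory Submission
  imports Defs "HOL-Library.Function_Algebras" "HOL-Analysis.Finite_Function_Topology" "HOL-Computational_Algebra.Primes"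
begin

text \<open>
  Rank-nullity for \<open>[\<partial>\<^sub>d | D]\<close> reduces the claim to the coefficient of \<open>k^(d-2)\<close> in the Hilbert polynomial of \<open>N\<close>.
  Multiplying by the product \<open>s\<close> of all \<open>l \<tau> ^ (r + 1)\<close> whose hyperplane misses a codimension two subspace \<open>\<xi>\<close>
  kills the rows of these \<open>\<tau>\<close>, and \<open>\<partial>\<^sub>d\<close> then reads along the components of \<open>G \<xi>\<close>. These have degree at most two: on a
  path every row dies, starting from an end, whereas on a cycle \<open>\<psi>\<close> all rows become equal up to sign to a single one,
  whose annihilator is, up to multiples of \<open>s\<close>, the ideal of \<open>\<psi>\<close>, since the signed sum around the cycle maps the image
  of \<open>\<phi>\<close> into that ideal. Adjoining \<open>s\<close> times that row for each circle therefore changes the Hilbert function by that of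
  \<open>R/I\<close> up to \<open>o(k^(d-2))\<close>. What remains is killed near every subspace of codimension at most two, so its own Hilbert
  function is \<open>o(k^(d-2))\<close>. Finally, the ideal of \<open>\<xi>\<close> is associated to \<open>N\<close> as soon as \<open>G \<xi>\<close> has a circle, by a socle
  element of \<open>R/I\<close>, and each codimension two associated prime is the ideal of such an intersection \<open>\<xi>\<close> of two hyperplanes.
\<close>

section \<open>Real vector spaces of finite dimension\<close>

text \<open>The structure of \<open>N\<close> is understood only locally, near linear subspaces, so
  errors have to be controlled globally in some other way. The measure used is growth: a graded
  quotient that is annihilated by products of linear forms, arranged so that three independent forms
  act as zero at each last stage, has Hilbert function \<open>o(k^(d+1-3))\<close>, as there are d +
  1 variables. This is the origin of the exponent d - 2. Growth alone determines no coefficient,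
  hence all Hilbert functions involved are shown to be eventually polynomial, by leading monomials
  and Dickson's lemma. For a circle the Hilbert polynomial of R/I has degree at most d - 2, so the
  degree shift caused by \<open>s\<close> alters only lower coefficients, and R/(I + (s)) is
  negligible because \<open>s\<close> contributes a third independent form. The associated primes
  require the height of the ideal of a linear subspace among all prime chains, including
  inhomogeneous ones; it is obtained by counting polynomials of bounded degree, where every strict
  inclusion of primes raises the order of growth by one.\<close>

instantiation "fun" :: (type, real_vector) real_vector
begin

definition scaleR_fun :: "real \<Rightarrow> ('a \<Rightarrow> 'b) \<Rightarrow> 'a \<Rightarrow> 'b" where
  "scaleR_fun c f = (\<lambda>x. c *\<^sub>R f x)"

instance
  by standard (simp_all add: scaleR_fun_def fun_eq_iff scaleR_add_left scaleR_add_right)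

end

lemma scaleR_fun_apply [simp]: "(c *\<^sub>R f) x = c *\<^sub>R f x"
  by (simp add: scaleR_fun_def)

text \<open>The ambient types of polynomials and tuples are infinite dimensional, and there
  \<open>dim\<close> is informative only on sets inside the span of a finite set. This side
  condition is carried along explicitly.\<close>

definition findim :: "'v::real_vector set \<Rightarrow> bool" where
  "findim V \<longleftrightarrow> (\<exists>B. finite B \<and> V \<subseteq> span B)"

lemma findim_subset: "findim W \<Longrightarrow> V \<subseteq> W \<Longrightarrow> findim V"
  unfolding findim_def by blast

lemma findim_independent: "findim V \<Longrightarrow> B \<subseteq> V \<Longrightarrow> independent B \<Longrightarrow> finite B"
  unfolding findim_def using independent_span_bound by blast

lemma findim_basis:
  assumes "findim V"
  obtains B where "finite B" "B \<subseteq> V" "independent B" "V \<subseteq> span B" "card B = dim V"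
  using basis_exists[of V] findim_independent[OF assms] by metis

lemma findim_add_image:
  assumes "linear f" "findim S" "findim V"
  shows "findim {s + f v | s v. s \<in> S \<and> v \<in> V}"
proof -
  obtain A where A: "finite A" "S \<subseteq> span A" using assms by (auto simp: findim_def)
  obtain B where B: "finite B" "V \<subseteq> span B" using assms by (auto simp: findim_def)
  have "s + f v \<in> span (A \<union> f ` B)" if "s \<in> S" "v \<in> V" for s v
  proof (rule span_add)
    show "s \<in> span (A \<union> f ` B)" using that A(2) span_mono[of A "A \<union> f ` B"] by blast
    have "f v \<in> span (f ` B)" using that B(2) linear_span_image[OF assms(1), of B] by auto
    then show "f v \<in> span (A \<union> f ` B)" using span_mono[of "f ` B" "A \<union> f ` B"] by blast
  qed
  then have "{s + f v | s v. s \<in> S \<and> v \<in> V} \<subseteq> span (A \<union> f ` B)" by clarify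
  then show ?thesis unfolding findim_def using A(1) B(1) by (intro exI[of _ "A \<union> f ` B"]) simp
qed

lemma subspace_add_image:
  assumes "linear f" "subspace S" "subspace V"
  shows "subspace {s + f v | s v. s \<in> S \<and> v \<in> V}"
proof -
  have "{s + f v | s v. s \<in> S \<and> v \<in> V} = {x + y |x y. x \<in> S \<and> y \<in> f ` V}" by auto
  then show ?thesis using subspace_sums[OF assms(2) linear_subspace_image[OF assms(1,3)]] by simp
qed

lemma subspace_preimage:
  assumes "linear f" "subspace S" "subspace V"
  shows "subspace {v \<in> V. f v \<in> S}"
  using assms unfolding subspace_def by (simp add: linear_0 linear_add linear_scale)

text \<open>Rank-nullity for the map that \<open>f\<close> induces from \<open>V\<close> to the
  quotient modulo \<open>S\<close>, phrased without quotients. The exact sequences used later are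
  instances, with \<open>f\<close> the boundary map, multiplication by a form, or the map adjoining
  multiples of one vector.\<close>

theorem dim_add_image:
  assumes f: "linear f" and S: "subspace S" "findim S" and V: "subspace V" "findim V"
  shows "dim {s + f v | s v. s \<in> S \<and> v \<in> V} + dim {v \<in> V. f v \<in> S} = dim S + dim V"
proof -
  let ?K = "{v \<in> V. f v \<in> S}"
  have subK: "subspace ?K" by (rule subspace_preimage[OF f S(1) V(1)])
  have "findim ?K" by (rule findim_subset[OF V(2)]) auto
  then obtain A where A: "finite A" "A \<subseteq> ?K" "independent A" "?K \<subseteq> span A" "card A = dim ?K"
    by (rule findim_basis)
  obtain B where B: "A \<subseteq> B" "B \<subseteq> V" "independent B" "V \<subseteq> span B"
    using maximal_independent_subset_extend[of A V] A by auto
  have finB: "finite B" using findim_independent[OF V(2) B(2,3)] .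
  obtain D where D: "finite D" "D \<subseteq> S" "independent D" "S \<subseteq> span D" "card D = dim S"
    using findim_basis[OF S(2)] .
  let ?C = "B - A"
  \<comment> \<open>\<open>A\<close> is a basis of the kernel and \<open>B\<close> extends it to
    \<open>V\<close>. The vectors \<open>f c\<close> with \<open>c\<close> outside \<open>A\<close>
    join the basis \<open>D\<close> of \<open>S\<close> one at a time; a dependence would put
    \<open>c\<close> into the span of the other members of \<open>B\<close>.\<close>
  have main: "independent (D \<union> f ` C') \<and> card (D \<union> f ` C') = card D + card C'"
    if "finite C'" "C' \<subseteq> ?C" for C'
    using that
  proof (induction C')
    case empty
    then show ?case using D by simp
  next
    case (insert c C')
    have nin: "f c \<notin> span (D \<union> f ` C')"
    proof
      assume "f c \<in> span (D \<union> f ` C')"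
      then have "f c \<in> {x + y |x y. x \<in> span D \<and> y \<in> span (f ` C')}" by (simp only: span_Un)
      then obtain s w where sw: "f c = s + w" "s \<in> span D" "w \<in> span (f ` C')"
        by blast
      then obtain v where v: "v \<in> span C'" "w = f v" using linear_span_image[OF f, of C'] by auto
      have "span D \<subseteq> S" using D(2) S(1) by (intro span_minimal)
      then have "f (c - v) \<in> S" using sw v by (simp add: linear_diff[OF f] subsetD)
      moreover have "span C' \<subseteq> V" using insert.prems B(2) V(1) by (intro span_minimal) auto
      then have "c - v \<in> V" using v insert.prems B(2) V(1) by (auto intro: subspace_diff)
      ultimately have "c - v \<in> span A" using A(4) by blast
      moreover have "c = (c - v) + v" by simp
      ultimately have "c \<in> span (A \<union> C')" using v(1) span_add[of "c - v" "A \<union> C'" v] span_mono[of A "A \<union> C'"] span_mono[of C' "A \<union> C'"]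
        by (metis Un_upper1 Un_upper2 subsetD)
      moreover have "A \<union> C' \<subseteq> B - {c}" using insert.prems insert.hyps B(1) by auto
      ultimately have "c \<in> span (B - {c})" using span_mono[of "A \<union> C'" "B - {c}"] by auto
      then show False using B(3) insert.prems unfolding dependent_def by blast
    qed
    have IH: "independent (D \<union> f ` C')" "card (D \<union> f ` C') = card D + card C'" using insert by auto
    have "independent (insert (f c) (D \<union> f ` C'))" using independent_insertI[OF nin IH(1)] .
    moreover have "f c \<notin> D \<union> f ` C'" using nin span_base[of "f c"] by metis
    moreover have "finite (D \<union> f ` C')" using insert.hyps(1) D(1) by (intro finite_UnI finite_imageI)
    ultimately have "independent (insert (f c) (D \<union> f ` C')) \<and> card (insert (f c) (D \<union> f ` C')) = card D + Suc (card C')"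
      using IH(2) by simp
    then show ?case using insert.hyps by simp
  qed
  have ind: "independent (D \<union> f ` ?C)" "card (D \<union> f ` ?C) = card D + card ?C"
    using main[of ?C] finB by auto
  have "card ?C + card A = dim V"
    using basis_card_eq_dim[OF B(2,4,3)] card_Diff_subset[OF A(1) B(1)] card_mono[OF finB B(1)] by simp
  moreover have "dim {s + f v | s v. s \<in> S \<and> v \<in> V} = card (D \<union> f ` ?C)"
  proof (rule dim_unique)
    show "D \<union> f ` ?C \<subseteq> {s + f v | s v. s \<in> S \<and> v \<in> V}"
    proof
      fix x assume "x \<in> D \<union> f ` ?C"
      then consider "x \<in> S" | v where "v \<in> V" "x = f v" using D(2) B(2) by blast
      then show "x \<in> {s + f v | s v. s \<in> S \<and> v \<in> V}"
      proof cases
        case 1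
        moreover have "x = x + f 0" by (simp add: linear_0[OF f])
        ultimately show ?thesis using V(1) subspace_0 by blast
      next
        case 2
        moreover have "x = 0 + x" by simp
        ultimately show ?thesis using S(1) subspace_0 by blast
      qed
    qed
    show "{s + f v |s v. s \<in> S \<and> v \<in> V} \<subseteq> span (D \<union> f ` (B - A))"
    proof clarify
      fix s v assume s: "s \<in> S" and v: "v \<in> V"
      have "A \<union> ?C = B" using B(1) by blast
      then have "v \<in> span (A \<union> ?C)" using v B(4) by auto
      then have "v \<in> {x + y |x y. x \<in> span A \<and> y \<in> span ?C}" by (simp only: span_Un)
      then obtain a c where ac: "v = a + c" "a \<in> span A" "c \<in> span ?C" by blast
      have "span A \<subseteq> ?K" using A(2) subK by (intro span_minimal)
      then have "f a \<in> S" using ac by blast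
      then have "s + f a \<in> span D" using subspace_add[OF S(1) s] D(4) by blast
      moreover have "f c \<in> span (f ` ?C)" using ac linear_span_image[OF f, of ?C] by auto
      moreover have "s + f v = (s + f a) + f c" using ac by (simp add: linear_add[OF f])
      ultimately have "s + f v \<in> {x + y |x y. x \<in> span D \<and> y \<in> span (f ` ?C)}" by blast
      then show "s + f v \<in> span (D \<union> f ` (B - A))" by (simp only: span_Un)
    qed
  qed (use ind in auto)
  ultimately show ?thesis using ind A(5) D(5) by linarith
qed

lemma dim_mono_findim:
  assumes "findim W" "subspace V" "V \<subseteq> W"
  shows "dim V \<le> dim W"
proof -
  obtain B where B: "finite B" "B \<subseteq> V" "independent B" "V \<subseteq> span B" "card B = dim V"
    using findim_basis[OF findim_subset[OF assms(1,3)]] .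
  obtain C where C: "finite C" "C \<subseteq> W" "independent C" "W \<subseteq> span C" "card C = dim W"
    using findim_basis[OF assms(1)] .
  have "B \<subseteq> span C" using B(2) assms(3) C(4) by blast
  then show ?thesis using independent_span_bound[OF C(1) B(3)] B(5) C(5) by simp
qed

lemma dim_zero: "dim {0::'v::real_vector} = 0"
  using dim_unique[of "{}" "{0::'v}" 0] independent_empty by simp

lemma findim_zero: "findim {0}"
  unfolding findim_def by (rule exI[of _ "{}"]) simp

lemma dim_image_kernel:
  fixes f :: "'v::real_vector \<Rightarrow> 'w::real_vector"
  assumes "linear f" "subspace V" "findim V"
  shows "dim (f ` V) + dim {v \<in> V. f v = 0} = dim V"
proof -
  have "f ` V = {s + f v |s v. s \<in> {0} \<and> v \<in> V}" by auto
  then show ?thesis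
    using dim_add_image[OF assms(1) subspace_single_0 findim_zero assms(2,3)] by (simp add: dim_zero)
qed

lemma findim_image: "linear f \<Longrightarrow> findim V \<Longrightarrow> findim (f ` V)"
  unfolding findim_def by (metis finite_imageI image_mono linear_span_image)

lemma dim_image_inj:
  assumes "linear f" "subspace V" "findim V" "inj_on f V"
  shows "dim (f ` V) = dim V"
proof -
  have "{v \<in> V. f v = 0} = {0}"
    using assms(2,4) linear_0[OF assms(1)] subspace_0[OF assms(2)] by (auto simp: inj_on_def)
  then show ?thesis using dim_image_kernel[OF assms(1-3)] by (simp add: dim_zero)
qed

text \<open>Functions vanish outside the index set, the convention of \<open>free_gmodule\<close>,
  so that tuples can be added and compared as functions.\<close>

definition prod_space :: "'i set \<Rightarrow> ('i \<Rightarrow> 'v::real_vector set) \<Rightarrow> ('i \<Rightarrow> 'v) set" where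
  "prod_space I A = {f. (\<forall>i\<in>I. f i \<in> A i) \<and> (\<forall>i. i \<notin> I \<longrightarrow> f i = 0)}"

definition unit_at :: "'i \<Rightarrow> 'v::zero \<Rightarrow> 'i \<Rightarrow> 'v" where
  "unit_at i p = (\<lambda>j. if j = i then p else 0)"

lemma linear_unit_at: "linear (unit_at i)"
  by (rule linearI) (auto simp: unit_at_def fun_eq_iff)

lemma linear_apply: "linear (\<lambda>f. f i)"
  by (rule linearI) auto

lemma subspace_prod_space: "(\<And>i. i \<in> I \<Longrightarrow> subspace (A i)) \<Longrightarrow> subspace (prod_space I A)"
  by (auto simp: prod_space_def subspace_def)

lemma prod_space_insert:
  assumes "i \<notin> I" "\<And>i. subspace (A i)"
  shows "prod_space (insert i I) A = {s + unit_at i p | s p. s \<in> prod_space I A \<and> p \<in> A i}"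
proof (intro equalityI subsetI)
  fix f assume f: "f \<in> prod_space (insert i I) A"
  have "f = f(i := 0) + unit_at i (f i)" by (auto simp: unit_at_def fun_eq_iff)
  moreover have "f(i := 0) \<in> prod_space I A" "f i \<in> A i" using f assms by (auto simp: prod_space_def)
  ultimately show "f \<in> {s + unit_at i p | s p. s \<in> prod_space I A \<and> p \<in> A i}" by blast
next
  fix f assume "f \<in> {s + unit_at i p | s p. s \<in> prod_space I A \<and> p \<in> A i}"
  then show "f \<in> prod_space (insert i I) A" using assms(1)
    by (auto simp: prod_space_def unit_at_def)
qed

lemma findim_dim_prod_space:
  assumes "finite I" "\<And>i. subspace (A i)" "\<And>i. findim (A i)"
  shows "findim (prod_space I A) \<and> dim (prod_space I A) = (\<Sum>i\<in>I. dim (A i))"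
  using assms(1)
proof (induction I)
  case empty
  have "prod_space {} A = {0}" by (auto simp: prod_space_def fun_eq_iff)
  then show ?case by (simp add: dim_zero findim_zero)
next
  case (insert i I)
  have sub: "subspace (prod_space I A)" using assms by (intro subspace_prod_space) auto
  have "{p \<in> A i. unit_at i p \<in> prod_space I A} = {0}"
    using insert.hyps subspace_0[OF assms(2)]
    by (auto simp: prod_space_def unit_at_def split: if_splits)
  then have "dim (prod_space (insert i I) A) = dim (prod_space I A) + dim (A i)"
    using dim_add_image[OF linear_unit_at sub _ assms(2,3), of i i] insert
    unfolding prod_space_insert[OF insert.hyps(2) assms(2)] by (simp add: dim_zero)
  moreover have "findim (prod_space (insert i I) A)"
    unfolding prod_space_insert[OF insert.hyps(2) assms(2)]
    using findim_add_image[OF linear_unit_at conjunct1[OF insert.IH] assms(3)] .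
  ultimately show ?case using insert by simp
qed

lemmas findim_prod_space = findim_dim_prod_space[THEN conjunct1]
lemmas dim_prod_space = findim_dim_prod_space[THEN conjunct2]

text \<open>Bridge from the sums in \<open>real_basis\<close>, which live in a module record, to
  sums in a real vector space: \<open>r\<close> picks a representative in \<open>V\<close> for each
  basis element, and \<open>h\<close> is additive on \<open>V\<close>.\<close>

lemma finsum_via_linear:
  fixes h :: "'v::real_vector \<Rightarrow> 'b" and M :: "('x mpoly, 'b) gmodule"
  assumes M: "abelian_monoid M" and V: "subspace V" "h ` V \<subseteq> carrier M"
    and h: "h 0 = \<zero>\<^bsub>M\<^esub>" "\<And>x y. x \<in> V \<Longrightarrow> y \<in> V \<Longrightarrow> h (x + y) = h x \<oplus>\<^bsub>M\<^esub> h y"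
      "\<And>c x. x \<in> V \<Longrightarrow> h (c *\<^sub>R x) = mconst c \<odot>\<^bsub>M\<^esub> h x"
    and B: "finite B" "\<And>b. b \<in> B \<Longrightarrow> r b \<in> V" "\<And>b. b \<in> B \<Longrightarrow> h (r b) = b"
  shows "(\<Oplus>\<^bsub>M\<^esub>b\<in>B. mconst (c b) \<odot>\<^bsub>M\<^esub> b) = h (\<Sum>b\<in>B. c b *\<^sub>R r b)"
proof -
  interpret abelian_monoid M by (rule M)
  have smul: "mconst (c b) \<odot>\<^bsub>M\<^esub> b = h (c b *\<^sub>R r b)" if "b \<in> B" for b
    using h(3)[OF B(2)[OF that]] B(3)[OF that] by simp
  have inV: "c b *\<^sub>R r b \<in> V" if "b \<in> B" for b using B(2)[OF that] V(1) by (simp add: subspace_scale)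
  show ?thesis using B(1) smul inV
  proof (induction B)
    case empty
    then show ?case using h by simp
  next
    case (insert b B)
    have "(\<Sum>b\<in>B. c b *\<^sub>R r b) \<in> V" using insert V(1) by (intro subspace_sum) auto
    moreover have "(\<Oplus>\<^bsub>M\<^esub>b\<in>insert b B. mconst (c b) \<odot>\<^bsub>M\<^esub> b) =
       (mconst (c b) \<odot>\<^bsub>M\<^esub> b) \<oplus>\<^bsub>M\<^esub> (\<Oplus>\<^bsub>M\<^esub>b\<in>B. mconst (c b) \<odot>\<^bsub>M\<^esub> b)"
      using insert V(2) by (intro finsum_insert) auto
    ultimately show ?case using insert h(2) by simp
  qed
qed

lemma findim_UNIV: "findim (UNIV :: 'a::euclidean_space set)"
  unfolding findim_def using span_Basis finite_Basis by blast

text \<open>A degree piece is presented as \<open>V\<close> modulo \<open>U\<close> through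
  \<open>h\<close>. Representatives of a basis complement \<open>U\<close> in \<open>V\<close>, so
  rank-nullity allows only one cardinality; this gives the definite description in
  \<open>hilbert_function\<close> a meaning.\<close>

lemma hilbert_function_transfer:
  fixes h :: "'v::real_vector \<Rightarrow> 'b" and M :: "('x mpoly, 'b) gmodule"
  assumes M: "abelian_monoid M"
    and V: "subspace V" "findim V" "piece M k = h ` V" "h ` V \<subseteq> carrier M"
    and U: "subspace U" "U \<subseteq> V"
    and h: "h 0 = \<zero>\<^bsub>M\<^esub>" "\<And>x y. x \<in> V \<Longrightarrow> y \<in> V \<Longrightarrow> h (x + y) = h x \<oplus>\<^bsub>M\<^esub> h y"
      "\<And>c x. x \<in> V \<Longrightarrow> h (c *\<^sub>R x) = mconst c \<odot>\<^bsub>M\<^esub> h x"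
    and ker: "\<And>x y. x \<in> V \<Longrightarrow> y \<in> V \<Longrightarrow> h x = h y \<longleftrightarrow> x - y \<in> U"
  shows "hilbert_function M k + dim U = dim V"
proof -
  have fU: "findim U" using findim_subset[OF V(2) U(2)] .
  have card: "card B + dim U = dim V" if B: "finite B" "real_basis M (piece M k) B" for B
  proof -
    have BV: "B \<subseteq> h ` V" using B(2) V(3) by (simp add: real_basis_def)
    define r where "r = inv_into V h"
    have r: "r b \<in> V" "h (r b) = b" if "b \<in> B" for b
      using BV that by (auto simp: r_def inv_into_into f_inv_into_f)
    define f where "f c = (\<Sum>b\<in>B. c b *\<^sub>R r b)" for c
    have lf: "linear f" unfolding f_def
      by (rule linearI) (simp_all add: scaleR_left_distrib sum.distrib scaleR_sum_right)
    have fin: "f c \<in> V" for c unfolding f_def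
      using V(1) r by (intro subspace_sum) (auto intro: subspace_scale)
    have fs: "(\<Oplus>\<^bsub>M\<^esub>b\<in>B. mconst (c b) \<odot>\<^bsub>M\<^esub> b) = h (f c)" for c
      unfolding f_def using finsum_via_linear[OF M V(1,4) h B(1) r] by auto
    have ex1: "\<exists>!c. c \<in> B \<rightarrow>\<^sub>E (UNIV::real set) \<and> h x = h (f c)" if "x \<in> V" for x
      using B(2) that unfolding real_basis_def V(3) fs by blast
    let ?W = "prod_space B (\<lambda>_. UNIV :: real set)"
    have "{s + f v |s v. s \<in> U \<and> v \<in> ?W} = V"
    proof (intro equalityI subsetI)
      fix x assume x: "x \<in> V"
      then obtain c where c: "h x = h (f c)" using ex1 by blast
      \<comment> \<open>Coefficient families in \<open>real_basis\<close> are
        \<open>undefined\<close> off \<open>B\<close>, those in \<open>prod_space\<close> are 0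
        there; the sum over \<open>B\<close> does not notice the difference.\<close>
      define c' where "c' = (\<lambda>b. if b \<in> B then c b else 0)"
      have "f c' = f c" unfolding f_def c'_def by (rule sum.cong) auto
      then have "x - f c' \<in> U" using ker[OF x fin, of c'] c by metis
      moreover have "c' \<in> ?W" by (simp add: prod_space_def c'_def)
      moreover have "x = (x - f c') + f c'" by simp
      ultimately show "x \<in> {s + f v |s v. s \<in> U \<and> v \<in> ?W}" by blast
    qed (use fin U V(1) in \<open>auto intro: subspace_add\<close>)
    moreover have "{v \<in> ?W. f v \<in> U} = {0}"
    proof -
      have "v = 0" if v: "v \<in> ?W" "f v \<in> U" for v
      proof -
        have f0: "f 0 = 0" using lf by (rule linear_0)
        have "h 0 = h (f v)" using ker[of "f v" 0] v fin subspace_0[OF V(1)] by simp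
        moreover have "f (restrict v B) = f v" "f (restrict 0 B) = f 0"
          unfolding f_def by (auto intro!: sum.cong)
        moreover have "restrict c B \<in> B \<rightarrow>\<^sub>E (UNIV::real set)" for c by simp
        ultimately have "restrict v B = restrict 0 B"
          using ex1[OF subspace_0[OF V(1)]] f0 by metis
        then have "v b = 0" if "b \<in> B" for b using that by (metis restrict_apply' zero_fun_apply)
        then show "v = 0" using v(1) by (auto simp: prod_space_def fun_eq_iff)
      qed
      moreover have "0 \<in> {v \<in> ?W. f v \<in> U}"
        using linear_0[OF lf] subspace_0[OF U(1)] by (simp add: prod_space_def)
      ultimately show ?thesis by blast
    qed
    moreover have "dim ?W = card B" "findim ?W"
      using findim_dim_prod_space[OF B(1), of "\<lambda>_. UNIV :: real set"] findim_UNIV[where 'a = real]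
      by simp_all
    ultimately show ?thesis
      using dim_add_image[OF lf U(1) fU subspace_prod_space, of B "\<lambda>_. UNIV"] by (simp add: dim_zero)
  qed
  \<comment> \<open>For existence, a basis \<open>A\<close> of \<open>U\<close> is extended to a
    basis \<open>D\<close> of \<open>V\<close>; the images of \<open>D - A\<close> form a basis of
    the piece.\<close>
  have ex: "\<exists>B. finite B \<and> real_basis M (piece M k) B"
  proof -
    obtain A where A: "finite A" "A \<subseteq> U" "independent A" "U \<subseteq> span A"
      using findim_basis[OF fU] by metis
    obtain D where D: "A \<subseteq> D" "D \<subseteq> V" "independent D" "V \<subseteq> span D"
      using maximal_independent_subset_extend[of A V] A(2,3) U(2) by (metis subset_trans)
    have finD: "finite D" using findim_independent[OF V(2) D(2,3)] .
    let ?C = "D - A"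
    have spA: "span A = U" using A U(1) span_minimal by blast
    have ind: "c b = 0" if "(\<Sum>b\<in>?C. c b *\<^sub>R b) \<in> U" "b \<in> ?C" for c b
    proof -
      have "(\<Sum>b\<in>?C. c b *\<^sub>R b) \<in> range (\<lambda>u. \<Sum>v\<in>A. u v *\<^sub>R v)"
        using that(1) spA span_finite[OF A(1)] by simp
      then obtain a where a: "(\<Sum>b\<in>?C. c b *\<^sub>R b) = (\<Sum>b\<in>A. a b *\<^sub>R b)" by blast
      have "(\<Sum>b\<in>D. (if b \<in> A then - a b else c b) *\<^sub>R b) =
         (\<Sum>b\<in>?C. (if b \<in> A then - a b else c b) *\<^sub>R b) + (\<Sum>b\<in>A. (if b \<in> A then - a b else c b) *\<^sub>R b)"
        using sum.subset_diff[OF D(1) finD] .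
      also have "\<dots> = 0" using a by (simp add: sum_negf)
      finally show ?thesis
        using independentD[OF D(3) finD subset_refl, of "\<lambda>b. if b \<in> A then - a b else c b" b] that(2)
        by simp
    qed
    have inj: "inj_on h ?C"
    proof (rule inj_onI, rule ccontr)
      fix x y assume xy: "x \<in> ?C" "y \<in> ?C" "h x = h y" "x \<noteq> y"
      then have "x - y \<in> U" using ker D(2) by blast
      moreover have "(\<Sum>b\<in>?C. (if b = x then 1 else if b = y then -1 else 0) *\<^sub>R b) = x - y"
      proof -
        have "(\<Sum>b\<in>?C. (if b = x then 1 else if b = y then -1 else 0) *\<^sub>R b)
           = (\<Sum>b\<in>?C. (if b = x then b else 0) + (if b = y then - b else 0))"
          using xy by (intro sum.cong) auto
        also have "\<dots> = x - y" using xy finD by (simp add: sum.distrib sum.delta)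
        finally show ?thesis .
      qed
      ultimately have "(\<Sum>b\<in>?C. (if b = x then 1 else if b = y then -1 else 0) *\<^sub>R b) \<in> U" by simp
      then show False using ind[of "\<lambda>b. if b = x then 1 else if b = y then -1 else 0" x] xy by simp
    qed
    define B where "B = h ` ?C"
    define r where "r = inv_into ?C h"
    have r: "r b \<in> ?C" "h (r b) = b" if "b \<in> B" for b
      using that inv_into_into[of b h ?C] by (auto simp: r_def B_def f_inv_into_f)
    have rV: "r b \<in> V" if "b \<in> B" for b using r[OF that] D(2) by blast
    have finB: "finite B" using finD by (simp add: B_def)
    have reind: "(\<Sum>b\<in>B. c b *\<^sub>R r b) = (\<Sum>b\<in>?C. c (h b) *\<^sub>R b)" for c :: "'b \<Rightarrow> real"
      unfolding B_def r_def using inj by (simp add: sum.reindex)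
    have fs: "(\<Oplus>\<^bsub>M\<^esub>b\<in>B. mconst (c b) \<odot>\<^bsub>M\<^esub> b) = h (\<Sum>b\<in>?C. c (h b) *\<^sub>R b)" for c
      using finsum_via_linear[OF M V(1,4) h finB rV r(2)] reind by auto
    have inV: "(\<Sum>b\<in>?C. c b *\<^sub>R b) \<in> V" for c
      using V(1) D(2) by (intro subspace_sum) (auto intro: subspace_scale)
    have "\<exists>!c. c \<in> B \<rightarrow>\<^sub>E (UNIV::real set) \<and> h x = h (\<Sum>b\<in>?C. c (h b) *\<^sub>R b)" if x: "x \<in> V" for x
    proof -
      have "A \<union> ?C = D" using D(1) by blast
      then have "x \<in> span (A \<union> ?C)" using x D(4) by auto
      then have "x \<in> {x + y |x y. x \<in> span A \<and> y \<in> span ?C}" by (simp only: span_Un)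
      then obtain u y where uy: "x = u + y" "u \<in> span A" "y \<in> span ?C" by blast
      then obtain c where c: "y = (\<Sum>b\<in>?C. c b *\<^sub>R b)" using span_finite[of ?C] finD by auto
      let ?c = "restrict (\<lambda>b. c (r b)) B"
      have "(\<Sum>b\<in>?C. ?c (h b) *\<^sub>R b) = y"
        unfolding c using inj by (intro sum.cong) (auto simp: B_def r_def)
      then have "h x = h (\<Sum>b\<in>?C. ?c (h b) *\<^sub>R b)"
        using ker[OF x inV[of c]] uy spA c by simp
      moreover have "c1 = c2" if c12: "c1 \<in> B \<rightarrow>\<^sub>E (UNIV::real set)" "c2 \<in> B \<rightarrow>\<^sub>E (UNIV::real set)"
        "h x = h (\<Sum>b\<in>?C. c1 (h b) *\<^sub>R b)" "h x = h (\<Sum>b\<in>?C. c2 (h b) *\<^sub>R b)" for c1 c2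
      proof -
        have "(\<Sum>b\<in>?C. c1 (h b) *\<^sub>R b) - (\<Sum>b\<in>?C. c2 (h b) *\<^sub>R b) \<in> U"
          using ker[OF inV[of "\<lambda>b. c1 (h b)"] inV[of "\<lambda>b. c2 (h b)"]] c12 by simp
        then have "(\<Sum>b\<in>?C. (c1 (h b) - c2 (h b)) *\<^sub>R b) \<in> U"
          by (simp add: scaleR_left_diff_distrib sum_subtractf)
        then have "c1 (h b) = c2 (h b)" if "b \<in> ?C" for b using ind[of "\<lambda>b. c1 (h b) - c2 (h b)"] that by simp
        then show ?thesis using c12 by (intro PiE_ext[of c1 B "\<lambda>_. UNIV"]) (auto simp: B_def)
      qed
      moreover have "?c \<in> B \<rightarrow>\<^sub>E (UNIV::real set)" by simp
      ultimately show ?thesis by blast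
    qed
    then have "real_basis M (piece M k) B"
      unfolding real_basis_def V(3) fs using D(2) by (auto simp: B_def)
    then show ?thesis using finB by blast
  qed
  then have "(THE n. \<exists>B. finite B \<and> card B = n \<and> real_basis M (piece M k) B) = dim V - dim U"
    using card by (intro the_equality) fastforce+
  then show ?thesis using ex card unfolding hilbert_function_def by fastforce
qed

section \<open>Polynomials in several variables\<close>

lemma lookup_scaleR [simp]: "Poly_Mapping.lookup (c *\<^sub>R p) m = c *\<^sub>R Poly_Mapping.lookup p m"
proof -
  have "finite {i. c *\<^sub>R Poly_Mapping.lookup p i \<noteq> 0}"
    by (rule finite_subset[of _ "Poly_Mapping.keys p"]) (auto simp: in_keys_iff)
  then show ?thesis by (simp add: scaleR_poly_mapping_def)
qed

lemma lookup_mconst_mult: "Poly_Mapping.lookup (mconst c * p) m = c * Poly_Mapping.lookup p m"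
  by (simp add: mconst_def mult_map_scale_conv_mult[symmetric] Poly_Mapping.map.rep_eq when_def)

lemma mconst_mult_scaleR: "mconst c * p = c *\<^sub>R p"
  by (rule poly_mapping_eqI) (simp add: lookup_mconst_mult)

lemma poly_mapping_sum_singles:
  assumes "finite A" "Poly_Mapping.keys p \<subseteq> A"
  shows "p = (\<Sum>m\<in>A. Poly_Mapping.single m (Poly_Mapping.lookup p m))"
proof (rule poly_mapping_eqI)
  fix k
  have "(\<Sum>m\<in>A. Poly_Mapping.lookup (Poly_Mapping.single m (Poly_Mapping.lookup p m)) k) = (\<Sum>m\<in>A. if m = k then Poly_Mapping.lookup p k else 0)"
    by (intro sum.cong) (auto simp: lookup_single when_def)
  also have "\<dots> = Poly_Mapping.lookup p k" using assms by (auto simp: in_keys_iff)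
  finally show "Poly_Mapping.lookup p k = Poly_Mapping.lookup (\<Sum>m\<in>A. Poly_Mapping.single m (Poly_Mapping.lookup p m)) k"
    by (simp add: lookup_sum)
qed

section \<open>Evaluation of polynomials at real points\<close>

definition mono_val :: "real ^ 'x::finite \<Rightarrow> ('x \<Rightarrow>\<^sub>0 nat) \<Rightarrow> real" where
  "mono_val x m = (\<Prod>i\<in>UNIV. (x $ i) ^ Poly_Mapping.lookup m i)"

lemma mono_val_add: "mono_val x (m + n) = mono_val x m * mono_val x n"
  by (simp add: mono_val_def lookup_add power_add prod.distrib)

lemma mono_val_0 [simp]: "mono_val x 0 = 1"
  by (simp add: mono_val_def)

lemma mpeval_superset:
  assumes "finite A" "Poly_Mapping.keys p \<subseteq> A"
  shows "mpeval p x = (\<Sum>m\<in>A. Poly_Mapping.lookup p m * mono_val x m)"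
  unfolding mpeval_def mono_val_def[symmetric]
  by (rule sum.mono_neutral_left) (use assms in \<open>auto simp: in_keys_iff\<close>)

lemma mpeval_add [simp]: "mpeval (p + q) x = mpeval p x + mpeval q x"
proof -
  let ?A = "Poly_Mapping.keys p \<union> Poly_Mapping.keys q"
  have "mpeval (p + q) x = (\<Sum>m\<in>?A. Poly_Mapping.lookup (p + q) m * mono_val x m)"
    by (rule mpeval_superset) (auto simp: keys_add)
  moreover have "mpeval p x = (\<Sum>m\<in>?A. Poly_Mapping.lookup p m * mono_val x m)"
    by (rule mpeval_superset) auto
  moreover have "mpeval q x = (\<Sum>m\<in>?A. Poly_Mapping.lookup q m * mono_val x m)"
    by (rule mpeval_superset) auto
  ultimately show ?thesis by (simp add: lookup_add distrib_right sum.distrib)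
qed

lemma mpeval_0 [simp]: "mpeval 0 x = 0"
  by (simp add: mpeval_def)

lemma mpeval_uminus [simp]: "mpeval (- p) x = - mpeval p x"
  using mpeval_add[of p "- p" x] by simp

lemma mpeval_diff [simp]: "mpeval (p - q) x = mpeval p x - mpeval q x"
  using mpeval_add[of p "- q" x] by simp

lemma mpeval_sum [simp]: "mpeval (\<Sum>i\<in>I. f i) x = (\<Sum>i\<in>I. mpeval (f i) x)"
  by (induction I rule: infinite_finite_induct) auto

lemma mpeval_single [simp]: "mpeval (Poly_Mapping.single m c) x = c * mono_val x m"
  using mpeval_superset[of "{m}" "Poly_Mapping.single m c" x] by simp

lemma mpeval_mult [simp]: "mpeval (p * q) x = mpeval p x * mpeval q x"
proof -
  have "p * q = (\<Sum>m\<in>Poly_Mapping.keys p. Poly_Mapping.single m (Poly_Mapping.lookup p m)) * (\<Sum>n\<in>Poly_Mapping.keys q. Poly_Mapping.single n (Poly_Mapping.lookup q n))"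
    using poly_mapping_sum_singles[of "Poly_Mapping.keys p" p] poly_mapping_sum_singles[of "Poly_Mapping.keys q" q] by simp
  also have "\<dots> = (\<Sum>m\<in>Poly_Mapping.keys p. \<Sum>n\<in>Poly_Mapping.keys q. Poly_Mapping.single (m + n) (Poly_Mapping.lookup p m * Poly_Mapping.lookup q n))"
    by (simp add: sum_product mult_single)
  finally have "mpeval (p * q) x
     = (\<Sum>m\<in>Poly_Mapping.keys p. \<Sum>n\<in>Poly_Mapping.keys q. (Poly_Mapping.lookup p m * mono_val x m) * (Poly_Mapping.lookup q n * mono_val x n))"
    by (simp add: mono_val_add mult_ac)
  also have "\<dots> = mpeval p x * mpeval q x"
    by (simp add: sum_product mpeval_def mono_val_def)
  finally show ?thesis .
qed

lemma mpeval_mconst [simp]: "mpeval (mconst c) x = c"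
  by (simp add: mconst_def)

lemma mpeval_1 [simp]: "mpeval 1 x = 1"
  using mpeval_mconst[of 1 x] by (simp add: mconst_def)

lemma mpeval_power [simp]: "mpeval (p ^ k) x = mpeval p x ^ k"
  by (induction k) auto

lemma mpeval_prod [simp]: "mpeval (\<Prod>i\<in>I. f i) x = (\<Prod>i\<in>I. mpeval (f i) x)"
  by (induction I rule: infinite_finite_induct) auto

lemma mpeval_scaleR [simp]: "mpeval (c *\<^sub>R p) x = c * mpeval p x"
  using mpeval_mult[of "mconst c" p x] by (simp add: mconst_mult_scaleR)

text \<open>Ordering monomials by their value at distinct primes gives an injective, multiplicative weight;
  it serves both as a monomial order and to separate polynomials by evaluation.\<close>

definition prime_at :: "'x::finite \<Rightarrow> nat" where
  "prime_at = (SOME e. inj e \<and> (\<forall>i. prime (e i)))"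

lemma prime_at: "inj (prime_at :: 'x::finite \<Rightarrow> nat)" "prime (prime_at (i::'x))"
proof -
  obtain B :: "nat set" where B: "finite B" "card B = CARD('x)" "B \<subseteq> {p. prime p}"
    using infinite_arbitrarily_large[OF primes_infinite] by blast
  obtain e where e: "bij_betw e (UNIV :: 'x set) B"
    using finite_same_card_bij[of "UNIV :: 'x set" B] B by auto
  then have "\<exists>e :: 'x \<Rightarrow> nat. inj e \<and> (\<forall>i. prime (e i))"
    using B by (intro exI[of _ e]) (auto simp: bij_betw_def)
  then have "inj (prime_at :: 'x \<Rightarrow> nat) \<and> (\<forall>i::'x. prime (prime_at i))"
    unfolding prime_at_def by (rule someI_ex)
  then show "inj (prime_at :: 'x::finite \<Rightarrow> nat)" "prime (prime_at (i::'x))" by auto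
qed

definition mono_weight :: "('x::finite \<Rightarrow>\<^sub>0 nat) \<Rightarrow> nat" where
  "mono_weight m = (\<Prod>i\<in>UNIV. prime_at i ^ Poly_Mapping.lookup m i)"

lemma mono_weight_pos: "mono_weight m > 0"
  unfolding mono_weight_def by (rule prod_pos) (auto intro: prime_gt_0_nat prime_at)

lemma mono_weight_add: "mono_weight (m + n) = mono_weight m * mono_weight n"
  by (simp add: mono_weight_def lookup_add power_add prod.distrib)

text \<open>By unique factorization the exponent of the variable \<open>i\<close> is the
  multiplicity of \<open>prime_at i\<close> in the weight.\<close>

lemma inj_mono_weight: "inj mono_weight"
proof (rule injI)
  fix m n :: "'x::finite \<Rightarrow>\<^sub>0 nat"
  assume eq: "mono_weight m = mono_weight n"
  have mult: "multiplicity (prime_at i) (mono_weight m) = Poly_Mapping.lookup m i" for m :: "'x \<Rightarrow>\<^sub>0 nat" and i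
  proof -
    have "mono_weight m = (\<Prod>p\<in>range (prime_at :: 'x \<Rightarrow> nat). p ^ Poly_Mapping.lookup m (the_inv prime_at p))"
      unfolding mono_weight_def using prime_at(1)[where 'x = 'x]
      by (simp add: prod.reindex the_inv_f_f)
    then have "multiplicity (prime_at i) (mono_weight m) = Poly_Mapping.lookup m (the_inv prime_at (prime_at i))"
      by (simp only:) (subst multiplicity_prod_prime_powers, auto simp: prime_at)
    then show ?thesis using prime_at(1)[where 'x = 'x] by (simp add: the_inv_f_f)
  qed
  show "m = n" by (rule poly_mapping_eqI) (metis eq mult)
qed

text \<open>At the point with coordinates \<open>prime_at i ^ t\<close> a monomial takes its weight
  to the power t as value. Distinct monomials have distinct weights, so the heaviest one dominates
  for large t and its coefficient must vanish.\<close>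

theorem mpeval_eq_0_iff: "(\<forall>x. mpeval p x = 0) \<longleftrightarrow> p = 0"
proof
  assume ev: "\<forall>x. mpeval p x = 0"
  show "p = 0"
  proof (rule ccontr)
    assume "p \<noteq> 0"
    then have ne: "Poly_Mapping.keys p \<noteq> {}" by simp
    obtain m0 where m0: "m0 \<in> Poly_Mapping.keys p" "\<And>m. m \<in> Poly_Mapping.keys p \<Longrightarrow> mono_weight m \<le> mono_weight m0"
      using Max_in[of "mono_weight ` Poly_Mapping.keys p"] Max_ge[of "mono_weight ` Poly_Mapping.keys p"] ne
      by (metis (no_types, lifting) finite_imageI finite_keys image_iff image_is_empty)
    let ?r = "\<lambda>m. real (mono_weight m) / real (mono_weight m0)"
    have key: "Poly_Mapping.lookup p m0 + (\<Sum>m\<in>Poly_Mapping.keys p - {m0}. Poly_Mapping.lookup p m * ?r m ^ t) = 0" for t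
    proof -
      define x :: "real ^ 'a" where "x = (\<chi> i. real (prime_at i) ^ t)"
      have mv: "mono_val x m = real (mono_weight m) ^ t" for m
        by (simp add: mono_val_def mono_weight_def x_def prod_power_distrib power_mult[symmetric] mult.commute)
      have "0 = (\<Sum>m\<in>Poly_Mapping.keys p. Poly_Mapping.lookup p m * real (mono_weight m) ^ t)"
        using ev mpeval_superset[of "Poly_Mapping.keys p" p x] by (simp add: mv)
      also have "\<dots> = (\<Sum>m\<in>Poly_Mapping.keys p. Poly_Mapping.lookup p m * ?r m ^ t) * real (mono_weight m0) ^ t"
        unfolding sum_distrib_right using mono_weight_pos[of m0]
        by (intro sum.cong) (auto simp: power_divide)
      finally have "(\<Sum>m\<in>Poly_Mapping.keys p. Poly_Mapping.lookup p m * ?r m ^ t) = 0" using mono_weight_pos[of m0] by auto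
      then show ?thesis using m0(1) mono_weight_pos[of m0] by (simp add: sum.remove)
    qed
    have "(\<lambda>t. Poly_Mapping.lookup p m0 + (\<Sum>m\<in>Poly_Mapping.keys p - {m0}. Poly_Mapping.lookup p m * ?r m ^ t))
        \<longlonglongrightarrow> Poly_Mapping.lookup p m0 + (\<Sum>m\<in>Poly_Mapping.keys p - {m0}. Poly_Mapping.lookup p m * 0)"
    proof (intro tendsto_intros LIMSEQ_power_zero)
      fix m assume m: "m \<in> Poly_Mapping.keys p - {m0}"
      then have "mono_weight m \<noteq> mono_weight m0" by (simp add: inj_eq[OF inj_mono_weight])
      then have "mono_weight m < mono_weight m0" using m0(2)[of m] m by simp
      then show "norm (?r m) < 1" by simp
    qed
    then have "(\<lambda>t. 0::real) \<longlonglongrightarrow> Poly_Mapping.lookup p m0" unfolding key by simp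
    then have "Poly_Mapping.lookup p m0 = 0" using LIMSEQ_unique[OF _ tendsto_const[of "0::real"]] by simp
    then show False using m0(1) by (simp add: in_keys_iff)
  qed
qed simp

lemma mpoly_eqI: "(\<And>x. mpeval p x = mpeval q x) \<Longrightarrow> p = q"
  using mpeval_eq_0_iff[of "p - q"] by simp

definition X :: "'x::finite \<Rightarrow> 'x mpoly" where
  "X i = Poly_Mapping.single (Poly_Mapping.single i 1) 1"

lemma mpeval_X [simp]: "mpeval (X i) x = x $ i"
proof -
  have "mono_val x (Poly_Mapping.single i 1) = (\<Prod>j\<in>UNIV. if j = i then x $ i else 1)"
    unfolding mono_val_def by (intro prod.cong) (auto simp: lookup_single when_def)
  then show ?thesis by (simp add: X_def)
qed

definition lin :: "real ^ 'x::finite \<Rightarrow> 'x mpoly" where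
  "lin a = (\<Sum>i\<in>UNIV. (a $ i) *\<^sub>R X i)"

lemma mpeval_lin [simp]: "mpeval (lin a) x = a \<bullet> x"
  by (simp add: lin_def inner_vec_def)

lemma lin_add: "lin (a + b) = lin a + lin b"
  by (rule mpoly_eqI) (simp add: inner_add_left)

lemma lin_scaleR: "lin (c *\<^sub>R a) = c *\<^sub>R lin a"
  by (rule mpoly_eqI) simp

lemma X_eq_lin: "X i = lin (axis i 1)"
  by (rule mpoly_eqI) (simp add: inner_axis')

section \<open>Degree, linear forms and homogeneous components\<close>

definition mdeg :: "('x::finite \<Rightarrow>\<^sub>0 nat) \<Rightarrow> nat" where
  "mdeg m = (\<Sum>i\<in>UNIV. Poly_Mapping.lookup m i)"

lemma mdeg_add: "mdeg (m + n) = mdeg m + mdeg n"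
  by (simp add: mdeg_def lookup_add sum.distrib)

lemma mdeg_single [simp]: "mdeg (Poly_Mapping.single i k) = k"
proof -
  have "mdeg (Poly_Mapping.single i k) = (\<Sum>j\<in>UNIV. if j = i then k else 0)"
    unfolding mdeg_def by (intro sum.cong) (auto simp: lookup_single when_def)
  then show ?thesis by simp
qed

lemma finite_mdeg_le: "finite {m :: 'x::finite \<Rightarrow>\<^sub>0 nat. mdeg m \<le> k}"
proof -
  have "Poly_Mapping.lookup ` {m :: 'x \<Rightarrow>\<^sub>0 nat. mdeg m \<le> k} \<subseteq> (UNIV :: 'x set) \<rightarrow>\<^sub>E {..k}"
    using member_le_sum[of _ UNIV "Poly_Mapping.lookup _ :: 'x \<Rightarrow> nat"]
    by (auto simp: mdeg_def intro: order_trans)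
  moreover have "finite ((UNIV :: 'x set) \<rightarrow>\<^sub>E {..k})" by (simp add: finite_PiE)
  ultimately have "finite (Poly_Mapping.lookup ` {m :: 'x \<Rightarrow>\<^sub>0 nat. mdeg m \<le> k})" by (rule finite_subset)
  then show ?thesis by (rule finite_imageD) (intro inj_onI poly_mapping_eq_iff[THEN iffD2])
qed

lemma forms_iff: "p \<in> forms k \<longleftrightarrow> (\<forall>m\<in>Poly_Mapping.keys p. int (mdeg m) = k)"
  by (simp add: forms_def mdeg_def)

lemma subspace_forms: "subspace (forms k)"
proof (rule subspaceI)
  fix p q :: "('a \<Rightarrow>\<^sub>0 nat) \<Rightarrow>\<^sub>0 real" assume "p \<in> forms k" "q \<in> forms k"
  then show "p + q \<in> forms k" using keys_add[of p q] by (auto simp: forms_iff)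
qed (auto simp: forms_iff in_keys_iff)

lemma subspace_span_singles:
  assumes "finite A"
  shows "findim {p :: 'a \<Rightarrow>\<^sub>0 real. Poly_Mapping.keys p \<subseteq> A}"
  unfolding findim_def
proof (intro exI conjI subsetI)
  show "finite ((\<lambda>m. Poly_Mapping.single m (1::real)) ` A)" using assms by simp
  fix p :: "'a \<Rightarrow>\<^sub>0 real" assume p: "p \<in> {p. Poly_Mapping.keys p \<subseteq> A}"
  have "Poly_Mapping.single m c = c *\<^sub>R Poly_Mapping.single m 1" for m :: 'a and c :: real
    by (rule poly_mapping_eqI) (simp add: lookup_single when_def)
  then have sc: "(\<Sum>m\<in>A. Poly_Mapping.single m (Poly_Mapping.lookup p m)) = (\<Sum>m\<in>A. Poly_Mapping.lookup p m *\<^sub>R Poly_Mapping.single m 1)"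
    by (intro sum.cong refl)
  have "p = (\<Sum>m\<in>A. Poly_Mapping.single m (Poly_Mapping.lookup p m))"
    using poly_mapping_sum_singles[OF assms] p by blast
  then have "p = (\<Sum>m\<in>A. Poly_Mapping.lookup p m *\<^sub>R Poly_Mapping.single m 1)" by (rule trans[OF _ sc])
  moreover have "(\<Sum>m\<in>A. Poly_Mapping.lookup p m *\<^sub>R Poly_Mapping.single m 1) \<in> span ((\<lambda>m. Poly_Mapping.single m (1::real)) ` A)"
    by (intro span_sum span_scale span_base) auto
  ultimately show "p \<in> span ((\<lambda>m. Poly_Mapping.single m (1::real)) ` A)" by (rule ssubst)
qed

lemma findim_forms: "findim (forms k)"
  by (rule findim_subset[OF subspace_span_singles[OF finite_mdeg_le[of "nat k"]]]) (force simp: forms_iff)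

lemma forms_0 [simp]: "0 \<in> forms k"
  by (simp add: forms_iff)

lemma forms_mult:
  assumes "p \<in> forms j" "q \<in> forms k"
  shows "p * q \<in> forms (j + k)"
  unfolding forms_iff
proof
  fix m assume "m \<in> Poly_Mapping.keys (p * q)"
  then obtain a b where "a \<in> Poly_Mapping.keys p" "b \<in> Poly_Mapping.keys q" "m = a + b" using keys_mult[of p q] by blast
  then show "int (mdeg m) = j + k" using assms by (auto simp: forms_iff mdeg_add)
qed

lemma forms_one: "1 \<in> forms 0"
  by (simp add: forms_iff mdeg_def)

lemma forms_power: "p \<in> forms j \<Longrightarrow> p ^ k \<in> forms (int k * j)"
  by (induction k) (auto simp: forms_one dest: forms_mult simp: algebra_simps)

lemma X_forms: "X i \<in> forms 1"
  by (simp add: X_def forms_iff)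

lemma lin_forms: "lin a \<in> forms 1"
  unfolding lin_def
  by (intro subspace_sum subspace_forms subspace_scale X_forms)

lemma mdeg_eq_1D:
  assumes "mdeg m = 1"
  obtains i where "m = Poly_Mapping.single i 1"
proof -
  from assms obtain i where i: "Poly_Mapping.lookup m i \<noteq> 0"
    unfolding mdeg_def by (metis (mono_tags, lifting) sum.neutral zero_neq_one)
  have "Poly_Mapping.lookup m i + (\<Sum>j\<in>UNIV - {i}. Poly_Mapping.lookup m j) = 1"
    using assms by (simp add: mdeg_def sum.remove[of UNIV i])
  then have "Poly_Mapping.lookup m i = 1" "(\<Sum>j\<in>UNIV - {i}. Poly_Mapping.lookup m j) = 0" using i by linarith+
  then have "m = Poly_Mapping.single i 1"
    by (intro poly_mapping_eqI) (auto simp: lookup_single when_def)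
  then show thesis by (rule that)
qed

text \<open>Exponents of degree one are unit vectors, so a linear form is given by a coefficient
  vector. Walls are handled through such vectors later on.\<close>

lemma forms_1_lin:
  assumes "l \<in> forms 1"
  obtains a where "l = lin a"
proof
  have inj: "inj_on (\<lambda>i::'a. Poly_Mapping.single i (1::nat)) UNIV"
  proof (rule injI)
    fix i j :: 'a assume "Poly_Mapping.single i (1::nat) = Poly_Mapping.single j 1"
    then have "Poly_Mapping.keys (Poly_Mapping.single i (1::nat)) = Poly_Mapping.keys (Poly_Mapping.single j (1::nat))"
      by (rule arg_cong)
    then show "i = j" by simp
  qed
  have supp: "Poly_Mapping.keys l \<subseteq> range (\<lambda>i. Poly_Mapping.single i 1)"
  proof
    fix m assume "m \<in> Poly_Mapping.keys l"
    then have "mdeg m = 1" using assms by (auto simp: forms_iff)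
    then show "m \<in> range (\<lambda>i. Poly_Mapping.single i 1)" by (rule mdeg_eq_1D) blast
  qed
  have sc: "Poly_Mapping.single m c = c *\<^sub>R Poly_Mapping.single m 1" for m :: "'a \<Rightarrow>\<^sub>0 nat" and c :: real
    by (rule poly_mapping_eqI) (simp add: lookup_single when_def)
  have "l = (\<Sum>m\<in>range (\<lambda>i. Poly_Mapping.single i 1). Poly_Mapping.single m (Poly_Mapping.lookup l m))"
    by (rule poly_mapping_sum_singles) (use supp in auto)
  also have "\<dots> = (\<Sum>i\<in>UNIV. Poly_Mapping.single (Poly_Mapping.single i 1) (Poly_Mapping.lookup l (Poly_Mapping.single i 1)))"
    using inj by (simp add: sum.reindex)
  also have "\<dots> = lin (\<chi> i. Poly_Mapping.lookup l (Poly_Mapping.single i 1))"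
    unfolding lin_def X_def by (simp add: sc[of _ "Poly_Mapping.lookup l _"])
  finally show "l = lin (\<chi> i. Poly_Mapping.lookup l (Poly_Mapping.single i 1))" .
qed

text \<open>Serves to replace an arbitrary preimage of a homogeneous element by a homogeneous
  one.\<close>

definition hcomp :: "int \<Rightarrow> 'x::finite mpoly \<Rightarrow> 'x mpoly" where
  "hcomp k p = (\<Sum>m\<in>{m \<in> Poly_Mapping.keys p. int (mdeg m) = k}. Poly_Mapping.single m (Poly_Mapping.lookup p m))"

lemma lookup_hcomp: "Poly_Mapping.lookup (hcomp k p) m = (if int (mdeg m) = k then Poly_Mapping.lookup p m else 0)"
proof -
  have "Poly_Mapping.lookup (hcomp k p) m = (\<Sum>m'\<in>{m \<in> Poly_Mapping.keys p. int (mdeg m) = k}. if m' = m then Poly_Mapping.lookup p m else 0)"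
    unfolding hcomp_def lookup_sum by (intro sum.cong) (auto simp: lookup_single when_def)
  then show ?thesis by (auto simp: in_keys_iff)
qed

lemma hcomp_add: "hcomp k (p + q) = hcomp k p + hcomp k q"
  by (rule poly_mapping_eqI) (simp add: lookup_hcomp lookup_add)

lemma hcomp_0 [simp]: "hcomp k 0 = 0"
  by (rule poly_mapping_eqI) (simp add: lookup_hcomp)

lemma hcomp_sum: "hcomp k (\<Sum>i\<in>I. f i) = (\<Sum>i\<in>I. hcomp k (f i))"
  by (induction I rule: infinite_finite_induct) (auto simp: hcomp_add)

lemma hcomp_forms: "hcomp k p \<in> forms k"
  by (auto simp: forms_iff in_keys_iff lookup_hcomp split: if_splits)

lemma hcomp_form: "p \<in> forms j \<Longrightarrow> hcomp k p = (if j = k then p else 0)"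
  by (rule poly_mapping_eqI) (auto simp: forms_iff lookup_hcomp in_keys_iff)

lemma hcomp_mult:
  assumes "q \<in> forms e"
  shows "hcomp k (q * p) = q * hcomp (k - e) p"
proof -
  let ?A = "Poly_Mapping.keys p"
  have p: "p = (\<Sum>m\<in>?A. Poly_Mapping.single m (Poly_Mapping.lookup p m))"
    by (rule poly_mapping_sum_singles) auto
  have "hcomp k (q * Poly_Mapping.single m c) = q * hcomp (k - e) (Poly_Mapping.single m c)" for m c
  proof -
    have s: "Poly_Mapping.single m c \<in> forms (int (mdeg m))" by (simp add: forms_iff)
    show ?thesis
      using hcomp_form[OF s, of "k - e"] hcomp_form[OF forms_mult[OF assms s], of k] by auto
  qed
  then have "hcomp k (q * (\<Sum>m\<in>?A. Poly_Mapping.single m (Poly_Mapping.lookup p m)))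
     = q * hcomp (k - e) (\<Sum>m\<in>?A. Poly_Mapping.single m (Poly_Mapping.lookup p m))"
    by (simp add: sum_distrib_left hcomp_sum)
  then show ?thesis unfolding p[symmetric] .
qed

lemma mpoly_induct [case_names const X add mult]:
  fixes p :: "'x::finite mpoly"
  assumes "\<And>c. P (mconst c)" "\<And>i. P (X i)" "\<And>p q. P p \<Longrightarrow> P q \<Longrightarrow> P (p + q)"
    "\<And>p q. P p \<Longrightarrow> P q \<Longrightarrow> P (p * q)"
  shows "P p"
proof -
  have one: "P 1" using assms(1)[of 1] by (simp add: mconst_def)
  have pow: "P (X i ^ k)" for i k by (induction k) (auto intro: one assms)
  have prod: "P (\<Prod>i\<in>I. X i ^ e i)" if "finite I" for I :: "'x set" and e
    using that by induction (auto intro: one assms pow)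
  have single: "P (Poly_Mapping.single m c)" for m c
  proof -
    have "Poly_Mapping.single m c = mconst c * (\<Prod>i\<in>UNIV. X i ^ Poly_Mapping.lookup m i)"
      by (rule mpoly_eqI) (simp add: mono_val_def)
    then show ?thesis using assms(1,4) prod by simp
  qed
  have "P (\<Sum>m\<in>A. Poly_Mapping.single m (f m))" if "finite A" for A f
    using that by induction (use assms(1)[of 0] assms(3) single in \<open>auto simp: mconst_def\<close>)
  then show ?thesis using poly_mapping_sum_singles[of "Poly_Mapping.keys p" p] by (metis finite_keys subset_refl)
qed

section \<open>Substitution and ideals of linear subspaces\<close>

definition msubst :: "('x \<Rightarrow> 'y mpoly) \<Rightarrow> 'x::finite mpoly \<Rightarrow> 'y::finite mpoly" where
  "msubst s p = (\<Sum>m\<in>Poly_Mapping.keys p. mconst (Poly_Mapping.lookup p m) * (\<Prod>i\<in>UNIV. s i ^ Poly_Mapping.lookup m i))"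

lemma mpeval_msubst [simp]: "mpeval (msubst s p) x = mpeval p (\<chi> i. mpeval (s i) x)"
  unfolding msubst_def mpeval_def[of p] by simp

text \<open>Congruence modulo an ideal is preserved by sums and products, so it suffices to know it
  for the variables. The application takes for \<open>s\<close> the coordinates of a linear
  projection onto a subspace.\<close>

lemma msubst_congruent:
  assumes J: "0 \<in> J" "\<And>p q. p \<in> J \<Longrightarrow> q \<in> J \<Longrightarrow> p + q \<in> J" "\<And>p q. p \<in> J \<Longrightarrow> q * p \<in> J"
    and s: "\<And>i. X i - s i \<in> J"
  shows "p - msubst s p \<in> J"
proof (induction p rule: mpoly_induct)
  case (const c)
  have "mconst c - msubst s (mconst c) = 0" by (rule mpoly_eqI) simp
  then show ?case using J by simp
next
  case (X i)
  have "msubst s (X i) = s i" by (rule mpoly_eqI) simp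
  then show ?case using s by simp
next
  case (add p q)
  have "p + q - msubst s (p + q) = (p - msubst s p) + (q - msubst s q)" by (rule mpoly_eqI) simp
  then show ?case by (simp only:) (intro J(2) add)
next
  case (mult p q)
  have "p * q - msubst s (p * q) = q * (p - msubst s p) + msubst s p * (q - msubst s q)"
    by (rule mpoly_eqI) (simp add: algebra_simps)
  then show ?case by (simp only:) (intro J(2,3) mult)
qed

definition van :: "(real ^ 'x::finite) set \<Rightarrow> 'x mpoly set" where
  "van V = {p. \<forall>x\<in>V. mpeval p x = 0}"

lemma mpeval_line: "\<exists>P. \<forall>t. poly P t = mpeval p (x + t *\<^sub>R v)"
proof
  let ?P = "\<Sum>m\<in>Poly_Mapping.keys p. Polynomial.smult (Poly_Mapping.lookup p m) (\<Prod>i\<in>UNIV. [:x $ i, v $ i:] ^ Poly_Mapping.lookup m i)"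
  show "\<forall>t. poly ?P t = mpeval p (x + t *\<^sub>R v)"
    by (simp add: mpeval_def poly_sum poly_prod mult.commute)
qed

text \<open>Take a point where \<open>p\<close> does not vanish and one where \<open>q\<close> does
  not. On the line through them, which stays in \<open>V\<close>, both become nonzero polynomials in
  one variable, and hence so does the product.\<close>

theorem van_prime:
  assumes "subspace V" "p * q \<in> van V"
  shows "p \<in> van V \<or> q \<in> van V"
proof (rule ccontr)
  assume "\<not> ?thesis"
  then obtain x y where xy: "x \<in> V" "mpeval p x \<noteq> 0" "y \<in> V" "mpeval q y \<noteq> 0"
    by (auto simp: van_def)
  obtain P where P: "\<And>t. poly P t = mpeval p (x + t *\<^sub>R (y - x))" using mpeval_line by metis
  obtain Q where Q: "\<And>t. poly Q t = mpeval q (x + t *\<^sub>R (y - x))" using mpeval_line by metis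
  have "P \<noteq> 0" using P[of 0] xy by auto
  moreover have "Q \<noteq> 0" using Q[of 1] xy by auto
  ultimately have "P * Q \<noteq> 0" by simp
  moreover have "poly (P * Q) t = 0" for t
  proof -
    have "x + t *\<^sub>R (y - x) \<in> V" using xy assms(1) by (simp add: subspace_add subspace_scale subspace_diff)
    then show ?thesis using assms(2) by (simp add: P Q van_def)
  qed
  ultimately show False using poly_all_0_iff_0[of "P * Q"] by blast
qed

lemma mpoly_mult_eq_0: "p * q = 0 \<longleftrightarrow> p = 0 \<or> (q :: 'x::finite mpoly) = 0"
proof
  assume "p * q = 0"
  then have "p * q \<in> van UNIV" by (simp add: van_def)
  then have "p \<in> van UNIV \<or> q \<in> van UNIV" by (intro van_prime) simp
  then show "p = 0 \<or> q = 0" using mpeval_eq_0_iff[of p] mpeval_eq_0_iff[of q] by (auto simp: van_def)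
qed auto

lemma mpoly_mult_cancel: "p \<noteq> 0 \<Longrightarrow> p * q = p * r \<longleftrightarrow> q = (r :: 'x::finite mpoly)"
  using mpoly_mult_eq_0[of p "q - r"] by (simp add: right_diff_distrib)

lemma mpoly_power_ne_0: "p \<noteq> 0 \<Longrightarrow> p ^ k \<noteq> (0 :: 'x::finite mpoly)"
proof (induction k)
  case 0
  show ?case by simp
next
  case (Suc k)
  then show ?case by (simp add: mpoly_mult_eq_0)
qed

lemma linear_mult: "linear (\<lambda>q. p * q :: 'x::finite mpoly)"
  by (rule linearI) (simp_all add: distrib_left mconst_mult_scaleR[symmetric] mult_ac)

section \<open>Growth of graded families of subspaces\<close>

definition evpoly :: "(nat \<Rightarrow> real) \<Rightarrow> bool" where
  "evpoly f \<longleftrightarrow> (\<exists>p. \<forall>\<^sub>F k in sequentially. f k = poly p (real k))"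

lemma evpolyI: "(\<And>k. k \<ge> K \<Longrightarrow> f k = poly p (real k)) \<Longrightarrow> evpoly f"
  unfolding evpoly_def eventually_sequentially by blast

lemma evpolyE:
  assumes "evpoly f"
  obtains p K where "\<And>k. k \<ge> K \<Longrightarrow> f k = poly p (real k)"
  using assms unfolding evpoly_def eventually_sequentially by blast

lemma evpoly_cong:
  assumes "evpoly f" "\<And>k. k \<ge> K \<Longrightarrow> g k = f k"
  shows "evpoly g"
proof -
  obtain p L where p: "\<And>k. k \<ge> L \<Longrightarrow> f k = poly p (real k)" using assms(1) by (rule evpolyE) blast
  show ?thesis by (rule evpolyI[of "max K L" _ p]) (simp add: p assms(2))
qed

lemma evpoly_const: "evpoly (\<lambda>_. c)"
  by (rule evpolyI[of 0 _ "[:c:]"]) simp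

lemma evpoly_add:
  assumes "evpoly f" "evpoly g"
  shows "evpoly (\<lambda>k. f k + g k)"
proof -
  obtain p K where p: "\<And>k. k \<ge> K \<Longrightarrow> f k = poly p (real k)" using assms(1) by (rule evpolyE) blast
  obtain q L where q: "\<And>k. k \<ge> L \<Longrightarrow> g k = poly q (real k)" using assms(2) by (rule evpolyE) blast
  show ?thesis by (rule evpolyI[of "max K L" _ "p + q"]) (simp add: p q)
qed

lemma evpoly_mult_left:
  assumes "evpoly f"
  shows "evpoly (\<lambda>k. c * f k)"
proof -
  obtain p K where p: "\<And>k. k \<ge> K \<Longrightarrow> f k = poly p (real k)" using assms(1) by (rule evpolyE) blast
  show ?thesis by (rule evpolyI[of K _ "Polynomial.smult c p"]) (simp add: p)
qed

lemma evpoly_diff: "evpoly f \<Longrightarrow> evpoly g \<Longrightarrow> evpoly (\<lambda>k. f k - g k)"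
  using evpoly_add[OF _ evpoly_mult_left[of g "-1"], of f] by simp

lemma evpoly_sum: "(\<And>i. i \<in> I \<Longrightarrow> evpoly (f i)) \<Longrightarrow> evpoly (\<lambda>k. \<Sum>i\<in>I. f i k)"
  by (induction I rule: infinite_finite_induct) (auto intro: evpoly_add evpoly_const)

lemma evpoly_shift:
  assumes "evpoly f"
  shows "evpoly (\<lambda>k. f (k - c))"
proof -
  obtain p K where p: "\<And>k. k \<ge> K \<Longrightarrow> f k = poly p (real k)" using assms(1) by (rule evpolyE) blast
  show ?thesis
    by (rule evpolyI[of "K + c" _ "p \<circ>\<^sub>p [:- real c, 1:]"]) (simp add: p poly_pcompose of_nat_diff)
qed

text \<open>The falling factorials have explicit antidifferences, and they span all polynomials.\<close>

definition falling :: "nat \<Rightarrow> real poly" where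
  "falling n = (\<Prod>i<n. [:- real i, 1:])"

inductive_set falling_span :: "real poly set" where
  base: "falling n \<in> falling_span"
| add: "p \<in> falling_span \<Longrightarrow> q \<in> falling_span \<Longrightarrow> p + q \<in> falling_span"
| smult: "p \<in> falling_span \<Longrightarrow> Polynomial.smult c p \<in> falling_span"

lemma falling_span_pCons: "p \<in> falling_span \<Longrightarrow> pCons 0 p \<in> falling_span"
proof (induction rule: falling_span.induct)
  case (base n)
  have "pCons 0 (falling n) = falling (Suc n) + Polynomial.smult (real n) (falling n)"
    by (rule poly_eq_poly_eq_iff[THEN iffD1]) (auto simp: falling_def fun_eq_iff algebra_simps)
  then show ?case by (metis falling_span.base falling_span.add falling_span.smult)
next
  case (add p q)
  have "pCons 0 (p + q) = pCons 0 p + pCons 0 q" by simp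
  then show ?case using add by (metis falling_span.add)
next
  case (smult p c)
  have "pCons 0 (Polynomial.smult c p) = Polynomial.smult c (pCons 0 p)" by simp
  then show ?case using smult by (metis falling_span.smult)
qed

lemma falling_span_UNIV: "p \<in> falling_span"
proof (induction p)
  case 0
  show ?case using falling_span.smult[OF falling_span.base, of 0 0] by simp
next
  case (pCons a p)
  have "pCons a p = Polynomial.smult a (falling 0) + pCons 0 p" by (simp add: falling_def one_pCons)
  then show ?case using pCons falling_span_pCons by (metis falling_span.base falling_span.add falling_span.smult)
qed

lemma falling_step: "poly (falling (Suc n)) (x + 1) = (x + 1) * poly (falling n) x"
  by (induction n) (auto simp: falling_def algebra_simps)

lemma antidifference: "\<exists>q. \<forall>x. poly q (x + 1) - poly q x = poly p x" for p :: "real poly"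
  using falling_span_UNIV[of p]
proof (induction rule: falling_span.induct)
  case (base n)
  have "poly (falling (Suc n)) x = (x - real n) * poly (falling n) x" for x
    by (simp add: falling_def algebra_simps)
  then have "poly (falling (Suc n)) (x + 1) - poly (falling (Suc n)) x = (1 + real n) * poly (falling n) x" for x
    by (simp only: falling_step) (simp add: algebra_simps)
  then have "\<forall>x. poly (Polynomial.smult (1 / (1 + real n)) (falling (Suc n))) (x + 1)
      - poly (Polynomial.smult (1 / (1 + real n)) (falling (Suc n))) x = poly (falling n) x"
    by (simp add: diff_divide_distrib[symmetric])
  then show ?case by blast
next
  case (add p q)
  then obtain p' q' where "\<forall>x. poly p' (x + 1) - poly p' x = poly p x" "\<forall>x. poly q' (x + 1) - poly q' x = poly q x"
    by auto
  then have "\<forall>x. poly (p' + q') (x + 1) - poly (p' + q') x = poly (p + q) x" by (simp add: algebra_simps)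
  then show ?case by blast
next
  case (smult p c)
  then obtain p' where "\<forall>x. poly p' (x + 1) - poly p' x = poly p x" by auto
  then have "\<forall>x. poly (Polynomial.smult c p') (x + 1) - poly (Polynomial.smult c p') x = poly (Polynomial.smult c p) x"
    by (simp add: right_diff_distrib[symmetric])
  then show ?case by blast
qed

text \<open>An antidifference of the eventual polynomial sums it up; the constant \<open>c\<close>
  absorbs the finitely many initial values.\<close>

lemma evpoly_partial_sums:
  assumes "evpoly f"
  shows "evpoly (\<lambda>k. \<Sum>t\<le>k. f t)"
proof -
  obtain p K where p: "\<And>k. k \<ge> K \<Longrightarrow> f k = poly p (real k)" using assms(1) by (rule evpolyE) blast
  obtain q where q: "\<And>x. poly q (x + 1) - poly q x = poly p x" using antidifference[of p] by blast
  define c where "c = (\<Sum>t\<le>K. f t) - poly q (real K + 1)"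
  have "(\<Sum>t\<le>k. f t) = poly q (real k + 1) + c" if "k \<ge> K" for k
    using that
  proof (induction rule: dec_induct)
    case base
    show ?case by (simp add: c_def)
  next
    case (step k)
    then show ?case using p[of "Suc k"] q[of "real k + 1"] by (simp add: algebra_simps)
  qed
  then show ?thesis
    by (intro evpolyI[of K _ "q \<circ>\<^sub>p [:1, 1:] + [:c:]"]) (simp add: poly_pcompose add.commute)
qed

section \<open>Dickson's lemma\<close>

lemma nat_mono_subseq: "\<exists>h :: nat \<Rightarrow> nat. strict_mono h \<and> mono (\<lambda>n. (s :: nat \<Rightarrow> nat) (h n))"
proof -
  obtain g :: "nat \<Rightarrow> nat" where g: "strict_mono g" "monoseq (\<lambda>n. s (g n))" using seq_monosub[of s] by blast
  show ?thesis
  proof (cases "mono (\<lambda>n. s (g n))")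
    case True
    then have "strict_mono g \<and> mono (\<lambda>n. s (g n))" using g(1) by simp
    then show ?thesis by (rule exI[of _ g])
  next
    case False
    \<comment> \<open>A decreasing sequence of natural numbers is constant once it has reached its
      minimum, so a tail of it is increasing as well.\<close>
    then have dec: "n \<le> m \<Longrightarrow> s (g m) \<le> s (g n)" for n m
      using g(2) by (auto simp: monoseq_def mono_def)
    obtain N where N: "\<And>n. s (g N) \<le> s (g n)"
      using ex_has_least_nat[of "\<lambda>_. True" 0 "\<lambda>n. s (g n)"] by auto
    have "s (g (n + N)) = s (g N)" for n using dec[of N "n + N"] N[of "n + N"] by simp
    then have "mono (\<lambda>n. s (g (n + N)))" by (simp add: mono_def)
    moreover have "strict_mono (\<lambda>n. g (n + N))" using g(1) by (simp add: strict_mono_def)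
    ultimately have "strict_mono (\<lambda>n. g (n + N)) \<and> mono (\<lambda>n. s (g (n + N)))" by simp
    then show ?thesis by (rule exI[of _ "\<lambda>n. g (n + N)"])
  qed
qed

text \<open>Passing to a further subsequence keeps the coordinates already treated monotone, so they
  can be treated one after the other.\<close>

lemma dickson_subseq:
  assumes "finite Y"
  shows "\<exists>h :: nat \<Rightarrow> nat. strict_mono h \<and> (\<forall>x\<in>Y. mono (\<lambda>n. (f :: nat \<Rightarrow> 'x \<Rightarrow> nat) (h n) x))"
  using assms
proof (induction Y)
  case empty
  show ?case by (rule exI[of _ "\<lambda>n. n"]) (simp add: strict_mono_def)
next
  case (insert x Y)
  then obtain h :: "nat \<Rightarrow> nat" where h: "strict_mono h" "\<forall>x\<in>Y. mono (\<lambda>n. f (h n) x)"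
    by (elim exE conjE)
  obtain g :: "nat \<Rightarrow> nat" where g: "strict_mono g" "mono (\<lambda>n. f (h (g n)) x)"
    using nat_mono_subseq[of "\<lambda>n. f (h n) x"] by (elim exE conjE)
  have "mono (\<lambda>n. f (h (g n)) y)" if "y \<in> Y" for y
    using h(2) that g(1) by (auto simp: mono_def strict_mono_less_eq)
  moreover have "strict_mono (\<lambda>n. h (g n))" using h(1) g(1) by (simp add: strict_mono_def)
  ultimately have "strict_mono (\<lambda>n. h (g n)) \<and> (\<forall>y\<in>insert x Y. mono (\<lambda>n. f (h (g n)) y))"
    using g(2) by simp
  then show ?case by (rule exI[of _ "\<lambda>n. h (g n)"])
qed

text \<open>The exponent set of a monomial ideal in the variables \<open>Y\<close>.\<close>

definition upset :: "'x set \<Rightarrow> ('x \<Rightarrow> nat) set \<Rightarrow> bool" where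
  "upset Y U \<longleftrightarrow> (\<forall>a\<in>U. \<forall>i. i \<notin> Y \<longrightarrow> a i = 0) \<and> (\<forall>a\<in>U. \<forall>i\<in>Y. a(i := Suc (a i)) \<in> U)"

lemma upset_mono:
  assumes "finite Y" "upset Y U" "a \<in> U" "\<And>i. i \<in> Y \<Longrightarrow> a i \<le> b i" "\<And>i. i \<notin> Y \<Longrightarrow> b i = 0"
  shows "b \<in> U"
  using assms(3,4)
proof (induction "\<Sum>i\<in>Y. b i - a i" arbitrary: a)
  case 0
  then have "b i = a i" for i
    using assms(1,2,5) by (cases "i \<in> Y") (auto simp: upset_def le_antisym)
  then have "b = a" by (rule ext)
  then show ?case using 0 by simp
next
  case (Suc n)
  then obtain i where i: "i \<in> Y" "b i - a i \<noteq> 0"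
    using sum.neutral[of Y "\<lambda>i. b i - a i"] by (metis Zero_not_Suc)
  let ?a = "a(i := Suc (a i))"
  have "(\<Sum>j\<in>Y. b j - ?a j) = (b i - Suc (a i)) + (\<Sum>j\<in>Y - {i}. b j - a j)"
    using assms(1) i by (simp add: sum.remove)
  moreover have "(\<Sum>j\<in>Y. b j - a j) = (b i - a i) + (\<Sum>j\<in>Y - {i}. b j - a j)"
    using assms(1) i by (simp add: sum.remove)
  ultimately have "n = (\<Sum>j\<in>Y. b j - ?a j)" using Suc(2) i by linarith
  moreover have "?a \<in> U" using assms(2) Suc.prems i by (auto simp: upset_def)
  moreover have "?a j \<le> b j" if "j \<in> Y" for j using Suc.prems(2)[OF that] i by (cases "j = i") auto
  ultimately show ?case using Suc(1) by blast
qed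

text \<open>Otherwise new exponents would appear forever. Along a subsequence that increases in
  every coordinate, a later exponent lies above an earlier one and therefore already belongs to the
  set it was chosen to avoid.\<close>

lemma upset_chain_stabilizes:
  assumes Y: "finite Y" and up: "\<And>j. upset Y (S j)" and inc: "\<And>j. S j \<subseteq> S (Suc j)"
  shows "\<exists>J. \<forall>j\<ge>J. S j = S J"
proof (rule ccontr)
  assume "\<not> ?thesis"
  then have "\<forall>J. \<exists>j a. J < j \<and> a \<in> S j \<and> a \<notin> S J"
    using lift_Suc_mono_le[of S, OF inc] by (metis order_le_less subsetI subset_antisym)
  then obtain j a where ja: "\<And>J. J < j J \<and> a J \<in> S (j J) \<and> a J \<notin> S J" by metis
  define J where "J n = (j ^^ n) 0" for n
  have J: "J (Suc n) = j (J n)" for n by (simp add: J_def)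
  obtain h :: "nat \<Rightarrow> nat" where h: "strict_mono h" "\<forall>x\<in>Y. mono (\<lambda>n. a (J (h n)) x)"
    using dickson_subseq[OF Y, of "\<lambda>n. a (J n)"] by (elim exE conjE)
  have "strict_mono J" unfolding strict_mono_Suc_iff using ja J by simp
  then have "J (Suc (h 0)) \<le> J (h 1)" using h(1) by (simp add: strict_mono_less_eq strict_mono_def Suc_leI)
  then have "S (J (Suc (h 0))) \<subseteq> S (J (h 1))" by (rule lift_Suc_mono_le[of S, OF inc])
  then have "a (J (h 0)) \<in> S (J (h 1))" using ja[of "J (h 0)"] J by auto
  moreover have "a (J (h 1)) i = 0" if "i \<notin> Y" for i
    using up[of "j (J (h 1))"] ja[of "J (h 1)"] that by (auto simp: upset_def)
  ultimately have "a (J (h 1)) \<in> S (J (h 1))"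
    using upset_mono[OF Y up, of "a (J (h 0))" "J (h 1)" "a (J (h 1))"] h(2) by (auto simp: mono_def)
  then show False using ja by blast
qed

lemma finite_functions_of_sum:
  assumes "finite Y"
  shows "finite {a :: 'x \<Rightarrow> nat. (\<forall>i. i \<notin> Y \<longrightarrow> a i = 0) \<and> sum a Y = k}"
proof -
  have "{a :: 'x \<Rightarrow> nat. (\<forall>i. i \<notin> Y \<longrightarrow> a i = 0) \<and> sum a Y = k}
     \<subseteq> {a. \<forall>i. (i \<in> Y \<longrightarrow> a i \<in> {..k}) \<and> (i \<notin> Y \<longrightarrow> a i = 0)}"
    using member_le_sum[of _ Y] assms by auto
  then show ?thesis by (rule finite_subset) (rule finite_set_of_finite_funs[OF assms], simp)
qed

text \<open>Slicing by the exponent of one variable gives an increasing chain of upsets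
  \<open>S j\<close> in fewer variables, constant from some \<open>J\<close> on. The count is thus a
  sum of finitely many shifted counts plus shifted partial sums of the count of
  \<open>S J\<close>.\<close>

theorem evpoly_upset:
  assumes "finite Y" "upset Y U"
  shows "evpoly (\<lambda>k. real (card {a \<in> U. sum a Y = k}))"
  using assms
proof (induction Y arbitrary: U)
  case empty
  show ?case by (rule evpolyI[of 1 _ 0]) simp
next
  case (insert x Y)
  define S where "S j = {b. (\<forall>i. i \<notin> Y \<longrightarrow> b i = 0) \<and> b(x := j) \<in> U}" for j
  let ?c = "\<lambda>j k. card {b \<in> S j. sum b Y = k}"
  have up: "upset Y (S j)" for j
    unfolding upset_def
  proof (intro conjI ballI allI impI)
    fix b i assume b: "b \<in> S j" "i \<in> Y"
    have "(b(x := j))(i := Suc ((b(x := j)) i)) \<in> U"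
      using insert.prems b unfolding upset_def S_def by blast
    moreover have "(b(x := j))(i := Suc ((b(x := j)) i)) = (b(i := Suc (b i)))(x := j)"
      using b insert.hyps by (auto simp: fun_eq_iff)
    ultimately show "b(i := Suc (b i)) \<in> S j" using b by (auto simp: S_def)
  qed (auto simp: S_def)
  have inc: "S j \<subseteq> S (Suc j)" for j
  proof
    fix b assume b: "b \<in> S j"
    have "(b(x := j))(x := Suc ((b(x := j)) x)) \<in> U" using insert.prems b by (auto simp: upset_def S_def)
    then show "b \<in> S (Suc j)" using b by (auto simp: S_def)
  qed
  obtain J where J: "\<And>j. j \<ge> J \<Longrightarrow> S j = S J" using upset_chain_stabilizes[where S = S, OF insert.hyps(1) up inc] by blast
  have card: "card {a \<in> U. sum a (insert x Y) = k} = (\<Sum>j\<le>k. ?c j (k - j))" for k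
  proof -
    have "bij_betw (\<lambda>a. (a x, a(x := 0))) {a \<in> U. sum a (insert x Y) = k}
        (SIGMA j:{..k}. {b \<in> S j. sum b Y = k - j})"
    proof (rule bij_betwI[where g = "\<lambda>(j, b). b(x := j)"])
      show "(\<lambda>a. (a x, a(x := 0))) \<in> {a \<in> U. sum a (insert x Y) = k} \<rightarrow> (SIGMA j:{..k}. {b \<in> S j. sum b Y = k - j})"
      proof
        fix a assume a: "a \<in> {a \<in> U. sum a (insert x Y) = k}"
        have "sum (a(x := 0)) Y = sum a Y" using insert.hyps by (intro sum.cong) auto
        moreover have "sum a (insert x Y) = a x + sum a Y" using insert.hyps by simp
        moreover have "\<forall>i. i \<notin> Y \<longrightarrow> (a(x := 0)) i = 0" using a insert.prems by (auto simp: upset_def)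
        moreover have "(a(x := 0))(x := a x) = a" by simp
        ultimately show "(a x, a(x := 0)) \<in> (SIGMA j:{..k}. {b \<in> S j. sum b Y = k - j})"
          using a by (auto simp: S_def)
      qed
      show "(\<lambda>(j, b). b(x := j)) \<in> (SIGMA j:{..k}. {b \<in> S j. sum b Y = k - j}) \<rightarrow> {a \<in> U. sum a (insert x Y) = k}"
      proof
        fix y assume "y \<in> (SIGMA j:{..k}. {b \<in> S j. sum b Y = k - j})"
        then obtain j b where jb: "y = (j, b)" "j \<le> k" "b \<in> S j" "sum b Y = k - j" by blast
        have "sum (b(x := j)) Y = sum b Y" using insert.hyps by (intro sum.cong) auto
        then have "sum (b(x := j)) (insert x Y) = k" using insert.hyps jb by simp
        then show "(\<lambda>(j, b). b(x := j)) y \<in> {a \<in> U. sum a (insert x Y) = k}" using jb by (simp add: S_def)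
      qed
      show "(\<lambda>(j, b). b(x := j)) (a x, a(x := 0)) = a" for a :: "'a \<Rightarrow> nat" by simp
      fix y assume y: "y \<in> (SIGMA j:{..k}. {b \<in> S j. sum b Y = k - j})"
      then obtain j b where jb: "y = (j, b)" "b \<in> S j" by blast
      then have "b x = 0" using insert.hyps by (auto simp: S_def)
      then have "b(x := 0) = b" by auto
      then show "(\<lambda>a. (a x, a(x := 0))) ((\<lambda>(j, b). b(x := j)) y) = y" using jb by simp
    qed
    then have "card {a \<in> U. sum a (insert x Y) = k} = card (SIGMA j:{..k}. {b \<in> S j. sum b Y = k - j})"
      by (rule bij_betw_same_card)
    also have "\<dots> = (\<Sum>j\<le>k. ?c j (k - j))"
    proof (rule card_SigmaI)
      show "\<forall>j\<in>{..k}. finite {b \<in> S j. sum b Y = k - j}"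
      proof
        fix j
        have "{b \<in> S j. sum b Y = k - j} \<subseteq> {b. (\<forall>i. i \<notin> Y \<longrightarrow> b i = 0) \<and> sum b Y = k - j}"
          by (auto simp: S_def)
        then show "finite {b \<in> S j. sum b Y = k - j}"
          by (rule finite_subset[OF _ finite_functions_of_sum[OF insert.hyps(1)]])
      qed
    qed simp
    finally show ?thesis .
  qed
  have ev: "evpoly (\<lambda>k. real (?c j k))" for j using insert.IH[OF up] .
  have "evpoly (\<lambda>k. (\<Sum>j<J. real (?c j (k - j))) + (\<Sum>t\<le>k - J. real (?c J t)))"
    by (intro evpoly_add evpoly_sum evpoly_shift[where f = "\<lambda>k. real (?c _ k)"]
         evpoly_shift[where f = "\<lambda>k. \<Sum>t\<le>k. real (?c J t)"] evpoly_partial_sums ev)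
  moreover have "real (card {a \<in> U. sum a (insert x Y) = k}) = (\<Sum>j<J. real (?c j (k - j))) + (\<Sum>t\<le>k - J. real (?c J t))"
    if "k \<ge> J" for k
  proof -
    have "{..k} = {..<J} \<union> {J..k}" using that by auto
    then have "(\<Sum>j\<le>k. real (?c j (k - j))) = (\<Sum>j<J. real (?c j (k - j))) + (\<Sum>j\<in>{J..k}. real (?c j (k - j)))"
      by (simp add: sum.union_disjoint ivl_disj_int)
    also have "(\<Sum>j\<in>{J..k}. real (?c j (k - j))) = (\<Sum>j\<in>{J..k}. real (?c J (k - j)))"
    proof (rule sum.cong)
      fix j assume "j \<in> {J..k}"
      then have "S j = S J" using J[of j] by simp
      then show "real (?c j (k - j)) = real (?c J (k - j))" by (simp only:)
    qed simp
    also have "\<dots> = (\<Sum>t\<le>k - J. real (?c J t))"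
      by (rule sum.reindex_bij_witness[of _ "\<lambda>t. k - t" "\<lambda>j. k - j"]) (use that in auto)
    finally show ?thesis by (simp add: card)
  qed
  ultimately show ?case by (rule evpoly_cong)
qed

section \<open>Leading monomials and Hilbert functions of ideals\<close>

definition leads :: "'x::finite mpoly set \<Rightarrow> ('x \<Rightarrow>\<^sub>0 nat) set" where
  "leads V = {m. \<exists>v\<in>V. m \<in> Poly_Mapping.keys v \<and> (\<forall>m'\<in>Poly_Mapping.keys v. mono_weight m' \<le> mono_weight m)}"

text \<open>Filter \<open>V\<close> by a bound on the weights of monomials. Weights separate
  monomials, so each step admits at most one new monomial, and the dimension rises by one exactly
  when that monomial leads an element of \<open>V\<close>.\<close>

lemma dim_eq_card_leads:
  fixes V :: "'x::finite mpoly set"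
  assumes V: "subspace V" "findim V" and A: "finite A" "\<And>v. v \<in> V \<Longrightarrow> Poly_Mapping.keys v \<subseteq> A"
  shows "dim V = card (leads V)"
proof -
  define W where "W w = {v \<in> V. \<forall>m\<in>Poly_Mapping.keys v. mono_weight m < w}" for w
  have subW: "subspace (W w)" for w
  proof (rule subspaceI)
    fix p q assume "p \<in> W w" "q \<in> W w"
    then show "p + q \<in> W w"
      using keys_add[of p q] subspace_add[OF V(1), of p q] by (auto simp: W_def)
  qed (use V(1) in \<open>auto simp: W_def subspace_0 subspace_scale in_keys_iff\<close>)
  have finW: "findim (W w)" for w by (rule findim_subset[OF V(2)]) (auto simp: W_def)
  have leadsA: "leads V \<subseteq> A" using A(2) by (auto simp: leads_def)
  have finL: "finite {m \<in> leads V. mono_weight m < w}" for w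
    by (rule finite_subset[OF _ A(1)]) (use leadsA in auto)
  have main: "dim (W w) = card {m \<in> leads V. mono_weight m < w}" for w
  proof (induction w)
    case 0
    have "W 0 = {0}" using V(1) subspace_0 by (auto simp: W_def)
    then show ?case by (simp add: dim_zero)
  next
    case (Suc w)
    show ?case
    proof (cases "\<exists>m :: 'x \<Rightarrow>\<^sub>0 nat. mono_weight m = w")
      case False
      then have "W (Suc w) = W w" "{m \<in> leads V. mono_weight m < Suc w} = {m \<in> leads V. mono_weight m < w}"
        by (auto simp: W_def less_Suc_eq)
      then show ?thesis using Suc by simp
    next
      case True
      then obtain m :: "'x \<Rightarrow>\<^sub>0 nat" where m: "mono_weight m = w" by blast
      then have uniq: "mono_weight m' = w \<longleftrightarrow> m' = m" for m' :: "'x \<Rightarrow>\<^sub>0 nat"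
        using inj_mono_weight by (auto simp: inj_def)
      let ?f = "\<lambda>v :: 'x mpoly. Poly_Mapping.lookup v m"
      have lin: "linear ?f" by (rule linearI) (simp_all add: lookup_add)
      have ker: "{v \<in> W (Suc w). ?f v = 0} = W w"
      proof (intro equalityI subsetI)
        fix v assume v: "v \<in> {v \<in> W (Suc w). ?f v = 0}"
        have "mono_weight m' < w" if "m' \<in> Poly_Mapping.keys v" for m'
        proof -
          have "m' \<noteq> m" using v that by (auto simp: in_keys_iff)
          moreover have "mono_weight m' < Suc w" using v that by (auto simp: W_def)
          ultimately show ?thesis using uniq[of m'] by linarith
        qed
        then show "v \<in> W w" using v by (auto simp: W_def)
      next
        fix v assume v: "v \<in> W w"
        then have "m \<notin> Poly_Mapping.keys v" using m by (auto simp: W_def)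
        then show "v \<in> {v \<in> W (Suc w). ?f v = 0}" using v by (auto simp: W_def in_keys_iff less_Suc_eq)
      qed
      have lead: "m \<in> leads V \<longleftrightarrow> (\<exists>v\<in>W (Suc w). ?f v \<noteq> 0)"
        using m by (auto simp: leads_def W_def in_keys_iff less_Suc_eq_le)
      have eq: "dim (?f ` W (Suc w)) + dim (W w) = dim (W (Suc w))"
        using dim_image_kernel[OF lin subW finW, of "Suc w"] unfolding ker .
      show ?thesis
      proof (cases "m \<in> leads V")
        case True
        then obtain v where v: "v \<in> W (Suc w)" "?f v \<noteq> 0" using lead by blast
        have "c \<in> ?f ` W (Suc w)" for c
        proof
          show "c = ?f ((c / ?f v) *\<^sub>R v)" using v by simp
          show "(c / ?f v) *\<^sub>R v \<in> W (Suc w)" using subspace_scale[OF subW v(1)] .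
        qed
        then have "?f ` W (Suc w) = UNIV" by blast
        moreover have "{m' \<in> leads V. mono_weight m' < Suc w} = insert m {m \<in> leads V. mono_weight m < w}"
          using True uniq by (auto simp: less_Suc_eq)
        moreover have "m \<notin> {m \<in> leads V. mono_weight m < w}" using m by simp
        ultimately show ?thesis using eq Suc finL[of w] by simp
      next
        case False
        then have "?f ` W (Suc w) = {0}" using lead subspace_0[OF subW, of "Suc w"] by force
        moreover have "{m' \<in> leads V. mono_weight m' < Suc w} = {m \<in> leads V. mono_weight m < w}"
          using False uniq by (auto simp: less_Suc_eq)
        ultimately show ?thesis using eq Suc by (simp add: dim_zero)
      qed
    qed
  qed
  define w where "w = Suc (\<Sum>m\<in>A. mono_weight m)"
  have "mono_weight m < w" if "m \<in> A" for m
    using member_le_sum[OF that, of mono_weight] A(1) by (simp add: w_def less_Suc_eq_le)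
  then have "W w = V" "{m \<in> leads V. mono_weight m < w} = leads V"
    using A(2) leadsA by (auto simp: W_def)
  then show ?thesis using main[of w] by simp
qed

lemma lookup_X_mult: "Poly_Mapping.lookup (X i * p) (Poly_Mapping.single i 1 + m) = Poly_Mapping.lookup p m"
proof -
  let ?s = "Poly_Mapping.single i (1::nat)"
  have p: "p = (\<Sum>m\<in>Poly_Mapping.keys p. Poly_Mapping.single m (Poly_Mapping.lookup p m))"
    by (rule poly_mapping_sum_singles) auto
  have "X i * p = X i * (\<Sum>m\<in>Poly_Mapping.keys p. Poly_Mapping.single m (Poly_Mapping.lookup p m))" using p by (rule arg_cong)
  also have "\<dots> = (\<Sum>m\<in>Poly_Mapping.keys p. Poly_Mapping.single (?s + m) (Poly_Mapping.lookup p m))"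
    by (simp add: X_def sum_distrib_left mult_single)
  finally have "Poly_Mapping.lookup (X i * p) (?s + m) = (\<Sum>m'\<in>Poly_Mapping.keys p. if m' = m then Poly_Mapping.lookup p m else 0)"
    by (simp only: lookup_sum) (intro sum.cong, auto simp: lookup_single when_def)
  then show ?thesis by (auto simp: in_keys_iff)
qed

lemma keys_X_mult: "Poly_Mapping.keys (X i * p) = (\<lambda>m. Poly_Mapping.single i 1 + m) ` Poly_Mapping.keys p"
proof
  show "Poly_Mapping.keys (X i * p) \<subseteq> (\<lambda>m. Poly_Mapping.single i 1 + m) ` Poly_Mapping.keys p"
    using keys_mult[of "X i" p] by (auto simp: X_def)
  show "(\<lambda>m. Poly_Mapping.single i 1 + m) ` Poly_Mapping.keys p \<subseteq> Poly_Mapping.keys (X i * p)"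
    using lookup_X_mult[of i p] by (auto simp: in_keys_iff)
qed

text \<open>Macaulay's argument: multiplication by a variable scales all weights by the same factor,
  so it maps leading monomials to leading monomials and their exponents form an upset. In each
  degree this upset has as many elements as the dimension.\<close>

theorem evpoly_dim_ideal:
  fixes V :: "int \<Rightarrow> 'x::finite mpoly set"
  assumes V: "\<And>k. subspace (V k)" "\<And>k. V k \<subseteq> forms k" "\<And>i k p. p \<in> V k \<Longrightarrow> X i * p \<in> V (k + 1)"
  shows "evpoly (\<lambda>k. real (dim (V (int k))))"
proof -
  define U where "U = (\<Union>k. Poly_Mapping.lookup ` leads (V (int k)))"
  have deg: "mdeg m = k" if "m \<in> leads (V (int k))" for m k
    using that V(2)[of "int k"] by (force simp: leads_def forms_iff)
  have dim: "dim (V (int k)) = card (leads (V (int k)))" for k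
  proof (rule dim_eq_card_leads[OF V(1) _ finite_mdeg_le[of k]])
    show "findim (V (int k))" using findim_subset[OF findim_forms V(2)] .
    show "Poly_Mapping.keys v \<subseteq> {m. mdeg m \<le> k}" if "v \<in> V (int k)" for v
      using that V(2)[of "int k"] by (force simp: forms_iff)
  qed
  have up: "upset UNIV U"
    unfolding upset_def
  proof (intro conjI ballI allI impI)
    fix a i assume "a \<in> U"
    then obtain k m where km: "a = Poly_Mapping.lookup m" "m \<in> leads (V (int k))" by (auto simp: U_def)
    then obtain v where v: "v \<in> V (int k)" "m \<in> Poly_Mapping.keys v" "\<And>m'. m' \<in> Poly_Mapping.keys v \<Longrightarrow> mono_weight m' \<le> mono_weight m"
      by (auto simp: leads_def)
    let ?m = "Poly_Mapping.single i 1 + m"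
    have "X i * v \<in> V (int (Suc k))" using V(3)[OF v(1), of i] by (simp add: add.commute)
    moreover have "?m \<in> Poly_Mapping.keys (X i * v)" "\<forall>m'\<in>Poly_Mapping.keys (X i * v). mono_weight m' \<le> mono_weight ?m"
      using v by (auto simp: keys_X_mult mono_weight_add)
    ultimately have "?m \<in> leads (V (int (Suc k)))" unfolding leads_def by blast
    moreover have "Poly_Mapping.lookup ?m = a(i := Suc (a i))"
      using km by (auto simp: fun_eq_iff lookup_add lookup_single when_def)
    ultimately show "a(i := Suc (a i)) \<in> U" unfolding U_def by (metis UN_I UNIV_I image_eqI)
  qed simp
  have "{a \<in> U. sum a UNIV = k} = Poly_Mapping.lookup ` leads (V (int k))" for k
  proof (intro equalityI subsetI)
    fix a assume a: "a \<in> {a \<in> U. sum a UNIV = k}"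
    then obtain j m where jm: "a = Poly_Mapping.lookup m" "m \<in> leads (V (int j))" by (auto simp: U_def)
    have "j = k" using deg[OF jm(2)] a jm(1) by (simp add: mdeg_def)
    then show "a \<in> Poly_Mapping.lookup ` leads (V (int k))" using jm by blast
  next
    fix a assume a: "a \<in> Poly_Mapping.lookup ` leads (V (int k))"
    then have "sum a UNIV = k" using deg by (auto simp: mdeg_def)
    then show "a \<in> {a \<in> U. sum a UNIV = k}" using a by (auto simp: U_def)
  qed
  moreover have "inj_on Poly_Mapping.lookup A" for A :: "('x \<Rightarrow>\<^sub>0 nat) set"
    by (intro inj_onI poly_mapping_eq_iff[THEN iffD2])
  ultimately have "real (dim (V (int k))) = real (card {a \<in> U. sum a UNIV = k})" for k
    by (simp add: dim card_image)
  then show ?thesis using evpoly_upset[OF finite up] by simp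
qed

section \<open>Graded submodules of free modules\<close>

definition pmul :: "'x::finite mpoly \<Rightarrow> ('i \<Rightarrow> 'x mpoly) \<Rightarrow> 'i \<Rightarrow> 'x mpoly" where
  "pmul p f = (\<lambda>i. p * f i)"

lemma pmul_apply [simp]: "pmul p f i = p * f i"
  by (simp add: pmul_def)

lemma pmul_scaleR_left: "pmul (c *\<^sub>R p) f = c *\<^sub>R pmul p f"
  by (rule ext) (simp add: mconst_mult_scaleR[symmetric] mult_ac)

lemma linear_pmul: "linear (pmul p)"
  by (rule linearI) (auto simp: fun_eq_iff distrib_left mconst_mult_scaleR[symmetric] mult_ac)

lemma pmul_pmul: "pmul p (pmul q f) = pmul (p * q) f"
  by (auto simp: fun_eq_iff mult_ac)

lemma pmul_commute: "pmul p (pmul q f) = pmul q (pmul p f)"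
  by (auto simp: fun_eq_iff mult_ac)

lemma pmul_unit_at: "pmul p (unit_at i q) = unit_at i (p * q)"
  by (auto simp: fun_eq_iff unit_at_def)

abbreviation free_forms :: "'i set \<Rightarrow> int \<Rightarrow> ('i \<Rightarrow> 'x::finite mpoly) set" where
  "free_forms I k \<equiv> prod_space I (\<lambda>_. forms k)"

lemma subspace_free_forms: "subspace (free_forms I k)"
  by (intro subspace_prod_space subspace_forms)

lemma findim_free_forms: "finite I \<Longrightarrow> findim (free_forms I k)"
  by (rule findim_prod_space[OF _ subspace_forms findim_forms])

lemma dim_free_forms: "finite I \<Longrightarrow> dim (free_forms I k :: ('i \<Rightarrow> 'x::finite mpoly) set) = card I * dim (forms k :: 'x mpoly set)"
  using dim_prod_space[of I "\<lambda>_. forms k :: 'x mpoly set", OF _ subspace_forms findim_forms] by simp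

lemma pmul_free_forms: "p \<in> forms e \<Longrightarrow> f \<in> free_forms I k \<Longrightarrow> pmul p f \<in> free_forms I (e + k)"
  by (auto simp: prod_space_def intro: forms_mult)

text \<open>A graded submodule of the free module on \<open>I\<close>, kept as the family of its
  degree pieces; closure under the variables stands in for closure under the ring.\<close>

definition gfam :: "'i set \<Rightarrow> (int \<Rightarrow> ('i \<Rightarrow> 'x::finite mpoly) set) \<Rightarrow> bool" where
  "gfam I S \<longleftrightarrow> (\<forall>k. subspace (S k) \<and> S k \<subseteq> free_forms I k \<and> (\<forall>i. \<forall>f\<in>S k. pmul (X i) f \<in> S (k + 1)))"

text \<open>Induction on the rank: projection to one coordinate has an ideal as image and a graded
  submodule of smaller rank as kernel.\<close>

theorem evpoly_dim_gfam:
  assumes "finite I" "gfam I S"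
  shows "evpoly (\<lambda>k. real (dim (S (int k))))"
  using assms
proof (induction I arbitrary: S)
  case empty
  have "dim (S k) = 0" for k
  proof -
    have "S k \<subseteq> free_forms {} k" "subspace (S k)" using empty by (simp_all add: gfam_def)
    moreover have "free_forms {} k = {0 :: 'a \<Rightarrow> 'b mpoly}" by (auto simp: prod_space_def fun_eq_iff)
    ultimately have "S k = {0}" using subspace_0[of "S k"] by auto
    then show ?thesis by (simp only: dim_zero)
  qed
  then show ?case by (simp add: evpoly_const)
next
  case (insert i I)
  let ?A = "\<lambda>k. (\<lambda>f. f i) ` S k" and ?B = "\<lambda>k. {f \<in> S k. f i = 0}"
  have S: "subspace (S k)" "S k \<subseteq> free_forms (insert i I) k" "f \<in> S k \<Longrightarrow> pmul (X j) f \<in> S (k + 1)" for k f j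
    using insert.prems by (auto simp: gfam_def)
  have fS: "findim (S k)" for k
    using findim_subset[OF findim_free_forms S(2)] insert.hyps by simp
  have "gfam I ?B"
    unfolding gfam_def
  proof (intro allI conjI ballI)
    show "subspace {f \<in> S k. f i = 0}" for k
      using subspace_preimage[OF linear_apply[of i] subspace_single_0 S(1)[of k]] by simp
    show "{f \<in> S k. f i = 0} \<subseteq> free_forms I k" for k
      using S(2)[of k] by (force simp: prod_space_def)
    show "pmul (X j) f \<in> {f \<in> S (k + 1). f i = 0}" if "f \<in> {f \<in> S k. f i = 0}" for k j f
      using S(3) that by auto
  qed
  then have "evpoly (\<lambda>k. real (dim (?B (int k))))" by (rule insert.IH)
  moreover have "evpoly (\<lambda>k. real (dim (?A (int k))))"
  proof (rule evpoly_dim_ideal)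
    show "subspace (?A k)" for k by (rule linear_subspace_image[OF linear_apply S(1)])
    show "?A k \<subseteq> forms k" for k using S(2)[of k] by (auto simp: prod_space_def)
    show "X j * p \<in> ?A (k + 1)" if pk: "p \<in> ?A k" for p k j
    proof -
      obtain f where f: "f \<in> S k" "p = f i" using pk by auto
      then have "X j * p = pmul (X j) f i" by simp
      then show ?thesis using S(3)[OF f(1), of j] by blast
    qed
  qed
  ultimately have "evpoly (\<lambda>k. real (dim (?A (int k))) + real (dim (?B (int k))))" using evpoly_add by blast
  moreover have "real (dim (S (int k))) = real (dim (?A (int k))) + real (dim (?B (int k)))" for k
    using dim_image_kernel[OF linear_apply[of i] S(1) fS, of "int k"] by simp
  ultimately show ?case by simp
qed

text \<open>Means that \<open>u\<close> is \<open>o(k^m)\<close> along the natural numbers. If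
  \<open>u\<close> is eventually a polynomial, its coefficients from \<open>k^m\<close> on then
  vanish, which is how coefficients are read off in the end.\<close>

definition small :: "nat \<Rightarrow> (int \<Rightarrow> real) \<Rightarrow> bool" where
  "small m u \<longleftrightarrow> (\<lambda>k. u (int k) / real k ^ m) \<longlonglongrightarrow> 0"

lemma small_add: "small m u \<Longrightarrow> small m v \<Longrightarrow> small m (\<lambda>k. u k + v k)"
  unfolding small_def by (drule (1) tendsto_add) (simp add: add_divide_distrib)

lemma small_diff: "small m u \<Longrightarrow> small m v \<Longrightarrow> small m (\<lambda>k. u k - v k)"
  unfolding small_def by (drule (1) tendsto_diff) (simp add: diff_divide_distrib)

lemma small_le:
  assumes "small m v" "\<And>k. 0 \<le> u k" "\<And>k. u k \<le> v k"
  shows "small m u"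
  unfolding small_def
proof (rule tendsto_sandwich[OF _ _ tendsto_const])
  show "(\<lambda>k. v (int k) / real k ^ m) \<longlonglongrightarrow> 0" using assms(1) by (simp add: small_def)
qed (use assms(2,3) in \<open>auto intro!: always_eventually divide_right_mono\<close>)

lemma small_eventually_0:
  assumes "\<And>k. k \<ge> K \<Longrightarrow> u (int k) = 0"
  shows "small m u"
  unfolding small_def
  by (rule tendsto_eventually) (use assms in \<open>auto simp: eventually_sequentially\<close>)

lemma small_shift:
  assumes "small m u"
  shows "small m (\<lambda>k. u (k - int e))"
proof -
  have "(\<lambda>k. (real k / real (k + e)) ^ m) \<longlonglongrightarrow> 1 ^ m"
  proof (rule tendsto_power)
    have "(\<lambda>k. real k / real (k + e)) \<longlonglongrightarrow> 1" by real_asymp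
    then show "(\<lambda>k. real k / real (k + e)) \<longlonglongrightarrow> 1" .
  qed
  then have "(\<lambda>k. u (int k) / real k ^ m * (real k / real (k + e)) ^ m) \<longlonglongrightarrow> 0 * 1 ^ m"
    using assms unfolding small_def by (intro tendsto_mult)
  moreover have "\<forall>\<^sub>F k in sequentially. u (int k) / real k ^ m * (real k / real (k + e)) ^ m
     = u (int (k + e) - int e) / real (k + e) ^ m"
    using eventually_gt_at_top[of 0] by eventually_elim (simp add: power_divide)
  ultimately have "(\<lambda>k. u (int (k + e) - int e) / real (k + e) ^ m) \<longlonglongrightarrow> 0 * 1 ^ m"
    by (rule Lim_transform_eventually)
  then have "(\<lambda>k. u (int (k + e) - int e) / real (k + e) ^ m) \<longlonglongrightarrow> 0" by simp
  then show ?thesis unfolding small_def by (rule LIMSEQ_offset)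
qed

text \<open>Discrete integration: summing increments of size \<open>o(k^m)\<close> costs one power
  of k. It passes from the quotient of a module by a linear form back to the module.\<close>

lemma small_accumulate:
  assumes v: "small m v" and u: "\<And>k. 0 \<le> u k" "\<And>k. u k \<le> u (k - 1) + v k"
  shows "small (Suc m) u"
  unfolding small_def
proof (rule LIMSEQ_I)
  fix e :: real assume e: "e > 0"
  obtain K where K: "\<And>k. k \<ge> K \<Longrightarrow> \<bar>v (int k) / real k ^ m\<bar> < e / 2"
    using LIMSEQ_D[OF v[unfolded small_def], of "e / 2"] e by auto
  \<comment> \<open>The successor makes all arguments from \<open>K1\<close> on positive, so that
    division by powers of k is harmless.\<close>
  define K1 where "K1 = Suc K"
  have vk: "v (int k) \<le> e / 2 * real k ^ m" if "k \<ge> K1" for k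
  proof -
    have pos: "real k ^ m > 0" using that by (simp add: K1_def)
    have "v (int k) / real k ^ m \<le> \<bar>v (int k) / real k ^ m\<bar>" by (rule abs_ge_self)
    also have "\<dots> < e / 2" using that by (intro K) (simp add: K1_def)
    finally show ?thesis using pos_divide_le_eq[OF pos] by (meson less_imp_le)
  qed
  have bound: "u (int k) \<le> u (int K1) + e / 2 * real k ^ Suc m" if "k \<ge> K1" for k
  proof -
    have "u (int k) \<le> u (int K1) + real (k - K1) * (e / 2 * real k ^ m)"
      using that
    proof (induction rule: dec_induct)
      case base
      show ?case by simp
    next
      case (step k)
      have "u (int (Suc k)) \<le> u (int k) + v (int (Suc k))" using u(2)[of "int (Suc k)"] by simp
      also have "\<dots> \<le> u (int K1) + real (k - K1) * (e / 2 * real k ^ m) + e / 2 * real (Suc k) ^ m"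
        using step vk[of "Suc k"] by linarith
      also have "real (k - K1) * (e / 2 * real k ^ m) \<le> real (k - K1) * (e / 2 * real (Suc k) ^ m)"
        using e by (intro mult_left_mono power_mono) auto
      finally show ?case using step(1) by (simp add: of_nat_diff algebra_simps diff_divide_distrib add_divide_distrib)
    qed
    also have "real (k - K1) * (e / 2 * real k ^ m) \<le> real k * (e / 2 * real k ^ m)"
      using e by (intro mult_right_mono) auto
    finally show ?thesis by (simp add: mult_ac)
  qed
  obtain L where L: "\<And>k. k \<ge> L \<Longrightarrow> u (int K1) / real k < e / 2"
  proof -
    have "(\<lambda>k. u (int K1) / real k) \<longlonglongrightarrow> 0" by (rule lim_const_over_n)
    then obtain L where "\<And>k. k \<ge> L \<Longrightarrow> \<bar>u (int K1) / real k\<bar> < e / 2"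
      using LIMSEQ_D[of "\<lambda>k. u (int K1) / real k" 0 "e / 2"] e by auto
    then show thesis using that by (meson abs_ge_self order_le_less_trans)
  qed
  show "\<exists>no. \<forall>n\<ge>no. norm (u (int n) / real n ^ Suc m - 0) < e"
  proof (intro exI allI impI)
    fix k assume k: "k \<ge> max K1 L"
    then have k1: "k \<ge> 1" by (simp add: K1_def)
    have "u (int k) / real k ^ Suc m \<le> (u (int K1) + e / 2 * real k ^ Suc m) / real k ^ Suc m"
      using bound[of k] k by (intro divide_right_mono) auto
    also have "\<dots> = u (int K1) / real k ^ Suc m + e / 2" using k1 by (simp add: add_divide_distrib)
    also have "u (int K1) / real k ^ Suc m \<le> u (int K1) / real k"
      using u(1)[of "int K1"] k1 self_le_power[of "real k" "Suc m"] by (intro divide_left_mono) auto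
    also have "u (int K1) / real k + e / 2 < e"
    proof -
      have "u (int K1) / real k < e / 2" using k by (intro L) simp
      then show ?thesis by linarith
    qed
    finally show "norm (u (int k) / real k ^ Suc m - 0) < e" using u(1)[of "int k"] by simp
  qed
qed

lemma poly_over_power_limit:
  fixes p :: "real poly"
  assumes "degree p \<le> m"
  shows "(\<lambda>k. poly p (real k) / real k ^ m) \<longlonglongrightarrow> coeff p m"
proof -
  have "(\<lambda>k. \<Sum>i\<le>m. coeff p i * (real k ^ i / real k ^ m)) \<longlonglongrightarrow> (\<Sum>i\<le>m. coeff p i * (if i = m then 1 else 0))"
  proof (intro tendsto_sum tendsto_mult tendsto_const)
    fix i assume "i \<in> {..m}"
    show "(\<lambda>k. real k ^ i / real k ^ m) \<longlonglongrightarrow> (if i = m then 1 else 0)"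
    proof (cases "i = m")
      case True
      have "\<forall>\<^sub>F k in sequentially. real k ^ i / real k ^ m = 1"
        using eventually_gt_at_top[of 0] by eventually_elim (simp add: True)
      then show ?thesis by (simp add: True[symmetric] tendsto_eventually)
    next
      case False
      then have "i < m" using \<open>i \<in> {..m}\<close> by simp
      then obtain j where j: "m = i + Suc j" using less_imp_Suc_add[of i m] by auto
      have "(\<lambda>k. (1 / real k) ^ Suc j) \<longlonglongrightarrow> 0 ^ Suc j" by (intro tendsto_power lim_1_over_n)
      moreover have "\<forall>\<^sub>F k in sequentially. (1 / real k) ^ Suc j = real k ^ i / real k ^ m"
        using eventually_gt_at_top[of 0] by eventually_elim (simp add: j power_add power_divide)
      ultimately have "(\<lambda>k. real k ^ i / real k ^ m) \<longlonglongrightarrow> 0 ^ Suc j"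
        by (rule Lim_transform_eventually)
      then show ?thesis using False by simp
    qed
  qed
  moreover have "poly p (real k) / real k ^ m = (\<Sum>i\<le>m. coeff p i * (real k ^ i / real k ^ m))" for k
  proof -
    have "poly p (real k) = (\<Sum>i\<le>m. coeff p i * real k ^ i)"
      unfolding poly_altdef by (rule sum.mono_neutral_left) (use assms in \<open>auto simp: coeff_eq_0\<close>)
    then show ?thesis by (simp add: sum_divide_distrib)
  qed
  moreover have "(\<Sum>i\<le>m. coeff p i * (if i = m then 1 else 0)) = coeff p m"
    by (simp add: if_distrib cong: if_cong)
  ultimately show ?thesis by (simp only:)
qed

text \<open>A nonzero coefficient would make the degree n at least m; dividing further by
  \<open>k^(n-m)\<close> then exhibits the leading coefficient as the limit 0.\<close>

lemma small_poly_coeff_0: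
  fixes p :: "real poly"
  assumes sm: "(\<lambda>k. poly p (real k) / real k ^ m) \<longlonglongrightarrow> 0" and im: "i \<ge> m"
  shows "coeff p i = 0"
proof (rule ccontr)
  assume "coeff p i \<noteq> 0"
  then have deg: "i \<le> degree p" by (rule le_degree)
  define n where "n = degree p"
  have "(\<lambda>k. poly p (real k) / real k ^ m * (1 / real k ^ (n - m))) \<longlonglongrightarrow> 0"
  proof (rule Lim_null_comparison[OF _ tendsto_rabs_zero[OF sm]])
    show "\<forall>\<^sub>F k in sequentially. norm (poly p (real k) / real k ^ m * (1 / real k ^ (n - m))) \<le> \<bar>poly p (real k) / real k ^ m\<bar>"
      using eventually_gt_at_top[of 0]
    proof eventually_elim
      case (elim k)
      then have "1 \<le> real k ^ (n - m)" by (simp add: one_le_power)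
      then have "\<bar>1 / real k ^ (n - m)\<bar> \<le> 1" using elim by (simp add: divide_le_eq_1)
      then show ?case unfolding real_norm_def abs_mult by (rule mult_left_le) simp
    qed
  qed
  moreover have "poly p (real k) / real k ^ m * (1 / real k ^ (n - m)) = poly p (real k) / real k ^ n" for k
  proof -
    have "n = m + (n - m)" using im deg by (simp add: n_def)
    then have "real k ^ n = real k ^ m * real k ^ (n - m)" by (metis power_add)
    then show ?thesis by simp
  qed
  ultimately have "(\<lambda>k. poly p (real k) / real k ^ n) \<longlonglongrightarrow> 0" by (simp only:)
  then have "coeff p n = 0"
    using LIMSEQ_unique[OF poly_over_power_limit[of p n]] by (simp add: n_def)
  then have "p = 0" by (simp add: n_def)
  then show False using \<open>coeff p i \<noteq> 0\<close> by simp
qed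

text \<open>Divided by \<open>k^m\<close>, the function and its shift have the same limit, the
  coefficient of \<open>k^m\<close>; a change of grading is invisible in top degree.\<close>

lemma small_poly_shift:
  fixes p :: "real poly"
  assumes "degree p \<le> m" "\<And>k. k \<ge> K \<Longrightarrow> u (int k) = poly p (real k)"
  shows "small m (\<lambda>k. u k - u (k - int e))"
proof -
  have lim: "(\<lambda>k. u (int k) / real k ^ m) \<longlonglongrightarrow> coeff p m"
    using poly_over_power_limit[OF assms(1)]
    by (rule Lim_transform_eventually) (auto simp: eventually_sequentially assms(2) intro!: exI[of _ K])
  define c where "c = coeff p m"
  have "(\<lambda>k. (real k / real (k + e)) ^ m) \<longlonglongrightarrow> 1 ^ m"
    by (rule tendsto_power) real_asymp
  then have "(\<lambda>k. u (int k) / real k ^ m * (real k / real (k + e)) ^ m) \<longlonglongrightarrow> c * 1 ^ m"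
    using lim unfolding c_def by (intro tendsto_mult)
  moreover have "\<forall>\<^sub>F k in sequentially. u (int k) / real k ^ m * (real k / real (k + e)) ^ m
     = u (int (k + e) - int e) / real (k + e) ^ m"
    using eventually_gt_at_top[of 0] by eventually_elim (simp add: power_divide)
  ultimately have "(\<lambda>k. u (int (k + e) - int e) / real (k + e) ^ m) \<longlonglongrightarrow> c * 1 ^ m"
    by (rule Lim_transform_eventually)
  then have "(\<lambda>k. u (int (k + e) - int e) / real (k + e) ^ m) \<longlonglongrightarrow> c" by simp
  then have "(\<lambda>k. u (int k - int e) / real k ^ m) \<longlonglongrightarrow> c" by (rule LIMSEQ_offset)
  then have "(\<lambda>k. u (int k) / real k ^ m - u (int k - int e) / real k ^ m) \<longlonglongrightarrow> c - c"
    using lim unfolding c_def by (intro tendsto_diff)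
  then show ?thesis by (simp add: small_def diff_divide_distrib)
qed

text \<open>The Hilbert function of the quotient of the free module by \<open>S\<close>, real valued
  because such functions get subtracted from each other.\<close>

definition codim :: "'i set \<Rightarrow> (int \<Rightarrow> ('i \<Rightarrow> 'x::finite mpoly) set) \<Rightarrow> int \<Rightarrow> real" where
  "codim I S k = real (dim (free_forms I k :: ('i \<Rightarrow> 'x mpoly) set)) - real (dim (S k))"

lemma gfamD:
  assumes "gfam I S"
  shows "subspace (S k)" "S k \<subseteq> free_forms I k" "f \<in> S k \<Longrightarrow> pmul (X i) f \<in> S (k + 1)"
  using assms by (auto simp: gfam_def)


lemma sum_fun_apply: "(\<Sum>i\<in>A. f i) x = (\<Sum>i\<in>A. f i x)"
  by (induction A rule: infinite_finite_induct) auto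

lemma gfam_lin:
  assumes "gfam I S" "f \<in> S k"
  shows "pmul (lin a) f \<in> S (k + 1)"
proof -
  have "pmul (lin a) f i = (\<Sum>j\<in>UNIV. (a $ j) *\<^sub>R pmul (X j) f) i" for i
  proof -
    have "(\<Sum>j\<in>UNIV. (a $ j) *\<^sub>R pmul (X j) f) i = (\<Sum>j\<in>UNIV. (a $ j) *\<^sub>R (X j * f i))"
      by (induction rule: infinite_finite_induct[of _ UNIV]) auto
    then show ?thesis
      by (simp add: lin_def sum_distrib_right) (simp add: mconst_mult_scaleR[symmetric] mult.assoc)
  qed
  then have "pmul (lin a) f = (\<Sum>j\<in>UNIV. (a $ j) *\<^sub>R pmul (X j) f)" by (rule ext)
  moreover have "(\<Sum>j\<in>UNIV. (a $ j) *\<^sub>R pmul (X j) f) \<in> S (k + 1)"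
    by (intro subspace_sum subspace_scale gfamD[OF assms(1)] assms(2))
  ultimately show ?thesis by simp
qed

text \<open>The degree pieces of S + aF, with F the free module and a the linear form of the vector;
  the next definition gives the corresponding quotient (S : a).\<close>

definition addp :: "'i set \<Rightarrow> (int \<Rightarrow> ('i \<Rightarrow> 'x::finite mpoly) set) \<Rightarrow> real ^ 'x \<Rightarrow> int \<Rightarrow> ('i \<Rightarrow> 'x mpoly) set" where
  "addp I S a k = {s + pmul (lin a) f | s f. s \<in> S k \<and> f \<in> free_forms I (k - 1)}"

definition colon :: "'i set \<Rightarrow> (int \<Rightarrow> ('i \<Rightarrow> 'x::finite mpoly) set) \<Rightarrow> real ^ 'x \<Rightarrow> int \<Rightarrow> ('i \<Rightarrow> 'x mpoly) set" where
  "colon I S a k = {f \<in> free_forms I k. pmul (lin a) f \<in> S (k + 1)}"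

lemma pmul_lin_free_forms: "f \<in> free_forms I (k - 1) \<Longrightarrow> pmul (lin a) f \<in> free_forms I k"
  using pmul_free_forms[OF lin_forms, of f I "k - 1" a] by simp

lemma pmul_X_free_forms: "f \<in> free_forms I k \<Longrightarrow> pmul (X i) f \<in> free_forms I (k + 1)"
  using pmul_free_forms[OF X_forms, of f I k i] by (simp add: add.commute)

lemma gfam_addp:
  assumes "gfam I S"
  shows "gfam I (addp I S a)"
  unfolding gfam_def
proof (intro allI conjI ballI)
  fix k
  show "subspace (addp I S a k)" unfolding addp_def
    by (rule subspace_add_image[OF linear_pmul gfamD(1)[OF assms] subspace_free_forms])
  show "addp I S a k \<subseteq> free_forms I k"
    unfolding addp_def using gfamD(2)[OF assms, of k] pmul_lin_free_forms[of _ I k a]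
    by (auto intro!: subspace_add[OF subspace_free_forms])
  fix i f assume "f \<in> addp I S a k"
  then obtain s g where sg: "f = s + pmul (lin a) g" "s \<in> S k" "g \<in> free_forms I (k - 1)"
    by (auto simp: addp_def)
  have "pmul (X i) f = pmul (X i) s + pmul (lin a) (pmul (X i) g)"
    unfolding sg(1) linear_add[OF linear_pmul] by (simp add: pmul_commute)
  moreover have "pmul (X i) s \<in> S (k + 1)" by (rule gfamD(3)[OF assms sg(2)])
  moreover have "pmul (X i) g \<in> free_forms I (k + 1 - 1)" using pmul_X_free_forms[OF sg(3), of i] by simp
  ultimately show "pmul (X i) f \<in> addp I S a (k + 1)" unfolding addp_def by blast
qed

lemma gfam_colon:
  assumes "gfam I S"
  shows "gfam I (colon I S a)"
  unfolding gfam_def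
proof (intro allI conjI ballI)
  fix k
  show "subspace (colon I S a k)" unfolding colon_def
    by (rule subspace_preimage[OF linear_pmul gfamD(1)[OF assms] subspace_free_forms])
  show "colon I S a k \<subseteq> free_forms I k" by (auto simp: colon_def)
  fix i f assume f: "f \<in> colon I S a k"
  then have "pmul (X i) (pmul (lin a) f) \<in> S (k + 1 + 1)"
    by (intro gfamD(3)[OF assms]) (simp add: colon_def)
  then have "pmul (lin a) (pmul (X i) f) \<in> S (k + 1 + 1)" by (subst pmul_commute)
  then show "pmul (X i) f \<in> colon I S a (k + 1)"
    using f pmul_X_free_forms[of f I k i] by (simp add: colon_def)
qed

lemma subset_colon: "gfam I S \<Longrightarrow> S k \<subseteq> colon I S a k"
  using gfamD(2)[of I S k] gfam_lin[of I S _ k a] by (auto simp: colon_def)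

lemma subset_addp: "S k \<subseteq> addp I S a k"
proof
  fix s assume "s \<in> S k"
  moreover have "s = s + pmul (lin a) 0" by (simp add: linear_0[OF linear_pmul])
  moreover have "0 \<in> free_forms I (k - 1)" using subspace_free_forms by (rule subspace_0)
  ultimately show "s \<in> addp I S a k" unfolding addp_def by blast
qed

context
  fixes I :: "'i set"
  assumes I: "finite I"
begin

lemma findim_gfam: "gfam I S \<Longrightarrow> findim (S k)"
  using findim_subset[OF findim_free_forms[OF I] gfamD(2)] .

lemma codim_nonneg:
  assumes g: "gfam I S"
  shows "0 \<le> codim I S k"
proof -
  have "dim (S k) \<le> dim (free_forms I k :: ('i \<Rightarrow> 'a mpoly) set)"
    by (rule dim_mono_findim[OF findim_free_forms[OF I] gfamD(1)[OF g] gfamD(2)[OF g]])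
  then show ?thesis by (simp add: codim_def)
qed

lemma codim_mono:
  assumes g: "gfam I S" "gfam I T" and sub: "S k \<subseteq> T k"
  shows "codim I T k \<le> codim I S k"
proof -
  have "dim (S k) \<le> dim (T k)"
    by (rule dim_mono_findim[OF findim_gfam[OF g(2)] gfamD(1)[OF g(1)] sub])
  then show ?thesis by (simp add: codim_def)
qed

text \<open>Multiplication by the form embeds F/(S : a), shifted by one degree, into F/S, and the
  cokernel is F/(S + aF).\<close>

lemma codim_split:
  assumes "gfam I S"
  shows "codim I S k = codim I (addp I S a) k + codim I (colon I S a) (k - 1)"
proof -
  have "dim (addp I S a k) + dim (colon I S a (k - 1)) = dim (S k) + dim (free_forms I (k - 1) :: ('i \<Rightarrow> 'a mpoly) set)"
    using dim_add_image[OF linear_pmul gfamD(1)[OF assms] findim_gfam[OF assms] subspace_free_forms findim_free_forms[OF I], of "lin a" k "k - 1"]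
    by (simp add: addp_def colon_def)
  then show ?thesis by (simp add: codim_def)
qed

text \<open>Peel off one factor at a time: F/S is assembled from F/(S + aF) and a shift of F/(S :
  a), and the latter is killed by the remaining factors. Since (S : a) contains S, its quotients by
  the remaining forms are no larger than those of S.\<close>

lemma small_product:
  fixes S :: "int \<Rightarrow> ('i \<Rightarrow> 'x::finite mpoly) set"
  assumes "gfam I S"
    and "\<And>k f. f \<in> free_forms I k \<Longrightarrow> pmul (prod_list (map lin as)) f \<in> S (k + int (length as))"
    and "\<And>a. a \<in> set as \<Longrightarrow> small m (codim I (addp I S a))"
  shows "small m (codim I S)"
  using assms
proof (induction as arbitrary: S)
  case Nil
  have "S k = free_forms I k" for k
  proof
    show "free_forms I k \<subseteq> S k"
    proof
      fix f :: "'i \<Rightarrow> 'x mpoly" assume "f \<in> free_forms I k"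
      then show "f \<in> S k" using Nil.prems(2)[of f k] by simp
    qed
  qed (rule gfamD(2)[OF Nil.prems(1)])
  then show ?case by (intro small_eventually_0[of 0]) (simp add: codim_def)
next
  case (Cons a as)
  have gC: "gfam I (colon I S a)" by (rule gfam_colon[OF Cons.prems(1)])
  have "small m (codim I (colon I S a))"
  proof (rule Cons.IH[OF gC])
    fix k and f :: "'i \<Rightarrow> 'x mpoly" assume f: "f \<in> free_forms I k"
    have "prod_list (map lin as) \<in> forms (int (length as))"
      by (induction as) (auto simp: forms_one dest: forms_mult[OF lin_forms])
    then have 1: "pmul (prod_list (map lin as)) f \<in> free_forms I (k + int (length as))"
      using pmul_free_forms[OF _ f] by (metis add.commute)
    have "pmul (lin a) (pmul (prod_list (map lin as)) f) \<in> S (k + int (length as) + 1)"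
      using Cons.prems(2)[OF f] by (simp del: pmul_apply add: pmul_pmul add_ac)
    then show "pmul (prod_list (map lin as)) f \<in> colon I S a (k + int (length as))"
      using 1 by (simp add: colon_def)
  next
    fix b assume b: "b \<in> set as"
    have "addp I S b k \<subseteq> addp I (colon I S a) b k" for k
      unfolding addp_def using subset_colon[OF Cons.prems(1), of k a] by blast
    then show "small m (codim I (addp I (colon I S a) b))"
      using b by (intro small_le[OF Cons.prems(3)[of b] codim_nonneg[OF gfam_addp[OF gC]]]
          codim_mono[OF gfam_addp[OF Cons.prems(1)] gfam_addp[OF gC]]) auto
  qed
  then have "small m (\<lambda>k. codim I (colon I S a) (k - int 1))" by (rule small_shift)
  then have "small m (\<lambda>k. codim I (addp I S a) k + codim I (colon I S a) (k - int 1))"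
    using Cons.prems(3) by (intro small_add) auto
  moreover have "codim I S = (\<lambda>k. codim I (addp I S a) k + codim I (colon I S a) (k - int 1))"
    by (rule ext) (use codim_split[OF Cons.prems(1), of _ a] in simp)
  ultimately show ?case by (simp only:)
qed

text \<open>If all forms of \<open>L\<close> act as zero, the quotient is a module over a polynomial
  ring in \<open>CARD('x) - dim L\<close> variables, so its Hilbert function stays below that power
  of k. The induction adjoins one form outside \<open>L\<close> and integrates back with
  \<open>small_accumulate\<close>.\<close>

lemma small_linear_forms:
  fixes S :: "int \<Rightarrow> ('i \<Rightarrow> 'x::finite mpoly) set" and L :: "(real ^ 'x) set"
  assumes "gfam I S" "subspace L" "\<And>a k f. a \<in> L \<Longrightarrow> f \<in> free_forms I (k - 1) \<Longrightarrow> pmul (lin a) f \<in> S k"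
  shows "small (CARD('x) - dim L) (codim I S)"
  using assms
proof (induction "CARD('x) - dim L" arbitrary: L S)
  case 0
  have "dim L \<le> CARD('x)" using dim_subset_UNIV[of L] by simp
  then have "dim L = CARD('x)" using 0(1) by simp
  then have "L = UNIV" using 0(3) subspace_dim_equal[of L UNIV] by simp
  then have lin: "pmul (lin a) f \<in> S k" if "f \<in> free_forms I (k - 1)" for a k f
  proof -
    have "a \<in> L" by (simp add: \<open>L = UNIV\<close>)
    then show ?thesis using that by (rule 0(4))
  qed
  \<comment> \<open>Here all linear forms kill the quotient, and every monomial of positive degree
    has a variable as factor; at most the piece of degree 0 survives.\<close>
  have eq: "S (int k) = free_forms I (int k)" if k: "k \<ge> 1" for k
  proof
    show "free_forms I (int k) \<subseteq> S (int k)"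
    proof
      fix f :: "'i \<Rightarrow> 'x mpoly" assume f: "f \<in> free_forms I (int k)"
      have single: "unit_at j (Poly_Mapping.single m c) \<in> S (int k)" if j: "j \<in> I" and m: "mdeg m = k" for j m c
      proof -
        obtain i where i: "Poly_Mapping.lookup m i \<noteq> 0"
          using m k unfolding mdeg_def by (metis (mono_tags, lifting) not_one_le_zero sum.neutral)
        define m' where "m' = m - Poly_Mapping.single i 1"
        have mm: "m = Poly_Mapping.single i 1 + m'"
          by (rule poly_mapping_eqI) (use i in \<open>auto simp: m'_def lookup_add lookup_minus lookup_single when_def\<close>)
        then have "mdeg m' = k - 1" using m mdeg_add[of "Poly_Mapping.single i 1" m'] by simp
        then have "Poly_Mapping.single m' c \<in> forms (int k - 1)" using k by (auto simp: forms_iff of_nat_diff)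
        then have "unit_at j (Poly_Mapping.single m' c) \<in> free_forms I (int k - 1)"
          using j by (auto simp: prod_space_def unit_at_def)
        then have "pmul (lin (axis i 1)) (unit_at j (Poly_Mapping.single m' c)) \<in> S (int k)" by (rule lin)
        moreover have "pmul (lin (axis i 1)) (unit_at j (Poly_Mapping.single m' c)) = unit_at j (Poly_Mapping.single m c)"
          unfolding pmul_unit_at X_eq_lin[symmetric] by (subst mm) (simp add: X_def mult_single)
        ultimately show ?thesis by simp
      qed
      have "f j' = (\<Sum>j\<in>I. \<Sum>m\<in>Poly_Mapping.keys (f j). unit_at j (Poly_Mapping.single m (Poly_Mapping.lookup (f j) m))) j'" for j'
      proof -
        have "(\<Sum>j\<in>I. \<Sum>m\<in>Poly_Mapping.keys (f j). unit_at j (Poly_Mapping.single m (Poly_Mapping.lookup (f j) m))) j'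
          = (\<Sum>j\<in>I. if j = j' then f j' else 0)"
          unfolding sum_fun_apply
        proof (rule sum.cong[OF refl])
          fix j assume "j \<in> I"
          show "(\<Sum>m\<in>Poly_Mapping.keys (f j). unit_at j (Poly_Mapping.single m (Poly_Mapping.lookup (f j) m)) j') = (if j = j' then f j' else 0)"
            using poly_mapping_sum_singles[of "Poly_Mapping.keys (f j')" "f j'", symmetric] by (cases "j = j'") (simp_all add: unit_at_def)
        qed
        also have "\<dots> = f j'" using f I by (auto simp: prod_space_def)
        finally show ?thesis by simp
      qed
      then have "f = (\<Sum>j\<in>I. \<Sum>m\<in>Poly_Mapping.keys (f j). unit_at j (Poly_Mapping.single m (Poly_Mapping.lookup (f j) m)))" by (rule ext)
      moreover have "(\<Sum>j\<in>I. \<Sum>m\<in>Poly_Mapping.keys (f j). unit_at j (Poly_Mapping.single m (Poly_Mapping.lookup (f j) m))) \<in> S (int k)"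
        using f by (intro subspace_sum gfamD(1)[OF 0(2)] single) (auto simp: prod_space_def forms_iff)
      ultimately show "f \<in> S (int k)" by simp
    qed
  qed (rule gfamD(2)[OF 0(2)])
  show ?case by (rule small_eventually_0[of 1]) (simp add: codim_def eq)
next
  case (Suc n)
  then have "L \<noteq> UNIV" by auto
  then obtain a where a: "a \<notin> L" by blast
  define L' where "L' = span (insert a L)"
  have spL: "span L = L" using Suc.prems(2) by (simp add: span_eq_iff)
  have "dim L' = dim L + 1" unfolding L'_def using dim_insert[of a L] a spL by simp
  then have n: "n = CARD('x) - dim L'" using Suc(2) by simp
  let ?T = "addp I S a"
  have gT: "gfam I ?T" by (rule gfam_addp[OF Suc.prems(1)])
  have "small (CARD('x) - dim L') (codim I ?T)"
  proof (rule Suc(1)[OF n gT])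
    show "subspace L'" by (simp add: L'_def)
    fix b k and f :: "'i \<Rightarrow> 'x mpoly" assume b: "b \<in> L'" and f: "f \<in> free_forms I (k - 1)"
    obtain c where c: "b - c *\<^sub>R a \<in> L" using b spL by (auto simp: L'_def span_insert)
    have "lin b = lin (b - c *\<^sub>R a) + lin (c *\<^sub>R a)" by (simp add: lin_add[symmetric])
    then have "pmul (lin b) f = pmul (lin (b - c *\<^sub>R a)) f + pmul (lin a) (c *\<^sub>R f)"
      by (intro ext) (simp add: lin_scaleR mconst_mult_scaleR[symmetric] algebra_simps)
    moreover have "pmul (lin (b - c *\<^sub>R a)) f \<in> S k" by (rule Suc.prems(3)[OF c f])
    moreover have "c *\<^sub>R f \<in> free_forms I (k - 1)" by (rule subspace_scale[OF subspace_free_forms f])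
    ultimately show "pmul (lin b) f \<in> addp I S a k" unfolding addp_def by blast
  qed
  then have "small n (codim I ?T)" by (simp add: n)
  then have "small (Suc n) (codim I S)"
  proof (rule small_accumulate)
    show "0 \<le> codim I S k" for k by (rule codim_nonneg[OF Suc.prems(1)])
    \<comment> \<open>Since (S : a) contains S, the exact sequence becomes a recursive inequality
      for the codimension of \<open>S\<close> itself.\<close>
    have "codim I (colon I S a) (k - 1) \<le> codim I S (k - 1)" for k
      by (rule codim_mono[OF Suc.prems(1) gfam_colon[OF Suc.prems(1)] subset_colon[OF Suc.prems(1)]])
    then show "codim I S k \<le> codim I S (k - 1) + codim I ?T k" for k
      using codim_split[OF Suc.prems(1), of k a] by (smt (verit))
  qed
  then show ?case using Suc(2) by simp
qed

end

section \<open>Walls of a polyhedral complex\<close>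

text \<open>The gradient of the affine function that the form induces on the hyperplane where the
  coordinate \<open>None\<close> equals 1.\<close>

definition linear_part :: "real ^ ('n option) \<Rightarrow> real ^ 'n::finite" where
  "linear_part a = (\<chi> i. a $ Some i)"

lemma inner_lift1: "a \<bullet> lift1 x = linear_part a \<bullet> x + a $ None"
proof -
  have "a \<bullet> lift1 x = (\<Sum>j\<in>insert None (range Some). a $ j * lift1 x $ j)"
    by (simp add: inner_vec_def UNIV_option_conv)
  also have "\<dots> = a $ None + (\<Sum>i\<in>UNIV. a $ Some i * x $ i)"
    by (subst sum.insert) (auto simp: sum.reindex lift1_def)
  finally show ?thesis by (simp add: linear_part_def inner_vec_def)
qed

lemma proportional_normals:
  fixes u v :: "'a::euclidean_space"
  assumes "u \<noteq> 0" "\<And>y. u \<bullet> y = 0 \<Longrightarrow> v \<bullet> y = 0"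
  shows "v = (v \<bullet> u / (u \<bullet> u)) *\<^sub>R u"
proof -
  define w where "w = v - (v \<bullet> u / (u \<bullet> u)) *\<^sub>R u"
  have "u \<bullet> w = 0" using assms(1) by (simp add: w_def inner_diff_right inner_commute)
  then have "v \<bullet> w = 0" "u \<bullet> w = 0" using assms(2) by auto
  then have "w \<bullet> w = 0" by (simp add: w_def inner_diff_left)
  then show ?thesis by (simp add: w_def)
qed

locale wall_complex =
  fixes P :: "(real ^ 'n) set set" and a :: "(real ^ 'n) set \<Rightarrow> real ^ ('n option)"
  assumes complex: "polyhedral_complex P"
    and normal: "\<And>\<tau>. \<tau> \<in> walls P \<Longrightarrow> a \<tau> \<noteq> 0"
    and normal_zero: "\<And>\<tau> x. \<tau> \<in> walls P \<Longrightarrow> x \<in> \<tau> \<Longrightarrow> a \<tau> \<bullet> lift1 x = 0"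
begin

lemma finite_P: "finite P" and face_convex: "\<sigma> \<in> P \<Longrightarrow> convex \<sigma>"
  using complex by (auto simp: polyhedral_complex_def polytope_imp_convex)

lemma finite_walls: "finite (walls P)" and finite_cells: "finite (cells P)"
  using finite_P by (auto simp: faces_def)

lemma wall_nonempty: "\<tau> \<in> walls P \<Longrightarrow> \<tau> \<noteq> {}"
  by (auto simp: faces_def)

lemma facet_wall: "\<sigma> \<in> cells P \<Longrightarrow> \<tau> facet_of \<sigma> \<Longrightarrow> \<tau> \<in> walls P"
  using complex by (auto simp: faces_def facet_of_def polyhedral_complex_def)

text \<open>A form without linear part is a multiple of the last coordinate, which is 1 on the
  embedded complex; vanishing on the wall would make the form zero.\<close>

lemma linear_part_nonzero:
  assumes "\<tau> \<in> walls P"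
  shows "linear_part (a \<tau>) \<noteq> 0"
proof
  assume 0: "linear_part (a \<tau>) = 0"
  obtain x where "x \<in> \<tau>" using wall_nonempty[OF assms] by blast
  then have "a \<tau> $ None = 0" using normal_zero[OF assms, of x] 0 by (simp add: inner_lift1)
  moreover have "a \<tau> $ Some i = 0" for i
    using arg_cong[OF 0, of "\<lambda>v. v $ i"] by (simp add: linear_part_def)
  ultimately have "a \<tau> $ j = 0" for j by (cases j) auto
  then have "a \<tau> = 0" by (simp add: vec_eq_iff)
  then show False using normal[OF assms] by simp
qed

text \<open>The hull lies in the hyperplane of the form, and both have dimension d - 1.\<close>

lemma affine_hull_wall:
  assumes "\<tau> \<in> walls P"
  shows "affine hull \<tau> = {x. a \<tau> \<bullet> lift1 x = 0}"
proof -
  let ?H = "{x. linear_part (a \<tau>) \<bullet> x = - (a \<tau> $ None)}"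
  have H: "?H = {x. a \<tau> \<bullet> lift1 x = 0}" by (auto simp: inner_lift1)
  have "affine hull \<tau> = ?H"
  proof (rule affine_dim_equal)
    show "affine hull \<tau> \<subseteq> ?H"
      by (rule hull_minimal[where S = affine, OF _ affine_hyperplane]) (use normal_zero[OF assms] H in blast)
    show "aff_dim (affine hull \<tau>) = aff_dim ?H"
      using assms linear_part_nonzero[OF assms] by (simp add: faces_def aff_dim_hyperplane)
  qed (use wall_nonempty[OF assms] in \<open>auto simp: affine_hyperplane\<close>)
  then show ?thesis using H by simp
qed

text \<open>A facet is exposed, and the exposing functional is constant on the affine hull of the
  wall, hence a nonzero multiple \<open>c\<close> of the given form up to that constant. So the form
  has one sign on the cell and cuts out exactly the facet.\<close>

lemma facet_functional:
  assumes \<sigma>: "\<sigma> \<in> cells P" and \<tau>: "\<tau> facet_of \<sigma>"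
  obtains c where "c \<noteq> 0" "\<And>x. x \<in> \<sigma> \<Longrightarrow> c * (a \<tau> \<bullet> lift1 x) \<le> 0"
    "\<tau> = {x \<in> \<sigma>. a \<tau> \<bullet> lift1 x = 0}"
proof -
  have w: "\<tau> \<in> walls P" by (rule facet_wall[OF assms])
  have "polyhedron \<sigma>" using \<sigma> complex by (auto simp: faces_def polyhedral_complex_def polytope_imp_polyhedron)
  then have "\<tau> exposed_face_of \<sigma>" using \<tau> by (simp add: exposed_face_of_polyhedron facet_of_def)
  moreover have ne: "\<tau> \<noteq> {}" "\<tau> \<noteq> \<sigma>" using \<tau> by (auto simp: facet_of_def)
  ultimately obtain v b where vb: "v \<noteq> 0" "\<sigma> \<subseteq> {x. v \<bullet> x \<le> b}" "\<tau> = \<sigma> \<inter> {x. v \<bullet> x = b}"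
    unfolding exposed_face_of by blast
  let ?u = "linear_part (a \<tau>)"
  have u0: "?u \<noteq> 0" by (rule linear_part_nonzero[OF w])
  have "affine hull \<tau> \<subseteq> {x. v \<bullet> x = b}"
    by (rule hull_minimal[where S = affine, OF _ affine_hyperplane]) (use vb(3) in blast)
  then have sub: "v \<bullet> x = b" if "a \<tau> \<bullet> lift1 x = 0" for x using affine_hull_wall[OF w] that by auto
  obtain x0 where x0: "x0 \<in> \<tau>" using ne by blast
  have a0: "a \<tau> \<bullet> lift1 x0 = 0" by (rule normal_zero[OF w x0])
  have orth: "v \<bullet> y = 0" if "?u \<bullet> y = 0" for y
  proof -
    have "a \<tau> \<bullet> lift1 (x0 + y) = 0" using a0 that by (simp add: inner_lift1 inner_add_right)
    then show ?thesis using sub[of "x0 + y"] sub[OF a0] by (simp add: inner_add_right)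
  qed
  define c where "c = v \<bullet> ?u / (?u \<bullet> ?u)"
  have c: "v = c *\<^sub>R ?u" unfolding c_def by (rule proportional_normals[OF u0 orth])
  have aN: "a \<tau> $ None = - (?u \<bullet> x0)" using a0 by (simp add: inner_lift1)
  have b: "b = c * (?u \<bullet> x0)" using sub[OF a0] by (simp add: c)
  have vx: "v \<bullet> x - b = c * (a \<tau> \<bullet> lift1 x)" for x
    by (simp add: c inner_lift1 aN b algebra_simps)
  show thesis
  proof
    show c0: "c \<noteq> 0" using c vb(1) by auto
    show "c * (a \<tau> \<bullet> lift1 x) \<le> 0" if "x \<in> \<sigma>" for x using vx[of x] vb(2) that by auto
    have "v \<bullet> x = b \<longleftrightarrow> a \<tau> \<bullet> lift1 x = 0" for x using vx[of x] c0 by auto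
    then have "\<sigma> \<inter> {x. v \<bullet> x = b} = {x \<in> \<sigma>. a \<tau> \<bullet> lift1 x = 0}" by blast
    with vb(3) show "\<tau> = {x \<in> \<sigma>. a \<tau> \<bullet> lift1 x = 0}" by (rule trans)
  qed
qed

lemma facet_eq: "\<sigma> \<in> cells P \<Longrightarrow> \<tau> facet_of \<sigma> \<Longrightarrow> \<tau> = {x \<in> \<sigma>. a \<tau> \<bullet> lift1 x = 0}"
  by (erule (1) facet_functional)

lemma facet_sign:
  assumes "\<sigma> \<in> cells P" "\<tau> facet_of \<sigma>"
  shows "\<exists>c. c \<noteq> 0 \<and> (\<forall>x\<in>\<sigma>. c * (a \<tau> \<bullet> lift1 x) \<le> 0)"
  by (rule facet_functional[OF assms]) blast

text \<open>Proportional forms have the same zeros, and each facet is the full zero set of its form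
  in the cell.\<close>

lemma facet_in_hyperplane_unique:
  assumes \<sigma>: "\<sigma> \<in> cells P" and \<tau>: "\<tau> facet_of \<sigma>" "\<tau>' facet_of \<sigma>" and span: "a \<tau>' \<in> span {a \<tau>}"
  shows "\<tau>' = \<tau>"
proof -
  obtain k where k: "a \<tau>' = k *\<^sub>R a \<tau>" using span by (auto simp: span_singleton)
  have "k \<noteq> 0" using k normal[OF facet_wall[OF \<sigma> \<tau>(2)]] by auto
  moreover have "\<tau> = {x \<in> \<sigma>. a \<tau> \<bullet> lift1 x = 0}" by (rule facet_eq[OF \<sigma> \<tau>(1)])
  moreover have "\<tau>' = {x \<in> \<sigma>. a \<tau>' \<bullet> lift1 x = 0}" by (rule facet_eq[OF \<sigma> \<tau>(2)])
  ultimately show ?thesis using k by simp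
qed

lemma facet_subset_eq:
  assumes \<sigma>: "\<sigma> \<in> cells P" and \<tau>: "\<tau> facet_of \<sigma>" "\<tau>' facet_of \<sigma>" and sub: "\<tau>' \<subseteq> \<tau>"
  shows "\<tau>' = \<tau>"
proof (rule ccontr)
  assume ne: "\<tau>' \<noteq> \<tau>"
  have "\<tau>' face_of \<tau>" using face_of_subset[of \<tau>' \<sigma> \<tau>] \<tau> sub by (auto simp: facet_of_def face_of_imp_subset)
  moreover have "convex \<tau>" using facet_wall[OF \<sigma> \<tau>(1)] face_convex by (auto simp: faces_def)
  ultimately have "aff_dim \<tau>' < aff_dim \<tau>" using ne by (intro face_of_aff_dim_lt)
  then show False using \<tau> by (simp add: facet_of_def)
qed

lemma cell_interior_point:
  assumes \<sigma>: "\<sigma> \<in> cells P"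
  obtains x where "x \<in> rel_interior \<sigma>" "x \<in> \<sigma>" "\<And>\<tau>. \<tau> facet_of \<sigma> \<Longrightarrow> a \<tau> \<bullet> lift1 x \<noteq> 0"
proof -
  have "\<sigma> \<noteq> {}" "convex \<sigma>" using \<sigma> face_convex by (auto simp: faces_def)
  then obtain x where x: "x \<in> rel_interior \<sigma>" using rel_interior_eq_empty[of \<sigma>] by blast
  have x\<sigma>: "x \<in> \<sigma>" using x rel_interior_subset[of \<sigma>] by blast
  have "a \<tau> \<bullet> lift1 x \<noteq> 0" if \<tau>: "\<tau> facet_of \<sigma>" for \<tau>
  proof
    assume "a \<tau> \<bullet> lift1 x = 0"
    moreover have "\<tau> = {x \<in> \<sigma>. a \<tau> \<bullet> lift1 x = 0}" by (rule facet_eq[OF \<sigma> \<tau>])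
    ultimately have "x \<in> \<tau>" using x\<sigma> by blast
    moreover have "\<tau> face_of \<sigma>" "\<tau> \<noteq> \<sigma>" using \<tau> by (auto simp: facet_of_def)
    ultimately show False using face_of_disjoint_rel_interior[of \<tau> \<sigma>] x by blast
  qed
  then show thesis using that x x\<sigma> by blast
qed

text \<open>The three functionals are nonpositive on the cell. If \<open>b3\<close> is nonnegative,
  an interior point makes the sum strictly negative. Otherwise look at points of
  \<open>\<tau>3\<close>: the third term is zero there, so the first two vanish, which places
  \<open>\<tau>3\<close> inside \<open>\<tau>1\<close>.\<close>

lemma no_positive_relation:
  assumes \<sigma>: "\<sigma> \<in> cells P" and \<tau>: "\<tau>1 facet_of \<sigma>" "\<tau>2 facet_of \<sigma>" "\<tau>3 facet_of \<sigma>"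
    and ne: "\<tau>3 \<noteq> \<tau>1"
    and c1: "\<And>x. x \<in> \<sigma> \<Longrightarrow> c1 * (a \<tau>1 \<bullet> lift1 x) \<le> 0" "c1 \<noteq> 0"
    and c2: "\<And>x. x \<in> \<sigma> \<Longrightarrow> c2 * (a \<tau>2 \<bullet> lift1 x) \<le> 0"
    and c3: "\<And>x. x \<in> \<sigma> \<Longrightarrow> c3 * (a \<tau>3 \<bullet> lift1 x) \<le> 0"
    and rel: "(b1 * c1) *\<^sub>R a \<tau>1 + (b2 * c2) *\<^sub>R a \<tau>2 + (b3 * c3) *\<^sub>R a \<tau>3 = 0"
    and b: "b1 > 0" "b2 > 0"
  shows False
proof -
  have rel': "b1 * (c1 * (a \<tau>1 \<bullet> lift1 x)) + b2 * (c2 * (a \<tau>2 \<bullet> lift1 x)) + b3 * (c3 * (a \<tau>3 \<bullet> lift1 x)) = 0" for x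
    using arg_cong[OF rel, of "\<lambda>v. v \<bullet> lift1 x"] by (simp add: inner_add_left mult.assoc)
  show False
  proof (cases "b3 \<ge> 0")
    case True
    obtain x where x: "x \<in> \<sigma>" "\<And>\<tau>. \<tau> facet_of \<sigma> \<Longrightarrow> a \<tau> \<bullet> lift1 x \<noteq> 0"
      by (rule cell_interior_point[OF \<sigma>]) blast
    have "c1 * (a \<tau>1 \<bullet> lift1 x) < 0" using c1(1)[OF x(1)] c1(2) x(2)[OF \<tau>(1)] by (simp add: order_less_le)
    then have "b1 * (c1 * (a \<tau>1 \<bullet> lift1 x)) < 0" using b by (simp add: mult_pos_neg)
    moreover have "b2 * (c2 * (a \<tau>2 \<bullet> lift1 x)) \<le> 0" using c2[OF x(1)] b by (simp add: mult_nonneg_nonpos)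
    moreover have "b3 * (c3 * (a \<tau>3 \<bullet> lift1 x)) \<le> 0" using c3[OF x(1)] True by (simp add: mult_nonneg_nonpos)
    ultimately show False using rel'[of x] by linarith
  next
    case False
    have "\<tau>3 \<subseteq> \<tau>1"
    proof
      fix x assume x: "x \<in> \<tau>3"
      then have x\<sigma>: "x \<in> \<sigma>" using \<tau>(3) by (auto simp: facet_of_def dest: face_of_imp_subset)
      have "a \<tau>3 \<bullet> lift1 x = 0" using normal_zero[OF facet_wall[OF \<sigma> \<tau>(3)] x] .
      then have "b1 * (c1 * (a \<tau>1 \<bullet> lift1 x)) + b2 * (c2 * (a \<tau>2 \<bullet> lift1 x)) = 0" using rel'[of x] by simp
      moreover have "b1 * (c1 * (a \<tau>1 \<bullet> lift1 x)) \<le> 0" "b2 * (c2 * (a \<tau>2 \<bullet> lift1 x)) \<le> 0"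
        using c1(1)[OF x\<sigma>] c2[OF x\<sigma>] b by (simp_all add: mult_nonneg_nonpos)
      ultimately have "b1 * (c1 * (a \<tau>1 \<bullet> lift1 x)) = 0" by linarith
      then have "a \<tau>1 \<bullet> lift1 x = 0" using b c1(2) by simp
      moreover have "\<tau>1 = {x \<in> \<sigma>. a \<tau>1 \<bullet> lift1 x = 0}" by (rule facet_eq[OF \<sigma> \<tau>(1)])
      ultimately show "x \<in> \<tau>1" using x\<sigma> by blast
    qed
    then show False using facet_subset_eq[OF \<sigma> \<tau>(1,3)] ne by simp
  qed
qed

text \<open>In a linear relation between three facet normals all coefficients are nonzero. After
  normalizing the forms to be nonpositive on the cell, two coefficients have the same sign, which
  \<open>no_positive_relation\<close> excludes.\<close>

lemma three_facets_independent:
  assumes \<sigma>: "\<sigma> \<in> cells P" and \<tau>: "\<tau>1 facet_of \<sigma>" "\<tau>2 facet_of \<sigma>" "\<tau>3 facet_of \<sigma>"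
    and ne: "\<tau>1 \<noteq> \<tau>2" "\<tau>1 \<noteq> \<tau>3" "\<tau>2 \<noteq> \<tau>3"
  shows "a \<tau>3 \<notin> span {a \<tau>1, a \<tau>2}"
proof
  assume "a \<tau>3 \<in> span {a \<tau>1, a \<tau>2}"
  then obtain x y where xy: "a \<tau>3 = x *\<^sub>R a \<tau>1 + y *\<^sub>R a \<tau>2"
    by (auto simp: span_insert span_singleton algebra_simps)
  have y0: "y \<noteq> 0"
  proof
    assume "y = 0"
    then have "a \<tau>3 \<in> span {a \<tau>1}" using xy by (auto simp: span_singleton)
    then show False using facet_in_hyperplane_unique[OF \<sigma> \<tau>(1,3)] ne by simp
  qed
  have x0: "x \<noteq> 0"
  proof
    assume "x = 0"
    then have "a \<tau>3 \<in> span {a \<tau>2}" using xy by (auto simp: span_singleton)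
    then show False using facet_in_hyperplane_unique[OF \<sigma> \<tau>(2,3)] ne by simp
  qed
  obtain c1 where c1: "c1 \<noteq> 0" "\<And>x. x \<in> \<sigma> \<Longrightarrow> c1 * (a \<tau>1 \<bullet> lift1 x) \<le> 0" using facet_sign[OF \<sigma> \<tau>(1)] by blast
  obtain c2 where c2: "c2 \<noteq> 0" "\<And>x. x \<in> \<sigma> \<Longrightarrow> c2 * (a \<tau>2 \<bullet> lift1 x) \<le> 0" using facet_sign[OF \<sigma> \<tau>(2)] by blast
  obtain c3 where c3: "c3 \<noteq> 0" "\<And>x. x \<in> \<sigma> \<Longrightarrow> c3 * (a \<tau>3 \<bullet> lift1 x) \<le> 0" using facet_sign[OF \<sigma> \<tau>(3)] by blast
  \<comment> \<open>The coefficients of the relation with respect to the sign-normalized forms,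
    whose scaling factors are \<open>c1\<close>, \<open>c2\<close>, \<open>c3\<close>. The later
    choices 1 and -1 for \<open>s\<close> cover both common signs.\<close>
  define b1 b2 b3 where "b1 = x / c1" and "b2 = y / c2" and "b3 = - 1 / c3"
  have b0: "b1 \<noteq> 0" "b2 \<noteq> 0" "b3 \<noteq> 0" using x0 y0 c1 c2 c3 by (auto simp: b1_def b2_def b3_def)
  have rel: "(s * b1 * c1) *\<^sub>R a \<tau>1 + (s * b2 * c2) *\<^sub>R a \<tau>2 + (s * b3 * c3) *\<^sub>R a \<tau>3 = 0" for s
    using c1(1) c2(1) c3(1) by (simp add: b1_def b2_def b3_def xy scaleR_add_right)
  have pos: "\<not> (s * b1 > 0 \<and> s * b2 > 0)" "\<not> (s * b1 > 0 \<and> s * b3 > 0)" "\<not> (s * b2 > 0 \<and> s * b3 > 0)" for s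
    using no_positive_relation[OF \<sigma> \<tau>(1,2,3) ne(2)[symmetric] c1(2,1) c2(2) c3(2), where ?b1.0 = "s * b1" and ?b2.0 = "s * b2" and ?b3.0 = "s * b3"]
      no_positive_relation[OF \<sigma> \<tau>(1,3,2) ne(1)[symmetric] c1(2,1) c3(2) c2(2), where ?b1.0 = "s * b1" and ?b2.0 = "s * b3" and ?b3.0 = "s * b2"]
      no_positive_relation[OF \<sigma> \<tau>(2,3,1) ne(1) c2(2,1) c3(2) c1(2), where ?b1.0 = "s * b2" and ?b2.0 = "s * b3" and ?b3.0 = "s * b1"]
      rel[of s] by (auto simp: add_ac)
  show False using pos[of 1] pos[of "-1"] b0 by (auto simp: not_less)
qed

text \<open>Three such facets would have three independent normals in a space spanned by two
  vectors. This bound is the source of degree at most two in the graph of a codimension two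
  subspace.\<close>

lemma facets_through_codim2:
  assumes \<sigma>: "\<sigma> \<in> cells P"
  shows "card {\<tau> \<in> walls P. \<tau> facet_of \<sigma> \<and> a \<tau> \<in> span {u, v}} \<le> 2"
proof (rule ccontr)
  let ?T = "{\<tau> \<in> walls P. \<tau> facet_of \<sigma> \<and> a \<tau> \<in> span {u, v}}"
  assume "\<not> card ?T \<le> 2"
  then have "3 \<le> card ?T" by simp
  then obtain T where T: "T \<subseteq> ?T" "card T = 3" by (rule obtain_subset_with_card_n)
  then obtain \<tau>1 \<tau>2 \<tau>3 where t: "T = {\<tau>1, \<tau>2, \<tau>3}" "\<tau>1 \<noteq> \<tau>2" "\<tau>1 \<noteq> \<tau>3" "\<tau>2 \<noteq> \<tau>3"
    by (auto simp: card_3_iff)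
  have f: "\<tau>1 facet_of \<sigma>" "\<tau>2 facet_of \<sigma>" "\<tau>3 facet_of \<sigma>" using T t by auto
  have s: "a \<tau>1 \<in> span {u, v}" "a \<tau>2 \<in> span {u, v}" "a \<tau>3 \<in> span {u, v}" using T t by auto
  have n3: "a \<tau>3 \<notin> span {a \<tau>1, a \<tau>2}" by (rule three_facets_independent[OF \<sigma> f t(2-4)])
  have n2: "a \<tau>2 \<notin> span {a \<tau>1}" using facet_in_hyperplane_unique[OF \<sigma> f(1,2)] t by auto
  have n1: "a \<tau>1 \<noteq> 0" using normal[OF facet_wall[OF \<sigma> f(1)]] .
  have "independent {a \<tau>1}" using n1 by simp
  then have "independent {a \<tau>2, a \<tau>1}" by (rule independent_insertI[OF n2])
  then have "independent {a \<tau>1, a \<tau>2}" by (simp add: insert_commute)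
  then have ind: "independent {a \<tau>3, a \<tau>1, a \<tau>2}" by (rule independent_insertI[OF n3])
  have "a \<tau>3 \<noteq> a \<tau>1" "a \<tau>3 \<noteq> a \<tau>2" using n3 span_base[of "a \<tau>3" "{a \<tau>1, a \<tau>2}"] by auto
  moreover have "a \<tau>2 \<noteq> a \<tau>1" using n2 span_base[of "a \<tau>2" "{a \<tau>1}"] by auto
  ultimately have "card {a \<tau>3, a \<tau>1, a \<tau>2} = 3" by auto
  moreover have "card {a \<tau>3, a \<tau>1, a \<tau>2} \<le> card {u, v}"
    using independent_span_bound[of "{u, v}", OF _ ind] s by auto
  moreover have "card {u, v} \<le> 2" by (simp add: card_insert_if)
  ultimately show False by linarith
qed

text \<open>Two cells on the same side of a common wall overlap near a relative interior point of the wall.\<close>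

lemma same_side_cells_eq:
  assumes \<sigma>: "\<sigma> \<in> cells P" "\<sigma>' \<in> cells P" and \<tau>: "\<tau> facet_of \<sigma>" "\<tau> facet_of \<sigma>'"
    and p: "p \<in> rel_interior \<sigma>" "p' \<in> \<sigma>'"
    and same: "(a \<tau> \<bullet> lift1 p) * (a \<tau> \<bullet> lift1 p') > 0"
  shows "\<sigma> = \<sigma>'"
proof -
  define h where "h y = a \<tau> \<bullet> lift1 y" for y
  have haff: "h y = linear_part (a \<tau>) \<bullet> y + a \<tau> $ None" for y by (simp add: h_def inner_lift1)
  have w: "\<tau> \<in> walls P" by (rule facet_wall[OF \<sigma>(1) \<tau>(1)])
  have conv: "convex \<sigma>" "convex \<sigma>'" "convex \<tau>" using \<sigma> w face_convex by (auto simp: faces_def)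
  have sub: "\<tau> \<subseteq> \<sigma>" "\<tau> \<subseteq> \<sigma>'" using \<tau> by (auto simp: facet_of_def dest: face_of_imp_subset)
  obtain x where x: "x \<in> rel_interior \<tau>" using rel_interior_eq_empty[OF conv(3)] wall_nonempty[OF w] by blast
  have x\<tau>: "x \<in> \<tau>" using x rel_interior_subset[of \<tau>] by blast
  then have hx: "h x = 0" using normal_zero[OF w] by (simp add: h_def)
  \<comment> \<open>\<open>q\<close> balances the heights of \<open>p\<close> and \<open>p'\<close>
    over the hyperplane of the wall, so that \<open>w'\<close> is parallel to it.\<close>
  define q where "q = h p / h p'"
  have hp': "h p' \<noteq> 0" using same by (auto simp: h_def)
  have q: "q > 0" using same unfolding q_def h_def[symmetric] by (simp add: zero_less_divide_iff zero_less_mult_iff)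
  define w' where "w' = (p - x) - q *\<^sub>R (p' - x)"
  obtain e where e: "e > 0" "ball x e \<inter> affine hull \<tau> \<subseteq> \<tau>" using x mem_rel_interior_ball[of x \<tau>] by blast
  \<comment> \<open>A step so short that \<open>z\<close> stays in the wall; the summand 1 prevents
    a zero denominator.\<close>
  define s where "s = min 1 (e / (2 * (norm w' + 1)))"
  have np: "2 * (norm w' + 1) > 0" by (simp add: add_nonneg_pos)
  have s: "0 < s" "s \<le> 1" using e(1) np by (auto simp: s_def)
  have "s * norm w' \<le> e / (2 * (norm w' + 1)) * norm w'" by (rule mult_right_mono) (auto simp: s_def)
  also have "\<dots> < e" using e(1) np by (simp add: field_simps) (smt (verit) mult_nonneg_nonneg norm_ge_zero)
  finally have sw: "s * norm w' < e" .
  define z where "z = x + s *\<^sub>R w'"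
  have "linear_part (a \<tau>) \<bullet> w' = (h p - h x) - q * (h p' - h x)"
    by (simp add: w'_def haff inner_diff_right)
  then have "linear_part (a \<tau>) \<bullet> w' = 0" using hx hp' by (simp add: q_def)
  then have "h z = 0" using hx by (simp add: haff z_def inner_add_right)
  then have "z \<in> affine hull \<tau>" using affine_hull_wall[OF w] by (simp add: h_def)
  moreover have "z \<in> ball x e" using sw s by (simp add: z_def dist_norm)
  ultimately have z: "z \<in> \<tau>" using e by blast
  \<comment> \<open>With this \<open>t\<close> the point \<open>y\<close> lies on the segment from
    \<open>x\<close> to \<open>p\<close> and also on the one from \<open>z\<close> to
    \<open>p'\<close>, so in the relative interior of the first cell and in the second.\<close>
  define t where "t = s / (1 + s * q)"
  have den: "1 + s * q > 0" using s q by (simp add: add_pos_pos)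
  have "s \<le> 1 + s * q" using s q by (smt (verit) mult_pos_pos)
  then have t: "0 < t" "t \<le> 1" using s den by (auto simp: t_def)
  define y where "y = (1 - t) *\<^sub>R x + t *\<^sub>R p"
  have tq: "t * q = s * q / (1 + s * q)" "1 - t * q = 1 / (1 + s * q)" using den by (auto simp: t_def field_simps)
  have ts: "(1 - t * q) * s = t" using tq den by (simp add: t_def)
  have "(1 - t * q) *\<^sub>R z + (t * q) *\<^sub>R p' = (1 - t * q) *\<^sub>R x + ((1 - t * q) * s) *\<^sub>R w' + (t * q) *\<^sub>R p'"
    by (simp add: z_def scaleR_add_right)
  also have "\<dots> = y" unfolding ts by (simp add: y_def w'_def algebra_simps)
  finally have y': "y = (1 - t * q) *\<^sub>R z + (t * q) *\<^sub>R p'" by simp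
  have "0 \<le> 1 - t * q" "0 \<le> t * q" using tq s q den by auto
  then have "y \<in> \<sigma>'" unfolding y' using conv(2) z p(2) sub by (intro convexD) auto
  moreover have "y = x - t *\<^sub>R (x - p)" by (simp add: y_def algebra_simps)
  then have yr: "y \<in> rel_interior \<sigma>"
    using rel_interior_convex_shrink[OF conv(1) p(1), of x t] x\<tau> sub(1) t by auto
  ultimately have "y \<in> (\<sigma> \<inter> \<sigma>') \<inter> rel_interior \<sigma>" using rel_interior_subset[of \<sigma>] by blast
  moreover have f: "\<sigma> \<inter> \<sigma>' face_of \<sigma>" "\<sigma> \<inter> \<sigma>' face_of \<sigma>'"
    using complex \<sigma> by (auto simp: polyhedral_complex_def faces_def)
  ultimately have "\<sigma> \<inter> \<sigma>' = \<sigma>" using face_of_disjoint_rel_interior[OF f(1)] by blast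
  then have "\<sigma> face_of \<sigma>'" using f(2) by simp
  then show ?thesis using face_of_aff_dim_lt[OF conv(2), of \<sigma>] \<sigma> by (force simp: faces_def)
qed

text \<open>Among the heights of interior points of three cells over the wall, two have the same
  sign, and cells on the same side coincide.\<close>

lemma wall_in_two_cells: "card {\<sigma> \<in> cells P. \<tau> facet_of \<sigma>} \<le> 2"
proof (rule ccontr)
  let ?S = "{\<sigma> \<in> cells P. \<tau> facet_of \<sigma>}"
  assume "\<not> card ?S \<le> 2"
  then have "3 \<le> card ?S" by simp
  then obtain T where T: "T \<subseteq> ?S" "card T = 3" by (rule obtain_subset_with_card_n)
  then obtain \<sigma>1 \<sigma>2 \<sigma>3 where t: "T = {\<sigma>1, \<sigma>2, \<sigma>3}" "\<sigma>1 \<noteq> \<sigma>2" "\<sigma>1 \<noteq> \<sigma>3" "\<sigma>2 \<noteq> \<sigma>3"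
    by (auto simp: card_3_iff)
  have c: "\<sigma>1 \<in> cells P" "\<sigma>2 \<in> cells P" "\<sigma>3 \<in> cells P" and f: "\<tau> facet_of \<sigma>1" "\<tau> facet_of \<sigma>2" "\<tau> facet_of \<sigma>3"
    using T t by auto
  obtain p1 where p1: "p1 \<in> rel_interior \<sigma>1" "p1 \<in> \<sigma>1" "a \<tau> \<bullet> lift1 p1 \<noteq> 0"
    by (rule cell_interior_point[OF c(1)]) (use f(1) in blast)
  obtain p2 where p2: "p2 \<in> rel_interior \<sigma>2" "p2 \<in> \<sigma>2" "a \<tau> \<bullet> lift1 p2 \<noteq> 0"
    by (rule cell_interior_point[OF c(2)]) (use f(2) in blast)
  obtain p3 where p3: "p3 \<in> rel_interior \<sigma>3" "p3 \<in> \<sigma>3" "a \<tau> \<bullet> lift1 p3 \<noteq> 0"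
    by (rule cell_interior_point[OF c(3)]) (use f(3) in blast)
  have "\<not> (a \<tau> \<bullet> lift1 p1) * (a \<tau> \<bullet> lift1 p2) > 0"
    using same_side_cells_eq[OF c(1,2) f(1,2) p1(1) p2(2)] t by blast
  moreover have "\<not> (a \<tau> \<bullet> lift1 p1) * (a \<tau> \<bullet> lift1 p3) > 0"
    using same_side_cells_eq[OF c(1,3) f(1,3) p1(1) p3(2)] t by blast
  moreover have "\<not> (a \<tau> \<bullet> lift1 p2) * (a \<tau> \<bullet> lift1 p3) > 0"
    using same_side_cells_eq[OF c(2,3) f(2,3) p2(1) p3(2)] t by blast
  ultimately show False using p1(3) p2(3) p3(3) by (auto simp: zero_less_mult_iff not_less)
qed

text \<open>The intersection of the cells is a proper face of \<sigma> that contains the facet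
  \<tau>, and no dimension lies strictly between d - 1 and d.\<close>

lemma common_wall_unique:
  assumes \<sigma>: "\<sigma> \<in> cells P" "\<sigma>' \<in> cells P" "\<sigma> \<noteq> \<sigma>'" and \<tau>: "\<tau> facet_of \<sigma>" "\<tau> facet_of \<sigma>'"
  shows "\<tau> = \<sigma> \<inter> \<sigma>'"
proof (rule ccontr)
  assume ne: "\<tau> \<noteq> \<sigma> \<inter> \<sigma>'"
  have f: "\<sigma> \<inter> \<sigma>' face_of \<sigma>" "\<sigma> \<inter> \<sigma>' face_of \<sigma>'"
    using complex \<sigma> by (auto simp: polyhedral_complex_def faces_def)
  have conv: "convex \<sigma>" "convex \<sigma>'" using \<sigma> face_convex by (auto simp: faces_def)
  have "\<sigma> \<inter> \<sigma>' \<noteq> \<sigma>"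
  proof
    assume "\<sigma> \<inter> \<sigma>' = \<sigma>"
    then have "\<sigma> face_of \<sigma>'" using f by simp
    then show False using face_of_aff_dim_lt[OF conv(2), of \<sigma>] \<sigma> by (auto simp: faces_def)
  qed
  then have d: "aff_dim (\<sigma> \<inter> \<sigma>') < aff_dim \<sigma>" using face_of_aff_dim_lt[OF conv(1) f(1)] by simp
  have "\<tau> \<subseteq> \<sigma> \<inter> \<sigma>'" "\<tau> face_of \<sigma>" using \<tau> by (auto simp: facet_of_def dest: face_of_imp_subset)
  then have "\<tau> face_of (\<sigma> \<inter> \<sigma>')" using face_of_subset[of \<tau> \<sigma> "\<sigma> \<inter> \<sigma>'"] by simp
  then have "aff_dim \<tau> < aff_dim (\<sigma> \<inter> \<sigma>')" using ne conv by (intro face_of_aff_dim_lt convex_Int)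
  then show False using d \<tau>(1) by (simp add: facet_of_def)
qed

lemma interior_wall_iff:
  assumes "\<sigma> \<in> cells P" "\<sigma>' \<in> cells P" "\<sigma> \<noteq> \<sigma>'" "\<tau> facet_of \<sigma>" "\<tau> facet_of \<sigma>'"
  shows "\<tau> \<in> interior_walls P" "{\<rho> \<in> cells P. \<tau> facet_of \<rho>} = {\<sigma>, \<sigma>'}"
proof -
  have sub: "{\<sigma>, \<sigma>'} \<subseteq> {\<rho> \<in> cells P. \<tau> facet_of \<rho>}" and fin: "finite {\<rho> \<in> cells P. \<tau> facet_of \<rho>}"
    using assms finite_cells by auto
  have "card {\<rho> \<in> cells P. \<tau> facet_of \<rho>} \<le> card {\<sigma>, \<sigma>'}" using wall_in_two_cells[of \<tau>] assms(3) by simp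
  then show eq: "{\<rho> \<in> cells P. \<tau> facet_of \<rho>} = {\<sigma>, \<sigma>'}" using card_seteq[OF fin sub] by simp
  then show "\<tau> \<in> interior_walls P"
    using facet_wall[OF assms(1,4)] assms(3) by (simp add: interior_walls_def)
qed

end

section \<open>Graphs of degree two\<close>

text \<open>The tent function: the barycentric coordinate of a vertex while the parameter runs along
  its two adjacent edges.\<close>

definition hat :: "real \<Rightarrow> real" where
  "hat s = max 0 (1 - \<bar>s\<bar>)"

text \<open>Parametrizes the walk \<open>w\<close> by the interval from 0 to \<open>N\<close>. The
  sum over indices lets a vertex visited twice, as at the ends of a cycle, collect both
  contributions.\<close>

definition polyline :: "(nat \<Rightarrow> 'v) \<Rightarrow> nat \<Rightarrow> real \<Rightarrow> 'v \<Rightarrow> real" where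
  "polyline w N s = (\<lambda>v. \<Sum>j\<le>N. if w j = v then hat (s - real j) else 0)"

definition edge_point :: "'v \<Rightarrow> 'v \<Rightarrow> real \<Rightarrow> 'v \<Rightarrow> real" where
  "edge_point u v t = (\<lambda>x. (if x = u then 1 - t else 0) + (if x = v then t else 0))"

lemma polyline_segment:
  assumes "i < N" "0 \<le> t" "t \<le> 1"
  shows "polyline w N (real i + t) = edge_point (w i) (w (Suc i)) t"
proof
  fix v
  have "polyline w N (real i + t) v = (\<Sum>j\<in>{i, Suc i}. if w j = v then hat (real i + t - real j) else 0)"
    unfolding polyline_def
  proof (rule sum.mono_neutral_right)
    show "\<forall>j\<in>{..N} - {i, Suc i}. (if w j = v then hat (real i + t - real j) else 0) = 0"
    proof
      fix j assume "j \<in> {..N} - {i, Suc i}"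
      then have "j + 1 \<le> i \<or> i + 2 \<le> j" by auto
      then have "real j + 1 \<le> real i \<or> real i + 2 \<le> real j" by linarith
      then have "1 \<le> \<bar>real i + t - real j\<bar>" using assms by linarith
      then show "(if w j = v then hat (real i + t - real j) else 0) = 0" by (simp add: hat_def)
    qed
  qed (use assms in auto)
  then show "polyline w N (real i + t) v = edge_point (w i) (w (Suc i)) t v"
    using assms by (simp add: edge_point_def hat_def)
qed

lemma polyline_vertex: "polyline w 0 0 = edge_point (w 0) v 0"
  by (auto simp: polyline_def edge_point_def hat_def fun_eq_iff)

lemma continuous_polyline: "continuous_on A (polyline w N)"
  unfolding polyline_def
proof (rule continuous_on_coordinatewise_then_product)
  fix v
  show "continuous_on A (\<lambda>s. \<Sum>j\<le>N. if w j = v then hat (s - real j) else 0)"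
  proof (rule continuous_on_sum)
    fix j
    show "continuous_on A (\<lambda>s. if w j = v then hat (s - real j) else 0)"
      by (cases "w j = v") (auto simp: hat_def intro!: continuous_intros)
  qed
qed

lemma realization_vertex: "v \<in> C \<Longrightarrow> edge_point v u 0 \<in> realization (C, E)"
proof -
  assume v: "v \<in> C"
  have "{x. edge_point v u 0 x \<noteq> 0} = {v}" by (auto simp: edge_point_def)
  then show ?thesis using v by (auto simp: realization_def edge_point_def)
qed

lemma realization_edge:
  assumes "u \<in> C" "v \<in> C" "{u, v} \<in> E" "u \<noteq> v" "0 \<le> t" "t \<le> 1"
  shows "edge_point u v t \<in> realization (C, E)"
proof -
  consider "t = 0" | "t = 1" | "0 < t" "t < 1" using assms by linarith
  then show ?thesis
  proof cases
    case 1
    then show ?thesis using realization_vertex[OF assms(1)] by simp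
  next
    case 2
    have "edge_point u v 1 = edge_point v u 0" by (auto simp: edge_point_def fun_eq_iff)
    then show ?thesis using realization_vertex[OF assms(2), of u E] 2 by simp
  next
    case 3
    then have "{x. edge_point u v t x \<noteq> 0} = {u, v}" using assms(4) by (auto simp: edge_point_def)
    moreover have "0 \<le> edge_point u v t x" for x using 3 by (auto simp: edge_point_def)
    moreover have "(\<Sum>x\<in>{u, v}. edge_point u v t x) = 1" using assms(4) by (simp add: edge_point_def)
    ultimately show ?thesis using assms(3) by (simp add: realization_def)
  qed
qed

lemma realization_cases:
  assumes x: "x \<in> realization (C, E)" and E: "\<And>e. e \<in> E \<Longrightarrow> \<exists>u v. e = {u, v} \<and> u \<noteq> v"
  shows "(\<exists>v\<in>C. x = edge_point v v 0) \<or> (\<exists>u v t. {u, v} \<in> E \<and> 0 \<le> t \<and> t \<le> 1 \<and> x = edge_point u v t)"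
proof -
  have x1: "0 \<le> x v" "(\<Sum>v | x v \<noteq> 0. x v) = 1" for v using x by (auto simp: realization_def)
  consider v where "v \<in> C" "{v. x v \<noteq> 0} = {v}" | "{v. x v \<noteq> 0} \<in> E"
    using x by (auto simp: realization_def)
  then show ?thesis
  proof cases
    case 1
    then have "x v = 1" using x1(2) by simp
    moreover have "x y = 0" if "y \<noteq> v" for y using 1(2) that by blast
    ultimately have "x = edge_point v v 0" by (auto simp: edge_point_def fun_eq_iff)
    then show ?thesis using 1 by blast
  next
    case 2
    then obtain u v where uv: "{v. x v \<noteq> 0} = {u, v}" "u \<noteq> v" using E by blast
    then have "x u + x v = 1" using x1(2) by simp
    moreover have "x y = 0" if "y \<noteq> u" "y \<noteq> v" for y using uv(1) that by blast
    ultimately have "x = edge_point u v (x v)" using uv(2) by (auto simp: edge_point_def fun_eq_iff)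
    moreover have "0 \<le> x v" "x v \<le> 1" using x1(1)[of u] x1(1)[of v] \<open>x u + x v = 1\<close> by auto
    moreover have "{u, v} \<in> E" using 2 uv(1) by simp
    ultimately show ?thesis by blast
  qed
qed

definition line_graph :: "(nat \<Rightarrow> 'v) \<Rightarrow> nat \<Rightarrow> 'v graph" where
  "line_graph w N = (w ` {..N}, {{w i, w (Suc i)} | i. i < N})"

text \<open>The clause \<open>t < 1\<close> assigns every parameter except the right end to the
  segment that it starts or lies inside; the injectivity argument for cycles depends on
  this.\<close>

lemma nat_floor_interval:
  assumes "0 \<le> s" "s \<le> real N" "N > 0"
  shows "\<exists>i t. i < N \<and> 0 \<le> t \<and> t \<le> 1 \<and> s = real i + t \<and> (s < real N \<longrightarrow> t < 1)"
proof (cases "s = real N")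
  case True
  have "real (N - 1) + 1 = real N" using assms(3) by linarith
  then show ?thesis using assms(3) True by (intro exI[of _ "N - 1"] exI[of _ 1]) simp
next
  case False
  define i where "i = nat \<lfloor>s\<rfloor>"
  have i: "real i \<le> s" "s < real i + 1" using assms(1) unfolding i_def by linarith+
  then have "real i < real N" using assms(2) False by linarith
  then show ?thesis using i by (intro exI[of _ i] exI[of _ "s - real i"]) simp
qed

lemma realization_line_graph:
  assumes ne: "\<And>i. i < N \<Longrightarrow> w i \<noteq> w (Suc i)"
  shows "realization (line_graph w N) = polyline w N ` {0..real N}"
proof (cases "N = 0")
  case True
  have lg: "line_graph w 0 = ({w 0}, {})" by (auto simp: line_graph_def)
  show ?thesis
  proof (intro equalityI subsetI)
    fix x assume "x \<in> realization (line_graph w N)"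
    then have "x = edge_point (w 0) (w 0) 0" using realization_cases[of x "{w 0}" "{}"] True lg by auto
    then show "x \<in> polyline w N ` {0..real N}" using True polyline_vertex[of w] by auto
  next
    fix x assume "x \<in> polyline w N ` {0..real N}"
    then show "x \<in> realization (line_graph w N)"
      using True lg polyline_vertex[of w] realization_vertex[of "w 0" "{w 0}"] by auto
  qed
next
  case False
  show ?thesis
  proof (intro equalityI subsetI)
    fix x assume "x \<in> polyline w N ` {0..real N}"
    then obtain s where s: "0 \<le> s" "s \<le> real N" "x = polyline w N s" by auto
    obtain i t where it: "i < N" "0 \<le> t" "t \<le> 1" "s = real i + t"
      using nat_floor_interval[OF s(1,2)] False by blast
    have "x = edge_point (w i) (w (Suc i)) t" using s it polyline_segment[OF it(1-3)] by simp
    moreover have "edge_point (w i) (w (Suc i)) t \<in> realization (w ` {..N}, {{w i, w (Suc i)} | i. i < N})"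
      by (rule realization_edge) (use it ne in auto)
    ultimately show "x \<in> realization (line_graph w N)" by (simp add: line_graph_def)
  next
    fix x assume "x \<in> realization (line_graph w N)"
    then have "(\<exists>v\<in>w ` {..N}. x = edge_point v v 0) \<or>
        (\<exists>u v t. {u, v} \<in> {{w i, w (Suc i)} | i. i < N} \<and> 0 \<le> t \<and> t \<le> 1 \<and> x = edge_point u v t)"
      unfolding line_graph_def by (rule realization_cases) (use ne in blast)
    then show "x \<in> polyline w N ` {0..real N}"
    proof (elim disjE bexE exE conjE)
      fix v assume v: "v \<in> w ` {..N}" "x = edge_point v v 0"
      then obtain k where k: "k \<le> N" "v = w k" by auto
      have "x = polyline w N (real k)"
      proof (cases "k < N")
        case True
        have "x = edge_point (w k) (w (Suc k)) 0" using v k by (auto simp: edge_point_def)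
        then show ?thesis using polyline_segment[OF True, of 0 w] by simp
      next
        case F: False
        then have k': "k = Suc (N - 1)" "N - 1 < N" using k False by auto
        have "x = edge_point (w (N - 1)) (w (Suc (N - 1))) 1" using v k k' by (auto simp: edge_point_def)
        then have "x = polyline w N (real (N - 1) + 1)" using polyline_segment[OF k'(2), of 1 w] by simp
        moreover have "real (N - 1) + 1 = real k" using k' by linarith
        ultimately show ?thesis by simp
      qed
      then show ?thesis using k by auto
    next
      fix u v t assume uv: "{u, v} \<in> {{w i, w (Suc i)} | i. i < N}" and t: "0 \<le> t" "t \<le> 1" "x = edge_point u v t"
      then obtain i where i: "i < N" "{u, v} = {w i, w (Suc i)}" by auto
      then consider "u = w i" "v = w (Suc i)" | "v = w i" "u = w (Suc i)" by (auto simp: doubleton_eq_iff)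
      then show ?thesis
      proof cases
        case 1
        then have "x = polyline w N (real i + t)" using t polyline_segment[OF i(1) t(1,2), of w] by simp
        moreover have "real i + 1 \<le> real N" using i by linarith
        ultimately show ?thesis using t i by (intro image_eqI[of _ _ "real i + t"]) auto
      next
        case 2
        have "x = edge_point v u (1 - t)" using t by (auto simp: edge_point_def)
        then have "x = polyline w N (real i + (1 - t))" using 2 t polyline_segment[OF i(1), of "1 - t" w] by simp
        moreover have "real i + 1 \<le> real N" using i by linarith
        ultimately show ?thesis using t i by (intro image_eqI[of _ _ "real i + (1 - t)"]) auto
      qed
    qed
  qed
qed

text \<open>The realization of a path is homeomorphic to an interval, hence contractible, and the
  circle is not.\<close>

lemma path_realization_not_circle:
  assumes inj: "inj_on w {..N}"
  shows "\<not> realization (line_graph w N) homotopy_eqv sphere (0::complex) 1"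
proof
  assume eqv: "realization (line_graph w N) homotopy_eqv sphere (0::complex) 1"
  have ne: "w i \<noteq> w (Suc i)" if "i < N" for i using inj_onD[OF inj, of i "Suc i"] that by auto
  have rl: "realization (line_graph w N) = polyline w N ` {0..real N}"
    by (rule realization_line_graph) (rule ne)
  \<comment> \<open>The inverse of the parametrization: the mean of the indices, weighted by the
    barycentric coordinates, is the parameter.\<close>
  define g where "g x = (\<Sum>k\<le>N. real k * x (w k))" for x :: "'a \<Rightarrow> real"
  have gf: "g (polyline w N s) = s" if s: "s \<in> {0..real N}" for s
  proof (cases "N = 0")
    case True
    then show ?thesis using s by (simp add: g_def)
  next
    case False
    have "\<exists>i t. i < N \<and> 0 \<le> t \<and> t \<le> 1 \<and> s = real i + t \<and> (s < real N \<longrightarrow> t < 1)"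
      by (rule nat_floor_interval) (use s False in auto)
    then obtain i t where it: "i < N" "0 \<le> t" "t \<le> 1" "s = real i + t" by blast
    have wk: "w k = w j \<longleftrightarrow> k = j" if "k \<le> N" "j \<le> N" for k j using inj that by (auto simp: inj_on_def)
    have "g (polyline w N s) = (\<Sum>k\<le>N. real k * ((if k = i then 1 - t else 0) + (if k = Suc i then t else 0)))"
      unfolding g_def it(4) polyline_segment[OF it(1-3)]
      by (intro sum.cong) (use it wk in \<open>auto simp: edge_point_def\<close>)
    also have "\<dots> = (\<Sum>k\<le>N. (if k = i then real i * (1 - t) else 0) + (if k = Suc i then real (Suc i) * t else 0))"
      by (intro sum.cong) auto
    also have "\<dots> = real i * (1 - t) + real (Suc i) * t" using it by (simp add: sum.distrib)
    finally show ?thesis using it by (simp add: algebra_simps)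
  qed
  have "{0..real N} homeomorphic realization (line_graph w N)"
    unfolding homeomorphic_def
  proof (intro exI)
    show "homeomorphism {0..real N} (realization (line_graph w N)) (polyline w N) g"
    proof (rule homeomorphismI)
      show "continuous_on {0..real N} (polyline w N)" by (rule continuous_polyline)
      show "continuous_on (realization (line_graph w N)) g" unfolding g_def
        by (intro continuous_intros continuous_on_product_then_coordinatewise[of _ "\<lambda>x. x"])
      show "polyline w N ` {0..real N} \<subseteq> realization (line_graph w N)"
        using rl by simp
      show "g ` realization (line_graph w N) \<subseteq> {0..real N}"
        using rl gf by auto
      show "g (polyline w N x) = x" if "x \<in> {0..real N}" for x by (rule gf[OF that])
      show "polyline w N (g y) = y" if "y \<in> realization (line_graph w N)" for y
        using rl gf that by auto
    qed
  qed
  then have "{0..real N} homotopy_eqv realization (line_graph w N)" by (rule homeomorphic_imp_homotopy_eqv)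
  then have "{0..real N} homotopy_eqv sphere (0::complex) 1" using eqv by (rule homotopy_eqv_trans)
  then have "contractible (sphere (0::complex) 1)"
    using homotopy_eqv_contractibility convex_imp_contractible[OF convex_real_interval(5)] by blast
  then show False by (simp add: contractible_sphere)
qed

text \<open>The polyline around the cycle is a simple closed path, and the image of such a path is
  homeomorphic to the circle.\<close>

lemma cycle_realization_circle_nat:
  fixes w :: "nat \<Rightarrow> nat"
  assumes N: "3 \<le> N" and inj: "inj_on w {..<N}" and loop: "w N = w 0"
  shows "realization (line_graph w N) homotopy_eqv sphere (0::complex) 1"
proof -
  have wcong: "w i = w j \<longleftrightarrow> i = j" if "i < N" "j < N" for i j using inj that by (auto simp: inj_on_def)
  have wSuc: "w i = w (Suc j) \<longleftrightarrow> (if Suc j < N then i = Suc j else i = 0)" if "i < N" "j < N" for i j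
  proof (cases "Suc j < N")
    case False
    then have "Suc j = N" using that by simp
    then show ?thesis using wcong[of i 0] that loop by auto
  qed (use wcong that in auto)
  have ne: "w i \<noteq> w (Suc i)" if "i < N" for i using wSuc[OF that that] N by (auto split: if_splits)
  have rl: "realization (line_graph w N) = polyline w N ` {0..real N}"
    by (rule realization_line_graph) (rule ne)
  define p where "p t = polyline w N (real N * t)" for t
  have im: "(\<lambda>t. real N * t) ` {0..1} = {0..real N}"
  proof (intro equalityI subsetI)
    fix s assume "s \<in> {0..real N}"
    then show "s \<in> (\<lambda>t. real N * t) ` {0..1}" using N by (intro image_eqI[of _ _ "s / real N"]) auto
  qed (use N in \<open>auto simp: mult_left_le\<close>)
  have pim: "path_image p = realization (line_graph w N)"
    unfolding path_image_def rl im[symmetric] p_def by (simp add: image_image)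
  have path: "path p" unfolding path_def p_def
    by (rule continuous_on_compose2[OF continuous_polyline[of UNIV]]) (auto intro!: continuous_intros)
  have p01: "p 0 = p 1"
  proof -
    have "p 0 = edge_point (w 0) (w 1) 0" using polyline_segment[of 0 N 0 w] N by (simp add: p_def)
    moreover have "p 1 = edge_point (w (N - 1)) (w (Suc (N - 1))) 1"
      using polyline_segment[of "N - 1" N 1 w] N by (simp add: p_def of_nat_diff)
    moreover have "w (Suc (N - 1)) = w 0" using N loop by simp
    ultimately show ?thesis by (auto simp: edge_point_def)
  qed
  have inj0: "s = s'" if s: "0 \<le> s" "s < real N" "0 \<le> s'" "s' < real N" and eq: "polyline w N s = polyline w N s'" for s s'
  proof -
    have "\<exists>i t. i < N \<and> 0 \<le> t \<and> t \<le> 1 \<and> s = real i + t \<and> (s < real N \<longrightarrow> t < 1)"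
      by (rule nat_floor_interval) (use s N in auto)
    then obtain i t where it: "i < N" "0 \<le> t" "t \<le> 1" "s = real i + t" "t < 1" using s(2) by blast
    have "\<exists>i t. i < N \<and> 0 \<le> t \<and> t \<le> 1 \<and> s' = real i + t \<and> (s' < real N \<longrightarrow> t < 1)"
      by (rule nat_floor_interval) (use s N in auto)
    then obtain j t' where jt: "j < N" "0 \<le> t'" "t' \<le> 1" "s' = real j + t'" "t' < 1" using s(4) by blast
    have eq: "edge_point (w i) (w (Suc i)) t = edge_point (w j) (w (Suc j)) t'"
      using eq polyline_segment[OF it(1-3), of w] polyline_segment[OF jt(1-3), of w] it(4) jt(4) by simp
    show ?thesis
    proof (cases "i = j")
      case True
      then have "1 - t = 1 - t'" using fun_cong[OF eq, of "w i"] ne[OF it(1)] by (simp add: edge_point_def)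
      then show ?thesis using True it jt by simp
    next
      \<comment> \<open>A common point of two different segments has positive coordinate at both
        starting vertices, as \<open>t\<close> and \<open>t'\<close> are below 1. So each starting
        vertex is the successor of the other, impossible for at least three vertices.\<close>
      case False
      then have nij: "w i \<noteq> w j" using wcong it jt by simp
      have "w i = w (Suc j)"
      proof (rule ccontr)
        assume "w i \<noteq> w (Suc j)"
        then have "1 - t = 0" using fun_cong[OF eq, of "w i"] ne[OF it(1)] nij by (simp add: edge_point_def)
        then show False using it(5) by simp
      qed
      then have 1: "if Suc j < N then i = Suc j else i = 0" by (rule iffD1[OF wSuc[OF it(1) jt(1)]])
      have "w j = w (Suc i)"
      proof (rule ccontr)
        assume "w j \<noteq> w (Suc i)"
        then have "1 - t' = 0" using fun_cong[OF eq, of "w j"] ne[OF jt(1)] nij by (simp add: edge_point_def)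
        then show False using jt(5) by simp
      qed
      then have "if Suc i < N then j = Suc i else j = 0" by (rule iffD1[OF wSuc[OF jt(1) it(1)]])
      then have 2: "j = Suc i \<or> j = 0 \<and> Suc i = N" using it(1) by (cases "Suc i < N") auto
      have "i = Suc j \<or> i = 0 \<and> Suc j = N" using 1 jt(1) by (cases "Suc j < N") auto
      then have False using 2 N by linarith
      then show ?thesis ..
    qed
  qed
  have "simple_path p"
    unfolding simple_path_def loop_free_def
  proof (intro conjI ballI impI path)
    fix x y :: real assume x: "x \<in> {0..1}" and y: "y \<in> {0..1}" and eq: "p x = p y"
    have lt: "real N * z < real N" if "z < 1" for z using N that by simp
    have core: "z = z'" if "z \<in> {0..<1}" "z' \<in> {0..<1}" "p z = p z'" for z z'
    proof -
      have "real N * z = real N * z'" using that lt N by (intro inj0) (auto simp: p_def)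
      then show ?thesis using N by simp
    qed
    show "x = y \<or> x = 0 \<and> y = 1 \<or> x = 1 \<and> y = 0"
    proof (cases "x = 1")
      case x1: True
      show ?thesis
      proof (cases "y = 1")
        case False
        then have "0 = y" using y eq p01 x1 by (intro core) simp_all
        then show ?thesis using x1 by simp
      qed (use x1 in simp)
    next
      case x1: False
      show ?thesis
      proof (cases "y = 1")
        case True
        then have "x = 0" using x eq p01 x1 by (intro core) simp_all
        then show ?thesis using True by simp
      next
        case False
        then have "x = y" using x y eq x1 by (intro core) simp_all
        then show ?thesis by simp
      qed
    qed
  qed
  moreover have "pathfinish p = pathstart p" using p01 by (simp add: pathfinish_def pathstart_def)
  ultimately have "path_image p homeomorphic sphere (0::complex) 1"
    by (rule homeomorphic_simple_path_image_circle) simp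
  then show ?thesis unfolding pim by (rule homeomorphic_imp_homotopy_eqv)
qed

text \<open>Function spaces over an uncountable index type are not an instance of the Hausdorff class, so the
  vertices are renumbered by natural numbers first.\<close>

lemma cycle_realization_circle:
  assumes N: "3 \<le> N" and inj: "inj_on w {..<N}" and loop: "w N = w 0"
  shows "realization (line_graph w N) homotopy_eqv sphere (0::complex) 1"
proof -
  define w' where "w' i = (if i = N then 0 else i)" for i :: nat
  have inj': "inj_on w' {..<N}" by (auto simp: w'_def inj_on_def)
  have ww': "w (w' j) = w j" for j using loop by (simp add: w'_def)
  have w'N: "w' j < N" if "j \<le> N" for j using that N by (auto simp: w'_def)
  have weq: "w j = w i \<longleftrightarrow> w' j = i" if "j \<le> N" "i < N" for i j
    using inj_on_eq_iff[OF inj, of "w' j" i] w'N[OF that(1)] that(2) ww' by simp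
  have ne: "w i \<noteq> w (Suc i)" "w' i \<noteq> w' (Suc i)" if "i < N" for i
    using weq[of "Suc i" i] that N by (auto simp: w'_def split: if_splits)
  have rl: "realization (line_graph w N) = polyline w N ` {0..real N}"
    "realization (line_graph w' N) = polyline w' N ` {0..real N}"
    by (rule realization_line_graph, rule ne, assumption)+
  define F where "F x = (\<lambda>i. if i < N then x (w i) else 0)" for x :: "'a \<Rightarrow> real"
  define G where "G y = (\<lambda>v. \<Sum>i<N. if w i = v then y i else 0)" for y :: "nat \<Rightarrow> real"
  have F: "F (polyline w N s) = polyline w' N s" for s
  proof
    fix i
    show "F (polyline w N s) i = polyline w' N s i"
    proof (cases "i < N")
      case True
      have "(\<Sum>j\<le>N. if w j = w i then hat (s - real j) else 0) = (\<Sum>j\<le>N. if w' j = i then hat (s - real j) else 0)"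
        by (rule sum.cong) (simp_all add: weq[OF _ True])
      then show ?thesis using True by (simp add: F_def polyline_def)
    next
      case False
      then have "w' j \<noteq> i" if "j \<le> N" for j using w'N[OF that] by simp
      then show ?thesis using False unfolding F_def polyline_def by simp
    qed
  qed
  have G: "G (polyline w' N s) = polyline w N s" for s
  proof
    fix v
    have "G (polyline w' N s) v = (\<Sum>i<N. \<Sum>j\<le>N. if w' j = i then (if w i = v then hat (s - real j) else 0) else 0)"
      unfolding G_def polyline_def
    proof (rule sum.cong)
      fix i
      show "(if w i = v then \<Sum>j\<le>N. if w' j = i then hat (s - real j) else 0 else 0)
        = (\<Sum>j\<le>N. if w' j = i then (if w i = v then hat (s - real j) else 0) else 0)"
        by (cases "w i = v") (auto intro!: sum.cong sum.neutral)
    qed simp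
    also have "\<dots> = (\<Sum>j\<le>N. \<Sum>i<N. if w' j = i then (if w i = v then hat (s - real j) else 0) else 0)"
      by (rule sum.swap)
    also have "\<dots> = (\<Sum>j\<le>N. if w j = v then hat (s - real j) else 0)"
    proof (rule sum.cong)
      fix j assume "j \<in> {..N}"
      then have "w' j \<in> {..<N}" using w'N by simp
      then have "(\<Sum>i<N. if w' j = i then (if w i = v then hat (s - real j) else 0) else 0)
        = (if w (w' j) = v then hat (s - real j) else 0)" by simp
      then show "(\<Sum>i<N. if w' j = i then (if w i = v then hat (s - real j) else 0) else 0)
        = (if w j = v then hat (s - real j) else 0)" by (simp only: ww')
    qed simp
    finally show "G (polyline w' N s) v = polyline w N s v" by (simp add: polyline_def)
  qed
  have "realization (line_graph w N) homeomorphic realization (line_graph w' N)"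
    unfolding homeomorphic_def
  proof (intro exI)
    show "homeomorphism (realization (line_graph w N)) (realization (line_graph w' N)) F G"
    proof (rule homeomorphismI)
      show "continuous_on (realization (line_graph w N)) F"
        unfolding F_def
      proof (rule continuous_on_coordinatewise_then_product)
        fix i
        show "continuous_on (realization (line_graph w N)) (\<lambda>x. if i < N then x (w i) else 0)"
          by (cases "i < N") (auto intro!: continuous_intros continuous_on_product_then_coordinatewise[of _ "\<lambda>x. x"])
      qed
      show "continuous_on (realization (line_graph w' N)) G"
        unfolding G_def
      proof (rule continuous_on_coordinatewise_then_product, rule continuous_on_sum)
        fix v i
        show "continuous_on (realization (line_graph w' N)) (\<lambda>y. if w i = v then y i else 0)"
          by (cases "w i = v") (auto intro!: continuous_intros continuous_on_product_then_coordinatewise[of _ "\<lambda>x. x"])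
      qed
    qed (auto simp: rl F G)
  qed
  then have "realization (line_graph w N) homotopy_eqv realization (line_graph w' N)"
    by (rule homeomorphic_imp_homotopy_eqv)
  moreover have "realization (line_graph w' N) homotopy_eqv sphere (0::complex) 1"
    by (rule cycle_realization_circle_nat[OF N inj']) (use N in \<open>auto simp: w'_def\<close>)
  ultimately show ?thesis by (rule homotopy_eqv_trans)
qed

text \<open>The first vertex is repeated at index \<open>N\<close>, which gives all edges the same
  form; fewer than three vertices cannot form a cycle without loops or double edges.\<close>

definition cycle_enum :: "(nat \<Rightarrow> 'v) \<Rightarrow> nat \<Rightarrow> 'v graph \<Rightarrow> bool" where
  "cycle_enum w N \<psi> \<longleftrightarrow> 3 \<le> N \<and> inj_on w {..<N} \<and> w N = w 0 \<and> \<psi> = line_graph w N"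

definition path_enum :: "(nat \<Rightarrow> 'v) \<Rightarrow> nat \<Rightarrow> 'v graph \<Rightarrow> bool" where
  "path_enum w N \<psi> \<longleftrightarrow> inj_on w {..N} \<and> \<psi> = line_graph w N"

locale degree2_graph =
  fixes V :: "'v set" and E :: "'v set set"
  assumes finite_V: "finite V"
    and edge: "e \<in> E \<Longrightarrow> \<exists>u v. e = {u, v} \<and> u \<noteq> v \<and> u \<in> V \<and> v \<in> V"
    and degree: "card {e \<in> E. v \<in> e} \<le> 2"
begin

lemma edgeD: "{u, v} \<in> E \<Longrightarrow> u \<noteq> v \<and> u \<in> V \<and> v \<in> V"
  using edge[of "{u, v}"] by (auto simp: doubleton_eq_iff)

lemma finite_E: "finite E"
  by (rule finite_subset[of _ "Pow V"]) (use edge finite_V in auto)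

lemma component_closed:
  assumes C: "C \<in> V // reach (V, E)" and u: "u \<in> C" "{u, v} \<in> E"
  shows "v \<in> C"
proof -
  obtain c where c: "C = reach (V, E) `` {c}" using C by (auto simp: quotient_def)
  then have "(c, u) \<in> {(a, b). {a, b} \<in> E}\<^sup>*" "c \<in> V" using u by (auto simp: reach_def)
  then have "(c, v) \<in> {(a, b). {a, b} \<in> E}\<^sup>*" using u(2) by (auto intro: rtrancl_into_rtrancl)
  then show ?thesis using c \<open>c \<in> V\<close> edgeD[OF u(2)] by (auto simp: reach_def)
qed

lemma component_subset: "C \<in> V // reach (V, E) \<Longrightarrow> C \<subseteq> V"
  by (auto simp: quotient_def reach_def)

lemma component_nonempty: "C \<in> V // reach (V, E) \<Longrightarrow> C \<noteq> {}"
  by (auto simp: quotient_def reach_def)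

text \<open>Reachability is symmetric, so any member of a component can serve as its base
  point.\<close>

lemma component_minimal:
  assumes C: "C \<in> V // reach (V, E)" and u: "u \<in> C" "u \<in> D"
    and D: "\<And>x y. x \<in> D \<Longrightarrow> {x, y} \<in> E \<Longrightarrow> y \<in> D"
  shows "C \<subseteq> D"
proof
  fix v assume v: "v \<in> C"
  let ?r = "{(a, b). {a, b} \<in> E}"
  obtain c where c: "C = reach (V, E) `` {c}" using C by (auto simp: quotient_def)
  have "sym ?r" by (auto simp: sym_def insert_commute)
  then have "sym (?r\<^sup>*)" by (rule sym_rtrancl)
  moreover have "(c, u) \<in> ?r\<^sup>*" "(c, v) \<in> ?r\<^sup>*" using u v c by (auto simp: reach_def)
  ultimately have "(u, v) \<in> ?r\<^sup>*" by (meson rtrancl_trans symD)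
  then show "v \<in> D" by (induction rule: rtrancl_induct) (use u D in auto)
qed

text \<open>Take a longest simple path in the component. Its inner vertices have used up their
  degree, and its ends have no neighbours off the path by maximality, so it exhausts the component.
  The only edge it can miss joins its two ends.\<close>

lemma component_enum:
  assumes C: "C \<in> V // reach (V, E)"
  shows "\<exists>w N. path_enum w N (C, {e \<in> E. e \<subseteq> C}) \<or> cycle_enum w N (C, {e \<in> E. e \<subseteq> C})"
proof -
  define Wk where "Wk xs \<longleftrightarrow> distinct xs \<and> xs \<noteq> [] \<and> set xs \<subseteq> C \<and> (\<forall>i. Suc i < length xs \<longrightarrow> {xs ! i, xs ! Suc i} \<in> E)" for xs
  have finC: "finite C" using component_subset[OF C] finite_V finite_subset by blast
  have "length xs \<le> card C" if "Wk xs" for xs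
    using that finC card_mono[of C "set xs"] by (auto simp: Wk_def distinct_card)
  moreover obtain c where "c \<in> C" using component_nonempty[OF C] by blast
  then have "Wk [c]" by (auto simp: Wk_def)
  ultimately obtain vs where vs: "Wk vs" and max: "\<And>xs. Wk xs \<Longrightarrow> length xs \<le> length vs"
    using ex_has_greatest_nat[of Wk "[c]" length "Suc (card C)"] by (metis le_imp_less_Suc less_imp_le)
  define n where "n = length vs"
  have n: "n > 0" and dist: "distinct vs" and vsC: "set vs \<subseteq> C" using vs by (auto simp: Wk_def n_def)
  have adj: "{vs ! i, vs ! Suc i} \<in> E" if "Suc i < n" for i using vs that by (auto simp: Wk_def n_def)
  have nth_eq: "vs ! i = vs ! j \<longleftrightarrow> i = j" if "i < n" "j < n" for i j
    using dist that by (simp add: nth_eq_iff_index_eq n_def)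
  \<comment> \<open>The two path edges at an inner vertex are distinct and hence already all of its
    edges.\<close>
  have internal: "v = vs ! (i - 1) \<or> v = vs ! Suc i" if i: "0 < i" "Suc i < n" and e: "{vs ! i, v} \<in> E" for i v
  proof -
    let ?a = "{vs ! i, vs ! (i - 1)}" and ?b = "{vs ! i, vs ! Suc i}"
    have ab: "?a \<in> E" "?b \<in> E" using adj[of "i - 1"] adj[OF i(2)] i by (auto simp: insert_commute)
    have "vs ! (i - 1) \<noteq> vs ! Suc i" using nth_eq[of "i - 1" "Suc i"] i by auto
    then have "?a \<noteq> ?b" by (auto simp: doubleton_eq_iff)
    then have "card {?a, ?b} = 2" by simp
    then have le: "card {e \<in> E. vs ! i \<in> e} \<le> card {?a, ?b}" using degree[of "vs ! i"] by simp
    have sub: "{?a, ?b} \<subseteq> {e \<in> E. vs ! i \<in> e}" using ab by auto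
    have "finite {e \<in> E. vs ! i \<in> e}" using finite_E by simp
    then have eq: "{?a, ?b} = {e \<in> E. vs ! i \<in> e}" using sub le by (rule card_seteq)
    have "{vs ! i, v} \<in> {e \<in> E. vs ! i \<in> e}" using e by simp
    then have "{vs ! i, v} \<in> {?a, ?b}" by (simp only: eq[symmetric])
    then show ?thesis by (auto simp: doubleton_eq_iff)
  qed
  have closed: "v \<in> set vs" if i: "i < n" and e: "{vs ! i, v} \<in> E" for i v
  proof (rule ccontr)
    assume nv: "v \<notin> set vs"
    have "vs ! i \<in> C" using vsC i by (auto simp: n_def)
    then have vC: "v \<in> C" by (rule component_closed[OF C _ e])
    consider "i = 0" | "Suc i = n" | "0 < i" "Suc i < n" using i by linarith
    then show False
    proof cases
      case 1
      have "{(v # vs) ! k, (v # vs) ! Suc k} \<in> E" if "Suc k < length (v # vs)" for k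
        using that e 1 adj[of "k - 1"] by (cases k) (auto simp: n_def insert_commute)
      then have "Wk (v # vs)" using nv vC vs by (auto simp: Wk_def)
      then show False using max[of "v # vs"] by simp
    next
      case 2
      have "{(vs @ [v]) ! k, (vs @ [v]) ! Suc k} \<in> E" if "Suc k < length (vs @ [v])" for k
      proof (cases "Suc k < n")
        case True
        then show ?thesis using adj[of k] by (auto simp: nth_append n_def)
      next
        case False
        then have "k = i" using that 2 by (simp add: n_def)
        then show ?thesis using e 2 by (auto simp: nth_append n_def)
      qed
      then have "Wk (vs @ [v])" using nv vC vs by (auto simp: Wk_def)
      then show False using max[of "vs @ [v]"] by simp
    next
      case 3
      then have "v = vs ! (i - 1) \<or> v = vs ! Suc i" using internal e by blast
      then show False using nv 3 by (auto simp: n_def)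
    qed
  qed
  have "C \<subseteq> set vs"
  proof (rule component_minimal[OF C, of "vs ! 0"])
    show "vs ! 0 \<in> C" "vs ! 0 \<in> set vs" using vsC n by (auto simp: n_def)
    show "y \<in> set vs" if "x \<in> set vs" "{x, y} \<in> E" for x y
      using that closed by (metis in_set_conv_nth n_def)
  qed
  then have Cvs: "C = set vs" using vsC by blast
  \<comment> \<open>By \<open>internal\<close>, an edge between vertices that are not consecutive
    cannot touch an inner vertex.\<close>
  have long: "i = 0 \<and> j = n - 1" if ij: "i < j" "j < n" "Suc i \<noteq> j" and e: "{vs ! i, vs ! j} \<in> E" for i j
  proof
    show "i = 0"
    proof (rule ccontr)
      assume "i \<noteq> 0"
      then have "vs ! j = vs ! (i - 1) \<or> vs ! j = vs ! Suc i" using internal[of i "vs ! j"] ij e by auto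
      moreover have "i - 1 < n" "Suc i < n" using ij by linarith+
      ultimately have "j = i - 1 \<or> j = Suc i"
        using nth_eq[of j "i - 1"] nth_eq[of j "Suc i"] ij(2) by blast
      then show False using ij by linarith
    qed
    show "j = n - 1"
    proof (rule ccontr)
      assume "j \<noteq> n - 1"
      then have "vs ! i = vs ! (j - 1) \<or> vs ! i = vs ! Suc j" using internal[of j "vs ! i"] ij e by (auto simp: insert_commute)
      moreover have "j - 1 < n" "Suc j < n" "i < n" using ij \<open>j \<noteq> n - 1\<close> by linarith+
      ultimately have "i = j - 1 \<or> i = Suc j"
        using nth_eq[of i "j - 1"] nth_eq[of i "Suc j"] by blast
      then show False using ij by linarith
    qed
  qed
  have edges: "e \<in> {{vs ! i, vs ! Suc i} | i. Suc i < n} \<or> (e = {vs ! 0, vs ! (n - 1)} \<and> 3 \<le> n)" if e: "e \<in> E" "e \<subseteq> C" for e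
  proof -
    obtain u v where uv: "e = {u, v}" "u \<noteq> v" using edge[OF e(1)] by blast
    obtain i where i: "i < n" "u = vs ! i" using e uv Cvs by (auto simp: in_set_conv_nth n_def)
    obtain j where j: "j < n" "v = vs ! j" using e uv Cvs by (auto simp: in_set_conv_nth n_def)
    have main: "e \<in> {{vs ! i, vs ! Suc i} | i. Suc i < n} \<or> (e = {vs ! 0, vs ! (n - 1)} \<and> 3 \<le> n)"
      if ij: "i < j" "j < n" "e = {vs ! i, vs ! j}" for i j
    proof (cases "Suc i = j")
      case False
      then have "i = 0 \<and> j = n - 1" using long[OF ij(1,2)] e(1) ij(3) by auto
      then show ?thesis using ij False by auto
    qed (use ij in blast)
    have "i \<noteq> j" using i j uv by auto
    then consider "i < j" | "j < i" by linarith
    then show ?thesis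
      by cases (use main[of i j] main[of j i] i j uv in \<open>auto simp: insert_commute\<close>)
  qed
  have sub: "{{vs ! i, vs ! Suc i} | i. Suc i < n} \<subseteq> {e \<in> E. e \<subseteq> C}"
    using adj Cvs by (auto simp: n_def)
  show ?thesis
  proof (cases "{vs ! 0, vs ! (n - 1)} \<in> E \<and> 3 \<le> n")
    case False
    then have "{e \<in> E. e \<subseteq> C} = {{vs ! i, vs ! Suc i} | i. Suc i < n}" using edges sub by blast
    also have "\<dots> = {{vs ! i, vs ! Suc i} | i. i < n - 1}" using n by (auto simp: less_diff_conv)
    finally have E': "{e \<in> E. e \<subseteq> C} = {{vs ! i, vs ! Suc i} | i. i < n - 1}" .
    have "{..n - 1} = {..<n}" using n by auto
    then have "C = (\<lambda>i. vs ! i) ` {..n - 1}" unfolding Cvs by (auto simp: set_conv_nth n_def)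
    then have "path_enum (\<lambda>i. vs ! i) (n - 1) (C, {e \<in> E. e \<subseteq> C})"
      using E' n nth_eq by (auto simp: path_enum_def line_graph_def inj_on_def)
    then show ?thesis by blast
  next
    case True
    \<comment> \<open>Reduction modulo n produces the repeated vertex at index n.\<close>
    define w where "w i = vs ! (i mod n)" for i
    have w: "w i = vs ! i" if "i < n" for i using that by (simp add: w_def)
    have wn: "w n = vs ! 0" by (simp add: w_def)
    have "{{w i, w (Suc i)} | i. i < n} = {{vs ! i, vs ! Suc i} | i. Suc i < n} \<union> {{vs ! 0, vs ! (n - 1)}}"
    proof (intro equalityI subsetI)
      fix e assume "e \<in> {{w i, w (Suc i)} | i. i < n}"
      then obtain i where i: "i < n" "e = {w i, w (Suc i)}" by blast
      show "e \<in> {{vs ! i, vs ! Suc i} | i. Suc i < n} \<union> {{vs ! 0, vs ! (n - 1)}}"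
      proof (cases "Suc i < n")
        case True
        then show ?thesis using i w by auto
      next
        case False
        then have "Suc i = n" using i by simp
        then have "e = {vs ! 0, vs ! (n - 1)}" using i w[of i] wn by (auto simp: insert_commute)
        then show ?thesis by blast
      qed
    next
      fix e assume "e \<in> {{vs ! i, vs ! Suc i} | i. Suc i < n} \<union> {{vs ! 0, vs ! (n - 1)}}"
      then consider i where "Suc i < n" "e = {vs ! i, vs ! Suc i}" | "e = {vs ! 0, vs ! (n - 1)}" by blast
      then show "e \<in> {{w i, w (Suc i)} | i. i < n}"
      proof cases
        case 1
        then have "e = {w i, w (Suc i)}" using w by simp
        then show ?thesis using 1 by (auto intro: Suc_lessD)
      next
        case 2
        then have "e = {w (n - 1), w (Suc (n - 1))}" using w[of "n - 1"] wn n by (auto simp: insert_commute)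
        then show ?thesis using n by (intro CollectI exI[of _ "n - 1"]) simp
      qed
    qed
    moreover have "{e \<in> E. e \<subseteq> C} = {{vs ! i, vs ! Suc i} | i. Suc i < n} \<union> {{vs ! 0, vs ! (n - 1)}}"
      using edges sub True Cvs n by (auto simp: n_def)
    ultimately have E': "{e \<in> E. e \<subseteq> C} = {{w i, w (Suc i)} | i. i < n}" by simp
    have "w ` {..n} = set vs"
    proof -
      have "w ` {..n} \<subseteq> set vs" using n by (auto simp: w_def n_def)
      moreover have "set vs \<subseteq> w ` {..n}"
      proof
        fix v assume "v \<in> set vs"
        then obtain i where "i < n" "v = vs ! i" by (auto simp: in_set_conv_nth n_def)
        then show "v \<in> w ` {..n}" using w[of i] by (intro image_eqI[of _ _ i]) auto
      qed
      ultimately show ?thesis by blast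
    qed
    then have "cycle_enum w n (C, {e \<in> E. e \<subseteq> C})"
      using E' True Cvs nth_eq w wn n by (auto simp: cycle_enum_def line_graph_def inj_on_def)
    then show ?thesis by blast
  qed
qed

theorem circle_component_cases:
  assumes "\<psi> \<in> components_graph (V, E)"
  obtains w N where "\<psi> \<in> circle_components (V, E)" "cycle_enum w N \<psi>"
    | w N where "\<psi> \<notin> circle_components (V, E)" "path_enum w N \<psi>"
proof -
  obtain C where C: "C \<in> V // reach (V, E)" "\<psi> = (C, {e \<in> E. e \<subseteq> C})"
    using assms by (auto simp: components_graph_def)
  obtain w N where "path_enum w N \<psi> \<or> cycle_enum w N \<psi>" using component_enum[OF C(1)] C(2) by blast
  then show thesis
  proof
    assume p: "path_enum w N \<psi>"
    then have "\<psi> \<notin> circle_components (V, E)"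
      using path_realization_not_circle[of w N] by (auto simp: path_enum_def circle_components_def)
    then show thesis using that(2) p by blast
  next
    assume c: "cycle_enum w N \<psi>"
    then have "\<psi> \<in> circle_components (V, E)"
      using cycle_realization_circle[of N w] assms by (auto simp: cycle_enum_def circle_components_def)
    then show thesis using that(1) c by blast
  qed
qed

end

section \<open>Ideals of the polynomial ring\<close>

lemma poly_ring_simps [simp]:
  "carrier poly_ring = UNIV" "mult poly_ring = (*)" "one poly_ring = 1" "zero poly_ring = 0" "add poly_ring = (+)"
  by (simp_all add: poly_ring_def)

lemma cring_poly_ring: "cring (poly_ring :: 'x mpoly ring)"
proof (rule cringI)
  show "abelian_group (poly_ring :: 'x mpoly ring)"
  proof (rule abelian_groupI)
    show "\<exists>y\<in>carrier poly_ring. y \<oplus>\<^bsub>poly_ring\<^esub> x = \<zero>\<^bsub>poly_ring\<^esub>" for x :: "'x mpoly"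
      by (rule bexI[of _ "- x"]) simp_all
  qed (simp_all add: add_ac)
  show "Group.comm_monoid (poly_ring :: 'x mpoly ring)"
    by (rule comm_monoidI) (simp_all add: mult_ac)
qed (simp_all add: distrib_right)

lemma ideal_poly_ring_iff:
  "ideal J poly_ring \<longleftrightarrow> (0::'x mpoly) \<in> J \<and> (\<forall>p\<in>J. \<forall>q\<in>J. p + q \<in> J) \<and> (\<forall>p\<in>J. \<forall>q. q * p \<in> J)"
proof
  assume "ideal J (poly_ring :: 'x mpoly ring)"
  then interpret ideal J "poly_ring :: 'x mpoly ring" .
  show "(0::'x mpoly) \<in> J \<and> (\<forall>p\<in>J. \<forall>q\<in>J. p + q \<in> J) \<and> (\<forall>p\<in>J. \<forall>q. q * p \<in> J)"
    using additive_subgroup.zero_closed[OF additive_subgroup_axioms]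
      additive_subgroup.a_closed[OF additive_subgroup_axioms] I_l_closed by simp
next
  assume J: "(0::'x mpoly) \<in> J \<and> (\<forall>p\<in>J. \<forall>q\<in>J. p + q \<in> J) \<and> (\<forall>p\<in>J. \<forall>q. q * p \<in> J)"
  interpret R: cring "poly_ring :: 'x mpoly ring" by (rule cring_poly_ring)
  have minus: "- p \<in> J" if "p \<in> J" for p using J that by (metis mult_minus1)
  show "ideal J (poly_ring :: 'x mpoly ring)"
  proof (rule idealI)
    show "subgroup J (add_monoid (poly_ring :: 'x mpoly ring))"
    proof (rule group.subgroupI)
      fix p assume p: "p \<in> J"
      have "\<ominus>\<^bsub>poly_ring\<^esub> p = - p" by (rule R.minus_equality) simp_all
      then show "inv\<^bsub>add_monoid poly_ring\<^esub> p \<in> J" using minus[OF p] by (simp add: a_inv_def)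
    qed (use J R.a_group in auto)
  qed (use J in \<open>auto simp: mult.commute R.ring_axioms\<close>)
qed

lemma primeideal_poly_ring_iff:
  "primeideal Q poly_ring \<longleftrightarrow>
     ideal Q poly_ring \<and> (1::'x mpoly) \<notin> Q \<and> (\<forall>p q. p * q \<in> Q \<longrightarrow> p \<in> Q \<or> q \<in> Q)"
proof
  assume "primeideal Q (poly_ring :: 'x mpoly ring)"
  then interpret primeideal Q "poly_ring :: 'x mpoly ring" .
  show "ideal Q poly_ring \<and> (1::'x mpoly) \<notin> Q \<and> (\<forall>p q. p * q \<in> Q \<longrightarrow> p \<in> Q \<or> q \<in> Q)"
    using ideal_axioms one_imp_carrier I_notcarr I_prime by auto
next
  assume Q: "ideal Q poly_ring \<and> (1::'x mpoly) \<notin> Q \<and> (\<forall>p q. p * q \<in> Q \<longrightarrow> p \<in> Q \<or> q \<in> Q)"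
  show "primeideal Q (poly_ring :: 'x mpoly ring)"
    by (rule primeidealI) (use Q cring_poly_ring in auto)
qed

lemma idealD:
  assumes "ideal J poly_ring"
  shows "0 \<in> J" "p \<in> J \<Longrightarrow> q \<in> J \<Longrightarrow> p + q \<in> J" "p \<in> J \<Longrightarrow> q * p \<in> J" "p \<in> J \<Longrightarrow> p * q \<in> J"
  using assms by (auto simp: ideal_poly_ring_iff mult.commute[of p])

lemma ideal_subspace: "ideal J poly_ring \<Longrightarrow> subspace J"
  by (rule subspaceI) (auto simp: idealD mconst_mult_scaleR[symmetric])

lemma ideal_van: "ideal (van V) poly_ring"
  by (auto simp: ideal_poly_ring_iff van_def)

lemma primeideal_van: "subspace V \<Longrightarrow> primeideal (van V) poly_ring"
  using van_prime[of V] subspace_0[of V] by (auto simp: primeideal_poly_ring_iff ideal_van) (auto simp: van_def)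

lemma prime_prod_list:
  assumes "primeideal Q poly_ring" "prod_list ps \<in> Q"
  shows "\<exists>p\<in>set ps. p \<in> Q"
  using assms(2) by (induction ps) (use assms(1) in \<open>auto simp: primeideal_poly_ring_iff\<close>)

lemma Idl_ideal: "ideal (Idl\<^bsub>poly_ring\<^esub> A) (poly_ring :: 'x mpoly ring)"
proof -
  interpret cring "poly_ring :: 'x mpoly ring" by (rule cring_poly_ring)
  show ?thesis by (rule genideal_ideal) simp
qed

lemma Idl_base: "p \<in> A \<Longrightarrow> p \<in> Idl\<^bsub>poly_ring\<^esub> A" for p :: "'x mpoly"
proof -
  interpret cring "poly_ring :: 'x mpoly ring" by (rule cring_poly_ring)
  show "p \<in> A \<Longrightarrow> p \<in> Idl\<^bsub>poly_ring\<^esub> A" using genideal_self[of A] by auto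
qed

lemma Idl_minimal: "ideal J poly_ring \<Longrightarrow> A \<subseteq> J \<Longrightarrow> Idl\<^bsub>poly_ring\<^esub> A \<subseteq> (J :: 'x mpoly set)"
proof -
  interpret cring "poly_ring :: 'x mpoly ring" by (rule cring_poly_ring)
  show "ideal J poly_ring \<Longrightarrow> A \<subseteq> J \<Longrightarrow> Idl\<^bsub>poly_ring\<^esub> A \<subseteq> J" by (rule genideal_minimal)
qed

section \<open>Lengths of prime chains\<close>

text \<open>The primes of a chain need not be homogeneous, so the count uses the filtration by
  degree instead of the grading.\<close>

definition deg_le :: "nat \<Rightarrow> 'x::finite mpoly set" where
  "deg_le k = {p. Poly_Mapping.keys p \<subseteq> {m. mdeg m \<le> k}}"

lemma subspace_deg_le: "subspace (deg_le k)"
proof (rule subspaceI)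
  fix p q :: "'a mpoly" assume "p \<in> deg_le k" "q \<in> deg_le k"
  then show "p + q \<in> deg_le k" using keys_add[of p q] by (auto simp: deg_le_def)
qed (auto simp: deg_le_def in_keys_iff)

lemma findim_deg_le: "findim (deg_le k)"
  unfolding deg_le_def by (rule subspace_span_singles[OF finite_mdeg_le])

lemma card_mdeg_le: "card {m :: 'x::finite \<Rightarrow>\<^sub>0 nat. mdeg m \<le> k} \<le> (k + 1) ^ CARD('x)"
proof -
  have inj: "inj_on Poly_Mapping.lookup {m :: 'x \<Rightarrow>\<^sub>0 nat. mdeg m \<le> k}"
    by (intro inj_onI poly_mapping_eq_iff[THEN iffD2])
  have "Poly_Mapping.lookup ` {m :: 'x \<Rightarrow>\<^sub>0 nat. mdeg m \<le> k} \<subseteq> (UNIV :: 'x set) \<rightarrow>\<^sub>E {..k}"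
    using member_le_sum[of _ UNIV "Poly_Mapping.lookup _ :: 'x \<Rightarrow> nat"]
    by (auto simp: mdeg_def intro: order_trans)
  then have "card (Poly_Mapping.lookup ` {m :: 'x \<Rightarrow>\<^sub>0 nat. mdeg m \<le> k}) \<le> card ((UNIV :: 'x set) \<rightarrow>\<^sub>E {..k})"
    by (intro card_mono finite_PiE) auto
  then show ?thesis by (simp add: card_image[OF inj] card_PiE)
qed

lemma dim_deg_le: "dim (deg_le k :: 'x::finite mpoly set) \<le> (k + 1) ^ CARD('x)"
proof -
  have "dim (deg_le k :: 'x mpoly set) = card (leads (deg_le k :: 'x mpoly set))"
    by (rule dim_eq_card_leads[OF subspace_deg_le findim_deg_le finite_mdeg_le[of k]]) (auto simp: deg_le_def)
  also have "\<dots> \<le> card {m :: 'x \<Rightarrow>\<^sub>0 nat. mdeg m \<le> k}"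
    by (rule card_mono[OF finite_mdeg_le]) (auto simp: leads_def deg_le_def)
  finally show ?thesis using card_mdeg_le[of k, where 'x = 'x] by linarith
qed

lemma deg_le_mono: "j \<le> k \<Longrightarrow> deg_le j \<subseteq> deg_le k"
  by (auto simp: deg_le_def)

lemma deg_le_mult: "p \<in> deg_le j \<Longrightarrow> q \<in> deg_le k \<Longrightarrow> p * q \<in> deg_le (j + k)"
proof -
  assume p: "p \<in> deg_le j" and q: "q \<in> deg_le k"
  have "mdeg m \<le> j + k" if m: "m \<in> Poly_Mapping.keys (p * q)" for m
  proof -
    obtain a b where "m = a + b" "a \<in> Poly_Mapping.keys p" "b \<in> Poly_Mapping.keys q" using m keys_mult[of p q] by blast
    then show ?thesis using p q by (auto simp: deg_le_def mdeg_add intro: add_mono)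
  qed
  then show ?thesis by (auto simp: deg_le_def)
qed

lemma deg_le_exists: "\<exists>k. p \<in> deg_le k"
proof
  have "mdeg m \<le> (\<Sum>m\<in>Poly_Mapping.keys p. mdeg m)" if "m \<in> Poly_Mapping.keys p" for m
    using that by (intro member_le_sum) auto
  then show "p \<in> deg_le (\<Sum>m\<in>Poly_Mapping.keys p. mdeg m)" by (auto simp: deg_le_def)
qed

text \<open>The Hilbert function of the filtered ring R/J; for ideals the truncated subtraction is
  exact by \<open>affine_hilbert_eq\<close>.\<close>

definition affine_hilbert :: "'x::finite mpoly set \<Rightarrow> nat \<Rightarrow> nat" where
  "affine_hilbert J k = dim (deg_le k :: 'x mpoly set) - dim (J \<inter> deg_le k)"

lemma findim_Int_deg_le: "findim (J \<inter> deg_le k)"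
  by (rule findim_subset[OF findim_deg_le]) auto

lemma affine_hilbert_eq:
  fixes J :: "'x::finite mpoly set"
  assumes "ideal J poly_ring"
  shows "affine_hilbert J k + dim (J \<inter> deg_le k) = dim (deg_le k :: 'x mpoly set)"
proof -
  have "dim (J \<inter> deg_le k) \<le> dim (deg_le k :: 'x mpoly set)"
    by (rule dim_mono_findim[OF findim_deg_le subspace_inter[OF ideal_subspace[OF assms] subspace_deg_le]]) auto
  then show ?thesis by (simp add: affine_hilbert_def)
qed

text \<open>The constants embed into the quotient by a proper ideal.\<close>

lemma affine_hilbert_pos:
  assumes J: "ideal J poly_ring" and one: "1 \<notin> J"
  shows "affine_hilbert J k \<ge> 1"
proof -
  let ?S = "J \<inter> deg_le k" and ?f = "\<lambda>c. c *\<^sub>R (1 :: 'a mpoly)"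
  have S: "subspace ?S" "findim ?S"
    using subspace_inter[OF ideal_subspace[OF J] subspace_deg_le] findim_Int_deg_le by auto
  have lin: "linear ?f" by (rule linearI) (simp_all add: scaleR_left_distrib)
  have one_le: "1 \<in> deg_le k" by (auto simp: deg_le_def mdeg_def)
  have "{c \<in> UNIV. ?f c \<in> ?S} = {0}"
  proof -
    have "c = 0" if "?f c \<in> J" for c
    proof (rule ccontr)
      assume "c \<noteq> 0"
      then have "(1 / c) *\<^sub>R ?f c = 1" by simp
      then show False using subspace_scale[OF ideal_subspace[OF J] that, of "1 / c"] one by simp
    qed
    moreover have "?f 0 \<in> ?S" using subspace_0[OF S(1)] by simp
    ultimately show ?thesis by blast
  qed
  then have "dim {s + ?f c | s c. s \<in> ?S \<and> c \<in> UNIV} = dim ?S + 1"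
    using dim_add_image[OF lin S subspace_UNIV findim_UNIV] by (simp add: dim_zero)
  moreover have "dim {s + ?f c | s c. s \<in> ?S \<and> c \<in> UNIV} \<le> dim (deg_le k :: 'a mpoly set)"
  proof (rule dim_mono_findim[OF findim_deg_le subspace_add_image[OF lin S(1) subspace_UNIV]])
    show "{s + ?f c | s c. s \<in> ?S \<and> c \<in> UNIV} \<subseteq> deg_le k"
      using one_le by (auto intro!: subspace_add[OF subspace_deg_le] subspace_scale[OF subspace_deg_le])
  qed
  ultimately show ?thesis by (simp add: affine_hilbert_def)
qed

text \<open>Multiplication by \<open>g\<close> is injective modulo the prime \<open>P\<close> and
  its image lies in \<open>P'\<close>. So R/P up to degree e + k has room for R/P' and for a copy of
  R/P up to degree k.\<close>

lemma affine_hilbert_step: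
  assumes P: "primeideal P poly_ring" and P': "ideal P' poly_ring" "P \<subseteq> P'"
    and g: "g \<in> P'" "g \<notin> P" "g \<in> deg_le e"
  shows "affine_hilbert P' (e + k) + affine_hilbert P k \<le> affine_hilbert P (e + k)"
proof -
  have idP: "ideal P poly_ring" using P by (simp add: primeideal_poly_ring_iff)
  let ?S = "P \<inter> deg_le (e + k)" and ?V = "deg_le k :: 'a mpoly set"
  have S: "subspace ?S" "findim ?S"
    using subspace_inter[OF ideal_subspace[OF idP] subspace_deg_le] findim_Int_deg_le by auto
  have "{v \<in> ?V. g * v \<in> ?S} = P \<inter> ?V"
    using P g(2) deg_le_mult[OF g(3)] idealD(3)[OF idP] by (auto simp: primeideal_poly_ring_iff)
  then have "dim {s + g * v | s v. s \<in> ?S \<and> v \<in> ?V} + dim (P \<inter> ?V) = dim ?S + dim ?V"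
    using dim_add_image[OF linear_mult S subspace_deg_le findim_deg_le, of g k] by simp
  moreover have "dim {s + g * v | s v. s \<in> ?S \<and> v \<in> ?V} \<le> dim (P' \<inter> deg_le (e + k))"
  proof (rule dim_mono_findim[OF _ subspace_add_image[OF linear_mult S(1) subspace_deg_le]])
    show "findim (P' \<inter> deg_le (e + k))" by (rule findim_Int_deg_le)
    show "{s + g * v | s v. s \<in> ?S \<and> v \<in> ?V} \<subseteq> P' \<inter> deg_le (e + k)"
      using P' deg_le_mult[OF g(3)] idealD(2,4)[OF P'(1)] g(1)
      by (auto intro!: subspace_add[OF subspace_deg_le])
  qed
  ultimately show ?thesis
    using affine_hilbert_eq[OF idP, of k] affine_hilbert_eq[OF idP, of "e + k"] affine_hilbert_eq[OF P'(1), of "e + k"]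
    by linarith
qed

text \<open>Iterating \<open>affine_hilbert_step\<close> down a chain of length L bounds the Hilbert
  function at its bottom from below by a binomial coefficient of order \<open>t^L\<close>, while the
  whole ring in n variables has only order \<open>t^n\<close>. Hence L = n + 1 is
  impossible.\<close>

theorem prime_chain_length:
  fixes c :: "nat \<Rightarrow> 'x::finite mpoly set"
  assumes prime: "\<And>i. i \<le> N \<Longrightarrow> primeideal (c i) poly_ring" and chain: "\<And>i. i < N \<Longrightarrow> c i \<subset> c (Suc i)"
  shows "N \<le> CARD('x)"
proof (rule ccontr)
  assume "\<not> N \<le> CARD('x)"
  then have N: "Suc CARD('x) \<le> N" by simp
  have id: "ideal (c i) poly_ring" "1 \<notin> c i" if "i \<le> N" for i
    using prime[OF that] by (auto simp: primeideal_poly_ring_iff)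
  have "\<forall>i. \<exists>g d. i < N \<longrightarrow> g \<in> c (Suc i) \<and> g \<notin> c i \<and> g \<in> deg_le d"
    using chain deg_le_exists by (metis psubset_imp_ex_mem DiffD1 DiffD2)
  then obtain g d where g: "\<And>i. i < N \<Longrightarrow> g i \<in> c (Suc i) \<and> g i \<notin> c i \<and> g i \<in> deg_le (d i)" by metis
  \<comment> \<open>One degree bound that serves all the witnesses \<open>g i\<close>.\<close>
  define e where "e = (\<Sum>i<N. d i)"
  have ge: "g i \<in> deg_le e" if "i < N" for i
    using g[OF that] deg_le_mono[of "d i" e] that member_le_sum[of i "{..<N}" d] by (auto simp: e_def)
  \<comment> \<open>The double induction follows Pascal's rule: one summand comes from the shorter
    chain, the other from the smaller argument \<open>t\<close>.\<close>
  have main: "(t + L) choose L \<le> affine_hilbert (c (N - L)) (e * t)" if "L \<le> N" for L t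
    using that
  proof (induction L arbitrary: t)
    case 0
    show ?case using affine_hilbert_pos[OF id[of N]] by simp
  next
    case (Suc L)
    note outer = Suc.IH
    let ?i = "N - Suc L"
    have i: "?i < N" "Suc ?i = N - L" "?i \<le> N" using Suc.prems by auto
    show ?case
    proof (induction t)
      case 0
      show ?case using affine_hilbert_pos[OF id[OF i(3)]] by simp
    next
      case (Suc t)
      have "affine_hilbert (c (Suc ?i)) (e + e * t) + affine_hilbert (c ?i) (e * t) \<le> affine_hilbert (c ?i) (e + e * t)"
        by (rule affine_hilbert_step[OF prime[OF i(3)] id(1) _ _ _ ge[OF i(1)]]) (use i chain[OF i(1)] g[OF i(1)] in auto)
      moreover have "(Suc t + L) choose L \<le> affine_hilbert (c (N - L)) (e * Suc t)"
        by (rule outer) (use \<open>Suc L \<le> N\<close> in simp)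
      moreover have "(Suc t + Suc L) choose Suc L = ((Suc t + L) choose L) + ((t + Suc L) choose Suc L)"
        by simp
      ultimately show ?case using Suc i(2) by simp
    qed
  qed
  define n where "n = CARD('x)"
  \<comment> \<open>Chosen to exceed by one the bound for \<open>t\<close> that the two growth
    estimates yield at the end.\<close>
  define t where "t = Suc (Suc n ^ Suc n * (e + 1) ^ n)"
  have tpos: "t > 0" by (simp add: t_def)
  have "(t + Suc n) choose Suc n \<le> affine_hilbert (c (N - Suc n)) (e * t)"
    using main[of "Suc n" t] N by (simp only: n_def)
  also have "\<dots> \<le> dim (deg_le (e * t) :: 'x mpoly set)" by (simp add: affine_hilbert_def)
  also have "\<dots> \<le> (e * t + 1) ^ n" using dim_deg_le[of "e * t", where 'x = 'x] by (simp add: n_def)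
  also have "\<dots> \<le> ((e + 1) * t) ^ n" using tpos by (intro power_mono) auto
  finally have "real ((t + Suc n) choose Suc n) \<le> real (((e + 1) * t) ^ n)" by (simp only: of_nat_le_iff)
  also have "\<dots> = real ((e + 1) ^ n) * real t ^ n" by (simp only: power_mult_distrib of_nat_mult of_nat_power)
  finally have "real ((t + Suc n) choose Suc n) \<le> real ((e + 1) ^ n) * real t ^ n" .
  moreover have "(real (t + Suc n) / real (Suc n)) ^ Suc n \<le> real ((t + Suc n) choose Suc n)"
    using binomial_ge_n_over_k_pow_k[of "Suc n" "t + Suc n"] by simp
  moreover have "(real t / real (Suc n)) ^ Suc n \<le> (real (t + Suc n) / real (Suc n)) ^ Suc n"
    by (intro power_mono divide_right_mono) auto
  ultimately have "(real t / real (Suc n)) ^ Suc n \<le> real ((e + 1) ^ n) * real t ^ n" by linarith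
  then have "real t ^ Suc n \<le> real (Suc n) ^ Suc n * (real ((e + 1) ^ n) * real t ^ n)"
    by (simp add: power_divide pos_divide_le_eq mult.commute)
  then have "real t * real t ^ n \<le> (real (Suc n) ^ Suc n * real ((e + 1) ^ n)) * real t ^ n"
    by (simp add: mult_ac)
  then have "real t \<le> real (Suc n) ^ Suc n * real ((e + 1) ^ n)"
    by (rule mult_right_le_imp_le) (use tpos in simp)
  also have "\<dots> = real (Suc n ^ Suc n * (e + 1) ^ n)" by (simp only: of_nat_mult of_nat_power)
  finally have "t \<le> Suc n ^ Suc n * (e + 1) ^ n" by (simp only: of_nat_le_iff)
  then show False by (simp only: t_def)
qed

text \<open>The component of \<open>y\<close> orthogonal to \<open>W\<close> defines a linear form
  that vanishes on \<open>W\<close> but not at \<open>y\<close>.\<close>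

lemma van_strict:
  fixes V W :: "(real ^ 'x) set"
  assumes "subspace W" "W \<subset> V"
  shows "van V \<subset> van W"
proof -
  obtain y where y: "y \<in> V" "y \<notin> W" using assms(2) by blast
  obtain w z where wz: "w \<in> span W" "\<And>x. x \<in> span W \<Longrightarrow> orthogonal z x" "y = w + z"
    using orthogonal_subspace_decomp_exists[of W y] by metis
  have sp: "span W = W" using assms(1) by (simp add: span_eq_iff)
  have "lin z \<in> van W" using wz(2) sp by (auto simp: van_def orthogonal_def)
  moreover have "z \<noteq> 0" using wz y sp by auto
  then have "z \<bullet> y \<noteq> 0" using wz by (simp add: inner_add_right orthogonal_def)
  then have "lin z \<notin> van V" using y by (auto simp: van_def)
  moreover have "van V \<subseteq> van W" using assms(2) by (auto simp: van_def)
  ultimately show ?thesis by blast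
qed

text \<open>A chain ending at \<open>van V\<close> can be prolonged by the ideals of ever smaller
  subspaces, one dimension at a time, and the total length is bounded by the number of
  variables.\<close>

lemma prime_chain_to_van:
  fixes V :: "(real ^ 'x) set"
  assumes "subspace V" "\<And>i. i \<le> N \<Longrightarrow> primeideal (c i) poly_ring" "\<And>i. i < N \<Longrightarrow> c i \<subset> c (Suc i)" "c N = van V"
  shows "N + dim V \<le> CARD('x)"
  using assms
proof (induction "dim V" arbitrary: V c N)
  case 0
  then have "N \<le> CARD('x)" by (intro prime_chain_length[of N c])
  then show ?case using 0(1) by linarith
next
  case (Suc j)
  obtain W where W: "subspace W" "W \<subseteq> span V" "dim W = j"
    using choose_subspace_of_subspace[of j V] Suc(2) by (metis Suc_leD le_refl)
  have sp: "span V = V" using Suc.prems(1) by (simp add: span_eq_iff)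
  have "W \<subseteq> V" using W(2) unfolding sp .
  then have WV: "W \<subset> V" using W(3) Suc(2) by auto
  define c' where "c' i = (if i \<le> N then c i else van W)" for i
  have "Suc N + dim W \<le> CARD('x)"
  proof (rule Suc(1)[of W "Suc N" c'])
    show "primeideal (c' i) poly_ring" for i
      using Suc.prems(2)[of i] primeideal_van[OF W(1)] by (simp add: c'_def)
    show "c' i \<subset> c' (Suc i)" if "i < Suc N" for i
    proof (cases "i < N")
      case True
      then show ?thesis using Suc.prems(3) by (simp add: c'_def)
    next
      case False
      then have "i = N" using that by simp
      then show ?thesis using van_strict[OF W(1) WV] Suc.prems(4) by (simp add: c'_def)
    qed
  qed (use W in \<open>auto simp: c'_def\<close>)
  then show ?case using W(3) Suc(2) by simp
qed

section \<open>Linear subspaces of codimension two\<close>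

definition flat :: "(real ^ 'x) set \<Rightarrow> (real ^ 'x) set" where
  "flat A = {y. \<forall>a\<in>A. a \<bullet> y = 0}"

lemma subspace_flat: "subspace (flat A)"
  by (auto simp: flat_def subspace_def inner_add_right)

lemma flat_mono: "A \<subseteq> B \<Longrightarrow> flat B \<subseteq> flat A"
  by (auto simp: flat_def)

text \<open>A subspace is its own double orthogonal complement. This translates the containment of a
  flat in a hyperplane into a span condition on the normals.\<close>

lemma in_span_iff_flat: "a \<in> span A \<longleftrightarrow> flat A \<subseteq> {y. a \<bullet> y = 0}"
proof
  assume "a \<in> span A"
  show "flat A \<subseteq> {y. a \<bullet> y = 0}"
  proof
    fix y assume "y \<in> flat A"
    then have "A \<subseteq> {a. a \<bullet> y = 0}" by (auto simp: flat_def)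
    moreover have "subspace {a. a \<bullet> y = 0}" by (auto simp: subspace_def inner_add_left)
    ultimately have "span A \<subseteq> {a. a \<bullet> y = 0}" by (rule span_minimal)
    then show "y \<in> {y. a \<bullet> y = 0}" using \<open>a \<in> span A\<close> by blast
  qed
next
  assume fl: "flat A \<subseteq> {y. a \<bullet> y = 0}"
  obtain w z where wz: "w \<in> span A" "\<And>x. x \<in> span A \<Longrightarrow> orthogonal z x" "a = w + z"
    using orthogonal_subspace_decomp_exists[of A a] by metis
  have "z \<in> flat A" using wz(2) span_base by (auto simp: flat_def orthogonal_def inner_commute)
  then have "a \<bullet> z = 0" using fl by blast
  moreover have "w \<bullet> z = 0" using wz(1,2) by (auto simp: orthogonal_def inner_commute)
  ultimately have "z = 0" using wz(3) by (simp add: inner_add_left)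
  then show "a \<in> span A" using wz by simp
qed

lemma dim_flat: "dim (flat A) + dim A = CARD('x)" for A :: "(real ^ 'x) set"
proof -
  have "flat A = {y \<in> UNIV. \<forall>x\<in>span A. orthogonal x y}"
    using in_span_iff_flat[of _ A] span_base[of _ A] by (auto simp: flat_def orthogonal_def)
  moreover have "dim {y \<in> UNIV. \<forall>x\<in>span A. orthogonal x y} + dim (span A) = dim (UNIV :: (real ^ 'x) set)"
    by (rule dim_subspace_orthogonal_to_vectors) auto
  ultimately show ?thesis by simp
qed

lemma dual_vector:
  assumes "(u :: real ^ 'x) \<notin> span {v}"
  obtains w where "u \<bullet> w = 1" "v \<bullet> w = 0"
proof -
  obtain y where y: "y \<in> flat {v}" "u \<bullet> y \<noteq> 0" using in_span_iff_flat[of u "{v}"] assms by blast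
  show thesis
    by (rule that[of "(1 / (u \<bullet> y)) *\<^sub>R y"]) (use y in \<open>auto simp: flat_def\<close>)
qed

locale plane =
  fixes u v :: "real ^ 'x"
  assumes u0: "u \<noteq> 0" and vu: "v \<notin> span {u}"
begin

lemma uv: "u \<notin> span {v}"
proof
  assume "u \<in> span {v}"
  then obtain k where k: "u = k *\<^sub>R v" by (auto simp: span_singleton)
  then have "k \<noteq> 0" using u0 by auto
  then have "v = (1 / k) *\<^sub>R u" using k by simp
  then show False using vu by (auto simp: span_singleton)
qed

lemma independent_uv: "independent {v, u}" "v \<noteq> u"
proof -
  show "independent {v, u}" by (rule independent_insertI[OF vu]) (use u0 in simp)
  show "v \<noteq> u" using vu span_base[of u "{u}"] by auto
qed

lemma dim_uv: "dim {u, v} = 2"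
  using dim_eq_card_independent[OF independent_uv(1)] independent_uv(2) by (simp add: insert_commute)

lemma dual_basis:
  obtains w1 w2 where "u \<bullet> w1 = 1" "v \<bullet> w1 = 0" "u \<bullet> w2 = 0" "v \<bullet> w2 = 1"
  using dual_vector[OF uv] dual_vector[OF vu] by metis

text \<open>Modulo \<open>lin u\<close> and \<open>lin v\<close> every coordinate agrees with that
  of the projection to the flat along a dual basis \<open>w1\<close>, \<open>w2\<close>;
  substituting the projection turns a polynomial vanishing on the flat into zero.\<close>

lemma van_flat_subset:
  assumes J: "ideal J poly_ring" and uv: "lin u \<in> J" "lin v \<in> J"
  shows "van (flat {u, v}) \<subseteq> J"
proof
  fix p assume p: "p \<in> van (flat {u, v})"
  obtain w1 w2 where w: "u \<bullet> w1 = 1" "v \<bullet> w1 = 0" "u \<bullet> w2 = 0" "v \<bullet> w2 = 1" by (rule dual_basis)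
  define s where "s i = X i - ((w1 $ i) *\<^sub>R lin u + (w2 $ i) *\<^sub>R lin v)" for i
  have "p - msubst s p \<in> J"
  proof (rule msubst_congruent)
    show "X i - s i \<in> J" for i
      unfolding s_def using uv by (auto intro!: idealD(2)[OF J] subspace_scale[OF ideal_subspace[OF J]])
  qed (use idealD[OF J] in auto)
  moreover have "msubst s p = 0"
  proof (rule mpoly_eqI)
    fix x
    have "(\<chi> i. mpeval (s i) x) = x - (u \<bullet> x) *\<^sub>R w1 - (v \<bullet> x) *\<^sub>R w2"
      by (simp add: s_def vec_eq_iff mult.commute)
    moreover have "x - (u \<bullet> x) *\<^sub>R w1 - (v \<bullet> x) *\<^sub>R w2 \<in> flat {u, v}"
      using w by (simp add: flat_def inner_diff_right)
    ultimately show "mpeval (msubst s p) x = mpeval 0 x" using p by (simp add: van_def)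
  qed
  ultimately show "p \<in> J" by simp
qed

lemma lin_in_van: "lin u \<in> van (flat {u, v})" "lin v \<in> van (flat {u, v})"
  by (auto simp: van_def flat_def)

lemma zero_locus_van_flat: "zero_locus (van (flat {u, v})) = flat {u, v}"
proof
  show "zero_locus (van (flat {u, v})) \<subseteq> flat {u, v}"
    using lin_in_van by (force simp: zero_locus_def flat_def)
qed (auto simp: zero_locus_def van_def)

lemma flat_chain: "flat {u} \<subset> UNIV" "flat {u, v} \<subset> flat {u}"
proof -
  have "u \<notin> flat {u}" using u0 by (simp add: flat_def)
  then show "flat {u} \<subset> UNIV" by blast
  obtain y where y: "y \<in> flat {u}" "v \<bullet> y \<noteq> 0" using in_span_iff_flat[of v "{u}"] vu by blast
  then have "y \<notin> flat {u, v}" by (simp add: flat_def)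
  moreover have "flat {u, v} \<subseteq> flat {u}" by (rule flat_mono) simp
  ultimately show "flat {u, v} \<subset> flat {u}" using y(1) by blast
qed

text \<open>Upper bound: a prime chain ending here can be prolonged through the subspaces of the
  flat. Lower bound: the chain of ideals of the whole space, of the hyperplane of \<open>u\<close>,
  and of the flat.\<close>

lemma prime_codim_van_flat: "prime_codim poly_ring (van (flat {u, v})) = 2"
  unfolding prime_codim_def
proof (rule antisym)
  have d: "dim (flat {u, v}) + 2 = CARD('x)" using dim_flat[of "{u, v}"] dim_uv by simp
  show "Sup {enat n | n. \<exists>c. (\<forall>i\<le>n. primeideal (c i) poly_ring) \<and> (\<forall>i<n. c i \<subset> c (Suc i)) \<and> c n = van (flat {u, v})} \<le> 2"
  proof (rule Sup_least)
    fix h assume "h \<in> {enat n | n. \<exists>c. (\<forall>i\<le>n. primeideal (c i) poly_ring) \<and> (\<forall>i<n. c i \<subset> c (Suc i)) \<and> c n = van (flat {u, v})}"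
    then obtain n c where nc: "h = enat n" "\<forall>i\<le>n. primeideal (c i) poly_ring" "\<forall>i<n. c i \<subset> c (Suc i)" "c n = van (flat {u, v})"
      by blast
    have "n + dim (flat {u, v}) \<le> CARD('x)"
      by (rule prime_chain_to_van[OF subspace_flat, of n c]) (use nc in auto)
    then have "n \<le> 2" using d by linarith
    then show "h \<le> 2" using nc(1) by (simp add: numeral_eq_enat)
  qed
  define c where "c i = (if i = 0 then van (UNIV :: (real ^ 'x) set) else if i = 1 then van (flat {u}) else van (flat {u, v}))" for i :: nat
  note s1 = flat_chain(1) and s2 = flat_chain(2)
  have "(\<forall>i\<le>2. primeideal (c i) poly_ring) \<and> (\<forall>i<2. c i \<subset> c (Suc i)) \<and> c 2 = van (flat {u, v})"
    using van_strict[OF subspace_flat s1] van_strict[OF subspace_flat s2]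
    by (auto simp: c_def less_2_cases_iff intro!: primeideal_van subspace_flat)
  then have "enat 2 \<in> {enat n | n. \<exists>c. (\<forall>i\<le>n. primeideal (c i) poly_ring) \<and> (\<forall>i<n. c i \<subset> c (Suc i)) \<and> c n = van (flat {u, v})}"
    by blast
  then show "2 \<le> Sup {enat n | n. \<exists>c. (\<forall>i\<le>n. primeideal (c i) poly_ring) \<and> (\<forall>i<n. c i \<subset> c (Suc i)) \<and> c n = van (flat {u, v})}"
    unfolding numeral_eq_enat by (rule Sup_upper)
qed

text \<open>A prime of codimension two cannot properly contain the ideal of a linear subspace of codimension two.\<close>

lemma prime_over_van_flat:
  assumes Q: "primeideal Q poly_ring" "lin u \<in> Q" "lin v \<in> Q" and codim: "prime_codim poly_ring Q = 2"
  shows "Q = van (flat {u, v})"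
proof (rule ccontr)
  assume ne: "Q \<noteq> van (flat {u, v})"
  have sub: "van (flat {u, v}) \<subset> Q"
    using van_flat_subset[of Q] Q ne by (auto simp: primeideal_poly_ring_iff)
  define c where "c i = (if i = 0 then van (UNIV :: (real ^ 'x) set) else if i = 1 then van (flat {u})
      else if i = 2 then van (flat {u, v}) else Q)" for i :: nat
  note s1 = flat_chain(1) and s2 = flat_chain(2)
  have "c i \<subset> c (Suc i)" if "i < 3" for i
  proof -
    from that consider "i = 0" | "i = 1" | "i = 2" by linarith
    then show ?thesis
      by cases (use van_strict[OF subspace_flat s1] van_strict[OF subspace_flat s2] sub in \<open>simp_all add: c_def\<close>)
  qed
  moreover have "primeideal (c i) poly_ring" for i
    using Q(1) by (auto simp: c_def intro!: primeideal_van subspace_flat)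
  moreover have "c 3 = Q" by (simp add: c_def)
  ultimately have "enat 3 \<in> {enat n | n. \<exists>c. (\<forall>i\<le>n. primeideal (c i) poly_ring) \<and> (\<forall>i<n. c i \<subset> c (Suc i)) \<and> c n = Q}"
    by blast
  then have "enat 3 \<le> prime_codim poly_ring Q" unfolding prime_codim_def by (rule Sup_upper)
  then show False unfolding codim by (simp add: numeral_eq_enat)
qed

text \<open>\<open>g\<close> is a monomial in \<open>lin u\<close> and \<open>lin v\<close> of
  highest degree outside \<open>J\<close>, so both forms move it into \<open>J\<close>. If a
  \<open>p\<close> not vanishing on the flat did so as well, freezing the coordinates along the flat
  at a point where \<open>p\<close> is nonzero would put a nonzero multiple of \<open>g\<close> into
  \<open>J\<close>; the generators are unaffected, as they depend on the values of \<open>u\<close>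
  and \<open>v\<close> only.\<close>

lemma socle_element:
  assumes A: "A \<subseteq> span {u, v}" "u \<in> A" "v \<in> A" and J: "J = Idl\<^bsub>poly_ring\<^esub> ((\<lambda>a. lin a ^ Suc r) ` A)"
  obtains g where "\<And>p. p * g \<in> J \<longleftrightarrow> p \<in> van (flat {u, v})"
proof -
  have idJ: "ideal J poly_ring" unfolding J by (rule Idl_ideal)
  have gen: "lin a ^ Suc r \<in> J" if "a \<in> A" for a unfolding J using that by (intro Idl_base) auto
  have "J \<subseteq> van {0}" unfolding J by (rule Idl_minimal[OF ideal_van]) (auto simp: van_def)
  then have one: "1 \<notin> J" by (auto simp: van_def)
  let ?m = "\<lambda>i j. lin u ^ i * lin v ^ j"
  let ?P = "\<lambda>k. \<exists>i j. k = i + j \<and> ?m i j \<notin> J"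
  \<comment> \<open>The (r + 1)st power of either form lies in \<open>J\<close>, so the degrees over
    which the maximum is taken are bounded.\<close>
  have bound: "i \<le> r \<and> j \<le> r" if nin: "?m i j \<notin> J" for i j
  proof (rule ccontr)
    assume "\<not> (i \<le> r \<and> j \<le> r)"
    then consider k where "i = Suc r + k" | k where "j = Suc r + k"
      by (metis not_less_eq_eq le_iff_add)
    then show False
    proof cases
      case 1
      then have "?m i j = (lin u ^ k * lin v ^ j) * lin u ^ Suc r" by (simp only: power_add mult_ac)
      then show False using nin idealD(3)[OF idJ gen[OF A(2)]] by metis
    next
      case 2
      then have "?m i j = (lin u ^ i * lin v ^ k) * lin v ^ Suc r" by (simp only: power_add mult_ac)
      then show False using nin idealD(3)[OF idJ gen[OF A(3)]] by metis
    qed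
  qed
  have "?P 0" using one by auto
  moreover have "\<forall>k. ?P k \<longrightarrow> k < Suc (2 * r)"
  proof (intro allI impI)
    fix k assume "?P k"
    then obtain i j where "k = i + j" "?m i j \<notin> J" by blast
    then show "k < Suc (2 * r)" using bound[of i j] by linarith
  qed
  ultimately obtain k where k: "?P k" "\<forall>k'. ?P k' \<longrightarrow> k' \<le> k"
    using ex_has_greatest_nat[of ?P 0 "\<lambda>k. k" "Suc (2 * r)"] by blast
  then obtain i j where ij: "k = i + j" "?m i j \<notin> J" by blast
  define g where "g = ?m i j"
  have gJ: "g \<notin> J" using ij by (simp add: g_def)
  have ug: "lin u * g \<in> J"
  proof (rule ccontr)
    assume "lin u * g \<notin> J"
    then have "?P (Suc i + j)" by (intro exI[of _ "Suc i"] exI[of _ j]) (simp add: g_def mult.assoc)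
    then show False using k(2) ij(1) by fastforce
  qed
  have vg: "lin v * g \<in> J"
  proof (rule ccontr)
    assume "lin v * g \<notin> J"
    then have "?P (i + Suc j)" by (intro exI[of _ i] exI[of _ "Suc j"]) (simp add: g_def mult_ac)
    then show False using k(2) ij(1) by fastforce
  qed
  have idC: "ideal {p. p * g \<in> J} poly_ring"
    using idealD[OF idJ] by (auto simp: ideal_poly_ring_iff distrib_right mult.assoc)
  obtain w1 w2 where w: "u \<bullet> w1 = 1" "v \<bullet> w1 = 0" "u \<bullet> w2 = 0" "v \<bullet> w2 = 1" by (rule dual_basis)
  show thesis
  proof (rule that, rule iffI)
    fix p assume "p \<in> van (flat {u, v})"
    then show "p * g \<in> J" using van_flat_subset[OF idC] ug vg by auto
  next
    fix p assume pg: "p * g \<in> J"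
    show "p \<in> van (flat {u, v})"
    proof (rule ccontr)
      assume "p \<notin> van (flat {u, v})"
      then obtain x0 where x0: "x0 \<in> flat {u, v}" "mpeval p x0 \<noteq> 0" by (auto simp: van_def)
      \<comment> \<open>The projection to the flat along the dual basis: it replaces
        \<open>p\<close> by a polynomial that is constant in the directions \<open>w1\<close> and
        \<open>w2\<close> and has the same product with \<open>g\<close> modulo
        \<open>J\<close>.\<close>
      define s where "s i = X i - ((w1 $ i) *\<^sub>R lin u + (w2 $ i) *\<^sub>R lin v)" for i
      have s: "(\<chi> i. mpeval (s i) x) = x - (u \<bullet> x) *\<^sub>R w1 - (v \<bullet> x) *\<^sub>R w2" for x
        by (simp add: s_def vec_eq_iff mult.commute)
      have "p - msubst s p \<in> {p. p * g \<in> J}"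
      proof (rule msubst_congruent)
        have "lin u \<in> {p. p * g \<in> J}" "lin v \<in> {p. p * g \<in> J}" using ug vg by auto
        then have "(w1 $ i) *\<^sub>R lin u + (w2 $ i) *\<^sub>R lin v \<in> {p. p * g \<in> J}" for i
          by (intro idealD(2)[OF idC] subspace_scale[OF ideal_subspace[OF idC]])
        then show "X i - s i \<in> {p. p * g \<in> J}" for i by (simp add: s_def)
      qed (use idealD[OF idC] in blast)+
      then have "p * g - (p - msubst s p) * g \<in> J"
        using pg subspace_diff[OF ideal_subspace[OF idJ]] by blast
      then have sg: "msubst s p * g \<in> J" by (simp add: left_diff_distrib)
      \<comment> \<open>This substitution keeps the values of \<open>u\<close> and \<open>v\<close>
        while moving every point into the translate through \<open>x0\<close> of the plane of
        \<open>w1\<close> and \<open>w2\<close>.\<close>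
      define t where "t i = mconst (x0 $ i) + ((w1 $ i) *\<^sub>R lin u + (w2 $ i) *\<^sub>R lin v)" for i
      have t: "(\<chi> i. mpeval (t i) x) = x0 + (u \<bullet> x) *\<^sub>R w1 + (v \<bullet> x) *\<^sub>R w2" for x
        by (simp add: t_def vec_eq_iff mult.commute)
      have ut: "u \<bullet> (x0 + (u \<bullet> x) *\<^sub>R w1 + (v \<bullet> x) *\<^sub>R w2) = u \<bullet> x"
        "v \<bullet> (x0 + (u \<bullet> x) *\<^sub>R w1 + (v \<bullet> x) *\<^sub>R w2) = v \<bullet> x" for x
        using x0 w by (auto simp: flat_def inner_add_right)
      have at: "a \<bullet> (x0 + (u \<bullet> x) *\<^sub>R w1 + (v \<bullet> x) *\<^sub>R w2) = a \<bullet> x" if "a \<in> span {u, v}" for a x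
      proof -
        have "x - (x0 + (u \<bullet> x) *\<^sub>R w1 + (v \<bullet> x) *\<^sub>R w2) \<in> flat {u, v}"
          using ut by (simp add: flat_def inner_diff_right)
        then have "a \<bullet> (x - (x0 + (u \<bullet> x) *\<^sub>R w1 + (v \<bullet> x) *\<^sub>R w2)) = 0"
          using in_span_iff_flat[of a "{u, v}"] that by blast
        then show ?thesis by (simp add: inner_diff_right)
      qed
      have "ideal {q. msubst t q \<in> J} poly_ring"
      proof -
        have "msubst t 0 = 0" "msubst t (p + q) = msubst t p + msubst t q" "msubst t (p * q) = msubst t p * msubst t q" for p q
          by (rule mpoly_eqI; simp)+
        then show ?thesis using idealD[OF idJ] by (auto simp: ideal_poly_ring_iff)
      qed
      moreover have "(\<lambda>a. lin a ^ Suc r) ` A \<subseteq> {q. msubst t q \<in> J}"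
      proof clarify
        fix a assume a: "a \<in> A"
        have "msubst t (lin a ^ Suc r) = lin a ^ Suc r"
          by (rule mpoly_eqI) (use at[of a] a A(1) in \<open>auto simp: t\<close>)
        then show "msubst t (lin a ^ Suc r) \<in> J" using gen[OF a] by simp
      qed
      ultimately have "J \<subseteq> {q. msubst t q \<in> J}" unfolding J by (rule Idl_minimal)
      then have "msubst t (msubst s p * g) \<in> J" using sg by blast
      moreover have "msubst t (msubst s p * g) = mpeval p x0 *\<^sub>R g"
      proof (rule mpoly_eqI)
        fix x
        let ?y = "x0 + (u \<bullet> x) *\<^sub>R w1 + (v \<bullet> x) *\<^sub>R w2"
        have "?y - (u \<bullet> ?y) *\<^sub>R w1 - (v \<bullet> ?y) *\<^sub>R w2 = x0" unfolding ut by simp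
        then show "mpeval (msubst t (msubst s p * g)) x = mpeval (mpeval p x0 *\<^sub>R g) x"
          by (simp add: t s g_def ut)
      qed
      ultimately have "mpeval p x0 *\<^sub>R g \<in> J" by simp
      then have "(1 / mpeval p x0) *\<^sub>R (mpeval p x0 *\<^sub>R g) \<in> J"
        by (rule subspace_scale[OF ideal_subspace[OF idJ]])
      then show False using gJ x0(2) by simp
    qed
  qed
qed

end

lemma lin_multiples_subspace:
  assumes "gfam I S"
  shows "subspace {a. \<forall>k. \<forall>f\<in>free_forms I (k - 1). pmul (lin a) f \<in> S k}"
proof (rule subspaceI)
  show "0 \<in> {a. \<forall>k. \<forall>f\<in>free_forms I (k - 1). pmul (lin a) f \<in> S k}"
  proof -
    have "lin (0 :: real ^ 'b) = 0" by (rule mpoly_eqI) simp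
    then have "pmul (lin 0) f = (0 :: 'a \<Rightarrow> 'b mpoly)" for f by (simp add: fun_eq_iff)
    then show ?thesis using subspace_0[OF gfamD(1)[OF assms]] by (simp del: pmul_apply)
  qed
next
  fix a b :: "real ^ 'b"
  assume ab: "a \<in> {a. \<forall>k. \<forall>f\<in>free_forms I (k - 1). pmul (lin a) f \<in> S k}"
    "b \<in> {a. \<forall>k. \<forall>f\<in>free_forms I (k - 1). pmul (lin a) f \<in> S k}"
  have "pmul (lin (a + b)) f = pmul (lin a) f + pmul (lin b) f" for f :: "'a \<Rightarrow> 'b mpoly"
    by (simp add: fun_eq_iff lin_add distrib_right)
  then show "a + b \<in> {a. \<forall>k. \<forall>f\<in>free_forms I (k - 1). pmul (lin a) f \<in> S k}"
    using ab subspace_add[OF gfamD(1)[OF assms]] by (simp del: pmul_apply)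
next
  fix c and a :: "real ^ 'b"
  assume a: "a \<in> {a. \<forall>k. \<forall>f\<in>free_forms I (k - 1). pmul (lin a) f \<in> S k}"
  have "pmul (lin (c *\<^sub>R a)) f = c *\<^sub>R pmul (lin a) f" for f :: "'a \<Rightarrow> 'b mpoly"
    by (simp only: lin_scaleR pmul_scaleR_left)
  then show "c *\<^sub>R a \<in> {a. \<forall>k. \<forall>f\<in>free_forms I (k - 1). pmul (lin a) f \<in> S k}"
    using a subspace_scale[OF gfamD(1)[OF assms]] by (simp del: pmul_apply)
qed

lemma small_linear_forms_span:
  fixes S :: "int \<Rightarrow> ('i \<Rightarrow> 'x::finite mpoly) set"
  assumes "finite I" "gfam I S" "\<And>a k f. a \<in> A \<Longrightarrow> f \<in> free_forms I (k - 1) \<Longrightarrow> pmul (lin a) f \<in> S k"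
  shows "small (CARD('x) - dim A) (codim I S)"
proof -
  have "span A \<subseteq> {a. \<forall>k. \<forall>f\<in>free_forms I (k - 1). pmul (lin a) f \<in> S k}"
    by (rule span_minimal[OF _ lin_multiples_subspace[OF assms(2)]]) (use assms(3) in auto)
  then have "small (CARD('x) - dim (span A)) (codim I S)"
    by (intro small_linear_forms[OF assms(1,2)]) auto
  then show ?thesis by simp
qed

text \<open>The annihilating product is kept as a list of factors because
  \<open>small_product\<close> removes them one by one.\<close>

definition kills :: "'i set \<Rightarrow> (int \<Rightarrow> ('i \<Rightarrow> 'x::finite mpoly) set) \<Rightarrow> (real ^ 'x) list \<Rightarrow> bool" where
  "kills I S as \<longleftrightarrow>
     (\<forall>k. \<forall>f\<in>free_forms I k. pmul (prod_list (map lin as)) f \<in> S (k + int (length as)))"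

lemma kills_addp: "kills I S as \<Longrightarrow> kills I (addp I S a) as"
  using subset_addp[of S _ I a] by (auto simp: kills_def simp del: pmul_apply)

lemma lin_multiple_addp: "0 \<in> S k \<Longrightarrow> f \<in> free_forms I (k - 1) \<Longrightarrow> pmul (lin a) f \<in> addp I S a k"
  unfolding addp_def by (intro CollectI exI[of _ 0] exI[of _ f]) simp

text \<open>The quotient is supported on the hyperplanes of the forms \<open>a\<close>, and on each
  of these only where a further form \<open>b\<close> independent of \<open>a\<close> vanishes; what
  is left is annihilated by two independent forms.\<close>

lemma small_two:
  fixes S :: "int \<Rightarrow> ('i \<Rightarrow> 'x::finite mpoly) set"
  assumes I: "finite I" and S: "gfam I S" and as: "kills I S as"
    and a: "\<And>a. a \<in> set as \<Longrightarrow> a \<noteq> 0 \<and> (\<exists>bs. kills I S bs \<and> (\<forall>b\<in>set bs. b \<notin> span {a}))"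
  shows "small (CARD('x) - 2) (codim I S)"
proof (rule small_product[OF I S])
  show "pmul (prod_list (map lin as)) f \<in> S (k + int (length as))" if "f \<in> free_forms I k" for k f
    using as that by (auto simp: kills_def simp del: pmul_apply)
  fix a assume aa: "a \<in> set as"
  then obtain bs where bs: "kills I S bs" "\<And>b. b \<in> set bs \<Longrightarrow> b \<notin> span {a}" using a by blast
  have ga: "gfam I (addp I S a)" by (rule gfam_addp[OF S])
  show "small (CARD('x) - 2) (codim I (addp I S a))"
  proof (rule small_product[OF I ga])
    show "pmul (prod_list (map lin bs)) f \<in> addp I S a (k + int (length bs))" if "f \<in> free_forms I k" for k f
      using kills_addp[OF bs(1)] that by (auto simp: kills_def simp del: pmul_apply)
    fix b assume b: "b \<in> set bs"
    interpret plane a b by unfold_locales (use a[OF aa] bs(2)[OF b] in auto)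
    have gb: "gfam I (addp I (addp I S a) b)" by (rule gfam_addp[OF ga])
    have "small (CARD('x) - dim {a, b}) (codim I (addp I (addp I S a) b))"
    proof (rule small_linear_forms_span[OF I gb])
      fix c k and f :: "'i \<Rightarrow> 'x mpoly" assume c: "c \<in> {a, b}" and f: "f \<in> free_forms I (k - 1)"
      have "pmul (lin a) f \<in> addp I S a k"
        by (rule lin_multiple_addp[OF subspace_0[OF gfamD(1)[OF S]] f])
      then have "pmul (lin a) f \<in> addp I (addp I S a) b k"
        by (rule subsetD[OF subset_addp])
      moreover have "pmul (lin b) f \<in> addp I (addp I S a) b k"
        using lin_multiple_addp[OF subspace_0[OF gfamD(1)[OF ga]] f] .
      ultimately show "pmul (lin c) f \<in> addp I (addp I S a) b k" using c by (elim insertE) (simp_all del: pmul_apply)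
    qed
    then show "small (CARD('x) - 2) (codim I (addp I (addp I S a) b))" by (simp only: dim_uv)
  qed
qed

text \<open>One level more than \<open>small_two\<close>, ending with three independent forms. The
  annihilators may depend on the forms chosen before, which fits annihilators that are known
  subspace by subspace.\<close>

lemma small_three:
  fixes S :: "int \<Rightarrow> ('i \<Rightarrow> 'x::finite mpoly) set"
  assumes I: "finite I" and S: "gfam I S" and as: "kills I S as"
    and a: "\<And>a. a \<in> set as \<Longrightarrow> a \<noteq> 0 \<and> (\<exists>bs. kills I S bs \<and>
        (\<forall>b\<in>set bs. b \<notin> span {a} \<and> (\<exists>cs. kills I S cs \<and> (\<forall>c\<in>set cs. c \<notin> span {a, b}))))"
  shows "small (CARD('x) - 3) (codim I S)"
proof (rule small_product[OF I S])
  show "pmul (prod_list (map lin as)) f \<in> S (k + int (length as))" if "f \<in> free_forms I k" for k f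
    using as that by (auto simp: kills_def simp del: pmul_apply)
  fix a assume aa: "a \<in> set as"
  then obtain bs where bs: "kills I S bs"
    "\<And>b. b \<in> set bs \<Longrightarrow> b \<notin> span {a} \<and> (\<exists>cs. kills I S cs \<and> (\<forall>c\<in>set cs. c \<notin> span {a, b}))" using a by blast
  have ga: "gfam I (addp I S a)" by (rule gfam_addp[OF S])
  show "small (CARD('x) - 3) (codim I (addp I S a))"
  proof (rule small_product[OF I ga])
    show "pmul (prod_list (map lin bs)) f \<in> addp I S a (k + int (length bs))" if "f \<in> free_forms I k" for k f
      using kills_addp[OF bs(1)] that by (auto simp: kills_def simp del: pmul_apply)
    fix b assume b: "b \<in> set bs"
    then obtain cs where cs: "kills I S cs" "\<And>c. c \<in> set cs \<Longrightarrow> c \<notin> span {a, b}" using bs(2) by blast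
    interpret plane a b by unfold_locales (use a[OF aa] bs(2)[OF b] in auto)
    have gb: "gfam I (addp I (addp I S a) b)" by (rule gfam_addp[OF ga])
    show "small (CARD('x) - 3) (codim I (addp I (addp I S a) b))"
    proof (rule small_product[OF I gb])
      show "pmul (prod_list (map lin cs)) f \<in> addp I (addp I S a) b (k + int (length cs))" if "f \<in> free_forms I k" for k f
        using kills_addp[OF kills_addp[OF cs(1)]] that by (auto simp: kills_def simp del: pmul_apply)
      fix c assume c: "c \<in> set cs"
      let ?S = "addp I (addp I (addp I S a) b) c"
      have gc: "gfam I ?S" by (rule gfam_addp[OF gb])
      have ni: "c \<notin> span {b, a}" using cs(2)[OF c] by (simp add: insert_commute)
      have ind: "independent {c, b, a}" by (rule independent_insertI[OF ni independent_uv(1)])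
      have "c \<noteq> a" "c \<noteq> b" using ni span_base[of c "{b, a}"] by auto
      then have "dim {c, b, a} = 3" using dim_eq_card_independent[OF ind] independent_uv(2) by simp
      moreover have "small (CARD('x) - dim {c, b, a}) (codim I ?S)"
      proof (rule small_linear_forms_span[OF I gc])
        fix e k and f :: "'i \<Rightarrow> 'x mpoly" assume e: "e \<in> {c, b, a}" and f: "f \<in> free_forms I (k - 1)"
        have "pmul (lin a) f \<in> addp I S a k"
          by (rule lin_multiple_addp[OF subspace_0[OF gfamD(1)[OF S]] f])
        then have 1: "pmul (lin a) f \<in> ?S k"
          using subset_addp[of "addp I S a" k I b] subset_addp[of "addp I (addp I S a) b" k I c] by (metis subsetD)
        have "pmul (lin b) f \<in> addp I (addp I S a) b k"
          by (rule lin_multiple_addp[OF subspace_0[OF gfamD(1)[OF ga]] f])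
        then have 2: "pmul (lin b) f \<in> ?S k"
          using subset_addp[of "addp I (addp I S a) b" k I c] by (metis subsetD)
        have 3: "pmul (lin c) f \<in> ?S k"
          by (rule lin_multiple_addp[OF subspace_0[OF gfamD(1)[OF gb]] f])
        show "pmul (lin e) f \<in> ?S k" using e 1 2 3 by (elim insertE) (simp_all del: pmul_apply)
      qed
      ultimately show "small (CARD('x) - 3) (codim I ?S)" by (simp only:)
    qed
  qed
qed

section \<open>Hilbert functions of the modules\<close>

text \<open>Views an ideal as a submodule of the free module of rank one, so that the growth lemmas
  apply to it.\<close>

definition ufam :: "(int \<Rightarrow> 'x::finite mpoly set) \<Rightarrow> int \<Rightarrow> (unit \<Rightarrow> 'x mpoly) set" where
  "ufam V k = prod_space {()} (\<lambda>_. V k)"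

lemma gfam_ufam:
  assumes "\<And>k. subspace (V k)" "\<And>k. V k \<subseteq> forms k" "\<And>i k p. p \<in> V k \<Longrightarrow> X i * p \<in> V (k + 1)"
  shows "gfam {()} (ufam V)"
  unfolding gfam_def ufam_def
proof (intro allI conjI ballI)
  fix k
  show "subspace (prod_space {()} (\<lambda>_. V k))" using assms(1) by (intro subspace_prod_space)
qed (use assms(2,3) in \<open>auto simp: prod_space_def\<close>)

lemma codim_ufam:
  fixes V :: "int \<Rightarrow> 'x::finite mpoly set"
  assumes "subspace (V k)" "V k \<subseteq> forms k"
  shows "codim {()} (ufam V) k = real (dim (forms k :: 'x mpoly set)) - real (dim (V k))"
proof -
  have "findim (V k)" by (rule findim_subset[OF findim_forms assms(2)])
  then have "dim (ufam V k) = dim (V k)"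
    unfolding ufam_def using dim_prod_space[of "{()}" "\<lambda>_. V k"] assms(1) by simp
  then show ?thesis by (simp add: codim_def dim_free_forms)
qed

text \<open>The Hilbert function of R/J.\<close>

definition ideal_codim :: "'x::finite mpoly set \<Rightarrow> int \<Rightarrow> real" where
  "ideal_codim J k = real (dim (forms k :: 'x mpoly set)) - real (dim (J \<inter> forms k))"

lemma X_mult_forms: "p \<in> forms k \<Longrightarrow> X i * p \<in> forms (k + 1)"
  using forms_mult[OF X_forms, of p k i] by (simp add: add.commute)

lemma subspace_ideal_forms: "ideal J poly_ring \<Longrightarrow> subspace (J \<inter> forms k)"
  by (intro subspace_inter ideal_subspace subspace_forms)

lemma findim_ideal_forms: "findim (J \<inter> forms k)"
  by (rule findim_subset[OF findim_forms]) auto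

lemma gfam_ideal:
  assumes "ideal J poly_ring"
  shows "gfam {()} (ufam (\<lambda>k. J \<inter> forms k))"
  by (rule gfam_ufam) (use subspace_ideal_forms[OF assms] idealD(3)[OF assms] X_mult_forms in auto)

lemma ideal_codim_eq: "ideal J poly_ring \<Longrightarrow> ideal_codim J k = codim {()} (ufam (\<lambda>k. J \<inter> forms k)) k"
  unfolding ideal_codim_def by (rule codim_ufam[symmetric]) (auto simp: subspace_ideal_forms)

lemma evpoly_forms: "evpoly (\<lambda>k. real (dim (forms (int k) :: 'x::finite mpoly set)))"
  by (rule evpoly_dim_ideal[OF subspace_forms]) (auto simp: X_mult_forms)

lemma evpoly_ideal_codim:
  assumes "ideal J poly_ring"
  shows "evpoly (\<lambda>k. ideal_codim J (int k))"
  unfolding ideal_codim_def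
  by (intro evpoly_diff evpoly_forms evpoly_dim_ideal[of "\<lambda>k. J \<inter> forms k"])
     (use subspace_ideal_forms[OF assms] idealD(3)[OF assms] X_mult_forms in auto)

text \<open>Two polynomials that agree at all large natural numbers are equal, so the definite
  description in \<open>hilbert_poly\<close> denotes \<open>p\<close>.\<close>

lemma hilbert_coeffI:
  assumes "\<And>k. k \<ge> K \<Longrightarrow> real (hilbert_function M (int k)) = poly p (real k)"
  shows "hilbert_coeff i M = coeff p i"
proof -
  have "hilbert_poly M = p"
    unfolding hilbert_poly_def
  proof (rule the_equality)
    show "\<forall>\<^sub>F k in sequentially. poly p (real k) = real (hilbert_function M (int k))"
      unfolding eventually_sequentially using assms by (metis)
    fix q assume "\<forall>\<^sub>F k in sequentially. poly q (real k) = real (hilbert_function M (int k))"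
    then obtain L where L: "\<And>k. k \<ge> L \<Longrightarrow> poly q (real k) = real (hilbert_function M (int k))"
      unfolding eventually_sequentially by blast
    have "real ` {max K L..} \<subseteq> {x. poly (q - p) x = 0}" using assms L by auto
    moreover have "infinite (real ` {max K L..})"
      by (simp add: finite_image_iff infinite_Ici)
    ultimately have "infinite {x. poly (q - p) x = 0}" using finite_subset by blast
    then have "q - p = 0" using poly_roots_finite by blast
    then show "q = p" by simp
  qed
  then show ?thesis by (simp add: hilbert_coeff_def)
qed

lemma hilbert_function_twist_ring:
  "hilbert_function (twist ring_gmodule j :: ('x::finite mpoly, 'x mpoly) gmodule) k = dim (forms (j + k) :: 'x mpoly set)"
proof -
  have "hilbert_function (twist ring_gmodule j :: ('x mpoly, 'x mpoly) gmodule) k + dim {0 :: 'x mpoly} = dim (forms (j + k) :: 'x mpoly set)"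
  proof (rule hilbert_function_transfer[where h = "\<lambda>p. p", OF _ subspace_forms findim_forms])
    show "abelian_monoid (twist ring_gmodule j :: ('x mpoly, 'x mpoly) gmodule)"
      by (rule abelian_monoidI) (auto simp: twist_def ring_gmodule_def add_ac)
  qed (auto simp: twist_def ring_gmodule_def mconst_mult_scaleR)
  then show ?thesis by (simp add: dim_zero)
qed

lemma hilbert_function_ring:
  "hilbert_function (ring_gmodule :: ('x::finite mpoly, 'x mpoly) gmodule) k = dim (forms k :: 'x mpoly set)"
proof -
  have "twist (ring_gmodule :: ('x mpoly, 'x mpoly) gmodule) 0 = ring_gmodule"
    by (simp add: twist_def ring_gmodule_def)
  then show ?thesis using hilbert_function_twist_ring[of 0 k, where 'x = 'x] by simp
qed

lemma coset_ring_gmodule: "J +>\<^bsub>ring_gmodule\<^esub> p = (\<lambda>s. s + p) ` J"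
  by (auto simp: a_r_coset_def r_coset_def ring_gmodule_def)

lemma subspace_coset_eq_iff:
  fixes U :: "'v::real_vector set"
  assumes sub: "subspace U"
  shows "(\<lambda>s. s + x) ` U = (\<lambda>s. s + y) ` U \<longleftrightarrow> x - y \<in> U"
proof
  assume "(\<lambda>s. s + x) ` U = (\<lambda>s. s + y) ` U"
  moreover have "x \<in> (\<lambda>s. s + x) ` U" using subspace_0[OF sub] by (intro image_eqI[of _ _ 0]) simp_all
  ultimately have "x \<in> (\<lambda>s. s + y) ` U" by simp
  then show "x - y \<in> U" by (elim imageE) simp
next
  have main: "(\<lambda>s. s + x) ` U \<subseteq> (\<lambda>s. s + y) ` U" if xy: "x - y \<in> U" for x y
  proof
    fix z assume "z \<in> (\<lambda>s. s + x) ` U"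
    then obtain s where s: "s \<in> U" "z = s + x" by (elim imageE)
    show "z \<in> (\<lambda>s. s + y) ` U" by (rule image_eqI[OF _ subspace_add[OF sub s(1) xy]]) (simp add: s(2))
  qed
  assume xy: "x - y \<in> U"
  have "y - x \<in> U" using subspace_neg[OF sub xy] by simp
  then show "(\<lambda>s. s + x) ` U = (\<lambda>s. s + y) ` U" by (intro equalityI main xy)
qed

text \<open>\<open>h\<close> is the residue map; the work lies in recognizing the set-level
  operations of \<open>quot_gmodule\<close> as the induced ones.\<close>

lemma hilbert_function_quot_ring:
  fixes J :: "'x::finite mpoly set"
  assumes J: "ideal J poly_ring"
  shows "real (hilbert_function (quot_gmodule ring_gmodule J) k) = ideal_codim J k"
proof -
  let ?M = "quot_gmodule ring_gmodule J :: ('x mpoly, 'x mpoly set) gmodule"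
  define h where "h p = (\<lambda>s. s + p) ` J" for p
  have sub: "subspace J" by (rule ideal_subspace[OF J])
  have coset: "J +>\<^bsub>ring_gmodule\<^esub> p = h p" for p by (simp add: h_def coset_ring_gmodule)
  have h_eq: "h p = h q \<longleftrightarrow> p - q \<in> J" for p q unfolding h_def by (rule subspace_coset_eq_iff[OF ideal_subspace[OF J]])
  have carrier: "carrier ?M = range h"
    by (auto simp: quot_gmodule_def A_RCOSETS_def RCOSETS_def coset[unfolded a_r_coset_def] ring_gmodule_def r_coset_def h_def)
  have add: "h p \<oplus>\<^bsub>?M\<^esub> h q = h (p + q)" for p q
  proof -
    have "h p \<oplus>\<^bsub>?M\<^esub> h q = {x + y | x y. x \<in> h p \<and> y \<in> h q}"
      by (auto simp: quot_gmodule_def set_add_def set_mult_def ring_gmodule_def)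
    also have "\<dots> = h (p + q)"
    proof (intro equalityI subsetI)
      fix z assume "z \<in> {x + y | x y. x \<in> h p \<and> y \<in> h q}"
      then obtain s t where st: "s \<in> J" "t \<in> J" "z = (s + p) + (t + q)" by (auto simp: h_def)
      then have "z = (s + t) + (p + q)" by simp
      then show "z \<in> h (p + q)" unfolding h_def using subspace_add[OF sub st(1,2)] by blast
    next
      fix z assume "z \<in> h (p + q)"
      then obtain s where "s \<in> J" "z = (s + p) + (0 + q)" by (auto simp: h_def add_ac)
      then show "z \<in> {x + y | x y. x \<in> h p \<and> y \<in> h q}" unfolding h_def using subspace_0[OF sub] by blast
    qed
    finally show ?thesis .
  qed
  have zero: "\<zero>\<^bsub>?M\<^esub> = h 0" by (simp add: quot_gmodule_def h_def)
  have smult: "c \<odot>\<^bsub>?M\<^esub> h p = h (c * p)" for c p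
  proof -
    have "c \<odot>\<^bsub>?M\<^esub> h p = (\<Union>a\<in>h p. h (c * a))"
      by (simp add: quot_gmodule_def coset) (simp add: ring_gmodule_def)
    also have "\<dots> = (\<Union>a\<in>h p. h (c * p))"
    proof (rule SUP_cong)
      fix a assume "a \<in> h p"
      then have "c * a - c * p \<in> J" using idealD(3)[OF J] by (auto simp: distrib_left h_def)
      then show "h (c * a) = h (c * p)" by (simp only: h_eq)
    qed simp
    also have "\<dots> = h (c * p)"
    proof -
      have "h p \<noteq> {}" using subspace_0[OF sub] by (auto simp: h_def)
      then show ?thesis by simp
    qed
    finally show ?thesis .
  qed
  have "hilbert_function ?M k + dim (J \<inter> forms k) = dim (forms k :: 'x mpoly set)"
  proof (rule hilbert_function_transfer[where h = h, OF _ subspace_forms findim_forms])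
    show "abelian_monoid ?M"
    proof (rule abelian_monoidI)
      show "\<zero>\<^bsub>?M\<^esub> \<in> carrier ?M" unfolding zero carrier by (rule rangeI)
    next
      fix x y z assume "x \<in> carrier ?M" "y \<in> carrier ?M" "z \<in> carrier ?M"
      then obtain p q r where "x = h p" "y = h q" "z = h r" unfolding carrier by blast
      then show "(x \<oplus>\<^bsub>?M\<^esub> y) \<oplus>\<^bsub>?M\<^esub> z = x \<oplus>\<^bsub>?M\<^esub> (y \<oplus>\<^bsub>?M\<^esub> z)"
        by (simp only: add add.assoc)
    next
      fix x y assume "x \<in> carrier ?M" "y \<in> carrier ?M"
      then obtain p q where xy: "x = h p" "y = h q" unfolding carrier by blast
      show "x \<oplus>\<^bsub>?M\<^esub> y \<in> carrier ?M" unfolding xy add carrier by (rule rangeI)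
      show "x \<oplus>\<^bsub>?M\<^esub> y = y \<oplus>\<^bsub>?M\<^esub> x" unfolding xy add by (simp only: add.commute)
    next
      fix x assume "x \<in> carrier ?M"
      then obtain p where x: "x = h p" unfolding carrier by blast
      show "\<zero>\<^bsub>?M\<^esub> \<oplus>\<^bsub>?M\<^esub> x = x" unfolding x zero add by simp
    qed
    show "piece ?M k = h ` forms k"
      by (simp add: quot_gmodule_def coset) (simp add: ring_gmodule_def)
    show "h ` forms k \<subseteq> carrier ?M" unfolding carrier by blast
    show "subspace (J \<inter> forms k)" by (rule subspace_ideal_forms[OF J])
    show "h x = h y \<longleftrightarrow> x - y \<in> J \<inter> forms k" if "x \<in> forms k" "y \<in> forms k" for x y
      using h_eq[of x y] subspace_diff[OF subspace_forms that] by simp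
    show "h 0 = \<zero>\<^bsub>?M\<^esub>" by (simp only: zero)
    show "h (x + y) = h x \<oplus>\<^bsub>?M\<^esub> h y" for x y by (simp only: add)
    show "h (c *\<^sub>R x) = mconst c \<odot>\<^bsub>?M\<^esub> h x" for c x by (simp only: smult mconst_mult_scaleR)
  qed blast
  then show ?thesis by (simp add: ideal_codim_def)
qed

section \<open>The image of the spline map\<close>

lemma prod_list_concat: "prod_list (concat xss) = prod_list (map prod_list xss)" for xss :: "'a::monoid_mult list list"
  by (induction xss) auto

lemma prod_list_dvd: "x \<in> set xs \<Longrightarrow> x dvd prod_list xs" for x :: "'a::comm_monoid_mult"
  by (induction xs) auto

lemma prod_list_forms: "prod_list (map lin as) \<in> forms (int (length as))"
  by (induction as) (auto simp: forms_one dest: forms_mult[OF lin_forms])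

lemma unit_at_add: "unit_at i (p + q) = unit_at i p + unit_at i q" for p :: "'a::comm_monoid_add"
  by (auto simp: unit_at_def fun_eq_iff)

lemma unit_at_0 [simp]: "unit_at i 0 = 0"
  by (auto simp: unit_at_def fun_eq_iff)

locale spline_complex =
  fixes P :: "(real ^ 'n) set set"
    and l :: "(real ^ 'n) set \<Rightarrow> 'n option mpoly"
    and bd :: "(real ^ 'n) set \<Rightarrow> (real ^ 'n) set \<Rightarrow> 'n option mpoly"
    and r :: nat
  assumes pc: "polyhedral_complex P" and wf: "wall_forms P l" and bm: "boundary_matrix P bd"
begin

definition nv :: "(real ^ 'n) set \<Rightarrow> real ^ ('n option)" where
  "nv \<tau> = (SOME a. l \<tau> = lin a)"

lemma l_lin:
  assumes "\<tau> \<in> walls P"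
  shows "l \<tau> = lin (nv \<tau>)"
proof -
  have "l \<tau> \<in> forms 1" using wf assms by (auto simp: wall_forms_def)
  then have "\<exists>a. l \<tau> = lin a" by (rule forms_1_lin) blast
  then show ?thesis unfolding nv_def by (rule someI_ex)
qed

sublocale wall_complex P nv
proof
  show "polyhedral_complex P" by (rule pc)
  fix \<tau> assume \<tau>: "\<tau> \<in> walls P"
  have l: "l \<tau> \<noteq> 0" "\<And>x. x \<in> cone_over \<tau> \<Longrightarrow> mpeval (l \<tau>) x = 0" using wf \<tau> by (auto simp: wall_forms_def)
  have "lin (0 :: real ^ 'n option) = 0" by (rule mpoly_eqI) simp
  then show "nv \<tau> \<noteq> 0" using l(1) l_lin[OF \<tau>] by (cases "nv \<tau> = 0") simp_all
  fix x assume "x \<in> \<tau>"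
  then have "lift1 x \<in> cone_over \<tau>" unfolding cone_over_def by (intro hull_inc) blast
  then have "mpeval (l \<tau>) (lift1 x) = 0" by (rule l(2))
  then show "nv \<tau> \<bullet> lift1 x = 0" by (simp only: l_lin[OF \<tau>] mpeval_lin)
qed

abbreviation W where "W \<equiv> interior_walls P"
abbreviation C where "C \<equiv> cells P"

lemma W_walls: "\<tau> \<in> W \<Longrightarrow> \<tau> \<in> walls P"
  by (simp add: interior_walls_def)

lemma finite_W: "finite W"
  by (rule finite_subset[OF _ finite_walls]) (auto simp: interior_walls_def)

lemma W_two_cells:
  assumes "\<tau> \<in> W" "\<sigma> \<in> C" "\<tau> facet_of \<sigma>"
  obtains \<sigma>' where "\<sigma>' \<in> C" "\<sigma>' \<noteq> \<sigma>" "\<tau> facet_of \<sigma>'"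
proof -
  have "card {\<sigma> \<in> C. \<tau> facet_of \<sigma>} = 2" using assms(1) by (simp add: interior_walls_def)
  then have "\<exists>a b. {\<sigma> \<in> C. \<tau> facet_of \<sigma>} = {a, b} \<and> a \<noteq> b" by (simp only: card_2_iff)
  then obtain a b where ab: "{\<sigma> \<in> C. \<tau> facet_of \<sigma>} = {a, b}" "a \<noteq> b" by (elim exE conjE)
  have iff: "\<rho> \<in> C \<and> \<tau> facet_of \<rho> \<longleftrightarrow> \<rho> = a \<or> \<rho> = b" for \<rho> using ab(1) by (simp add: set_eq_iff)
  have "\<sigma> = a \<or> \<sigma> = b" "a \<in> C" "\<tau> facet_of a" "b \<in> C" "\<tau> facet_of b"
    using iff[of \<sigma>] iff[of a] iff[of b] assms by simp_all
  then show thesis using that[of a] that[of b] ab(2) by auto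
qed

lemma W_cell:
  assumes "\<tau> \<in> W"
  obtains \<sigma> where "\<sigma> \<in> C" "\<tau> facet_of \<sigma>"
proof -
  have "card {\<sigma> \<in> C. \<tau> facet_of \<sigma>} = 2" using assms by (simp add: interior_walls_def)
  then have "{\<sigma> \<in> C. \<tau> facet_of \<sigma>} \<noteq> {}" by force
  then show thesis using that by blast
qed

text \<open>The orientation of each row is arbitrary, so only facts shared by both choices are
  kept.\<close>

lemma bd_cases:
  assumes \<tau>: "\<tau> \<in> W" and \<sigma>: "\<sigma> \<in> C"
  shows "\<tau> facet_of \<sigma> \<Longrightarrow> bd \<tau> \<sigma> * bd \<tau> \<sigma> = 1" "\<not> \<tau> facet_of \<sigma> \<Longrightarrow> bd \<tau> \<sigma> = 0"
    "\<tau> facet_of \<sigma> \<Longrightarrow> \<sigma>' \<in> C \<Longrightarrow> \<tau> facet_of \<sigma>' \<Longrightarrow> \<sigma>' \<noteq> \<sigma> \<Longrightarrow> bd \<tau> \<sigma>' = - bd \<tau> \<sigma>"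
    "\<tau> facet_of \<sigma> \<Longrightarrow> bd \<tau> \<sigma> \<in> forms 0"
proof -
  obtain a b where ab: "a \<noteq> b" "{\<rho> \<in> C. \<tau> facet_of \<rho>} = {a, b}" "bd \<tau> a = 1" "bd \<tau> b = - 1"
    "\<forall>\<rho>\<in>C - {a, b}. bd \<tau> \<rho> = 0"
    using bspec[OF bm[unfolded boundary_matrix_def] \<tau>] by (elim exE conjE)
  have c: "\<rho> \<in> C \<Longrightarrow> \<tau> facet_of \<rho> \<Longrightarrow> \<rho> = a \<or> \<rho> = b" for \<rho> using ab(2) by blast
  have m1: "- 1 \<in> forms 0" using subspace_neg[OF subspace_forms forms_one] .
  show "\<tau> facet_of \<sigma> \<Longrightarrow> bd \<tau> \<sigma> * bd \<tau> \<sigma> = 1" using c[OF \<sigma>] ab by auto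
  show "\<tau> facet_of \<sigma> \<Longrightarrow> bd \<tau> \<sigma> \<in> forms 0" using c[OF \<sigma>] ab forms_one m1 by auto
  show "\<not> \<tau> facet_of \<sigma> \<Longrightarrow> bd \<tau> \<sigma> = 0" using ab(2,5) \<sigma> by blast
  show "\<tau> facet_of \<sigma> \<Longrightarrow> \<sigma>' \<in> C \<Longrightarrow> \<tau> facet_of \<sigma>' \<Longrightarrow> \<sigma>' \<noteq> \<sigma> \<Longrightarrow> bd \<tau> \<sigma>' = - bd \<tau> \<sigma>"
    using c[OF \<sigma>] c[of \<sigma>'] ab by auto
qed

lemma bd_forms: "\<tau> \<in> W \<Longrightarrow> \<sigma> \<in> C \<Longrightarrow> bd \<tau> \<sigma> \<in> forms 0"
  using bd_cases(2,4) by (cases "\<tau> facet_of \<sigma>") auto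

definition bdmap :: "((real ^ 'n) set \<Rightarrow> 'n option mpoly) \<Rightarrow> (real ^ 'n) set \<Rightarrow> 'n option mpoly" where
  "bdmap f = (\<lambda>\<tau>. if \<tau> \<in> W then \<Sum>\<sigma>\<in>C. bd \<tau> \<sigma> * f \<sigma> else 0)"

lemma bdmap_wall:
  assumes \<tau>: "\<tau> \<in> W" and \<sigma>: "\<sigma> \<in> C" "\<sigma>' \<in> C" "\<sigma> \<noteq> \<sigma>'" "\<tau> facet_of \<sigma>" "\<tau> facet_of \<sigma>'"
  shows "bdmap f \<tau> = bd \<tau> \<sigma> * (f \<sigma> - f \<sigma>')"
proof -
  have cells: "{\<rho> \<in> C. \<tau> facet_of \<rho>} = {\<sigma>, \<sigma>'}" using interior_wall_iff[OF \<sigma>] by simp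
  have "bdmap f \<tau> = (\<Sum>\<rho>\<in>C. bd \<tau> \<rho> * f \<rho>)" using \<tau> by (simp add: bdmap_def)
  also have "\<dots> = (\<Sum>\<rho>\<in>{\<sigma>, \<sigma>'}. bd \<tau> \<rho> * f \<rho>)"
  proof (rule sum.mono_neutral_right[OF finite_cells])
    show "{\<sigma>, \<sigma>'} \<subseteq> C" using \<sigma> by simp
    show "\<forall>\<rho>\<in>C - {\<sigma>, \<sigma>'}. bd \<tau> \<rho> * f \<rho> = 0"
    proof
      fix \<rho> assume \<rho>: "\<rho> \<in> C - {\<sigma>, \<sigma>'}"
      then have "\<not> \<tau> facet_of \<rho>" using cells by blast
      then show "bd \<tau> \<rho> * f \<rho> = 0" using bd_cases(2)[OF \<tau>, of \<rho>] \<rho> by simp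
    qed
  qed
  also have "\<dots> = bd \<tau> \<sigma> * f \<sigma> + bd \<tau> \<sigma>' * f \<sigma>'" using \<sigma>(3) by simp
  also have "bd \<tau> \<sigma>' = - bd \<tau> \<sigma>"
    by (rule bd_cases(3)[OF \<tau> \<sigma>(1) \<sigma>(4) \<sigma>(2) \<sigma>(5)]) (use \<sigma>(3) in simp)
  finally show ?thesis by (simp add: right_diff_distrib)
qed

definition dmap :: "((real ^ 'n) set \<Rightarrow> 'n option mpoly) \<Rightarrow> (real ^ 'n) set \<Rightarrow> 'n option mpoly" where
  "dmap g = (\<lambda>\<tau>. if \<tau> \<in> W then l \<tau> ^ (r + 1) * g \<tau> else 0)"

abbreviation free :: "'i set \<Rightarrow> ('i \<Rightarrow> 'n option mpoly) set" where
  "free I \<equiv> prod_space I (\<lambda>_. UNIV)"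

lemma carrier_free: "carrier (free_gmodule I) = free I"
  by (simp add: free_gmodule_def prod_space_def)

text \<open>The image of \<phi>, written as the image of \<open>D\<close> plus that of the boundary
  map in the form needed by \<open>dim_add_image\<close>; \<open>N\<close> is the quotient by
  it.\<close>

definition S :: "((real ^ 'n) set \<Rightarrow> 'n option mpoly) set" where
  "S = {s + bdmap f | s f. s \<in> dmap ` free W \<and> f \<in> free C}"

lemma S_iff: "F \<in> S \<longleftrightarrow> (\<exists>f g. f \<in> free C \<and> g \<in> free W \<and> F = dmap g + bdmap f)"
  unfolding S_def by (simp only: mem_Collect_eq image_iff) metis

lemma S_intro: "f \<in> free C \<Longrightarrow> g \<in> free W \<Longrightarrow> dmap g + bdmap f \<in> S"
  unfolding S_iff by (intro exI conjI) (assumption | rule refl)+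

lemma spline_map_image: "spline_map P l bd r ` (carrier (free_gmodule C) \<times> carrier (free_gmodule W)) = S"
proof -
  have m: "spline_map P l bd r (f, g) = dmap g + bdmap f" for f g
    by (simp add: spline_map_def dmap_def bdmap_def fun_eq_iff)
  show ?thesis
  proof (intro equalityI subsetI)
    fix F assume "F \<in> spline_map P l bd r ` (carrier (free_gmodule C) \<times> carrier (free_gmodule W))"
    then show "F \<in> S" unfolding carrier_free by (elim imageE SigmaE) (simp only: m S_intro)
  next
    fix F assume "F \<in> S"
    then obtain f g where fg: "f \<in> free C" "g \<in> free W" "F = dmap g + bdmap f" unfolding S_iff by (elim exE conjE)
    show "F \<in> spline_map P l bd r ` (carrier (free_gmodule C) \<times> carrier (free_gmodule W))"
      unfolding carrier_free by (rule image_eqI[of _ _ "(f, g)"]) (simp_all only: fg m mem_Sigma_iff simp_thms)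
  qed
qed

lemma linear_bdmap: "linear bdmap"
  by (rule linearI)
    (auto simp: bdmap_def fun_eq_iff sum.distrib distrib_left mconst_mult_scaleR[symmetric] sum_distrib_left mult_ac)

lemma linear_dmap: "linear dmap"
  by (rule linearI)
    (auto simp: dmap_def fun_eq_iff distrib_left mconst_mult_scaleR[symmetric] mult_ac)

lemma subspace_S: "subspace S"
  unfolding S_def
  by (intro subspace_add_image linear_bdmap linear_subspace_image linear_dmap subspace_prod_space) auto

lemma pmul_free: "f \<in> free I \<Longrightarrow> pmul p f \<in> free I"
  by (auto simp: prod_space_def)

lemma S_pmul:
  assumes "F \<in> S"
  shows "pmul p F \<in> S"
proof -
  obtain f g where fg: "f \<in> free C" "g \<in> free W" "F = dmap g + bdmap f" using assms unfolding S_iff by (elim exE conjE)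
  have "pmul p F = dmap (pmul p g) + bdmap (pmul p f)"
    unfolding fg(3) by (simp add: fun_eq_iff dmap_def bdmap_def distrib_left sum_distrib_left mult_ac)
  then show ?thesis using S_intro[OF pmul_free[OF fg(1)] pmul_free[OF fg(2)]] by (simp only:)
qed

lemma S_dmap: "g \<in> free W \<Longrightarrow> dmap g \<in> S"
  using S_intro[of 0 g] by (simp add: linear_0[OF linear_bdmap] prod_space_def)

lemma S_bdmap: "f \<in> free C \<Longrightarrow> bdmap f \<in> S"
  using S_intro[of f 0] by (simp add: linear_0[OF linear_dmap] prod_space_def)

lemma unit_at_free: "i \<in> I \<Longrightarrow> unit_at i p \<in> free I"
  by (auto simp: prod_space_def unit_at_def)

lemma S_wall:
  assumes "\<tau> \<in> W"
  shows "unit_at \<tau> (l \<tau> ^ (r + 1) * p) \<in> S"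
proof -
  have "dmap (unit_at \<tau> p) = unit_at \<tau> (l \<tau> ^ (r + 1) * p)"
    using assms by (auto simp: dmap_def unit_at_def fun_eq_iff)
  then show ?thesis using S_dmap[OF unit_at_free[OF assms, of p]] by simp
qed

lemma S_cell:
  assumes "\<sigma> \<in> C"
  shows "(\<Sum>\<tau>\<in>W. unit_at \<tau> (bd \<tau> \<sigma> * p)) \<in> S"
proof -
  have "bdmap (unit_at \<sigma> p) \<tau>' = (\<Sum>\<tau>\<in>W. unit_at \<tau> (bd \<tau> \<sigma> * p)) \<tau>'" for \<tau>'
  proof (cases "\<tau>' \<in> W")
    case True
    have "(\<Sum>\<rho>\<in>C. bd \<tau>' \<rho> * unit_at \<sigma> p \<rho>) = (\<Sum>\<rho>\<in>C. if \<rho> = \<sigma> then bd \<tau>' \<sigma> * p else 0)"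
      by (intro sum.cong) (auto simp: unit_at_def)
    also have "\<dots> = bd \<tau>' \<sigma> * p" using assms finite_cells by simp
    finally have 1: "bdmap (unit_at \<sigma> p) \<tau>' = bd \<tau>' \<sigma> * p" using True by (simp add: bdmap_def)
    have "(\<Sum>\<tau>\<in>W. unit_at \<tau> (bd \<tau> \<sigma> * p)) \<tau>' = (\<Sum>\<tau>\<in>W. if \<tau> = \<tau>' then bd \<tau>' \<sigma> * p else 0)"
      unfolding sum_fun_apply by (intro sum.cong) (auto simp: unit_at_def)
    also have "\<dots> = bd \<tau>' \<sigma> * p" using True finite_W by simp
    finally show ?thesis using 1 by simp
  next
    case False
    then have "(\<Sum>\<tau>\<in>W. unit_at \<tau> (bd \<tau> \<sigma> * p)) \<tau>' = 0"
      unfolding sum_fun_apply by (intro sum.neutral) (auto simp: unit_at_def)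
    then show ?thesis using False by (simp add: bdmap_def)
  qed
  then have "bdmap (unit_at \<sigma> p) = (\<Sum>\<tau>\<in>W. unit_at \<tau> (bd \<tau> \<sigma> * p))" by (rule ext)
  then show ?thesis using S_bdmap[OF unit_at_free[OF assms, of p]] by simp
qed

definition thr :: "(real ^ 'n option) set \<Rightarrow> (real ^ 'n) set \<Rightarrow> bool" where
  "thr \<xi> \<tau> \<longleftrightarrow> \<xi> \<subseteq> zero_locus {l \<tau>}"

lemma zero_locus_wall: "\<tau> \<in> walls P \<Longrightarrow> zero_locus {l \<tau>} = {y. nv \<tau> \<bullet> y = 0}"
  by (simp add: zero_locus_def l_lin)

lemma thr_flat: "\<tau> \<in> walls P \<Longrightarrow> thr (flat A) \<tau> \<longleftrightarrow> nv \<tau> \<in> span A"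
  by (simp add: thr_def zero_locus_wall in_span_iff_flat)

text \<open>The product of the forms \<open>l \<tau> ^ (r + 1)\<close> over the interior walls whose span misses \<open>\<xi>\<close>: multiplication
  by it is an elementary substitute for localization at the ideal of \<open>\<xi>\<close>. It is kept as a list of
  normal vectors.\<close>

definition wall_list :: "(real ^ 'n) set list" where
  "wall_list = (SOME xs. set xs = W)"

definition missing :: "(real ^ 'n option) set \<Rightarrow> (real ^ 'n option) list" where
  "missing \<xi> = concat (map (\<lambda>\<tau>. replicate (Suc r) (nv \<tau>)) (filter (\<lambda>\<tau>. \<not> thr \<xi> \<tau>) wall_list))"

definition sfac :: "(real ^ 'n option) set \<Rightarrow> 'n option mpoly" where
  "sfac \<xi> = prod_list (map lin (missing \<xi>))"

lemma set_wall_list: "set wall_list = W"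
  unfolding wall_list_def by (rule someI_ex) (rule finite_list[OF finite_W])

lemma set_missing: "set (missing \<xi>) = nv ` {\<tau> \<in> W. \<not> thr \<xi> \<tau>}"
  by (auto simp: missing_def set_wall_list)

lemma sfac_forms: "sfac \<xi> \<in> forms (int (length (missing \<xi>)))"
  unfolding sfac_def by (rule prod_list_forms)

lemma sfac_dvd:
  assumes "\<tau> \<in> W" "\<not> thr \<xi> \<tau>"
  shows "l \<tau> ^ (r + 1) dvd sfac \<xi>"
proof -
  have rep: "prod_list (map lin (replicate k (nv \<tau>))) = lin (nv \<tau>) ^ k" for k and \<tau> by (induction k) auto
  have "sfac \<xi> = prod_list (map (\<lambda>\<tau>. lin (nv \<tau>) ^ Suc r) (filter (\<lambda>\<tau>. \<not> thr \<xi> \<tau>) wall_list))"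
    unfolding sfac_def missing_def map_concat prod_list_concat map_map o_def rep ..
  moreover have "lin (nv \<tau>) ^ Suc r \<in> set (map (\<lambda>\<tau>. lin (nv \<tau>) ^ Suc r) (filter (\<lambda>\<tau>. \<not> thr \<xi> \<tau>) wall_list))"
    using assms by (auto simp: set_wall_list)
  ultimately show ?thesis using prod_list_dvd l_lin[OF W_walls[OF assms(1)]] by (metis Suc_eq_plus1)
qed

text \<open>A prime containing a product contains a factor, and none of the factors vanishes on all
  of \<xi>.\<close>

lemma sfac_not_van:
  assumes "subspace \<xi>"
  shows "sfac \<xi> \<notin> van \<xi>"
proof
  assume "sfac \<xi> \<in> van \<xi>"
  then have "\<exists>p\<in>set (map lin (missing \<xi>)). p \<in> van \<xi>"
    unfolding sfac_def by (rule prime_prod_list[OF primeideal_van[OF assms]])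
  then obtain \<tau> where \<tau>: "\<tau> \<in> W" "\<not> thr \<xi> \<tau>" "lin (nv \<tau>) \<in> van \<xi>" by (auto simp: set_missing)
  then show False using zero_locus_wall[OF W_walls[OF \<tau>(1)]] by (auto simp: thr_def van_def)
qed

lemma S_sfac:
  assumes "\<tau> \<in> W" "\<not> thr \<xi> \<tau>"
  shows "unit_at \<tau> (sfac \<xi> * p) \<in> S"
proof -
  obtain q where "sfac \<xi> = l \<tau> ^ (r + 1) * q" using sfac_dvd[OF assms] by (auto elim: dvdE)
  then have "unit_at \<tau> (sfac \<xi> * p) = unit_at \<tau> (l \<tau> ^ (r + 1) * (q * p))" by (simp only: mult.assoc)
  then show ?thesis using S_wall[OF assms(1), of "q * p"] by (simp only:)
qed

definition T :: "(real ^ 'n option) set \<Rightarrow> (real ^ 'n) set \<Rightarrow> (real ^ 'n) set set" where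
  "T \<xi> \<sigma> = {\<tau> \<in> W. \<tau> facet_of \<sigma> \<and> thr \<xi> \<tau>}"

text \<open>This is the column of \<sigma> multiplied by \<open>sfac \<xi>\<close>. The rows of
  interior walls whose span does not contain \<xi> may be dropped, because \<open>sfac \<xi>\<close>
  kills them in \<open>N\<close>.\<close>

lemma S_relation:
  assumes \<sigma>: "\<sigma> \<in> C"
  shows "(\<Sum>\<tau>\<in>T \<xi> \<sigma>. unit_at \<tau> (sfac \<xi> * (bd \<tau> \<sigma> * p))) \<in> S"
proof -
  let ?f = "\<lambda>\<tau>. unit_at \<tau> (sfac \<xi> * (bd \<tau> \<sigma> * p))"
  have "(\<Sum>\<tau>\<in>W. ?f \<tau>) = (\<Sum>\<tau>\<in>W. unit_at \<tau> (bd \<tau> \<sigma> * (sfac \<xi> * p)))"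
    by (intro sum.cong refl) (simp add: mult_ac)
  then have all: "(\<Sum>\<tau>\<in>W. ?f \<tau>) \<in> S" using S_cell[OF \<sigma>, of "sfac \<xi> * p"] by (simp only:)
  have rest: "(\<Sum>\<tau>\<in>W - T \<xi> \<sigma>. ?f \<tau>) \<in> S"
  proof (rule subspace_sum[OF subspace_S])
    fix \<tau> assume \<tau>: "\<tau> \<in> W - T \<xi> \<sigma>"
    show "?f \<tau> \<in> S"
    proof (cases "\<tau> facet_of \<sigma>")
      case True
      then have "\<not> thr \<xi> \<tau>" using \<tau> by (auto simp: T_def)
      then show ?thesis using S_sfac \<tau> by blast
    next
      case False
      then show ?thesis using bd_cases(2)[OF _ \<sigma>] \<tau> subspace_0[OF subspace_S] by simp
    qed
  qed
  have "T \<xi> \<sigma> \<subseteq> W" by (auto simp: T_def)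
  then have "(\<Sum>\<tau>\<in>T \<xi> \<sigma>. ?f \<tau>) = (\<Sum>\<tau>\<in>W. ?f \<tau>) - (\<Sum>\<tau>\<in>W - T \<xi> \<sigma>. ?f \<tau>)"
    by (simp add: sum.subset_diff[OF _ finite_W])
  then show ?thesis using subspace_diff[OF subspace_S all rest] by (simp only:)
qed

text \<open>Witnesses that the row of \<tau> becomes zero in the localization of \<open>N\<close> at
  the ideal of \<xi>, with \<open>sfac \<xi>\<close> as explicit denominator.\<close>

definition dead :: "(real ^ 'n option) set \<Rightarrow> (real ^ 'n) set \<Rightarrow> bool" where
  "dead \<xi> \<tau> \<longleftrightarrow> (\<forall>p. unit_at \<tau> (sfac \<xi> * p) \<in> S)"

text \<open>Equality of two rows near \<xi> up to a sign. The sign is a degree zero polynomial of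
  square one because the entries of \<open>bd\<close> are polynomials.\<close>

definition linked :: "(real ^ 'n option) set \<Rightarrow> (real ^ 'n) set \<Rightarrow> (real ^ 'n) set \<Rightarrow> bool" where
  "linked \<xi> \<tau> \<tau>' \<longleftrightarrow> (\<exists>c. c \<in> forms 0 \<and> c * c = 1 \<and> (\<forall>p. unit_at \<tau>' (sfac \<xi> * p) - unit_at \<tau> (sfac \<xi> * (c * p)) \<in> S))"

text \<open>The column of \<sigma> has a single surviving entry, and this entry is its own
  inverse.\<close>

lemma T_single_dead:
  assumes \<sigma>: "\<sigma> \<in> C" and T: "T \<xi> \<sigma> = {\<tau>}"
  shows "dead \<xi> \<tau>"
  unfolding dead_def
proof
  fix p
  have \<tau>: "\<tau> \<in> W" "\<tau> facet_of \<sigma>" using T by (auto simp: T_def)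
  have "unit_at \<tau> (sfac \<xi> * (bd \<tau> \<sigma> * (bd \<tau> \<sigma> * p))) \<in> S"
    using S_relation[OF \<sigma>, of \<xi> "bd \<tau> \<sigma> * p"] by (simp add: T)
  moreover have "bd \<tau> \<sigma> * (bd \<tau> \<sigma> * p) = p" using bd_cases(1)[OF \<tau>(1) \<sigma> \<tau>(2)] by (metis mult.assoc mult_1)
  ultimately show "unit_at \<tau> (sfac \<xi> * p) \<in> S" by simp
qed

lemma linked_refl: "linked \<xi> \<tau> \<tau>"
  unfolding linked_def by (rule exI[of _ 1]) (simp add: forms_one subspace_0[OF subspace_S])

lemma linked_trans:
  assumes "linked \<xi> \<tau> \<tau>'" "linked \<xi> \<tau>' \<tau>''"
  shows "linked \<xi> \<tau> \<tau>''"
proof -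
  obtain c where c: "c \<in> forms 0" "c * c = 1" "\<And>p. unit_at \<tau>' (sfac \<xi> * p) - unit_at \<tau> (sfac \<xi> * (c * p)) \<in> S"
    using assms(1) by (auto simp: linked_def)
  obtain c' where c': "c' \<in> forms 0" "c' * c' = 1" "\<And>p. unit_at \<tau>'' (sfac \<xi> * p) - unit_at \<tau>' (sfac \<xi> * (c' * p)) \<in> S"
    using assms(2) by (auto simp: linked_def)
  have "unit_at \<tau>'' (sfac \<xi> * p) - unit_at \<tau> (sfac \<xi> * ((c * c') * p)) \<in> S" for p
  proof -
    have "(unit_at \<tau>'' (sfac \<xi> * p) - unit_at \<tau>' (sfac \<xi> * (c' * p)))
       + (unit_at \<tau>' (sfac \<xi> * (c' * p)) - unit_at \<tau> (sfac \<xi> * (c * (c' * p)))) \<in> S"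
      by (rule subspace_add[OF subspace_S c'(3) c(3)])
    then show ?thesis by (simp add: mult.assoc)
  qed
  moreover have "c * c' \<in> forms 0" using forms_mult[OF c(1) c'(1)] by simp
  moreover have "(c * c') * (c * c') = 1"
  proof -
    have "(c * c') * (c * c') = (c * c) * (c' * c')" by (simp only: mult_ac)
    then show ?thesis by (simp add: c(2) c'(2))
  qed
  ultimately show ?thesis unfolding linked_def by blast
qed

lemma dead_linked: "dead \<xi> \<tau> \<Longrightarrow> linked \<xi> \<tau> \<tau>' \<Longrightarrow> dead \<xi> \<tau>'"
  unfolding dead_def linked_def
proof (elim exE conjE, rule allI)
  fix c p assume d: "\<forall>p. unit_at \<tau> (sfac \<xi> * p) \<in> S"
    and c: "\<forall>p. unit_at \<tau>' (sfac \<xi> * p) - unit_at \<tau> (sfac \<xi> * (c * p)) \<in> S"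
  show "unit_at \<tau>' (sfac \<xi> * p) \<in> S"
    using subspace_add[OF subspace_S c[rule_format, of p] d[rule_format, of "c * p"]] by simp
qed

text \<open>When the walls differ, the column of \<sigma> has two surviving entries of square one;
  solving for one row yields minus their product as the sign.\<close>

lemma T_pair_linked:
  assumes \<sigma>: "\<sigma> \<in> C" and T: "T \<xi> \<sigma> = {\<tau>, \<tau>'}"
  shows "linked \<xi> \<tau> \<tau>'"
proof (cases "\<tau> = \<tau>'")
  case True
  then show ?thesis using linked_refl by simp
next
  case False
  have t: "\<tau> \<in> W" "\<tau> facet_of \<sigma>" "\<tau>' \<in> W" "\<tau>' facet_of \<sigma>" using T by (auto simp: T_def)
  define c where "c = - (bd \<tau> \<sigma> * bd \<tau>' \<sigma>)"
  have "unit_at \<tau>' (sfac \<xi> * p) - unit_at \<tau> (sfac \<xi> * (c * p)) \<in> S" for p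
  proof -
    have "unit_at \<tau> (sfac \<xi> * (bd \<tau> \<sigma> * (bd \<tau>' \<sigma> * p))) + unit_at \<tau>' (sfac \<xi> * (bd \<tau>' \<sigma> * (bd \<tau>' \<sigma> * p))) \<in> S"
      using S_relation[OF \<sigma>, of \<xi> "bd \<tau>' \<sigma> * p"] False by (simp add: T)
    moreover have "bd \<tau>' \<sigma> * (bd \<tau>' \<sigma> * p) = p"
      using bd_cases(1)[OF t(3) \<sigma> t(4)] by (metis mult.assoc mult_1)
    moreover have "unit_at \<tau> (sfac \<xi> * (bd \<tau> \<sigma> * (bd \<tau>' \<sigma> * p))) = - unit_at \<tau> (sfac \<xi> * (c * p))"
      by (auto simp: c_def unit_at_def fun_eq_iff mult_ac)
    ultimately show ?thesis by simp
  qed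
  moreover have "c * c = 1"
  proof -
    have "c * c = (bd \<tau> \<sigma> * bd \<tau> \<sigma>) * (bd \<tau>' \<sigma> * bd \<tau>' \<sigma>)" by (simp add: c_def mult_ac)
    then show ?thesis using bd_cases(1)[OF t(1) \<sigma> t(2)] bd_cases(1)[OF t(3) \<sigma> t(4)] by simp
  qed
  moreover have "c \<in> forms 0"
    unfolding c_def using forms_mult[OF bd_forms[OF t(1) \<sigma>] bd_forms[OF t(3) \<sigma>]] subspace_neg[OF subspace_forms] by simp
  ultimately show ?thesis unfolding linked_def by blast
qed

lemma dead_missing: "\<tau> \<in> W \<Longrightarrow> \<not> thr \<xi> \<tau> \<Longrightarrow> dead \<xi> \<tau>"
  unfolding dead_def using S_sfac by blast

text \<open>No hyperplane contains the whole space, so \<open>sfac\<close> has a factor for every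
  interior wall: \<open>N\<close> vanishes generically.\<close>

lemma dead_UNIV:
  assumes "\<tau> \<in> W"
  shows "dead UNIV \<tau>"
proof (rule dead_missing[OF assms])
  have "nv \<tau> \<notin> {y. nv \<tau> \<bullet> y = 0}" using normal[OF W_walls[OF assms]] by simp
  then show "\<not> thr UNIV \<tau>" unfolding thr_def zero_locus_wall[OF W_walls[OF assms]] by blast
qed

text \<open>A cell has at most one facet in a given hyperplane, so its column leaves a single row
  there. Thus \<open>N\<close> also vanishes near a general point of a wall hyperplane.\<close>

lemma dead_hyperplane:
  assumes \<tau>1: "\<tau>1 \<in> W" and \<tau>: "\<tau> \<in> W"
  shows "dead (flat {nv \<tau>1}) \<tau>"
proof (cases "thr (flat {nv \<tau>1}) \<tau>")
  case True
  obtain \<sigma> where \<sigma>: "\<sigma> \<in> C" "\<tau> facet_of \<sigma>" using W_cell[OF \<tau>] .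
  have "nv \<tau> \<in> span {nv \<tau>1}" using True thr_flat[OF W_walls[OF \<tau>]] by simp
  then obtain k where k: "nv \<tau> = k *\<^sub>R nv \<tau>1" by (auto simp: span_singleton)
  then have "k \<noteq> 0" using normal[OF W_walls[OF \<tau>]] by auto
  then have k': "nv \<tau>1 = (1 / k) *\<^sub>R nv \<tau>" using k by simp
  have "T (flat {nv \<tau>1}) \<sigma> = {\<tau>}"
  proof (intro equalityI subsetI)
    fix \<tau>' assume t': "\<tau>' \<in> T (flat {nv \<tau>1}) \<sigma>"
    then have "nv \<tau>' \<in> span {nv \<tau>1}" using thr_flat[OF W_walls] by (auto simp: T_def)
    then obtain k'' where "nv \<tau>' = k'' *\<^sub>R nv \<tau>1" by (auto simp: span_singleton)
    then have "nv \<tau>' = (k'' * (1 / k)) *\<^sub>R nv \<tau>" using k' by simp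
    then have "nv \<tau>' \<in> span {nv \<tau>}" unfolding span_singleton by blast
    then show "\<tau>' \<in> {\<tau>}" using facet_in_hyperplane_unique[OF \<sigma>(1,2)] t' by (auto simp: T_def)
  qed (use True \<tau> \<sigma> in \<open>auto simp: T_def\<close>)
  then show ?thesis by (rule T_single_dead[OF \<sigma>(1)])
qed (rule dead_missing[OF \<tau>])

section \<open>Walls through a subspace of codimension two\<close>

abbreviation G where "G \<xi> \<equiv> span_graph P l \<xi>"

lemma G_edge:
  "e \<in> snd (G \<xi>) \<longleftrightarrow> (\<exists>\<sigma> \<sigma>' \<tau>. e = {\<sigma>, \<sigma>'} \<and> \<sigma> \<in> C \<and> \<sigma>' \<in> C \<and> \<sigma> \<noteq> \<sigma>' \<and> \<tau> facet_of \<sigma> \<and> \<tau> facet_of \<sigma>' \<and> thr \<xi> \<tau>)"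
proof -
  have w: "\<sigma> \<in> C \<Longrightarrow> (\<exists>\<tau>\<in>walls P. \<tau> facet_of \<sigma> \<and> \<tau> facet_of \<sigma>' \<and> thr \<xi> \<tau>) \<longleftrightarrow> (\<exists>\<tau>. \<tau> facet_of \<sigma> \<and> \<tau> facet_of \<sigma>' \<and> thr \<xi> \<tau>)" for \<sigma> \<sigma>'
    using facet_wall[of \<sigma>] by fast
  show ?thesis
    unfolding span_graph_def thr_def[symmetric] snd_conv mem_Collect_eq using w by fast
qed

lemma G_vertex: "\<sigma> \<in> fst (G \<xi>) \<longleftrightarrow> \<sigma> \<in> C \<and> (\<exists>\<tau>. \<tau> facet_of \<sigma> \<and> thr \<xi> \<tau>)"
proof -
  have w: "\<sigma> \<in> C \<Longrightarrow> (\<exists>\<tau>\<in>walls P. \<tau> facet_of \<sigma> \<and> thr \<xi> \<tau>) \<longleftrightarrow> (\<exists>\<tau>. \<tau> facet_of \<sigma> \<and> thr \<xi> \<tau>)"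
    using facet_wall[of \<sigma>] by fast
  show ?thesis
    unfolding span_graph_def thr_def[symmetric] fst_conv mem_Collect_eq using w by fast
qed

lemma G_edge_wall:
  assumes "{\<sigma>, \<sigma>'} \<in> snd (G \<xi>)"
  shows "\<sigma> \<in> C" "\<sigma>' \<in> C" "\<sigma> \<noteq> \<sigma>'" "\<sigma> \<inter> \<sigma>' \<in> W" "\<sigma> \<inter> \<sigma>' facet_of \<sigma>" "\<sigma> \<inter> \<sigma>' facet_of \<sigma>'" "thr \<xi> (\<sigma> \<inter> \<sigma>')"
    "{\<rho> \<in> C. \<sigma> \<inter> \<sigma>' facet_of \<rho>} = {\<sigma>, \<sigma>'}"
proof -
  obtain a b \<tau> where ab: "{\<sigma>, \<sigma>'} = {a, b}" "a \<in> C" "b \<in> C" "a \<noteq> b" "\<tau> facet_of a" "\<tau> facet_of b" "thr \<xi> \<tau>"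
    using assms unfolding G_edge by (elim exE conjE)
  then have \<sigma>: "\<sigma> \<in> C" "\<sigma>' \<in> C" "\<sigma> \<noteq> \<sigma>'" "\<tau> facet_of \<sigma>" "\<tau> facet_of \<sigma>'" by (auto simp: doubleton_eq_iff)
  have "\<tau> = \<sigma> \<inter> \<sigma>'" by (rule common_wall_unique[OF \<sigma>])
  then show "\<sigma> \<in> C" "\<sigma>' \<in> C" "\<sigma> \<noteq> \<sigma>'" "\<sigma> \<inter> \<sigma>' \<in> W" "\<sigma> \<inter> \<sigma>' facet_of \<sigma>" "\<sigma> \<inter> \<sigma>' facet_of \<sigma>'" "thr \<xi> (\<sigma> \<inter> \<sigma>')"
    "{\<rho> \<in> C. \<sigma> \<inter> \<sigma>' facet_of \<rho>} = {\<sigma>, \<sigma>'}"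
    using \<sigma> ab(7) interior_wall_iff[OF \<sigma>] by simp_all
qed

lemma G_edge_ends:
  assumes "e \<in> snd (G \<xi>)"
  shows "\<exists>a b. e = {a, b} \<and> a \<noteq> b \<and> a \<in> C \<and> b \<in> C \<and> a \<in> fst (G \<xi>) \<and> b \<in> fst (G \<xi>)"
proof -
  obtain a b \<tau> where e: "e = {a, b}" "a \<in> C" "b \<in> C" "a \<noteq> b" "\<tau> facet_of a" "\<tau> facet_of b" "thr \<xi> \<tau>"
    using assms unfolding G_edge by (elim exE conjE)
  have "a \<in> fst (G \<xi>)" "b \<in> fst (G \<xi>)" unfolding G_vertex using e(2,3,5-7) by fast+
  then show ?thesis using e(1-4) by (intro exI[of _ a] exI[of _ b]) simp
qed

text \<open>An edge at \<sigma> is determined by the common facet, which is the intersection of its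
  two ends, and at most two facets of \<sigma> have normals in the span of \<open>u\<close> and
  \<open>v\<close>.\<close>

lemma degree2_G: "degree2_graph (fst (G (flat {u, v}))) (snd (G (flat {u, v})))"
proof
  let ?\<xi> = "flat {u, v}"
  show "finite (fst (G ?\<xi>))" by (rule finite_subset[OF _ finite_cells]) (simp add: subset_iff G_vertex)
  show "\<exists>a b. e = {a, b} \<and> a \<noteq> b \<and> a \<in> fst (G ?\<xi>) \<and> b \<in> fst (G ?\<xi>)" if "e \<in> snd (G ?\<xi>)" for e
    using G_edge_ends[OF that] by (elim exE conjE) (intro exI conjI)
  fix \<sigma>
  show "card {e \<in> snd (G ?\<xi>). \<sigma> \<in> e} \<le> 2"
  proof (cases "\<sigma> \<in> C")
    case False
    have "\<sigma> \<notin> e" if "e \<in> snd (G ?\<xi>)" for e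
      using G_edge_ends[OF that] False by (elim exE conjE) (simp, metis)
    then have "{e \<in> snd (G ?\<xi>). \<sigma> \<in> e} = {}" by blast
    then show ?thesis by (simp only: card.empty)
  next
    case True
    have edge: "\<exists>\<sigma>'. e = {\<sigma>, \<sigma>'}" if e: "e \<in> snd (G ?\<xi>)" "\<sigma> \<in> e" for e
    proof -
      obtain a b where ab: "e = {a, b}" using G_edge_ends[OF e(1)] by (elim exE conjE)
      then have "\<sigma> = a \<or> \<sigma> = b" using e(2) by simp
      then show ?thesis using ab insert_commute[of a b "{}"] by metis
    qed
    let ?F = "{\<tau> \<in> walls P. \<tau> facet_of \<sigma> \<and> nv \<tau> \<in> span {u, v}}"
    have "inj_on (\<lambda>e. \<Inter>e) {e \<in> snd (G ?\<xi>). \<sigma> \<in> e}"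
    proof (rule inj_onI)
      fix e e' assume "e \<in> {e \<in> snd (G ?\<xi>). \<sigma> \<in> e}" "e' \<in> {e \<in> snd (G ?\<xi>). \<sigma> \<in> e}" and eq: "\<Inter>e = \<Inter>e'"
      then have e: "e \<in> snd (G ?\<xi>)" "\<sigma> \<in> e" "e' \<in> snd (G ?\<xi>)" "\<sigma> \<in> e'" by simp_all
      obtain a where a: "e = {\<sigma>, a}" using edge[OF e(1,2)] by (elim exE)
      obtain b where b: "e' = {\<sigma>, b}" using edge[OF e(3,4)] by (elim exE)
      have "\<sigma> \<inter> a = \<sigma> \<inter> b" using eq by (simp add: a b)
      then have "{\<sigma>, a} = {\<sigma>, b}"
        using G_edge_wall(8)[OF e(1)[unfolded a]] G_edge_wall(8)[OF e(3)[unfolded b]] by simp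
      then show "e = e'" by (simp only: a b)
    qed
    moreover have "(\<lambda>e. \<Inter>e) ` {e \<in> snd (G ?\<xi>). \<sigma> \<in> e} \<subseteq> ?F"
    proof
      fix \<tau> assume "\<tau> \<in> (\<lambda>e. \<Inter>e) ` {e \<in> snd (G ?\<xi>). \<sigma> \<in> e}"
      then obtain e where e: "e \<in> snd (G ?\<xi>)" "\<sigma> \<in> e" "\<tau> = \<Inter>e" by blast
      obtain a where a: "e = {\<sigma>, a}" using edge[OF e(1,2)] by (elim exE)
      have t: "\<tau> = \<sigma> \<inter> a" using e(3) by (simp add: a)
      note w = G_edge_wall(4,5,7)[OF e(1)[unfolded a], folded t]
      show "\<tau> \<in> ?F" using w W_walls[OF w(1)] thr_flat[OF W_walls[OF w(1)]] by simp
    qed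
    moreover have "finite ?F" using finite_walls by simp
    ultimately have "card {e \<in> snd (G ?\<xi>). \<sigma> \<in> e} \<le> card ?F" by (rule card_inj_on_le)
    then show ?thesis using facets_through_codim2[OF True, of u v] by linarith
  qed
qed

text \<open>Translates an enumeration of a component into columns of the boundary matrix: the
  surviving rows of a cell are the walls it shares with its neighbours in the enumeration. No
  neighbour is missed because components are closed under edges.\<close>

lemma component_T:
  assumes comp: "\<psi> \<in> components_graph (G (flat {u, v}))" and lg: "\<psi> = line_graph w N"
  shows "\<And>j. j < N \<Longrightarrow> {w j, w (Suc j)} \<in> snd (G (flat {u, v}))"
    and "\<And>i \<tau>. i \<le> N \<Longrightarrow> \<tau> \<in> T (flat {u, v}) (w i) \<Longrightarrow> \<exists>j<N. \<tau> = w j \<inter> w (Suc j) \<and> (w i = w j \<or> w i = w (Suc j))"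
    and "\<And>j. j < N \<Longrightarrow> w j \<inter> w (Suc j) \<in> T (flat {u, v}) (w j) \<and> w j \<inter> w (Suc j) \<in> T (flat {u, v}) (w (Suc j))"
proof -
  let ?\<xi> = "flat {u, v}"
  interpret D: degree2_graph "fst (G ?\<xi>)" "snd (G ?\<xi>)" by (rule degree2_G)
  obtain B where B: "\<psi> = (B, {e \<in> snd (G ?\<xi>). e \<subseteq> B})" "B \<in> fst (G ?\<xi>) // reach (G ?\<xi>)"
    using comp unfolding components_graph_def mem_Collect_eq by (elim exE conjE)
  have B': "B \<in> fst (G ?\<xi>) // reach (fst (G ?\<xi>), snd (G ?\<xi>))" using B(2) by simp
  have "B = w ` {..N} \<and> {e \<in> snd (G ?\<xi>). e \<subseteq> B} = {{w i, w (Suc i)} | i. i < N}"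
    using trans[OF B(1)[symmetric] lg] unfolding line_graph_def prod.inject .
  note wB = this[THEN conjunct1] and edges = this[THEN conjunct2]
  show edge: "{w j, w (Suc j)} \<in> snd (G ?\<xi>)" if "j < N" for j using edges that by blast
  show "w j \<inter> w (Suc j) \<in> T ?\<xi> (w j) \<and> w j \<inter> w (Suc j) \<in> T ?\<xi> (w (Suc j))" if "j < N" for j
    using G_edge_wall(4-7)[OF edge[OF that]] by (auto simp: T_def)
  fix i \<tau> assume i: "i \<le> N" and \<tau>: "\<tau> \<in> T ?\<xi> (w i)"
  have wi: "w i \<in> B" using wB i by blast
  have wC: "w i \<in> C" using D.component_subset[OF B'] wi unfolding subset_iff G_vertex by blast
  have t: "\<tau> \<in> W" "\<tau> facet_of w i" "thr ?\<xi> \<tau>" using \<tau> by (auto simp: T_def)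
  obtain \<sigma>' where s': "\<sigma>' \<in> C" "\<sigma>' \<noteq> w i" "\<tau> facet_of \<sigma>'" using W_two_cells[OF t(1) wC t(2)] .
  have e: "{w i, \<sigma>'} \<in> snd (G ?\<xi>)"
    unfolding G_edge using wC s' t by (intro exI[of _ "w i"] exI[of _ \<sigma>'] exI[of _ \<tau>]) simp
  then have "\<sigma>' \<in> B" using D.component_closed[OF B' wi] by blast
  then have "{w i, \<sigma>'} \<in> {e \<in> snd (G ?\<xi>). e \<subseteq> B}" using e wi by blast
  then obtain j where j: "j < N" "{w i, \<sigma>'} = {w j, w (Suc j)}" unfolding edges by blast
  have "\<tau> = w i \<inter> \<sigma>'" using common_wall_unique[OF wC s'(1)] s' t by metis
  then have "\<tau> = w j \<inter> w (Suc j)" using j(2) by (auto simp: doubleton_eq_iff)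
  moreover have "w i = w j \<or> w i = w (Suc j)" using j(2) by (auto simp: doubleton_eq_iff)
  ultimately show "\<exists>j<N. \<tau> = w j \<inter> w (Suc j) \<and> (w i = w j \<or> w i = w (Suc j))" using j(1) by blast
qed

text \<open>The first cell of the path has only one surviving wall, which is therefore dead, and
  each further cell links a dead wall to the next one.\<close>

lemma path_component_dead:
  assumes comp: "\<psi> \<in> components_graph (G (flat {u, v}))" and path: "path_enum w N \<psi>"
    and \<tau>: "\<tau> \<in> T (flat {u, v}) \<sigma>" and \<sigma>: "\<sigma> \<in> fst \<psi>"
  shows "dead (flat {u, v}) \<tau>"
proof -
  let ?\<xi> = "flat {u, v}"
  have lg: "\<psi> = line_graph w N" and inj: "inj_on w {..N}" using path by (auto simp: path_enum_def)
  note ct = component_T[OF comp lg]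
  have weq: "w i = w j \<longleftrightarrow> i = j" if "i \<le> N" "j \<le> N" for i j using inj that by (auto simp: inj_on_def)
  define t where "t j = w j \<inter> w (Suc j)" for j
  have wC: "w j \<in> C" "w (Suc j) \<in> C" if "j < N" for j using G_edge_wall(1,2)[OF ct(1)[OF that]] .
  have dead: "dead ?\<xi> (t j)" if "j < N" for j
    using that
  proof (induction j)
    case 0
    have "T ?\<xi> (w 0) = {t 0}"
    proof (intro equalityI subsetI)
      fix \<tau> assume "\<tau> \<in> T ?\<xi> (w 0)"
      then obtain j where j: "j < N" "\<tau> = t j" "w 0 = w j \<or> w 0 = w (Suc j)" using ct(2)[of 0] unfolding t_def by blast
      then have "j = 0" using weq[of 0 j] weq[of 0 "Suc j"] by auto
      then show "\<tau> \<in> {t 0}" using j by simp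
    qed (use ct(3)[OF 0] in \<open>auto simp: t_def\<close>)
    then show ?case by (rule T_single_dead[OF wC(1)[OF 0]])
  next
    case (Suc j)
    have "T ?\<xi> (w (Suc j)) = {t j, t (Suc j)}"
    proof (intro equalityI subsetI)
      fix \<tau> assume "\<tau> \<in> T ?\<xi> (w (Suc j))"
      then obtain k where k: "k < N" "\<tau> = t k" "w (Suc j) = w k \<or> w (Suc j) = w (Suc k)"
        using ct(2)[of "Suc j" \<tau>] Suc.prems unfolding t_def by (metis less_imp_le)
      then have "k = Suc j \<or> k = j" using weq[of "Suc j" k] weq[of "Suc j" "Suc k"] Suc.prems by auto
      then show "\<tau> \<in> {t j, t (Suc j)}" using k by auto
    qed (use ct(3)[of j] ct(3)[of "Suc j"] Suc.prems in \<open>auto simp: t_def\<close>)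
    then have "linked ?\<xi> (t j) (t (Suc j))" by (rule T_pair_linked[OF wC(1)[OF Suc.prems]])
    moreover have "dead ?\<xi> (t j)" using Suc.IH Suc.prems by (simp only: Suc_lessD)
    ultimately show ?case by (rule dead_linked[rotated])
  qed
  obtain i where i: "i \<le> N" "\<sigma> = w i" using \<sigma> unfolding lg line_graph_def fst_conv by auto
  obtain j where "j < N" "\<tau> = t j" using ct(2)[OF i(1) \<tau>[unfolded i(2)]] unfolding t_def by (elim exE conjE)
  then show ?thesis using dead by simp
qed

text \<open>Collects what is used later about one circle: its walls \<open>A\<close>, a reference
  row \<open>\<tau>0\<close> to which all its rows are linked, and an additive functional \<Phi>
  that detects the edge ideal. The two independent normals ensure that the walls determine the
  codimension two subspace.\<close>

definition circle_datum ::
  "(real ^ 'n option) set \<Rightarrow> (real ^ 'n) set graph \<Rightarrow> (real ^ 'n) set set \<Rightarrow> (real ^ 'n) set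
    \<Rightarrow> (((real ^ 'n) set \<Rightarrow> 'n option mpoly) \<Rightarrow> 'n option mpoly) \<Rightarrow> bool" where
  "circle_datum \<xi> \<psi> A \<tau>0 \<Phi> \<longleftrightarrow>
     A = {\<tau>. \<exists>\<sigma>\<in>fst \<psi>. \<tau> \<in> T \<xi> \<sigma>} \<and> \<tau>0 \<in> A \<and>
     edge_ideal P l r \<xi> \<psi> = Idl\<^bsub>poly_ring\<^esub> ((\<lambda>\<tau>. l \<tau> ^ (r + 1)) ` A) \<and>
     (\<forall>F F'. \<Phi> (F + F') = \<Phi> F + \<Phi> F') \<and>
     (\<forall>F\<in>S. \<Phi> F \<in> edge_ideal P l r \<xi> \<psi>) \<and>
     (\<forall>\<tau> q. \<tau> \<notin> A \<longrightarrow> \<Phi> (unit_at \<tau> q) = 0) \<and>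
     (\<forall>\<tau> q. q \<in> edge_ideal P l r \<xi> \<psi> \<longrightarrow> \<Phi> (unit_at \<tau> q) \<in> edge_ideal P l r \<xi> \<psi>) \<and>
     (\<exists>b. b * b = 1 \<and> (\<forall>q. \<Phi> (unit_at \<tau>0 q) = b * q)) \<and>
     (\<forall>\<tau>\<in>A. linked \<xi> \<tau>0 \<tau>) \<and>
     (\<exists>\<tau>1\<in>A. \<exists>\<tau>2\<in>A. nv \<tau>2 \<notin> span {nv \<tau>1})"

text \<open>On a cycle of cells the boundary relations telescope, so that the signed sum of the coordinates along the
  cycle sends the image of \<open>\<phi>\<close> into the edge ideal.\<close>

lemma circle_datum_exists:
  assumes comp: "\<psi> \<in> components_graph (G (flat {u, v}))" and cyc: "cycle_enum w N \<psi>"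
  shows "\<exists>A \<tau>0 \<Phi>. circle_datum (flat {u, v}) \<psi> A \<tau>0 \<Phi>"
proof -
  let ?\<xi> = "flat {u, v}" and ?J = "edge_ideal P l r (flat {u, v}) \<psi>"
  have lg: "\<psi> = line_graph w N" and inj: "inj_on w {..<N}" and N: "3 \<le> N" and loop: "w N = w 0"
    using cyc by (auto simp: cycle_enum_def)
  note ct = component_T[OF comp lg]
  have weq: "w i = w j \<longleftrightarrow> i = j" if "i < N" "j < N" for i j using inj that by (auto simp: inj_on_def)
  have wSuc: "w i = w (Suc j) \<longleftrightarrow> (if Suc j < N then i = Suc j else i = 0)" if "i < N" "j < N" for i j
  proof (cases "Suc j < N")
    case True
    then show ?thesis using weq[OF that(1) True] by simp
  next
    case False
    then have "Suc j = N" using that by simp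
    then show ?thesis using weq[of i 0] that loop by auto
  qed
  define t where "t j = w j \<inter> w (Suc j)" for j
  note ge = G_edge_wall[OF ct(1), folded t_def]
  define A where "A = t ` {..<N}"
  have A: "A = {\<tau>. \<exists>\<sigma>\<in>fst \<psi>. \<tau> \<in> T ?\<xi> \<sigma>}"
  proof (intro equalityI subsetI)
    fix \<tau> assume "\<tau> \<in> A"
    then obtain j where j: "j < N" "\<tau> = t j" by (auto simp: A_def)
    then have "\<tau> \<in> T ?\<xi> (w j)" using ct(3)[OF j(1)] by (simp add: t_def)
    moreover have "w j \<in> fst \<psi>" unfolding lg line_graph_def fst_conv using j(1) by simp
    ultimately show "\<tau> \<in> {\<tau>. \<exists>\<sigma>\<in>fst \<psi>. \<tau> \<in> T ?\<xi> \<sigma>}" by blast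
  next
    fix \<tau> assume "\<tau> \<in> {\<tau>. \<exists>\<sigma>\<in>fst \<psi>. \<tau> \<in> T ?\<xi> \<sigma>}"
    then obtain i where i: "i \<le> N" "\<tau> \<in> T ?\<xi> (w i)" unfolding lg line_graph_def fst_conv by auto
    then obtain j where "j < N" "\<tau> = t j" using ct(2)[OF i] unfolding t_def by (elim exE conjE)
    then show "\<tau> \<in> A" by (auto simp: A_def)
  qed
  have tW: "t j \<in> W" if "j < N" for j using ge(4)[OF that] .
  have gens: "{l \<tau> ^ (r + 1) | \<tau>. \<tau> \<in> W \<and> ?\<xi> \<subseteq> zero_locus {l \<tau>} \<and>
       (\<exists>\<sigma> \<sigma>'. {\<sigma>, \<sigma>'} \<in> snd \<psi> \<and> \<sigma> \<noteq> \<sigma>' \<and> \<tau> facet_of \<sigma> \<and> \<tau> facet_of \<sigma>')} = (\<lambda>\<tau>. l \<tau> ^ (r + 1)) ` A"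
  proof (intro equalityI subsetI)
    fix p assume "p \<in> {l \<tau> ^ (r + 1) | \<tau>. \<tau> \<in> W \<and> ?\<xi> \<subseteq> zero_locus {l \<tau>} \<and>
       (\<exists>\<sigma> \<sigma>'. {\<sigma>, \<sigma>'} \<in> snd \<psi> \<and> \<sigma> \<noteq> \<sigma>' \<and> \<tau> facet_of \<sigma> \<and> \<tau> facet_of \<sigma>')}"
    then obtain \<tau> \<sigma> \<sigma>' where p: "p = l \<tau> ^ (r + 1)" "{\<sigma>, \<sigma>'} \<in> snd \<psi>" "\<tau> facet_of \<sigma>" "\<tau> facet_of \<sigma>'"
      unfolding mem_Collect_eq by (elim exE conjE)
    obtain j where j: "{\<sigma>, \<sigma>'} = {w j, w (Suc j)}" "j < N"
      using p(2) unfolding lg line_graph_def snd_conv mem_Collect_eq by (elim exE conjE)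
    note j = j(2,1)
    have "\<tau> facet_of w j" "\<tau> facet_of w (Suc j)" using p(3,4) j(2) by (auto simp: doubleton_eq_iff)
    then have "\<tau> = t j" unfolding t_def by (rule common_wall_unique[OF ge(1-3)[OF j(1)]])
    then show "p \<in> (\<lambda>\<tau>. l \<tau> ^ (r + 1)) ` A" using p j by (auto simp: A_def)
  next
    fix p assume "p \<in> (\<lambda>\<tau>. l \<tau> ^ (r + 1)) ` A"
    then obtain j where j: "j < N" "p = l (t j) ^ (r + 1)" by (auto simp: A_def)
    moreover have "{w j, w (Suc j)} \<in> snd \<psi>" unfolding lg line_graph_def snd_conv using j(1) by blast
    ultimately show "p \<in> {l \<tau> ^ (r + 1) | \<tau>. \<tau> \<in> W \<and> ?\<xi> \<subseteq> zero_locus {l \<tau>} \<and>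
       (\<exists>\<sigma> \<sigma>'. {\<sigma>, \<sigma>'} \<in> snd \<psi> \<and> \<sigma> \<noteq> \<sigma>' \<and> \<tau> facet_of \<sigma> \<and> \<tau> facet_of \<sigma>')}"
      using ge(3-7)[OF j(1)] unfolding thr_def by (intro CollectI exI[of _ "t j"] exI[of _ "w j"] exI[of _ "w (Suc j)"] conjI)
  qed
  have J: "?J = Idl\<^bsub>poly_ring\<^esub> ((\<lambda>\<tau>. l \<tau> ^ (r + 1)) ` A)" unfolding edge_ideal_def gens ..
  have idJ: "ideal ?J poly_ring" unfolding J by (rule Idl_ideal)
  have genJ: "l (t j) ^ (r + 1) \<in> ?J" if "j < N" for j
    unfolding J by (rule Idl_base) (use that in \<open>auto simp: A_def\<close>)
  \<comment> \<open>Multiplied by the sign \<open>b j\<close>, the row of \<open>t j\<close> applied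
    to \<open>f\<close> reads \<open>f (w j) - f (w (Suc j))\<close>, whatever the orientation
    chosen in \<open>bd\<close>.\<close>
  define b where "b j = bd (t j) (w j)" for j
  have bb: "b j * b j = 1" if "j < N" for j
    unfolding b_def by (rule bd_cases(1)[OF tW[OF that] ge(1)[OF that] ge(5)[OF that]])
  define \<Phi> where "\<Phi> F = (\<Sum>j<N. b j * F (t j))" for F :: "(real ^ 'n) set \<Rightarrow> 'n option mpoly"
  have \<Phi>_add: "\<Phi> (F + F') = \<Phi> F + \<Phi> F'" for F F' by (simp add: \<Phi>_def sum.distrib distrib_left)
  have \<Phi>_bd: "\<Phi> (bdmap f) = 0" for f
  proof -
    have "b j * bdmap f (t j) = f (w j) - f (w (Suc j))" if j: "j < N" for j
    proof -
      have eq: "bdmap f (t j) = bd (t j) (w j) * (f (w j) - f (w (Suc j)))"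
        by (rule bdmap_wall[OF tW[OF j] ge(1)[OF j] ge(2)[OF j] ge(3)[OF j] ge(5)[OF j] ge(6)[OF j]])
      have "b j * bdmap f (t j) = (b j * b j) * (f (w j) - f (w (Suc j)))"
        unfolding eq b_def by (simp only: mult.assoc)
      then show ?thesis using bb[OF j] by simp
    qed
    then have "\<Phi> (bdmap f) = (\<Sum>j<N. f (w j) - f (w (Suc j)))" unfolding \<Phi>_def by (intro sum.cong) auto
    also have "\<dots> = f (w 0) - f (w N)" by (rule sum_lessThan_telescope')
    finally show ?thesis using loop by simp
  qed
  have \<Phi>_d: "\<Phi> (dmap g) \<in> ?J" for g
    unfolding \<Phi>_def
  proof (rule subspace_sum[OF ideal_subspace[OF idJ]])
    fix j assume j: "j \<in> {..<N}"
    have "b j * dmap g (t j) = (b j * g (t j)) * l (t j) ^ (r + 1)" using tW[of j] j by (simp add: dmap_def mult_ac)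
    then show "b j * dmap g (t j) \<in> ?J" using idealD(3)[OF idJ genJ[of j]] j by simp
  qed
  have \<Phi>_S: "\<Phi> F \<in> ?J" if F: "F \<in> S" for F
  proof -
    obtain f g where "F = dmap g + bdmap f" using F unfolding S_iff by (elim exE conjE)
    then have "\<Phi> F = \<Phi> (dmap g)" by (simp add: \<Phi>_add \<Phi>_bd)
    then show ?thesis using \<Phi>_d by simp
  qed
  have \<Phi>_out: "\<Phi> (unit_at \<tau> q) = 0" if "\<tau> \<notin> A" for \<tau> q
    unfolding \<Phi>_def by (rule sum.neutral) (use that in \<open>auto simp: A_def unit_at_def\<close>)
  have \<Phi>_J: "\<Phi> (unit_at \<tau> q) \<in> ?J" if "q \<in> ?J" for \<tau> q
    unfolding \<Phi>_def
  proof (rule subspace_sum[OF ideal_subspace[OF idJ]])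
    fix j
    show "b j * unit_at \<tau> q (t j) \<in> ?J"
      using that idealD(1,3)[OF idJ] by (auto simp: unit_at_def)
  qed
  \<comment> \<open>Equal walls have the same two adjacent cells, and two steps of a cycle with at
    least three cells cannot join the same pair. Hence \<Phi> picks up the reference row exactly
    once.\<close>
  have t_inj: "t j = t 0 \<Longrightarrow> j = 0" if j: "j < N" for j
  proof -
    assume eq: "t j = t 0"
    have N0: "0 < N" "Suc 0 < N" using N by auto
    have "{w j, w (Suc j)} = {w 0, w (Suc 0)}" using ge(8)[OF j] ge(8)[OF N0(1)] eq by simp
    then consider "w j = w 0" | "w j = w (Suc 0)" "w 0 = w (Suc j)" by (auto simp: doubleton_eq_iff)
    then show "j = 0"
    proof cases
      case 1
      then show ?thesis using weq[OF j N0(1)] by simp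
    next
      case 2
      then have "j = Suc 0" using weq[OF j N0(2)] by simp
      moreover have "Suc (Suc 0) < N" using N by simp
      ultimately have False using 2(2) weq[of 0 "Suc (Suc 0)"] N0 by simp
      then show ?thesis ..
    qed
  qed
  have N0: "0 < N" "Suc 0 < N" using N by auto
  have \<Phi>_0: "\<Phi> (unit_at (t 0) q) = b 0 * q" for q
  proof -
    have "\<Phi> (unit_at (t 0) q) = (\<Sum>j<N. if j = 0 then b 0 * q else 0)"
      unfolding \<Phi>_def
    proof (rule sum.cong)
      fix j assume "j \<in> {..<N}"
      then show "b j * unit_at (t 0) q (t j) = (if j = 0 then b 0 * q else 0)"
        using t_inj[of j] by (cases "j = 0") (auto simp: unit_at_def)
    qed simp
    also have "\<dots> = b 0 * q" using N0 by simp
    finally show ?thesis .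
  qed
  have T_Suc: "T ?\<xi> (w (Suc j)) = {t j, t (Suc j)}" if j: "Suc j < N" for j
  proof (intro equalityI subsetI)
    fix \<tau> assume "\<tau> \<in> T ?\<xi> (w (Suc j))"
    then obtain k where k: "k < N" "\<tau> = t k" "w (Suc j) = w k \<or> w (Suc j) = w (Suc k)"
      using ct(2)[of "Suc j" \<tau>] j unfolding t_def by (metis less_imp_le)
    then have "k = Suc j \<or> k = j"
      using weq[OF j k(1)] wSuc[OF j k(1)] by (metis Suc_inject nat.simps(3))
    then show "\<tau> \<in> {t j, t (Suc j)}" using k by auto
  next
    fix \<tau> assume "\<tau> \<in> {t j, t (Suc j)}"
    then show "\<tau> \<in> T ?\<xi> (w (Suc j))" using ct(3)[of j] ct(3)[OF j] j by (auto simp: t_def)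
  qed
  have link: "linked ?\<xi> (t 0) (t j)" if "j < N" for j
    using that
  proof (induction j)
    case 0
    show ?case by (rule linked_refl)
  next
    case (Suc j)
    have "linked ?\<xi> (t j) (t (Suc j))" by (rule T_pair_linked[OF ge(1)[OF Suc.prems] T_Suc[OF Suc.prems]])
    moreover have "linked ?\<xi> (t 0) (t j)" using Suc.IH Suc.prems by (simp only: Suc_lessD)
    ultimately show ?case by (rule linked_trans[rotated])
  qed
  \<comment> \<open>Both walls are facets of the cell \<open>w (Suc 0)\<close>, and different facets
    of one cell do not lie in a common hyperplane.\<close>
  have "t (Suc 0) \<noteq> t 0" using t_inj[OF N0(2)] by auto
  then have "nv (t (Suc 0)) \<notin> span {nv (t 0)}"
    using facet_in_hyperplane_unique[OF ge(1)[OF N0(2)] ge(6)[OF N0(1)] ge(5)[OF N0(2)]] by blast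
  moreover have "t 0 \<in> A" "t (Suc 0) \<in> A" using N0 by (auto simp: A_def)
  ultimately have pair: "\<exists>\<tau>1\<in>A. \<exists>\<tau>2\<in>A. nv \<tau>2 \<notin> span {nv \<tau>1}" by (intro bexI)
  have sign: "\<exists>b. b * b = 1 \<and> (\<forall>q. \<Phi> (unit_at (t 0) q) = b * q)"
    using bb[OF N0(1)] \<Phi>_0 by (intro exI[of _ "b 0"]) simp
  have links: "\<forall>\<tau>\<in>A. linked ?\<xi> (t 0) \<tau>" unfolding A_def using link by simp
  have t0A: "t 0 \<in> A" using N0 by (auto simp: A_def)
  have m1: "\<forall>F F'. \<Phi> (F + F') = \<Phi> F + \<Phi> F'" by (intro allI) (rule \<Phi>_add)
  have m2: "\<forall>F\<in>S. \<Phi> F \<in> ?J" by (rule ballI) (rule \<Phi>_S)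
  have m3: "\<forall>\<tau> q. \<tau> \<notin> A \<longrightarrow> \<Phi> (unit_at \<tau> q) = 0" by (intro allI impI) (rule \<Phi>_out)
  have m4: "\<forall>\<tau> q. q \<in> ?J \<longrightarrow> \<Phi> (unit_at \<tau> q) \<in> ?J" by (intro allI impI) (rule \<Phi>_J)
  have "circle_datum ?\<xi> \<psi> A (t 0) \<Phi>"
    unfolding circle_datum_def by (intro conjI A t0A J m1 m2 m3 m4 sign links pair)
  then show ?thesis by (intro exI)
qed

end

section \<open>Degree pieces of the spline map and the Hilbert function of the splines\<close>

lemma prod_spaceI: "(\<And>i. i \<in> I \<Longrightarrow> f i \<in> A i) \<Longrightarrow> (\<And>i. i \<notin> I \<Longrightarrow> f i = 0) \<Longrightarrow> f \<in> prod_space I A"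
  by (simp add: prod_space_def)

lemma prod_spaceD: "f \<in> prod_space I A \<Longrightarrow> i \<in> I \<Longrightarrow> f i \<in> A i" "f \<in> prod_space I A \<Longrightarrow> i \<notin> I \<Longrightarrow> f i = 0"
  by (simp_all add: prod_space_def)

context spline_complex
begin

lemma W_two_cells_obtain:
  assumes "\<tau> \<in> W"
  obtains \<sigma> \<sigma>' where "\<sigma> \<in> C" "\<sigma>' \<in> C" "\<sigma> \<noteq> \<sigma>'" "\<tau> facet_of \<sigma>" "\<tau> facet_of \<sigma>'"
proof -
  obtain \<sigma> where \<sigma>: "\<sigma> \<in> C" "\<tau> facet_of \<sigma>" using W_cell[OF assms] .
  obtain \<sigma>' where \<sigma>': "\<sigma>' \<in> C" "\<sigma>' \<noteq> \<sigma>" "\<tau> facet_of \<sigma>'" using W_two_cells[OF assms \<sigma>] .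
  show thesis using that[OF \<sigma>(1) \<sigma>'(1) _ \<sigma>(2) \<sigma>'(3)] \<sigma>'(2) by simp
qed

abbreviation rk :: "int \<Rightarrow> int" where "rk k \<equiv> k - int (r + 1)"

lemma wall_power_forms: "\<tau> \<in> W \<Longrightarrow> l \<tau> ^ (r + 1) \<in> forms (int (r + 1))"
  using forms_power[OF lin_forms, of "nv \<tau>" "r + 1"] by (simp only: l_lin[OF W_walls] mult_1_right of_nat_1 mult_1)

lemma bdmap_forms: "f \<in> free_forms C k \<Longrightarrow> bdmap f \<in> free_forms W k"
proof (rule prod_spaceI)
  fix \<tau> assume f: "f \<in> free_forms C k" and \<tau>: "\<tau> \<in> W"
  have "(\<Sum>\<sigma>\<in>C. bd \<tau> \<sigma> * f \<sigma>) \<in> forms k"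
  proof (rule subspace_sum[OF subspace_forms])
    fix \<sigma> assume \<sigma>: "\<sigma> \<in> C"
    show "bd \<tau> \<sigma> * f \<sigma> \<in> forms k" using forms_mult[OF bd_forms[OF \<tau> \<sigma>] prod_spaceD(1)[OF f \<sigma>]] by simp
  qed
  then show "bdmap f \<tau> \<in> forms k" using \<tau> by (simp add: bdmap_def)
qed (simp add: bdmap_def)

lemma dmap_forms: "g \<in> free_forms W (rk k) \<Longrightarrow> dmap g \<in> free_forms W k"
proof (rule prod_spaceI)
  fix \<tau> assume g: "g \<in> free_forms W (rk k)" and \<tau>: "\<tau> \<in> W"
  show "dmap g \<tau> \<in> forms k"
    using forms_mult[OF wall_power_forms[OF \<tau>] prod_spaceD(1)[OF g \<tau>]] \<tau> by (simp add: dmap_def)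
qed (simp add: dmap_def)

definition Sk :: "int \<Rightarrow> ((real ^ 'n) set \<Rightarrow> 'n option mpoly) set" where
  "Sk k = S \<inter> free_forms W k"

lemma free_forms_free: "f \<in> free_forms I k \<Longrightarrow> f \<in> free I"
  by (simp add: prod_space_def)

lemma gfam_Sk: "gfam W Sk"
  unfolding gfam_def
proof (intro allI conjI ballI)
  fix k i and f :: "(real ^ 'n) set \<Rightarrow> 'n option mpoly"
  show "subspace (Sk k)" unfolding Sk_def by (rule subspace_inter[OF subspace_S subspace_free_forms])
  show "Sk k \<subseteq> free_forms W k" unfolding Sk_def by (rule Int_lower2)
  assume f: "f \<in> Sk k"
  have "pmul (X i) f \<in> free_forms W (k + 1)"
  proof (rule prod_spaceI)
    fix j
    show "j \<in> W \<Longrightarrow> pmul (X i) f j \<in> forms (k + 1)" using f X_mult_forms[of "f j" k i] by (simp add: Sk_def prod_space_def)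
    show "j \<notin> W \<Longrightarrow> pmul (X i) f j = 0" using f by (simp add: Sk_def prod_space_def)
  qed
  moreover have "pmul (X i) f \<in> S" by (rule S_pmul) (use f in \<open>simp add: Sk_def\<close>)
  ultimately show "pmul (X i) f \<in> Sk (k + 1)" unfolding Sk_def by (rule IntI[rotated])
qed

text \<open>The boundary map preserves degrees and \<open>dmap\<close> raises them by r + 1, so a
  homogeneous element of the image has homogeneous preimages, found by taking components.
  Rank-nullity then applies degree by degree.\<close>

lemma Sk_eq: "Sk k = {s + bdmap f | s f. s \<in> dmap ` free_forms W (rk k) \<and> f \<in> free_forms C k}"
proof (intro equalityI subsetI)
  fix F assume F: "F \<in> Sk k"
  then have FS: "F \<in> S" and Ff: "F \<in> free_forms W k" by (simp_all add: Sk_def)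
  obtain f g where fg: "f \<in> free C" "g \<in> free W" "F = dmap g + bdmap f" using FS unfolding S_iff by (elim exE conjE)
  define g' where "g' \<tau> = (if \<tau> \<in> W then hcomp (rk k) (g \<tau>) else 0)" for \<tau>
  define f' where "f' \<sigma> = (if \<sigma> \<in> C then hcomp k (f \<sigma>) else 0)" for \<sigma>
  have "F \<tau> = dmap g' \<tau> + bdmap f' \<tau>" for \<tau>
  proof (cases "\<tau> \<in> W")
    case True
    have "F \<tau> = hcomp k (F \<tau>)" using hcomp_form[OF prod_spaceD(1)[OF Ff True]] by simp
    also have "\<dots> = hcomp k (l \<tau> ^ (r + 1) * g \<tau>) + (\<Sum>\<sigma>\<in>C. hcomp k (bd \<tau> \<sigma> * f \<sigma>))"
      unfolding fg(3) using True by (simp add: dmap_def bdmap_def hcomp_add hcomp_sum)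
    also have "(\<Sum>\<sigma>\<in>C. hcomp k (bd \<tau> \<sigma> * f \<sigma>)) = bdmap f' \<tau>"
      using True hcomp_mult[OF bd_forms[OF True]] by (simp add: bdmap_def f'_def)
    also have "hcomp k (l \<tau> ^ (r + 1) * g \<tau>) = dmap g' \<tau>"
      unfolding hcomp_mult[OF wall_power_forms[OF True]] using True by (simp add: dmap_def g'_def)
    finally show ?thesis .
  next
    case False
    then show ?thesis using prod_spaceD(2)[OF Ff False] by (simp add: dmap_def bdmap_def)
  qed
  then have "F = dmap g' + bdmap f'" by (simp add: fun_eq_iff)
  moreover have "g' \<in> free_forms W (rk k)" by (rule prod_spaceI) (simp_all add: g'_def hcomp_forms)
  moreover have "f' \<in> free_forms C k" by (rule prod_spaceI) (simp_all add: f'_def hcomp_forms)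
  ultimately show "F \<in> {s + bdmap f | s f. s \<in> dmap ` free_forms W (rk k) \<and> f \<in> free_forms C k}"
    by (intro CollectI exI[of _ "dmap g'"] exI[of _ f'] conjI imageI)
next
  fix F assume "F \<in> {s + bdmap f | s f. s \<in> dmap ` free_forms W (rk k) \<and> f \<in> free_forms C k}"
  then obtain s f where "F = s + bdmap f" "s \<in> dmap ` free_forms W (rk k)" and f: "f \<in> free_forms C k"
    unfolding mem_Collect_eq by (elim exE conjE)
  then obtain g where F: "F = dmap g + bdmap f" and g: "g \<in> free_forms W (rk k)" by (elim imageE) simp
  have "F \<in> S" unfolding F by (rule S_intro[OF free_forms_free[OF f] free_forms_free[OF g]])
  moreover have "F \<in> free_forms W k"
    unfolding F by (rule subspace_add[OF subspace_free_forms dmap_forms[OF g] bdmap_forms[OF f]])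
  ultimately show "F \<in> Sk k" unfolding Sk_def by (rule IntI)
qed

definition SP :: "((real ^ 'n) set \<Rightarrow> 'n option mpoly) set" where
  "SP = {f \<in> free C. \<forall>\<sigma>\<in>C. \<forall>\<sigma>'\<in>C. \<forall>\<tau>\<in>walls P.
            \<tau> facet_of \<sigma> \<and> \<tau> facet_of \<sigma>' \<longrightarrow> l \<tau> ^ (r + 1) dvd f \<sigma> - f \<sigma>'}"

text \<open>The smoothness condition across an interior wall concerns one row of the boundary, whose
  entries are units: it says that this row is divisible by the power of the wall form. Hence splines
  are the tuples with boundary in the image of \<open>D\<close>.\<close>

lemma SP_forms:
  "free_forms C k \<inter> SP = {f \<in> free_forms C k. bdmap f \<in> dmap ` free_forms W (rk k)}"
proof (intro equalityI subsetI)
  fix f assume "f \<in> free_forms C k \<inter> SP"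
  then have f: "f \<in> free_forms C k"
    and dv: "\<And>\<sigma> \<sigma>' \<tau>. \<sigma> \<in> C \<Longrightarrow> \<sigma>' \<in> C \<Longrightarrow> \<tau> \<in> walls P \<Longrightarrow> \<tau> facet_of \<sigma> \<Longrightarrow> \<tau> facet_of \<sigma>' \<Longrightarrow> l \<tau> ^ (r + 1) dvd f \<sigma> - f \<sigma>'"
    by (simp_all add: SP_def)
  have "\<exists>q. q \<in> forms (rk k) \<and> bdmap f \<tau> = l \<tau> ^ (r + 1) * q" if \<tau>: "\<tau> \<in> W" for \<tau>
  proof -
    obtain \<sigma> \<sigma>' where \<sigma>: "\<sigma> \<in> C" "\<sigma>' \<in> C" "\<sigma> \<noteq> \<sigma>'" "\<tau> facet_of \<sigma>" "\<tau> facet_of \<sigma>'" using W_two_cells_obtain[OF \<tau>] .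
    obtain q where q: "f \<sigma> - f \<sigma>' = l \<tau> ^ (r + 1) * q" using dv[OF \<sigma>(1,2) W_walls[OF \<tau>] \<sigma>(4,5)] by (elim dvdE)
    have "bdmap f \<tau> = l \<tau> ^ (r + 1) * (bd \<tau> \<sigma> * q)" unfolding bdmap_wall[OF \<tau> \<sigma>] q by (simp only: mult_ac)
    then have "hcomp k (bdmap f \<tau>) = l \<tau> ^ (r + 1) * hcomp (rk k) (bd \<tau> \<sigma> * q)"
      using hcomp_mult[OF wall_power_forms[OF \<tau>]] by simp
    moreover have "hcomp k (bdmap f \<tau>) = bdmap f \<tau>"
      using hcomp_form[OF prod_spaceD(1)[OF bdmap_forms[OF f] \<tau>]] by simp
    ultimately show ?thesis using hcomp_forms by (intro exI[of _ "hcomp (rk k) (bd \<tau> \<sigma> * q)"]) simp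
  qed
  then have "\<exists>g. \<forall>\<tau>\<in>W. g \<tau> \<in> forms (rk k) \<and> bdmap f \<tau> = l \<tau> ^ (r + 1) * g \<tau>" by (intro bchoice ballI)
  then obtain g where gg: "\<forall>\<tau>\<in>W. g \<tau> \<in> forms (rk k) \<and> bdmap f \<tau> = l \<tau> ^ (r + 1) * g \<tau>" by (elim exE)
  note g = gg[THEN bspec, THEN conjunct1] gg[THEN bspec, THEN conjunct2]
  define g' where "g' \<tau> = (if \<tau> \<in> W then g \<tau> else 0)" for \<tau>
  have "bdmap f \<tau> = dmap g' \<tau>" for \<tau>
    using g(2)[of \<tau>] by (cases "\<tau> \<in> W") (simp_all add: dmap_def g'_def bdmap_def)
  then have "bdmap f = dmap g'" by (rule ext)
  moreover have "g' \<in> free_forms W (rk k)" by (rule prod_spaceI) (use g(1) in \<open>simp_all add: g'_def\<close>)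
  ultimately show "f \<in> {f \<in> free_forms C k. bdmap f \<in> dmap ` free_forms W (rk k)}" using f by simp
next
  fix f assume "f \<in> {f \<in> free_forms C k. bdmap f \<in> dmap ` free_forms W (rk k)}"
  then have f: "f \<in> free_forms C k" and "bdmap f \<in> dmap ` free_forms W (rk k)" by simp_all
  then obtain g where g: "bdmap f = dmap g" by (elim imageE)
  have "l \<tau> ^ (r + 1) dvd f \<sigma> - f \<sigma>'"
    if \<sigma>: "\<sigma> \<in> C" "\<sigma>' \<in> C" and \<tau>: "\<tau> facet_of \<sigma>" "\<tau> facet_of \<sigma>'" for \<sigma> \<sigma>' \<tau>
  proof (cases "\<sigma> = \<sigma>'")
    case False
    have w: "\<tau> \<in> W" using interior_wall_iff[OF \<sigma> False \<tau>] by simp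
    have "bd \<tau> \<sigma> * (f \<sigma> - f \<sigma>') = l \<tau> ^ (r + 1) * g \<tau>"
      using bdmap_wall[OF w \<sigma> False \<tau>, of f] w unfolding g by (simp add: dmap_def)
    then have "(bd \<tau> \<sigma> * bd \<tau> \<sigma>) * (f \<sigma> - f \<sigma>') = l \<tau> ^ (r + 1) * (bd \<tau> \<sigma> * g \<tau>)"
      by (simp only: mult.assoc mult.left_commute)
    then show ?thesis using bd_cases(1)[OF w \<sigma>(1) \<tau>(1)] by simp
  qed simp
  then show "f \<in> free_forms C k \<inter> SP" using f free_forms_free[OF f] unfolding SP_def by simp
qed

lemma abelian_monoid_splines: "abelian_monoid (splines P l r)"
proof -
  have carrier: "carrier (splines P l r) = SP"
    by (simp add: splines_def sub_gmodule_def SP_def carrier_free)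
  have add: "f \<oplus>\<^bsub>splines P l r\<^esub> g = f + g" for f g
    by (simp add: splines_def sub_gmodule_def free_gmodule_def fun_eq_iff)
  have zero: "\<zero>\<^bsub>splines P l r\<^esub> = 0"
    by (simp add: splines_def sub_gmodule_def free_gmodule_def fun_eq_iff)
  show ?thesis
  proof (rule abelian_monoidI)
    show "\<zero>\<^bsub>splines P l r\<^esub> \<in> carrier (splines P l r)" unfolding zero carrier by (simp add: SP_def prod_space_def)
    fix f g h assume f: "f \<in> carrier (splines P l r)" and g: "g \<in> carrier (splines P l r)"
    show "f \<oplus>\<^bsub>splines P l r\<^esub> g \<in> carrier (splines P l r)"
      using f g unfolding add carrier by (simp add: SP_def prod_space_def add_diff_add dvd_add)
    show "f \<oplus>\<^bsub>splines P l r\<^esub> g = g \<oplus>\<^bsub>splines P l r\<^esub> f" unfolding add by (rule add.commute)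
    show "(f \<oplus>\<^bsub>splines P l r\<^esub> g) \<oplus>\<^bsub>splines P l r\<^esub> h = f \<oplus>\<^bsub>splines P l r\<^esub> (g \<oplus>\<^bsub>splines P l r\<^esub> h)"
      unfolding add by (rule add.assoc)
    show "\<zero>\<^bsub>splines P l r\<^esub> \<oplus>\<^bsub>splines P l r\<^esub> f = f" unfolding zero add by simp
  qed
qed

text \<open>The alternating sum of dimensions along splines, source of \<phi>, target of \<phi> and
  \<open>N\<close>. Since the ring is a domain, \<open>D\<close> is injective and its image has the
  dimension of its source.\<close>

lemma hilbert_function_splines:
  "real (hilbert_function (splines P l r) k) =
     (real (card C) - real (card W)) * real (dim (forms k :: 'n option mpoly set))
     + real (card W) * real (dim (forms (rk k) :: 'n option mpoly set)) + codim W Sk k"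
proof -
  let ?V = "free_forms C k \<inter> SP" and ?D = "dmap ` free_forms W (rk k)"
  have subD: "subspace ?D" by (rule linear_subspace_image[OF linear_dmap subspace_free_forms])
  have fiD: "findim ?D" by (rule findim_image[OF linear_dmap findim_free_forms[OF finite_W]])
  have subV: "subspace ?V" unfolding SP_forms by (rule subspace_preimage[OF linear_bdmap subD subspace_free_forms])
  have "hilbert_function (splines P l r) k + dim {0 :: (real ^ 'n) set \<Rightarrow> 'n option mpoly} = dim ?V"
  proof (rule hilbert_function_transfer[where h = "\<lambda>f. f", OF abelian_monoid_splines subV])
    show "findim ?V" by (rule findim_subset[OF findim_free_forms[OF finite_cells] Int_lower1])
    show "piece (splines P l r) k = (\<lambda>f. f) ` ?V"
      by (simp add: splines_def sub_gmodule_def SP_def carrier_free) (simp add: free_gmodule_def prod_space_def conj_commute)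
    show "(\<lambda>f. f) ` ?V \<subseteq> carrier (splines P l r)"
      by (simp add: splines_def sub_gmodule_def carrier_free SP_def)
  qed (use subspace_0[OF subV] in \<open>simp_all add: splines_def sub_gmodule_def free_gmodule_def fun_eq_iff mconst_mult_scaleR[symmetric]\<close>)
  then have 1: "hilbert_function (splines P l r) k = dim ?V" by (simp add: dim_zero)
  have "dim (Sk k) + dim ?V = dim ?D + dim (free_forms C k :: ((real ^ 'n) set \<Rightarrow> 'n option mpoly) set)"
    unfolding Sk_eq SP_forms by (rule dim_add_image[OF linear_bdmap subD fiD subspace_free_forms findim_free_forms[OF finite_cells]])
  moreover have "dim ?D = dim (free_forms W (rk k) :: ((real ^ 'n) set \<Rightarrow> 'n option mpoly) set)"
  proof (rule dim_image_inj[OF linear_dmap subspace_free_forms findim_free_forms[OF finite_W]], rule inj_onI, rule ext)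
    fix g g' \<tau> assume g: "g \<in> free_forms W (rk k)" "g' \<in> free_forms W (rk k)" and eq: "dmap g = dmap g'"
    show "g \<tau> = g' \<tau>"
    proof (cases "\<tau> \<in> W")
      case True
      have "l \<tau> \<noteq> 0" using wf W_walls[OF True] by (simp add: wall_forms_def)
      moreover have "l \<tau> ^ (r + 1) * g \<tau> = l \<tau> ^ (r + 1) * g' \<tau>"
        using fun_cong[OF eq, of \<tau>] True by (simp only: dmap_def if_True)
      ultimately show ?thesis using mpoly_mult_cancel[OF mpoly_power_ne_0] by blast
    qed (use prod_spaceD(2)[OF g(1)] prod_spaceD(2)[OF g(2)] in simp)
  qed
  ultimately have "real (dim ?V) = real (card W * dim (forms (rk k) :: 'n option mpoly set))
      + real (card C * dim (forms k :: 'n option mpoly set)) - real (dim (Sk k))"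
    by (simp only: dim_free_forms[OF finite_W] dim_free_forms[OF finite_cells])
  then show ?thesis unfolding 1 codim_def dim_free_forms[OF finite_W] by (simp add: algebra_simps)
qed

end

section \<open>Reduction to one wall for each circle\<close>

lemma small_squeeze:
  assumes "small m a" "small m b" "\<And>k. a k \<le> u k" "\<And>k. u k \<le> b k"
  shows "small m u"
proof -
  have "small m (\<lambda>k. u k - a k)"
    by (rule small_le[OF small_diff[OF assms(2,1)]]) (simp_all add: assms(3,4))
  from small_add[OF this assms(1)] show ?thesis by simp
qed

lemma small_poly_coeff:
  fixes p :: "real poly"
  assumes "small m u" and p: "\<forall>\<^sub>F k in sequentially. u (int k) = poly p (real k)" and "m \<le> i"
  shows "coeff p i = 0"
proof -
  have "(\<lambda>k. u (int k) / real k ^ m) \<longlonglongrightarrow> 0" using assms(1) by (simp add: small_def)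
  moreover have "\<forall>\<^sub>F k in sequentially. u (int k) / real k ^ m = poly p (real k) / real k ^ m"
    using p by eventually_elim simp
  ultimately have "(\<lambda>k. poly p (real k) / real k ^ m) \<longlonglongrightarrow> 0" by (rule Lim_transform_eventually)
  then show ?thesis using assms(3) by (rule small_poly_coeff_0)
qed

lemma small_poly_degree:
  fixes p :: "real poly"
  assumes "small (Suc m) u" and p: "\<And>k. k \<ge> K \<Longrightarrow> u (int k) = poly p (real k)"
  shows "degree p \<le> m"
proof (rule degree_le, intro allI impI)
  fix i assume "m < i"
  have "\<forall>\<^sub>F k in sequentially. u (int k) = poly p (real k)" by (rule eventually_sequentiallyI[of K]) (rule p)
  then show "coeff p i = 0" by (rule small_poly_coeff[OF assms(1)]) (use \<open>m < i\<close> in simp)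
qed

lemma kills_ufam:
  assumes "\<And>k p. p \<in> forms k \<Longrightarrow> prod_list (map lin as) * p \<in> V (k + int (length as))"
  shows "kills {()} (ufam V) as"
  unfolding kills_def ufam_def using assms by (simp add: prod_space_def)

lemma pmul_eq_sum_unit_at:
  assumes "finite I" "\<And>i. i \<notin> I \<Longrightarrow> f i = 0"
  shows "pmul p f = (\<Sum>i\<in>I. unit_at i (p * f i))"
proof
  fix j
  have "(\<Sum>i\<in>I. unit_at i (p * f i)) j = (\<Sum>i\<in>I. if i = j then p * f j else 0)"
    unfolding sum_fun_apply by (intro sum.cong) (auto simp: unit_at_def)
  also have "\<dots> = p * f j" using assms by simp
  finally show "pmul p f j = (\<Sum>i\<in>I. unit_at i (p * f i)) j" by simp
qed

lemma gfam_add_line: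
  fixes S :: "int \<Rightarrow> ('i \<Rightarrow> 'x::finite mpoly) set"
  assumes S: "gfam I S" and i: "i \<in> I" and q: "q \<in> forms e"
  shows "gfam I (\<lambda>k. {s + unit_at i (q * p) | s p. s \<in> S k \<and> p \<in> forms (k - e)})"
  unfolding gfam_def
proof (intro allI conjI ballI)
  fix k j
  have lin: "linear (\<lambda>p. unit_at i (q * p))"
    using linear_compose[OF linear_mult[of q] linear_unit_at[of i]] by (simp only: o_def)
  show "subspace {s + unit_at i (q * p) | s p. s \<in> S k \<and> p \<in> forms (k - e)}"
    by (rule subspace_add_image[OF lin gfamD(1)[OF S] subspace_forms])
  show "{s + unit_at i (q * p) | s p. s \<in> S k \<and> p \<in> forms (k - e)} \<subseteq> free_forms I k"
  proof
    fix f assume "f \<in> {s + unit_at i (q * p) | s p. s \<in> S k \<and> p \<in> forms (k - e)}"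
    then obtain s p where f: "f = s + unit_at i (q * p)" "s \<in> S k" "p \<in> forms (k - e)"
      unfolding mem_Collect_eq by (elim exE conjE)
    have "q * p \<in> forms k" using forms_mult[OF q f(3)] by simp
    then have "unit_at i (q * p) \<in> free_forms I k"
      using i subspace_0[OF subspace_forms] by (intro prod_spaceI) (auto simp: unit_at_def)
    moreover have "s \<in> free_forms I k" using gfamD(2)[OF S] f(2) by (rule subsetD)
    ultimately show "f \<in> free_forms I k" unfolding f(1) by (intro subspace_add[OF subspace_free_forms])
  qed
  fix f assume "f \<in> {s + unit_at i (q * p) | s p. s \<in> S k \<and> p \<in> forms (k - e)}"
  then obtain s p where f: "f = s + unit_at i (q * p)" "s \<in> S k" "p \<in> forms (k - e)"
    unfolding mem_Collect_eq by (elim exE conjE)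
  have "pmul (X j) f = pmul (X j) s + unit_at i (q * (X j * p))"
    unfolding f(1) by (simp add: fun_eq_iff unit_at_def distrib_left mult.left_commute)
  moreover have "pmul (X j) s \<in> S (k + 1)" by (rule gfamD(3)[OF S f(2)])
  moreover have "X j * p \<in> forms (k + 1 - e)" using X_mult_forms[OF f(3), of j] by (simp add: algebra_simps)
  ultimately show "pmul (X j) f \<in> {s + unit_at i (q * p) | s p. s \<in> S (k + 1) \<and> p \<in> forms (k + 1 - e)}"
    by (intro CollectI exI[of _ "pmul (X j) s"] exI[of _ "X j * p"] conjI)
qed

context spline_complex
begin

text \<open>Among the subspaces of codimension two only these can carry a circle or give an
  associated prime of \<open>N\<close>, and there are finitely many of them.\<close>

definition Xi :: "(real ^ 'n option) set set" where
  "Xi = {flat {nv \<tau>1, nv \<tau>2} | \<tau>1 \<tau>2. \<tau>1 \<in> W \<and> \<tau>2 \<in> W \<and> nv \<tau>2 \<notin> span {nv \<tau>1}}"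

lemma finite_Xi: "finite Xi"
proof (rule finite_subset)
  show "Xi \<subseteq> (\<lambda>(\<tau>1, \<tau>2). flat {nv \<tau>1, nv \<tau>2}) ` (W \<times> W)" unfolding Xi_def by force
qed (simp add: finite_W)

lemma XiE:
  assumes "\<xi> \<in> Xi"
  obtains \<tau>1 \<tau>2 where "\<tau>1 \<in> W" "\<tau>2 \<in> W" "plane (nv \<tau>1) (nv \<tau>2)" "\<xi> = flat {nv \<tau>1, nv \<tau>2}"
proof -
  obtain \<tau>1 \<tau>2 where "\<xi> = flat {nv \<tau>1, nv \<tau>2}" "\<tau>1 \<in> W" "\<tau>2 \<in> W" "nv \<tau>2 \<notin> span {nv \<tau>1}"
    using assms unfolding Xi_def mem_Collect_eq by (elim exE conjE)
  moreover from this have "plane (nv \<tau>1) (nv \<tau>2)" using normal[OF W_walls] by (simp add: plane_def)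
  ultimately show thesis by (intro that)
qed

text \<open>Both sides have codimension two, so the inclusion forced by the two walls is an
  equality.\<close>

lemma Xi_eq:
  assumes \<xi>: "\<xi> \<in> Xi" and \<tau>: "\<tau>1 \<in> W" "\<tau>2 \<in> W" "thr \<xi> \<tau>1" "thr \<xi> \<tau>2" and ind: "nv \<tau>2 \<notin> span {nv \<tau>1}"
  shows "\<xi> = flat {nv \<tau>1, nv \<tau>2}"
proof -
  obtain \<rho>1 \<rho>2 where \<rho>: "plane (nv \<rho>1) (nv \<rho>2)" "\<xi> = flat {nv \<rho>1, nv \<rho>2}" using XiE[OF \<xi>] .
  have p: "plane (nv \<tau>1) (nv \<tau>2)" using normal[OF W_walls[OF \<tau>(1)]] ind by (simp add: plane_def)
  have "\<xi> \<subseteq> {y. nv \<tau>1 \<bullet> y = 0}" "\<xi> \<subseteq> {y. nv \<tau>2 \<bullet> y = 0}"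
    using \<tau>(3,4) by (simp_all only: thr_def zero_locus_wall[OF W_walls] \<tau>(1,2))
  then have sub: "\<xi> \<subseteq> flat {nv \<tau>1, nv \<tau>2}" by (auto simp: flat_def)
  have "dim (flat {nv \<tau>1, nv \<tau>2}) = dim \<xi>"
    using dim_flat[of "{nv \<tau>1, nv \<tau>2}"] dim_flat[of "{nv \<rho>1, nv \<rho>2}"] plane.dim_uv[OF p] plane.dim_uv[OF \<rho>(1)] \<rho>(2) by simp
  then show ?thesis using sub by (intro subspace_dim_equal) (simp_all add: \<rho>(2) subspace_flat)
qed

abbreviation Om where "Om \<equiv> Sigma Xi (\<lambda>\<xi>. circle_components (G \<xi>))"

lemma finite_components: "finite (components_graph (G \<xi>))"
proof -
  have fin: "finite (fst (G \<xi>))" by (rule finite_subset[OF _ finite_cells]) (simp add: subset_iff G_vertex)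
  have "reach (G \<xi>) \<subseteq> fst (G \<xi>) \<times> fst (G \<xi>)" unfolding reach_def by auto
  then have "finite (fst (G \<xi>) // reach (G \<xi>))" using fin by (rule finite_quotient[rotated])
  then have "finite ((\<lambda>B. (B, {e \<in> snd (G \<xi>). e \<subseteq> B})) ` (fst (G \<xi>) // reach (G \<xi>)))" by (rule finite_imageI)
  then show ?thesis by (rule finite_subset[rotated]) (auto simp: components_graph_def)
qed

lemma circle_component_sub: "\<psi> \<in> circle_components (G \<xi>) \<Longrightarrow> \<psi> \<in> components_graph (G \<xi>)"
  by (simp add: circle_components_def)

lemma finite_circle_components: "finite (circle_components (G \<xi>))"
  by (rule finite_subset[OF _ finite_components[of \<xi>]]) (rule subsetI, rule circle_component_sub)

lemma finite_Om: "finite Om"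
  by (intro finite_SigmaI finite_Xi finite_circle_components)

definition tA :: "(real ^ 'n option) set \<times> (real ^ 'n) set graph \<Rightarrow> (real ^ 'n) set set" where
  "tA \<omega> = {\<tau>. \<exists>\<sigma>\<in>fst (snd \<omega>). \<tau> \<in> T (fst \<omega>) \<sigma>}"

text \<open>One reference row, and below one functional, is fixed per circle so that the recursion
  over a list of circles can refer to them.\<close>

definition tau0 :: "(real ^ 'n option) set \<times> (real ^ 'n) set graph \<Rightarrow> (real ^ 'n) set" where
  "tau0 \<omega> = (SOME \<tau>0. \<exists>\<Phi>. circle_datum (fst \<omega>) (snd \<omega>) (tA \<omega>) \<tau>0 \<Phi>)"

definition Ph :: "(real ^ 'n option) set \<times> (real ^ 'n) set graph
    \<Rightarrow> ((real ^ 'n) set \<Rightarrow> 'n option mpoly) \<Rightarrow> 'n option mpoly" where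
  "Ph \<omega> = (SOME \<Phi>. circle_datum (fst \<omega>) (snd \<omega>) (tA \<omega>) (tau0 \<omega>) \<Phi>)"

abbreviation J where "J \<omega> \<equiv> edge_ideal P l r (fst \<omega>) (snd \<omega>)"

lemma datum:
  assumes "\<omega> \<in> Om"
  shows "circle_datum (fst \<omega>) (snd \<omega>) (tA \<omega>) (tau0 \<omega>) (Ph \<omega>)"
proof -
  have \<omega>: "fst \<omega> \<in> Xi" "snd \<omega> \<in> circle_components (G (fst \<omega>))" using assms by auto
  obtain \<tau>1 \<tau>2 where \<xi>: "fst \<omega> = flat {nv \<tau>1, nv \<tau>2}" using XiE[OF \<omega>(1)] .
  have "\<exists>A \<tau>0 \<Phi>. circle_datum (fst \<omega>) (snd \<omega>) A \<tau>0 \<Phi>"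
  proof (rule degree2_graph.circle_component_cases[OF degree2_G[of "nv \<tau>1" "nv \<tau>2", folded \<xi>], of "snd \<omega>"])
    show "snd \<omega> \<in> components_graph (fst (G (fst \<omega>)), snd (G (fst \<omega>)))"
      using circle_component_sub[OF \<omega>(2)] by simp
    fix w N assume "cycle_enum w N (snd \<omega>)"
    then show ?thesis unfolding \<xi> by (rule circle_datum_exists[OF circle_component_sub[OF \<omega>(2), unfolded \<xi>]])
  next
    assume "snd \<omega> \<notin> circle_components (fst (G (fst \<omega>)), snd (G (fst \<omega>)))"
    then show ?thesis using \<omega>(2) by simp
  qed
  then obtain A \<tau>0 \<Phi> where d: "circle_datum (fst \<omega>) (snd \<omega>) A \<tau>0 \<Phi>" by (elim exE)
  have "A = tA \<omega>" unfolding tA_def by (rule d[unfolded circle_datum_def, THEN conjunct1])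
  then have "\<exists>\<tau>0 \<Phi>. circle_datum (fst \<omega>) (snd \<omega>) (tA \<omega>) \<tau>0 \<Phi>" using d by (intro exI) (simp only:)
  then have "\<exists>\<Phi>. circle_datum (fst \<omega>) (snd \<omega>) (tA \<omega>) (tau0 \<omega>) \<Phi>" unfolding tau0_def by (rule someI_ex)
  then show ?thesis unfolding Ph_def by (rule someI_ex)
qed

lemma datumD:
  assumes "\<omega> \<in> Om"
  shows "tau0 \<omega> \<in> tA \<omega>" "J \<omega> = Idl\<^bsub>poly_ring\<^esub> ((\<lambda>\<tau>. l \<tau> ^ (r + 1)) ` tA \<omega>)"
    "\<And>F F'. Ph \<omega> (F + F') = Ph \<omega> F + Ph \<omega> F'" "\<And>F. F \<in> S \<Longrightarrow> Ph \<omega> F \<in> J \<omega>"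
    "\<And>\<tau> q. \<tau> \<notin> tA \<omega> \<Longrightarrow> Ph \<omega> (unit_at \<tau> q) = 0"
    "\<And>\<tau> q. q \<in> J \<omega> \<Longrightarrow> Ph \<omega> (unit_at \<tau> q) \<in> J \<omega>"
    "\<exists>b. b * b = 1 \<and> (\<forall>q. Ph \<omega> (unit_at (tau0 \<omega>) q) = b * q)"
    "\<And>\<tau>. \<tau> \<in> tA \<omega> \<Longrightarrow> linked (fst \<omega>) (tau0 \<omega>) \<tau>"
    "\<exists>\<tau>1\<in>tA \<omega>. \<exists>\<tau>2\<in>tA \<omega>. nv \<tau>2 \<notin> span {nv \<tau>1}"
proof -
  note d = datum[OF assms, unfolded circle_datum_def, THEN conjunct2]
  note d1 = d[THEN conjunct2] note d2 = d1[THEN conjunct2] note d3 = d2[THEN conjunct2]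
  note d4 = d3[THEN conjunct2] note d5 = d4[THEN conjunct2] note d6 = d5[THEN conjunct2]
  note d7 = d6[THEN conjunct2] note d8 = d7[THEN conjunct2]
  show "tau0 \<omega> \<in> tA \<omega>" by (rule d[THEN conjunct1])
  show "J \<omega> = Idl\<^bsub>poly_ring\<^esub> ((\<lambda>\<tau>. l \<tau> ^ (r + 1)) ` tA \<omega>)" by (rule d1[THEN conjunct1])
  show "Ph \<omega> (F + F') = Ph \<omega> F + Ph \<omega> F'" for F F' by (rule d2[THEN conjunct1, rule_format])
  show "Ph \<omega> F \<in> J \<omega>" if "F \<in> S" for F by (rule d3[THEN conjunct1, rule_format, OF that])
  show "Ph \<omega> (unit_at \<tau> q) = 0" if "\<tau> \<notin> tA \<omega>" for \<tau> q by (rule d4[THEN conjunct1, rule_format, OF that])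
  show "Ph \<omega> (unit_at \<tau> q) \<in> J \<omega>" if "q \<in> J \<omega>" for \<tau> q by (rule d5[THEN conjunct1, rule_format, OF that])
  show "\<exists>b. b * b = 1 \<and> (\<forall>q. Ph \<omega> (unit_at (tau0 \<omega>) q) = b * q)" by (rule d6[THEN conjunct1])
  show "linked (fst \<omega>) (tau0 \<omega>) \<tau>" if "\<tau> \<in> tA \<omega>" for \<tau> by (rule d7[THEN conjunct1, rule_format, OF that])
  show "\<exists>\<tau>1\<in>tA \<omega>. \<exists>\<tau>2\<in>tA \<omega>. nv \<tau>2 \<notin> span {nv \<tau>1}" by (rule d8)
qed

lemma tA_W: "\<tau> \<in> tA \<omega> \<Longrightarrow> \<tau> \<in> W" "\<tau> \<in> tA \<omega> \<Longrightarrow> thr (fst \<omega>) \<tau>"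
  by (auto simp: tA_def T_def)

lemma ideal_J: "\<omega> \<in> Om \<Longrightarrow> ideal (J \<omega>) poly_ring"
  by (simp add: datumD(2) Idl_ideal)

lemma J_base: "\<omega> \<in> Om \<Longrightarrow> \<tau> \<in> tA \<omega> \<Longrightarrow> l \<tau> ^ (r + 1) \<in> J \<omega>"
  unfolding datumD(2) by (rule Idl_base) (rule imageI)

text \<open>Two independent walls of the circle determine its subspace, so they cannot both pass
  through a different \<xi>. One of them contributes its full (r + 1)st power, a generator of the
  ideal, to \<open>sfac \<xi>\<close>.\<close>

lemma sfac_other:
  assumes \<omega>: "\<omega> \<in> Om" and \<xi>: "\<xi> \<in> Xi" "\<xi> \<noteq> fst \<omega>"
  shows "sfac \<xi> \<in> J \<omega>"
proof -
  obtain \<tau>1 \<tau>2 where \<tau>: "\<tau>1 \<in> tA \<omega>" "\<tau>2 \<in> tA \<omega>" "nv \<tau>2 \<notin> span {nv \<tau>1}" using datumD(9)[OF \<omega>] by (elim bexE)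
  have \<omega>1: "fst \<omega> \<in> Xi" using \<omega> by auto
  have "\<not> (thr \<xi> \<tau>1 \<and> thr \<xi> \<tau>2)"
  proof
    assume t: "thr \<xi> \<tau>1 \<and> thr \<xi> \<tau>2"
    have "\<xi> = flat {nv \<tau>1, nv \<tau>2}"
      by (rule Xi_eq[OF \<xi>(1) tA_W(1)[OF \<tau>(1)] tA_W(1)[OF \<tau>(2)] t[THEN conjunct1] t[THEN conjunct2] \<tau>(3)])
    moreover have "fst \<omega> = flat {nv \<tau>1, nv \<tau>2}"
      by (rule Xi_eq[OF \<omega>1 tA_W(1)[OF \<tau>(1)] tA_W(1)[OF \<tau>(2)] tA_W(2)[OF \<tau>(1)] tA_W(2)[OF \<tau>(2)] \<tau>(3)])
    ultimately show False using \<xi>(2) by simp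
  qed
  then obtain \<tau> where t: "\<tau> \<in> tA \<omega>" "\<not> thr \<xi> \<tau>" using \<tau>(1,2) by blast
  obtain q where "sfac \<xi> = l \<tau> ^ (r + 1) * q" using sfac_dvd[OF tA_W(1)[OF t(1)] t(2)] by (elim dvdE)
  then show ?thesis using idealD(4)[OF ideal_J[OF \<omega>] J_base[OF \<omega> t(1)], of q] by (simp only:)
qed

text \<open>Two cells sharing a wall through \<xi> are joined by an edge of the graph, so the wall
  cannot belong to two components.\<close>

lemma tA_disjoint:
  assumes \<xi>: "\<xi> \<in> Xi" and comp: "\<psi> \<in> components_graph (G \<xi>)" "\<psi>' \<in> components_graph (G \<xi>)"
    and \<tau>: "\<tau> \<in> tA (\<xi>, \<psi>)" "\<tau> \<in> tA (\<xi>, \<psi>')"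
  shows "\<psi> = \<psi>'"
proof -
  obtain \<tau>1 \<tau>2 where x: "\<xi> = flat {nv \<tau>1, nv \<tau>2}" using XiE[OF \<xi>] .
  interpret D: degree2_graph "fst (G \<xi>)" "snd (G \<xi>)" unfolding x by (rule degree2_G)
  obtain B where B: "\<psi> = (B, {e \<in> snd (G \<xi>). e \<subseteq> B})" "B \<in> fst (G \<xi>) // reach (G \<xi>)"
    using comp(1) unfolding components_graph_def mem_Collect_eq by (elim exE conjE)
  obtain B' where B': "\<psi>' = (B', {e \<in> snd (G \<xi>). e \<subseteq> B'})" "B' \<in> fst (G \<xi>) // reach (G \<xi>)"
    using comp(2) unfolding components_graph_def mem_Collect_eq by (elim exE conjE)
  have q: "B \<in> fst (G \<xi>) // reach (fst (G \<xi>), snd (G \<xi>))" "B' \<in> fst (G \<xi>) // reach (fst (G \<xi>), snd (G \<xi>))"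
    using B(2) B'(2) by simp_all
  obtain \<sigma> where s: "\<sigma> \<in> B" "\<tau> \<in> T \<xi> \<sigma>" using \<tau>(1) unfolding tA_def fst_conv snd_conv B(1) mem_Collect_eq by (elim bexE)
  obtain \<sigma>' where s': "\<sigma>' \<in> B'" "\<tau> \<in> T \<xi> \<sigma>'" using \<tau>(2) unfolding tA_def fst_conv snd_conv B'(1) mem_Collect_eq by (elim bexE)
  have "\<sigma>' \<in> B"
  proof (cases "\<sigma> = \<sigma>'")
    case False
    have "\<sigma> \<in> fst (G \<xi>)" "\<sigma>' \<in> fst (G \<xi>)"
      using D.component_subset[OF q(1)] D.component_subset[OF q(2)] s(1) s'(1) by (simp_all only: subset_iff)
    then have C: "\<sigma> \<in> C" "\<sigma>' \<in> C" by (simp_all add: G_vertex)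
    have "{\<sigma>, \<sigma>'} \<in> snd (G \<xi>)"
      unfolding G_edge using C False s(2) s'(2) by (intro exI[of _ \<sigma>] exI[of _ \<sigma>'] exI[of _ \<tau>]) (simp add: T_def)
    then show ?thesis by (rule D.component_closed[OF q(1) s(1)])
  qed (use s in simp)
  then have "B \<subseteq> B'" "B' \<subseteq> B"
    using D.component_minimal[OF q(1) _ s'(1) D.component_closed[OF q(2)]]
      D.component_minimal[OF q(2) s'(1) _ D.component_closed[OF q(1)]] by simp_all
  then show ?thesis by (simp add: B(1) B'(1))
qed

text \<open>The component of a cell with facet \<tau> is a path, along which rows die, or a
  circle.\<close>

lemma dead_or_circle:
  assumes \<xi>: "\<xi> \<in> Xi" and \<tau>: "\<tau> \<in> W" "thr \<xi> \<tau>"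
  shows "dead \<xi> \<tau> \<or> (\<exists>\<psi>. (\<xi>, \<psi>) \<in> Om \<and> \<tau> \<in> tA (\<xi>, \<psi>))"
proof -
  obtain \<tau>1 \<tau>2 where x: "\<xi> = flat {nv \<tau>1, nv \<tau>2}" using XiE[OF \<xi>] .
  obtain \<sigma> where \<sigma>: "\<sigma> \<in> C" "\<tau> facet_of \<sigma>" using W_cell[OF \<tau>(1)] .
  define B where "B = reach (G \<xi>) `` {\<sigma>}"
  define \<psi> where "\<psi> = (B, {e \<in> snd (G \<xi>). e \<subseteq> B})"
  have v: "\<sigma> \<in> fst (G \<xi>)" unfolding G_vertex using \<sigma> \<tau>(2) by (intro conjI exI[of _ \<tau>])
  have "B \<in> fst (G \<xi>) // reach (G \<xi>)" unfolding B_def by (rule quotientI[OF v])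
  then have comp: "\<psi> \<in> components_graph (G \<xi>)" unfolding components_graph_def \<psi>_def by (intro CollectI exI[of _ B] conjI refl)
  have "\<sigma> \<in> B" unfolding B_def reach_def using v by simp
  then have \<sigma>\<psi>: "\<sigma> \<in> fst \<psi>" by (simp add: \<psi>_def)
  have T: "\<tau> \<in> T \<xi> \<sigma>" using \<sigma> \<tau> by (simp add: T_def)
  show ?thesis
  proof (rule degree2_graph.circle_component_cases[OF degree2_G[of "nv \<tau>1" "nv \<tau>2", folded x], of \<psi>])
    show "\<psi> \<in> components_graph (fst (G \<xi>), snd (G \<xi>))" using comp by simp
    assume "\<psi> \<in> circle_components (fst (G \<xi>), snd (G \<xi>))"
    then have "(\<xi>, \<psi>) \<in> Om" using \<xi> by simp
    moreover have "\<tau> \<in> tA (\<xi>, \<psi>)" unfolding tA_def using T \<sigma>\<psi> by (intro CollectI bexI[of _ \<sigma>]) simp_all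
    ultimately show ?thesis by (intro disjI2 exI conjI)
  next
    fix w N assume "path_enum w N \<psi>"
    then have "dead \<xi> \<tau>"
      unfolding x by (rule path_component_dead[OF comp[unfolded x] _ T[unfolded x] \<sigma>\<psi>])
    then show ?thesis by (rule disjI1)
  qed
qed

abbreviation E :: "(real ^ 'n option) set \<Rightarrow> int" where "E \<xi> \<equiv> int (length (missing \<xi>))"

text \<open>Adjoining to the image of \<open>\<phi>\<close>, for each circle, the multiples of \<open>sfac \<xi>\<close> in one wall of that circle.\<close>

primrec SL :: "((real ^ 'n option) set \<times> (real ^ 'n) set graph) list \<Rightarrow> int
    \<Rightarrow> ((real ^ 'n) set \<Rightarrow> 'n option mpoly) set" where
  "SL [] k = Sk k"
| "SL (\<omega> # \<omega>s) k = {s + unit_at (tau0 \<omega>) (sfac (fst \<omega>) * p) | s p. s \<in> SL \<omega>s k \<and> p \<in> forms (k - E (fst \<omega>))}"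

lemma tau0_W: "\<omega> \<in> Om \<Longrightarrow> tau0 \<omega> \<in> W"
  by (rule tA_W(1)[OF datumD(1)])

lemma gfam_SL: "set \<omega>s \<subseteq> Om \<Longrightarrow> gfam W (SL \<omega>s)"
proof (induction \<omega>s)
  case Nil
  have "SL [] = Sk" by (rule ext) (simp only: SL.simps)
  then show ?case by (simp only: gfam_Sk)
next
  case (Cons \<omega> \<omega>s)
  have 1: "\<omega> \<in> Om" and 2: "set \<omega>s \<subseteq> Om" using Cons.prems by simp_all
  have "SL (\<omega> # \<omega>s) = (\<lambda>k. {s + unit_at (tau0 \<omega>) (sfac (fst \<omega>) * p) | s p. s \<in> SL \<omega>s k \<and> p \<in> forms (k - E (fst \<omega>))})"
    by (rule ext) (simp only: SL.simps)
  then show ?case by (simp only: gfam_add_line[OF Cons.IH[OF 2] tau0_W[OF 1] sfac_forms])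
qed

lemma SL_Cons_mono: "SL \<omega>s k \<subseteq> SL (\<omega> # \<omega>s) k"
proof
  fix s assume s: "s \<in> SL \<omega>s k"
  have "s = s + unit_at (tau0 \<omega>) (sfac (fst \<omega>) * 0)" by simp
  then show "s \<in> SL (\<omega> # \<omega>s) k" unfolding SL.simps using s subspace_0[OF subspace_forms]
    by (intro CollectI exI[of _ s] exI[of _ 0] conjI)
qed

lemma Sk_SL: "Sk k \<subseteq> SL \<omega>s k"
proof (induction \<omega>s)
  case (Cons \<omega> \<omega>s)
  then show ?case using SL_Cons_mono[of \<omega>s k \<omega>] by (rule order_trans)
qed simp

lemma SL_unit:
  "set \<omega>s \<subseteq> Om \<Longrightarrow> \<omega> \<in> set \<omega>s \<Longrightarrow> p \<in> forms (k - E (fst \<omega>)) \<Longrightarrow> unit_at (tau0 \<omega>) (sfac (fst \<omega>) * p) \<in> SL \<omega>s k"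
proof (induction \<omega>s)
  case (Cons \<omega>' \<omega>s)
  have 2: "set \<omega>s \<subseteq> Om" using Cons.prems by simp
  show ?case
  proof (cases "\<omega> = \<omega>'")
    case True
    have "unit_at (tau0 \<omega>) (sfac (fst \<omega>) * p) = 0 + unit_at (tau0 \<omega>) (sfac (fst \<omega>) * p)" by simp
    moreover have "0 \<in> SL \<omega>s k" by (rule subspace_0[OF gfamD(1)[OF gfam_SL[OF 2]]])
    ultimately show ?thesis unfolding True SL.simps using Cons.prems(3) True
      by (intro CollectI exI[of _ 0] exI[of _ p] conjI) simp_all
  next
    case False
    then have "unit_at (tau0 \<omega>) (sfac (fst \<omega>) * p) \<in> SL \<omega>s k" using Cons.IH[OF 2] Cons.prems by simp
    then show ?thesis using SL_Cons_mono by (rule subsetD[rotated])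
  qed
qed simp

text \<open>The functional of one circle ignores, modulo its ideal, the generators adjoined for
  other circles. At another subspace the factor \<open>sfac\<close> lies in the ideal; at the same
  subspace the other reference wall lies off \<open>tA \<omega>\<close>. This keeps the
  contributions of the circles independent.\<close>

lemma Ph_SL:
  assumes \<omega>: "\<omega> \<in> Om"
  shows "set \<omega>s \<subseteq> Om \<Longrightarrow> \<omega> \<notin> set \<omega>s \<Longrightarrow> F \<in> SL \<omega>s k \<Longrightarrow> Ph \<omega> F \<in> J \<omega>"
proof (induction \<omega>s arbitrary: F)
  case Nil
  then show ?case using datumD(4)[OF \<omega>] by (simp add: Sk_def)
next
  case (Cons \<omega>' \<omega>s)
  have 1: "\<omega>' \<in> Om" "\<omega>' \<noteq> \<omega>" "set \<omega>s \<subseteq> Om" "\<omega> \<notin> set \<omega>s" using Cons.prems by auto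
  obtain s p where F: "F = s + unit_at (tau0 \<omega>') (sfac (fst \<omega>') * p)" "s \<in> SL \<omega>s k"
    using Cons.prems(3) unfolding SL.simps mem_Collect_eq by (elim exE conjE)
  have "Ph \<omega> (unit_at (tau0 \<omega>') (sfac (fst \<omega>') * p)) \<in> J \<omega>"
  proof (cases "fst \<omega>' = fst \<omega>")
    case False
    have "fst \<omega>' \<in> Xi" using 1(1) by auto
    then show ?thesis using idealD(4)[OF ideal_J[OF \<omega>] sfac_other[OF \<omega> _ False]] datumD(6)[OF \<omega>] by simp
  next
    case True
    have "tau0 \<omega>' \<notin> tA \<omega>"
    proof
      assume t: "tau0 \<omega>' \<in> tA \<omega>"
      have x: "fst \<omega> \<in> Xi" using \<omega> by auto
      have c: "snd \<omega> \<in> components_graph (G (fst \<omega>))" "snd \<omega>' \<in> components_graph (G (fst \<omega>))"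
        using \<omega> 1(1) True circle_component_sub by (metis SigmaE fst_conv snd_conv)+
      have "snd \<omega> = snd \<omega>'"
      proof (rule tA_disjoint[OF x c])
        show "tau0 \<omega>' \<in> tA (fst \<omega>, snd \<omega>)" using t by simp
        show "tau0 \<omega>' \<in> tA (fst \<omega>, snd \<omega>')" using datumD(1)[OF 1(1)] True[symmetric] by simp
      qed
      then show False using 1(2) True by (simp add: prod_eq_iff)
    qed
    then show ?thesis using datumD(5)[OF \<omega>] idealD(1)[OF ideal_J[OF \<omega>]] by simp
  qed
  moreover have "Ph \<omega> s \<in> J \<omega>" by (rule Cons.IH[OF 1(3,4) F(2)])
  ultimately show ?case unfolding F(1) datumD(3)[OF \<omega>] by (intro idealD(2)[OF ideal_J[OF \<omega>]])
qed

end

lemma prod_list_replicate_lin: "prod_list (map lin (replicate m a)) = lin a ^ m"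
  by (induction m) simp_all

lemma kills_ideal_family:
  fixes I :: "'x::finite mpoly set"
  assumes id: "ideal I poly_ring" and V: "\<And>k. I \<inter> forms k \<subseteq> V k" and m: "lin a ^ m \<in> I"
  shows "kills {()} (ufam V) (replicate m a)"
proof (rule kills_ufam)
  fix k and p :: "'x mpoly" assume p: "p \<in> forms k"
  have "lin a ^ m * p \<in> I" by (rule idealD(4)[OF id m])
  moreover have "lin a ^ m * p \<in> forms (k + int m)"
    using forms_mult[OF forms_power[OF lin_forms[of a], of m] p] by (simp add: add.commute)
  ultimately have "lin a ^ m * p \<in> V (k + int m)" using V[of "k + int m"] by blast
  then show "prod_list (map lin (replicate m a)) * p \<in> V (k + int (length (replicate m a)))"
    unfolding prod_list_replicate_lin length_replicate .
qed

context spline_complex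
begin

lemma missing_not_span:
  assumes "c \<in> set (missing (flat A))"
  shows "c \<noteq> 0" "c \<notin> span A" "\<exists>\<tau>\<in>W. c = nv \<tau>"
proof -
  obtain \<tau> where \<tau>: "\<tau> \<in> W" "\<not> thr (flat A) \<tau>" "c = nv \<tau>" using assms unfolding set_missing by blast
  show "c \<noteq> 0" using normal[OF W_walls[OF \<tau>(1)]] \<tau>(3) by simp
  show "c \<notin> span A" using \<tau>(2,3) thr_flat[OF W_walls[OF \<tau>(1)]] by simp
  show "\<exists>\<tau>\<in>W. c = nv \<tau>" using \<tau>(1,3) by (intro bexI)
qed

text \<open>Two independent normals of the circle in the form required by the growth lemmas: powers
  of both forms lie in the ideal, and their flat is the subspace of the circle.\<close>

lemma J_generators:
  assumes \<omega>: "\<omega> \<in> Om"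
  obtains u v where "fst \<omega> = flat {u, v}" "u \<noteq> 0" "v \<noteq> 0" "v \<notin> span {u}" "u \<notin> span {v}"
    "u \<in> nv ` tA \<omega>" "v \<in> nv ` tA \<omega>" "lin u ^ (r + 1) \<in> J \<omega>" "lin v ^ (r + 1) \<in> J \<omega>"
proof -
  obtain \<tau>1 \<tau>2 where \<tau>: "\<tau>1 \<in> tA \<omega>" "\<tau>2 \<in> tA \<omega>" "nv \<tau>2 \<notin> span {nv \<tau>1}" using datumD(9)[OF \<omega>] by (elim bexE)
  have \<omega>1: "fst \<omega> \<in> Xi" using \<omega> by auto
  note w = W_walls[OF tA_W(1)[OF \<tau>(1)]] W_walls[OF tA_W(1)[OF \<tau>(2)]]
  have n: "nv \<tau>1 \<noteq> 0" "nv \<tau>2 \<noteq> 0" using normal w by simp_all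
  have "nv \<tau>1 \<notin> span {nv \<tau>2}"
  proof
    assume "nv \<tau>1 \<in> span {nv \<tau>2}"
    then obtain k where k: "nv \<tau>1 = k *\<^sub>R nv \<tau>2" unfolding span_singleton by blast
    then have "nv \<tau>2 = (1 / k) *\<^sub>R nv \<tau>1" using n(1) by (cases "k = 0") simp_all
    then have "nv \<tau>2 \<in> span {nv \<tau>1}" unfolding span_singleton by blast
    then show False using \<tau>(3) by simp
  qed
  moreover have "fst \<omega> = flat {nv \<tau>1, nv \<tau>2}"
    by (rule Xi_eq[OF \<omega>1 tA_W(1)[OF \<tau>(1)] tA_W(1)[OF \<tau>(2)] tA_W(2)[OF \<tau>(1)] tA_W(2)[OF \<tau>(2)] \<tau>(3)])
  ultimately show thesis
    using that[of "nv \<tau>1" "nv \<tau>2"] n \<tau> J_base[OF \<omega> \<tau>(1)] J_base[OF \<omega> \<tau>(2)] l_lin[OF w(1)] l_lin[OF w(2)] by simp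
qed

text \<open>Powers of two independent forms lie in the ideal, and the ring has d + 1 variables,
  whence the exponent d - 1.\<close>

lemma small_J:
  assumes \<omega>: "\<omega> \<in> Om"
  shows "small (CARD('n option) - 2) (ideal_codim (J \<omega>))"
proof -
  obtain u v where uv: "fst \<omega> = flat {u, v}" "u \<noteq> 0" "v \<noteq> 0" "v \<notin> span {u}" "u \<notin> span {v}"
    "u \<in> nv ` tA \<omega>" "v \<in> nv ` tA \<omega>" "lin u ^ (r + 1) \<in> J \<omega>" "lin v ^ (r + 1) \<in> J \<omega>"
    by (rule J_generators[OF \<omega>])
  note id = ideal_J[OF \<omega>]
  have "small (CARD('n option) - 2) (codim {()} (ufam (\<lambda>k. J \<omega> \<inter> forms k)))"
  proof (rule small_two[OF _ gfam_ideal[OF id] kills_ideal_family[OF id order_refl uv(8)]])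
    fix a assume "a \<in> set (replicate (r + 1) u)"
    then have a: "a = u" by auto
    have "kills {()} (ufam (\<lambda>k. J \<omega> \<inter> forms k)) (replicate (r + 1) v)"
      by (rule kills_ideal_family[OF id order_refl uv(9)])
    then show "a \<noteq> 0 \<and> (\<exists>bs. kills {()} (ufam (\<lambda>k. J \<omega> \<inter> forms k)) bs \<and> (\<forall>b\<in>set bs. b \<notin> span {a}))"
      using uv(2,4) a by (intro conjI exI[of _ "replicate (r + 1) v"]) simp_all
  qed simp
  moreover have "ideal_codim (J \<omega>) = codim {()} (ufam (\<lambda>k. J \<omega> \<inter> forms k))"
    by (rule ext) (rule ideal_codim_eq[OF id])
  ultimately show ?thesis by (simp only:)
qed

text \<open>By \<open>small_J\<close> the Hilbert polynomial of the quotient has degree at most d -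
  2, so shifting the degree by \<open>e\<close> affects only lower coefficients.\<close>

lemma small_J_shift:
  assumes \<omega>: "\<omega> \<in> Om" and d: "2 \<le> CARD('n)"
  shows "small (CARD('n) - 2) (\<lambda>k. ideal_codim (J \<omega>) k - ideal_codim (J \<omega>) (k - int e))"
proof -
  obtain p K where p: "\<And>k. k \<ge> K \<Longrightarrow> ideal_codim (J \<omega>) (int k) = poly p (real k)"
    using evpolyE[OF evpoly_ideal_codim[OF ideal_J[OF \<omega>]]] by blast
  have "CARD('n option) - 2 = Suc (CARD('n) - 2)" using d by (simp add: card_UNIV_option)
  then have "small (Suc (CARD('n) - 2)) (ideal_codim (J \<omega>))" using small_J[OF \<omega>] by (simp only:)
  from small_poly_degree[OF this p] have "degree p \<le> CARD('n) - 2" .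
  then show ?thesis using p by (rule small_poly_shift)
qed

text \<open>The degree pieces of I + (s), with I the ideal of the circle and s its
  \<open>sfac\<close>. The quotient R/(I + (s)) measures the error made when I is replaced by (I :
  s).\<close>

definition JD :: "(real ^ 'n option) set \<times> (real ^ 'n) set graph \<Rightarrow> int \<Rightarrow> 'n option mpoly set" where
  "JD \<omega> k = {j + sfac (fst \<omega>) * p | j p. j \<in> J \<omega> \<inter> forms k \<and> p \<in> forms (k - E (fst \<omega>))}"

lemma JD_facts:
  assumes \<omega>: "\<omega> \<in> Om"
  shows "subspace (JD \<omega> k)" "JD \<omega> k \<subseteq> forms k" "J \<omega> \<inter> forms k \<subseteq> JD \<omega> k"
    "p \<in> JD \<omega> k \<Longrightarrow> X i * p \<in> JD \<omega> (k + 1)"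
    "p \<in> forms (k - E (fst \<omega>)) \<Longrightarrow> sfac (fst \<omega>) * p \<in> JD \<omega> k"
proof -
  note id = ideal_J[OF \<omega>]
  show "subspace (JD \<omega> k)"
    unfolding JD_def by (rule subspace_add_image[OF linear_mult subspace_ideal_forms[OF id] subspace_forms])
  have sf: "sfac (fst \<omega>) * p \<in> forms k" if "p \<in> forms (k - E (fst \<omega>))" for p k
    using forms_mult[OF sfac_forms that, of "fst \<omega>"] by simp
  show "JD \<omega> k \<subseteq> forms k"
  proof
    fix q assume "q \<in> JD \<omega> k"
    then obtain j p where q: "q = j + sfac (fst \<omega>) * p" "j \<in> J \<omega> \<inter> forms k" "p \<in> forms (k - E (fst \<omega>))"
      unfolding JD_def mem_Collect_eq by (elim exE conjE)
    show "q \<in> forms k" unfolding q(1) by (rule subspace_add[OF subspace_forms IntD2[OF q(2)] sf[OF q(3)]])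
  qed
  show "J \<omega> \<inter> forms k \<subseteq> JD \<omega> k"
  proof
    fix j assume j: "j \<in> J \<omega> \<inter> forms k"
    have "j = j + sfac (fst \<omega>) * 0" by simp
    then show "j \<in> JD \<omega> k" unfolding JD_def using j subspace_0[OF subspace_forms]
      by (intro CollectI exI[of _ j] exI[of _ 0] conjI)
  qed
  show "sfac (fst \<omega>) * p \<in> JD \<omega> k" if "p \<in> forms (k - E (fst \<omega>))"
  proof -
    have "sfac (fst \<omega>) * p = 0 + sfac (fst \<omega>) * p" by simp
    then show ?thesis unfolding JD_def using that subspace_0[OF subspace_ideal_forms[OF id]]
      by (intro CollectI exI[of _ 0] exI[of _ p] conjI)
  qed
  show "X i * p \<in> JD \<omega> (k + 1)" if p: "p \<in> JD \<omega> k"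
  proof -
    obtain j q where q: "p = j + sfac (fst \<omega>) * q" "j \<in> J \<omega> \<inter> forms k" "q \<in> forms (k - E (fst \<omega>))"
      using p unfolding JD_def mem_Collect_eq by (elim exE conjE)
    have "X i * p = X i * j + sfac (fst \<omega>) * (X i * q)" unfolding q(1) by (simp add: distrib_left mult.left_commute)
    moreover have "X i * j \<in> J \<omega> \<inter> forms (k + 1)"
      by (rule IntI[OF idealD(3)[OF id IntD1[OF q(2)]] X_mult_forms[OF IntD2[OF q(2)]]])
    moreover have "X i * q \<in> forms (k + 1 - E (fst \<omega>))" using X_mult_forms[OF q(3), of i] by (simp add: algebra_simps)
    ultimately show ?thesis unfolding JD_def by (intro CollectI exI[of _ "X i * j"] exI[of _ "X i * q"] conjI)
  qed
qed

text \<open>The ideal supplies powers of \<open>u\<close> and \<open>v\<close>, and the factors of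
  \<open>sfac\<close> are forms outside their span, so \<open>small_three\<close> applies in d + 1
  variables.\<close>

lemma small_JD:
  assumes \<omega>: "\<omega> \<in> Om"
  shows "small (CARD('n option) - 3) (codim {()} (ufam (JD \<omega>)))"
proof -
  obtain u v where uv: "fst \<omega> = flat {u, v}" "u \<noteq> 0" "v \<noteq> 0" "v \<notin> span {u}" "u \<notin> span {v}"
    "u \<in> nv ` tA \<omega>" "v \<in> nv ` tA \<omega>" "lin u ^ (r + 1) \<in> J \<omega>" "lin v ^ (r + 1) \<in> J \<omega>"
    by (rule J_generators[OF \<omega>])
  note id = ideal_J[OF \<omega>] and f = JD_facts[OF \<omega>]
  let ?S = "ufam (JD \<omega>)"
  have ks: "kills {()} ?S (replicate (r + 1) u)" "kills {()} ?S (replicate (r + 1) v)"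
    by (rule kills_ideal_family[OF id f(3) uv(8)], rule kills_ideal_family[OF id f(3) uv(9)])
  have km: "kills {()} ?S (missing (fst \<omega>))"
  proof (rule kills_ufam)
    fix k and p :: "'n option mpoly" assume "p \<in> forms k"
    then have "sfac (fst \<omega>) * p \<in> JD \<omega> (k + E (fst \<omega>))" by (intro f(5)) simp
    then show "prod_list (map lin (missing (fst \<omega>))) * p \<in> JD \<omega> (k + E (fst \<omega>))" by (simp only: sfac_def)
  qed
  show ?thesis
  proof (rule small_three[OF _ gfam_ufam[OF f(1) f(2) f(4)] ks(1)])
    fix a assume "a \<in> set (replicate (r + 1) u)"
    then have a: "a = u" by auto
    have "\<forall>c\<in>set (missing (fst \<omega>)). c \<notin> span {u, v}" using missing_not_span(2) unfolding uv(1) by (intro ballI)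
    then have "\<exists>cs. kills {()} ?S cs \<and> (\<forall>c\<in>set cs. c \<notin> span {u, v})" using km by (intro exI conjI)
    then have "\<forall>b\<in>set (replicate (r + 1) v). b \<notin> span {u} \<and> (\<exists>cs. kills {()} ?S cs \<and> (\<forall>c\<in>set cs. c \<notin> span {u, b}))"
      using uv(4) by simp
    then show "a \<noteq> 0 \<and> (\<exists>bs. kills {()} ?S bs \<and> (\<forall>b\<in>set bs. b \<notin> span {a} \<and>
        (\<exists>cs. kills {()} ?S cs \<and> (\<forall>c\<in>set cs. c \<notin> span {a, b}))))"
      unfolding a using uv(2) ks(2) by (intro conjI exI[of _ "replicate (r + 1) v"])
  qed simp
qed

text \<open>Each generator of the ideal kills the row of its own wall, and every row of the circle
  is linked to the reference row.\<close>

lemma J_kills_tau0: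
  assumes \<omega>: "\<omega> \<in> Om" and p: "p \<in> J \<omega>"
  shows "unit_at (tau0 \<omega>) (sfac (fst \<omega>) * p) \<in> S"
proof -
  let ?I = "{p. unit_at (tau0 \<omega>) (sfac (fst \<omega>) * p) \<in> S}"
  have "ideal ?I poly_ring"
    unfolding ideal_poly_ring_iff
  proof (intro conjI ballI allI)
    show "0 \<in> ?I" by (simp add: subspace_0[OF subspace_S])
    fix p assume p: "p \<in> ?I"
    show "p + q \<in> ?I" if "q \<in> ?I" for q
      using subspace_add[OF subspace_S, of "unit_at (tau0 \<omega>) (sfac (fst \<omega>) * p)" "unit_at (tau0 \<omega>) (sfac (fst \<omega>) * q)"] p that
      by (simp add: distrib_left unit_at_add)
    show "q * p \<in> ?I" for q
      using S_pmul[of "unit_at (tau0 \<omega>) (sfac (fst \<omega>) * p)" q] p by (simp add: pmul_unit_at mult.left_commute)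
  qed
  moreover have "(\<lambda>\<tau>. l \<tau> ^ (r + 1)) ` tA \<omega> \<subseteq> ?I"
  proof
    fix q assume "q \<in> (\<lambda>\<tau>. l \<tau> ^ (r + 1)) ` tA \<omega>"
    then obtain \<tau> where \<tau>: "\<tau> \<in> tA \<omega>" "q = l \<tau> ^ (r + 1)" by (elim imageE)
    obtain c where c: "c * c = 1"
      "\<And>p. unit_at \<tau> (sfac (fst \<omega>) * p) - unit_at (tau0 \<omega>) (sfac (fst \<omega>) * (c * p)) \<in> S"
      using datumD(8)[OF \<omega> \<tau>(1)] unfolding linked_def by (elim exE conjE) simp
    have "unit_at \<tau> (sfac (fst \<omega>) * (c * q)) \<in> S"
      using S_wall[OF tA_W(1)[OF \<tau>(1)], of "sfac (fst \<omega>) * c"] unfolding \<tau>(2) by (simp only: mult_ac)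
    from subspace_diff[OF subspace_S this c(2)[of "c * q"]]
    have "unit_at (tau0 \<omega>) (sfac (fst \<omega>) * (c * (c * q))) \<in> S" by simp
    moreover have "c * (c * q) = q" using c(1) by (simp only: mult.assoc[symmetric] mult_1)
    ultimately show "q \<in> ?I" by simp
  qed
  ultimately have "J \<omega> \<subseteq> ?I" unfolding datumD(2)[OF \<omega>] by (rule Idl_minimal)
  then show ?thesis using p by blast
qed

lemma J_of_SL:
  assumes \<omega>: "\<omega> \<in> Om" and \<omega>s: "set \<omega>s \<subseteq> Om" "\<omega> \<notin> set \<omega>s" and q: "unit_at (tau0 \<omega>) q \<in> SL \<omega>s k"
  shows "q \<in> J \<omega>"
proof -
  obtain b where b: "b * b = 1" "\<forall>q. Ph \<omega> (unit_at (tau0 \<omega>) q) = b * q" using datumD(7)[OF \<omega>] by (elim exE conjE)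
  have "b * q \<in> J \<omega>" using Ph_SL[OF \<omega> \<omega>s q] b(2) by simp
  then have "b * (b * q) \<in> J \<omega>" by (rule idealD(3)[OF ideal_J[OF \<omega>]])
  moreover have "b * (b * q) = q" using b(1) by (simp only: mult.assoc[symmetric] mult_1)
  ultimately show ?thesis by simp
qed

text \<open>With I the ideal of the circle and s its \<open>sfac\<close>, the relations
  \<open>?K\<close> on the new generator lie between I and (I : s). The lower inclusion is
  \<open>J_kills_tau0\<close>, the upper one comes from the functional by \<open>J_of_SL\<close>.
  Counting with I gives the first bound; counting with (I : s), through the sequence for I + (s),
  gives the second.\<close>

lemma codim_SL_step:
  assumes \<omega>: "\<omega> \<in> Om" and \<omega>s: "set \<omega>s \<subseteq> Om" "\<omega> \<notin> set \<omega>s"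
  shows "codim W (SL \<omega>s) k - codim W (SL (\<omega> # \<omega>s)) k \<le> ideal_codim (J \<omega>) (k - E (fst \<omega>))"
    and "ideal_codim (J \<omega>) k - codim {()} (ufam (JD \<omega>)) k \<le> codim W (SL \<omega>s) k - codim W (SL (\<omega> # \<omega>s)) k"
proof -
  note id = ideal_J[OF \<omega>]
  let ?s = "sfac (fst \<omega>)" and ?F = "forms (k - E (fst \<omega>)) :: 'n option mpoly set"
  let ?K = "{p \<in> ?F. unit_at (tau0 \<omega>) (?s * p) \<in> SL \<omega>s k}" and ?L = "{p \<in> ?F. ?s * p \<in> J \<omega> \<inter> forms k}"
  have lin: "linear (\<lambda>p. unit_at (tau0 \<omega>) (?s * p))"
    using linear_compose[OF linear_mult[of ?s] linear_unit_at[of "tau0 \<omega>"]] by (simp only: o_def)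
  have step: "dim (SL (\<omega> # \<omega>s) k) + dim ?K = dim (SL \<omega>s k) + dim ?F"
    unfolding SL.simps by (rule dim_add_image[OF lin gfamD(1)[OF gfam_SL[OF \<omega>s(1)]] findim_gfam[OF finite_W gfam_SL[OF \<omega>s(1)]] subspace_forms findim_forms])
  have JL: "dim (JD \<omega> k) + dim ?L = dim (J \<omega> \<inter> forms k) + dim ?F"
    unfolding JD_def by (rule dim_add_image[OF linear_mult subspace_ideal_forms[OF id] findim_ideal_forms subspace_forms findim_forms])
  have subK: "subspace ?K" by (rule subspace_preimage[OF lin gfamD(1)[OF gfam_SL[OF \<omega>s(1)]] subspace_forms])
  have subL: "subspace ?L" by (rule subspace_preimage[OF linear_mult subspace_ideal_forms[OF id] subspace_forms])
  have sf: "?s * p \<in> forms k" if "p \<in> ?F" for p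
    using forms_mult[OF sfac_forms that, of "fst \<omega>"] by simp
  have "J \<omega> \<inter> ?F \<subseteq> ?K"
  proof
    fix p assume p: "p \<in> J \<omega> \<inter> ?F"
    have "unit_at (tau0 \<omega>) (?s * p) \<in> S" by (rule J_kills_tau0[OF \<omega> IntD1[OF p]])
    moreover have "unit_at (tau0 \<omega>) (?s * p) \<in> free_forms W k"
      using sf[OF IntD2[OF p]] tau0_W[OF \<omega>] subspace_0[OF subspace_forms] by (intro prod_spaceI) (auto simp: unit_at_def)
    ultimately have "unit_at (tau0 \<omega>) (?s * p) \<in> SL \<omega>s k" using Sk_SL[of k \<omega>s] unfolding Sk_def by blast
    then show "p \<in> ?K" using p by simp
  qed
  then have "dim (J \<omega> \<inter> ?F) \<le> dim ?K"
    by (rule dim_mono_findim[OF findim_subset[OF findim_forms Collect_subset] subspace_ideal_forms[OF id]])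
  then show "codim W (SL \<omega>s) k - codim W (SL (\<omega> # \<omega>s)) k \<le> ideal_codim (J \<omega>) (k - E (fst \<omega>))"
    using step unfolding codim_def ideal_codim_def by linarith
  have "?K \<subseteq> ?L"
  proof
    fix p assume "p \<in> ?K"
    then have p: "p \<in> ?F" "unit_at (tau0 \<omega>) (?s * p) \<in> SL \<omega>s k" by simp_all
    show "p \<in> ?L" using p(1) sf[OF p(1)] J_of_SL[OF \<omega> \<omega>s p(2)] by simp
  qed
  then have "dim ?K \<le> dim ?L"
    by (rule dim_mono_findim[OF findim_subset[OF findim_forms Collect_subset] subK])
  moreover have "codim {()} (ufam (JD \<omega>)) k = real (dim (forms k :: 'n option mpoly set)) - real (dim (JD \<omega> k))"
    by (rule codim_ufam[OF JD_facts(1,2)[OF \<omega>]])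
  ultimately show "ideal_codim (J \<omega>) k - codim {()} (ufam (JD \<omega>)) k \<le> codim W (SL \<omega>s) k - codim W (SL (\<omega> # \<omega>s)) k"
    using step JL unfolding codim_def ideal_codim_def by linarith
qed

text \<open>The bounds of \<open>codim_SL_step\<close> differ from the Hilbert function of R/I by a
  degree shift on one side and by the Hilbert function of R/(I + (s)) on the other, and both are
  negligible.\<close>

lemma small_SL_step:
  assumes d: "2 \<le> CARD('n)" and \<omega>: "\<omega> \<in> Om" and \<omega>s: "set \<omega>s \<subseteq> Om" "\<omega> \<notin> set \<omega>s"
  shows "small (CARD('n) - 2) (\<lambda>k. codim W (SL \<omega>s) k - codim W (SL (\<omega> # \<omega>s)) k - ideal_codim (J \<omega>) k)"
proof (rule small_squeeze)
  have "small (CARD('n) - 2) (codim {()} (ufam (JD \<omega>)))" using small_JD[OF \<omega>] by (simp add: card_UNIV_option)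
  from small_diff[OF _ this, of "\<lambda>_. 0"]
  show "small (CARD('n) - 2) (\<lambda>k. 0 - codim {()} (ufam (JD \<omega>)) k)" by (simp add: small_def)
  from small_diff[OF _ small_J_shift[OF \<omega> d], of "\<lambda>_. 0"]
  show "small (CARD('n) - 2) (\<lambda>k. 0 - (ideal_codim (J \<omega>) k - ideal_codim (J \<omega>) (k - E (fst \<omega>))))" by (simp add: small_def)
  fix k
  show "0 - codim {()} (ufam (JD \<omega>)) k \<le> codim W (SL \<omega>s) k - codim W (SL (\<omega> # \<omega>s)) k - ideal_codim (J \<omega>) k"
    using codim_SL_step(2)[OF \<omega> \<omega>s, of k] by linarith
  show "codim W (SL \<omega>s) k - codim W (SL (\<omega> # \<omega>s)) k - ideal_codim (J \<omega>) k \<le> 0 - (ideal_codim (J \<omega>) k - ideal_codim (J \<omega>) (k - E (fst \<omega>)))"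
    using codim_SL_step(1)[OF \<omega> \<omega>s, of k] by linarith
qed

lemma small_SL_sum:
  assumes d: "2 \<le> CARD('n)"
  shows "set \<omega>s \<subseteq> Om \<Longrightarrow> distinct \<omega>s \<Longrightarrow>
    small (CARD('n) - 2) (\<lambda>k. codim W Sk k - codim W (SL \<omega>s) k - (\<Sum>\<omega>\<in>set \<omega>s. ideal_codim (J \<omega>) k))"
proof (induction \<omega>s)
  case Nil
  have "SL [] = Sk" by (rule ext) (simp only: SL.simps)
  then show ?case by (simp add: small_def)
next
  case (Cons \<omega> \<omega>s)
  have 1: "\<omega> \<in> Om" "set \<omega>s \<subseteq> Om" "\<omega> \<notin> set \<omega>s" "distinct \<omega>s" using Cons.prems by simp_all
  have "codim W Sk k - codim W (SL (\<omega> # \<omega>s)) k - (\<Sum>\<omega>\<in>set (\<omega> # \<omega>s). ideal_codim (J \<omega>) k)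
    = (codim W Sk k - codim W (SL \<omega>s) k - (\<Sum>\<omega>\<in>set \<omega>s. ideal_codim (J \<omega>) k))
     + (codim W (SL \<omega>s) k - codim W (SL (\<omega> # \<omega>s)) k - ideal_codim (J \<omega>) k)" for k
    using 1(3) by (simp del: SL.simps)
  then show ?case using small_add[OF Cons.IH[OF 1(2,4)] small_SL_step[OF d 1(1-3)]] by (simp only:)
qed

lemma kills_SL:
  assumes \<omega>s: "set \<omega>s \<subseteq> Om" and units: "\<And>\<tau> p k. \<tau> \<in> W \<Longrightarrow> p \<in> forms (k - E \<xi>) \<Longrightarrow> unit_at \<tau> (sfac \<xi> * p) \<in> SL \<omega>s k"
  shows "kills W (SL \<omega>s) (missing \<xi>)"
  unfolding kills_def
proof (intro allI ballI)
  fix k and f :: "(real ^ 'n) set \<Rightarrow> 'n option mpoly" assume f: "f \<in> free_forms W k"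
  have eq: "pmul (prod_list (map lin (missing \<xi>))) f = (\<Sum>\<tau>'\<in>W. unit_at \<tau>' (sfac \<xi> * f \<tau>'))"
    unfolding sfac_def by (rule pmul_eq_sum_unit_at[OF finite_W prod_spaceD(2)[OF f]])
  show "pmul (prod_list (map lin (missing \<xi>))) f \<in> SL \<omega>s (k + E \<xi>)"
    unfolding eq
  proof (rule subspace_sum[OF gfamD(1)[OF gfam_SL[OF \<omega>s]]])
    fix \<tau> assume \<tau>: "\<tau> \<in> W"
    show "unit_at \<tau> (sfac \<xi> * f \<tau>) \<in> SL \<omega>s (k + E \<xi>)" by (rule units[OF \<tau>]) (use prod_spaceD(1)[OF f \<tau>] in simp)
  qed
qed

lemma unit_sfac_forms:
  assumes "\<tau> \<in> W" "p \<in> forms (k - E \<xi>)"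
  shows "unit_at \<tau> (sfac \<xi> * p) \<in> free_forms W k"
  using forms_mult[OF sfac_forms assms(2), of \<xi>] assms(1) subspace_0[OF subspace_forms]
  by (intro prod_spaceI) (auto simp: unit_at_def)

lemma dead_SL:
  assumes "dead \<xi> \<tau>" "\<tau> \<in> W" "p \<in> forms (k - E \<xi>)"
  shows "unit_at \<tau> (sfac \<xi> * p) \<in> SL \<omega>s k"
proof -
  have "unit_at \<tau> (sfac \<xi> * p) \<in> Sk k"
    unfolding Sk_def by (rule IntI[OF assms(1)[unfolded dead_def, rule_format] unit_sfac_forms[OF assms(2,3)]])
  then show ?thesis using Sk_SL by (rule subsetD[rotated])
qed

text \<open>Rows on paths and rows missing \<xi> are dead already; every row on a circle is linked
  to its reference row, whose multiples of \<open>sfac \<xi>\<close> have been adjoined.\<close>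

lemma kills_Xi:
  assumes \<omega>s: "set \<omega>s = Om" and \<xi>: "\<xi> \<in> Xi"
  shows "kills W (SL \<omega>s) (missing \<xi>)"
proof (rule kills_SL)
  show sub: "set \<omega>s \<subseteq> Om" using \<omega>s by simp
  fix \<tau> k and p :: "'n option mpoly" assume \<tau>: "\<tau> \<in> W" and p: "p \<in> forms (k - E \<xi>)"
  show "unit_at \<tau> (sfac \<xi> * p) \<in> SL \<omega>s k"
  proof (cases "dead \<xi> \<tau>")
    case True
    then show ?thesis by (rule dead_SL[OF _ \<tau> p])
  next
    case False
    then have "thr \<xi> \<tau>" using dead_missing[OF \<tau>] by blast
    then obtain \<psi> where \<psi>: "(\<xi>, \<psi>) \<in> Om" "\<tau> \<in> tA (\<xi>, \<psi>)" using dead_or_circle[OF \<xi> \<tau>] False by blast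
    obtain c where c: "c \<in> forms 0"
      "unit_at \<tau> (sfac \<xi> * p) - unit_at (tau0 (\<xi>, \<psi>)) (sfac \<xi> * (c * p)) \<in> S"
      using datumD(8)[OF \<psi>] unfolding linked_def fst_conv by (elim exE conjE) simp
    have cp: "c * p \<in> forms (k - E \<xi>)" using forms_mult[OF c(1) p] by simp
    have "unit_at \<tau> (sfac \<xi> * p) - unit_at (tau0 (\<xi>, \<psi>)) (sfac \<xi> * (c * p)) \<in> free_forms W k"
      by (rule subspace_diff[OF subspace_free_forms unit_sfac_forms[OF \<tau> p] unit_sfac_forms[OF tau0_W[OF \<psi>(1)] cp]])
    then have "unit_at \<tau> (sfac \<xi> * p) - unit_at (tau0 (\<xi>, \<psi>)) (sfac \<xi> * (c * p)) \<in> Sk k" unfolding Sk_def using c(2) by (intro IntI)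
    then have 1: "unit_at \<tau> (sfac \<xi> * p) - unit_at (tau0 (\<xi>, \<psi>)) (sfac \<xi> * (c * p)) \<in> SL \<omega>s k"
      using Sk_SL by (rule subsetD[rotated])
    have "unit_at (tau0 (\<xi>, \<psi>)) (sfac (fst (\<xi>, \<psi>)) * (c * p)) \<in> SL \<omega>s k"
      by (rule SL_unit[OF sub]) (use \<psi>(1) \<omega>s cp in simp_all)
    from subspace_add[OF gfamD(1)[OF gfam_SL[OF sub]] 1 this] show ?thesis by simp
  qed
qed

text \<open>The three levels of \<open>small_three\<close> are the whole space, the hyperplane of
  one wall and the intersection of two. Each list \<open>missing\<close> consists of normals outside
  the span of those chosen before, which is the independence required.\<close>

lemma small_codim_SL:
  assumes \<omega>s: "set \<omega>s = Om"
  shows "small (CARD('n option) - 3) (codim W (SL \<omega>s))"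
proof -
  have sub: "set \<omega>s \<subseteq> Om" using \<omega>s by simp
  have flat0: "flat {} = (UNIV :: (real ^ 'n option) set)" by (simp add: flat_def)
  show ?thesis
  proof (rule small_three[OF finite_W gfam_SL[OF sub]])
    show "kills W (SL \<omega>s) (missing UNIV)" by (rule kills_SL[OF sub]) (rule dead_SL[OF dead_UNIV])
    fix a assume "a \<in> set (missing UNIV)"
    then have "a \<in> set (missing (flat {}))" by (simp only: flat0)
    note a0 = missing_not_span[OF this]
    obtain \<tau>1 where \<tau>1: "\<tau>1 \<in> W" "a = nv \<tau>1" using a0(3) by (elim bexE)
    have k: "kills W (SL \<omega>s) (missing (flat {a}))"
      unfolding \<tau>1(2) by (rule kills_SL[OF sub]) (rule dead_SL[OF dead_hyperplane[OF \<tau>1(1)]])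
    have "b \<notin> span {a} \<and> (\<exists>cs. kills W (SL \<omega>s) cs \<and> (\<forall>c\<in>set cs. c \<notin> span {a, b}))"
      if b: "b \<in> set (missing (flat {a}))" for b
    proof -
      note b0 = missing_not_span[OF b]
      obtain \<tau>2 where \<tau>2: "\<tau>2 \<in> W" "b = nv \<tau>2" using b0(3) by (elim bexE)
      have "flat {a, b} \<in> Xi" unfolding Xi_def using \<tau>1 \<tau>2 b0(2)
        by (intro CollectI exI[of _ \<tau>1] exI[of _ \<tau>2]) simp
      then have "kills W (SL \<omega>s) (missing (flat {a, b}))" by (rule kills_Xi[OF \<omega>s])
      moreover have "\<forall>c\<in>set (missing (flat {a, b})). c \<notin> span {a, b}" using missing_not_span(2) by (intro ballI)
      ultimately show ?thesis using b0(2) by (intro conjI exI)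
    qed
    then have "\<forall>b\<in>set (missing (flat {a})). b \<notin> span {a} \<and> (\<exists>cs. kills W (SL \<omega>s) cs \<and> (\<forall>c\<in>set cs. c \<notin> span {a, b}))"
      by (intro ballI)
    then show "a \<noteq> 0 \<and> (\<exists>bs. kills W (SL \<omega>s) bs \<and> (\<forall>b\<in>set bs. b \<notin> span {a} \<and>
        (\<exists>cs. kills W (SL \<omega>s) cs \<and> (\<forall>c\<in>set cs. c \<notin> span {a, b}))))"
      using a0(1) k by (intro conjI exI[of _ "missing (flat {a})"])
  qed
qed

lemma small_codim_Sk:
  assumes d: "2 \<le> CARD('n)"
  shows "small (CARD('n) - 2) (\<lambda>k. codim W Sk k - (\<Sum>\<omega>\<in>Om. ideal_codim (J \<omega>) k))"
proof -
  obtain \<omega>s where \<omega>s: "set \<omega>s = Om" "distinct \<omega>s" using finite_distinct_list[OF finite_Om] by (elim exE conjE)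
  have "small (CARD('n) - 2) (codim W (SL \<omega>s))" using small_codim_SL[OF \<omega>s(1)] by (simp add: card_UNIV_option)
  moreover have "small (CARD('n) - 2) (\<lambda>k. codim W Sk k - codim W (SL \<omega>s) k - (\<Sum>\<omega>\<in>Om. ideal_codim (J \<omega>) k))"
    using small_SL_sum[OF d _ \<omega>s(2)] \<omega>s(1) by simp
  ultimately have "small (CARD('n) - 2) (\<lambda>k. codim W (SL \<omega>s) k + (codim W Sk k - codim W (SL \<omega>s) k - (\<Sum>\<omega>\<in>Om. ideal_codim (J \<omega>) k)))"
    by (rule small_add)
  then show ?thesis by (simp add: algebra_simps)
qed

end

section \<open>Associated primes\<close>

lemma hilbert_coeff_eventually:
  assumes "\<forall>\<^sub>F k in sequentially. real (hilbert_function M (int k)) = poly p (real k)"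
  shows "hilbert_coeff i M = coeff p i"
proof -
  obtain K where "\<forall>k\<ge>K. real (hilbert_function M (int k)) = poly p (real k)"
    using assms unfolding eventually_sequentially by (elim exE)
  then show ?thesis by (intro hilbert_coeffI[of K]) simp
qed

context spline_complex
begin

text \<open>Unfolds the coset operations of the cokernel, so that annihilators of elements of
  \<open>N\<close> become conditions of membership in \<open>S\<close>.\<close>

lemma associated_primes_iff:
  "Q \<in> associated_primes poly_ring (coker_N P l bd r) \<longleftrightarrow>
     primeideal Q poly_ring \<and> (\<exists>x\<in>free W. Q = {p. pmul p x \<in> S})"
proof -
  let ?N = "coker_N P l bd r"
  define h where "h x = (\<lambda>s. s + x) ` S" for x
  have N: "?N = quot_gmodule (free_gmodule W) S" unfolding coker_N_def spline_map_image ..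
  have coset: "S +>\<^bsub>free_gmodule W\<^esub> x = h x" for x
    by (auto simp: a_r_coset_def r_coset_def free_gmodule_def h_def plus_fun_def)
  have h_eq: "h x = h y \<longleftrightarrow> x - y \<in> S" for x y unfolding h_def by (rule subspace_coset_eq_iff[OF subspace_S])
  have carrier: "carrier ?N = h ` free W"
  proof -
    have "carrier ?N = (\<Union>x\<in>carrier (free_gmodule W). {S +>\<^bsub>free_gmodule W\<^esub> x})"
      by (simp add: N quot_gmodule_def A_RCOSETS_def RCOSETS_def a_r_coset_def)
    then show ?thesis unfolding coset carrier_free by auto
  qed
  have zero: "\<zero>\<^bsub>?N\<^esub> = h 0" by (simp add: N quot_gmodule_def h_def)
  have smult: "p \<odot>\<^bsub>?N\<^esub> h x = h (pmul p x)" for p x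
  proof -
    have "p \<odot>\<^bsub>?N\<^esub> h x = (\<Union>a\<in>h x. h (pmul p a))"
      by (simp add: N quot_gmodule_def coset) (simp add: free_gmodule_def pmul_def)
    also have "\<dots> = (\<Union>a\<in>h x. h (pmul p x))"
    proof (rule SUP_cong)
      fix a assume "a \<in> h x"
      then obtain s where s: "s \<in> S" "a = s + x" unfolding h_def by (elim imageE)
      have "pmul p a - pmul p x = pmul p s" unfolding s(2) by (simp add: fun_eq_iff distrib_left)
      then show "h (pmul p a) = h (pmul p x)" using S_pmul[OF s(1), of p] by (simp only: h_eq)
    qed simp
    also have "\<dots> = h (pmul p x)"
    proof -
      have "h x \<noteq> {}" using subspace_0[OF subspace_S] by (auto simp: h_def)
      then show ?thesis by simp
    qed
    finally show ?thesis .
  qed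
  have ann: "{p \<in> carrier poly_ring. p \<odot>\<^bsub>?N\<^esub> h x = \<zero>\<^bsub>?N\<^esub>} = {p. pmul p x \<in> S}" for x
    by (simp add: smult zero h_eq poly_ring_def)
  show ?thesis unfolding associated_primes_def mem_Collect_eq carrier by (simp only: bex_simps ann)
qed

lemma pmul_dead:
  assumes dead: "\<And>\<tau>. \<tau> \<in> W \<Longrightarrow> dead \<xi> \<tau>" and x: "x \<in> free W"
  shows "pmul (sfac \<xi>) x \<in> S"
proof -
  have eq: "pmul (sfac \<xi>) x = (\<Sum>\<tau>'\<in>W. unit_at \<tau>' (sfac \<xi> * x \<tau>'))"
    by (rule pmul_eq_sum_unit_at[OF finite_W prod_spaceD(2)[OF x]])
  show ?thesis unfolding eq by (rule subspace_sum[OF subspace_S]) (rule dead[unfolded dead_def, rule_format])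
qed

text \<open>\<open>Q\<close> contains the product that annihilates \<open>N\<close> generically,
  hence a wall form; it then contains the product attached to that hyperplane, hence a second,
  independent wall form. A prime of codimension two containing both is the ideal of their common
  zeros.\<close>

lemma associated_prime_Xi:
  assumes Q: "Q \<in> associated_primes poly_ring (coker_N P l bd r)" and codim: "prime_codim poly_ring Q = 2"
  shows "\<exists>\<xi>\<in>Xi. Q = van \<xi>"
proof -
  have prime: "primeideal Q poly_ring" using Q by (simp only: associated_primes_iff)
  obtain x where x: "x \<in> free W" "Q = {p. pmul p x \<in> S}" using Q unfolding associated_primes_iff by (elim conjE bexE)
  have wall: "\<exists>\<tau>\<in>W. lin (nv \<tau>) \<in> Q \<and> nv \<tau> \<notin> span A" if dead: "\<And>\<tau>. \<tau> \<in> W \<Longrightarrow> dead (flat A) \<tau>" for A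
  proof -
    have "prod_list (map lin (missing (flat A))) \<in> Q" using pmul_dead[OF dead x(1)] unfolding x(2) sfac_def by simp
    from prime_prod_list[OF prime this] obtain a where a: "a \<in> set (missing (flat A))" "lin a \<in> Q" by auto
    from missing_not_span(3)[OF a(1)] obtain \<tau> where \<tau>: "\<tau> \<in> W" "a = nv \<tau>" by (elim bexE)
    show ?thesis using missing_not_span(2)[OF a(1)] a(2) \<tau> by (intro bexI[of _ \<tau>]) simp_all
  qed
  have flat0: "flat {} = (UNIV :: (real ^ 'n option) set)" by (simp add: flat_def)
  obtain \<tau>1 where \<tau>1: "\<tau>1 \<in> W" "lin (nv \<tau>1) \<in> Q" using wall[of "{}"] dead_UNIV unfolding flat0 by blast
  obtain \<tau>2 where \<tau>2: "\<tau>2 \<in> W" "lin (nv \<tau>2) \<in> Q" "nv \<tau>2 \<notin> span {nv \<tau>1}" using wall[OF dead_hyperplane[OF \<tau>1(1)]] by blast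
  have "plane (nv \<tau>1) (nv \<tau>2)" using normal[OF W_walls[OF \<tau>1(1)]] \<tau>2(3) by (simp add: plane_def)
  then have "Q = van (flat {nv \<tau>1, nv \<tau>2})" by (rule plane.prime_over_van_flat[OF _ prime \<tau>1(2) \<tau>2(2) codim])
  moreover have "flat {nv \<tau>1, nv \<tau>2} \<in> Xi" unfolding Xi_def using \<tau>1(1) \<tau>2(1,3) by (intro CollectI exI[of _ \<tau>1] exI[of _ \<tau>2] conjI refl)
  ultimately show ?thesis by (intro bexI)
qed

text \<open>The witness is the socle element \<open>g\<close> times \<open>sfac\<close>, placed in
  the reference row. The functional of the circle turns an annihilator p into
  \<open>sfac (fst \<omega>) * p\<close> vanishing on the subspace, and \<open>sfac\<close> itself
  is outside that prime.\<close>

lemma circle_associated_prime: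
  assumes \<omega>: "\<omega> \<in> Om"
  shows "van (fst \<omega>) \<in> associated_primes poly_ring (coker_N P l bd r)"
proof -
  obtain u v where uv: "fst \<omega> = flat {u, v}" "u \<noteq> 0" "v \<noteq> 0" "v \<notin> span {u}" "u \<notin> span {v}"
    "u \<in> nv ` tA \<omega>" "v \<in> nv ` tA \<omega>" "lin u ^ (r + 1) \<in> J \<omega>" "lin v ^ (r + 1) \<in> J \<omega>"
    by (rule J_generators[OF \<omega>])
  have pl: "plane u v" using uv(2,4) by (simp add: plane_def)
  have span: "nv ` tA \<omega> \<subseteq> span {u, v}"
  proof
    fix a assume "a \<in> nv ` tA \<omega>"
    then obtain \<tau> where \<tau>: "\<tau> \<in> tA \<omega>" "a = nv \<tau>" by (elim imageE)
    show "a \<in> span {u, v}" using tA_W[OF \<tau>(1)] thr_flat[OF W_walls[OF tA_W(1)[OF \<tau>(1)]], of "{u, v}"] \<tau>(2) by (simp add: uv(1))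
  qed
  have "(\<lambda>a. lin a ^ Suc r) ` nv ` tA \<omega> = (\<lambda>\<tau>. l \<tau> ^ (r + 1)) ` tA \<omega>"
    unfolding image_image by (rule image_cong) (simp_all add: l_lin[OF W_walls[OF tA_W(1)]])
  then have J: "J \<omega> = Idl\<^bsub>poly_ring\<^esub> ((\<lambda>a. lin a ^ Suc r) ` nv ` tA \<omega>)" using datumD(2)[OF \<omega>] by simp
  obtain g where g: "\<And>p. p * g \<in> J \<omega> \<longleftrightarrow> p \<in> van (flat {u, v})"
    by (rule plane.socle_element[OF pl span uv(6,7) J]) blast
  note id = ideal_J[OF \<omega>]
  have sub: "subspace (fst \<omega>)" unfolding uv(1) by (rule subspace_flat)
  define x where "x = unit_at (tau0 \<omega>) (sfac (fst \<omega>) * g)"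
  have "p \<in> van (fst \<omega>) \<longleftrightarrow> pmul p x \<in> S" for p
  proof -
    have px: "pmul p x = unit_at (tau0 \<omega>) (sfac (fst \<omega>) * (p * g))"
      unfolding x_def pmul_unit_at by (simp only: mult.left_commute)
    show ?thesis
    proof
      assume "p \<in> van (fst \<omega>)"
      then have "p * g \<in> J \<omega>" using g uv(1) by simp
      then show "pmul p x \<in> S" unfolding px by (rule J_kills_tau0[OF \<omega>])
    next
      assume "pmul p x \<in> S"
      then have 1: "Ph \<omega> (unit_at (tau0 \<omega>) (sfac (fst \<omega>) * (p * g))) \<in> J \<omega>" unfolding px by (rule datumD(4)[OF \<omega>])
      obtain b where b: "b * b = 1" "\<forall>q. Ph \<omega> (unit_at (tau0 \<omega>) q) = b * q" using datumD(7)[OF \<omega>] by (elim exE conjE)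
      have "b * (b * (sfac (fst \<omega>) * (p * g))) \<in> J \<omega>" using idealD(3)[OF id 1, of b] b(2) by simp
      moreover have "b * (b * (sfac (fst \<omega>) * (p * g))) = (sfac (fst \<omega>) * p) * g"
        using b(1) by (simp only: mult.assoc[symmetric] mult_1)
      ultimately have "sfac (fst \<omega>) * p \<in> van (fst \<omega>)" using g uv(1) by simp
      then show "p \<in> van (fst \<omega>)" using van_prime[OF sub] sfac_not_van[OF sub] by blast
    qed
  qed
  then have "van (fst \<omega>) = {p. pmul p x \<in> S}" by blast
  moreover have "x \<in> free W" unfolding x_def by (rule unit_at_free[OF tau0_W[OF \<omega>]])
  ultimately show ?thesis unfolding associated_primes_iff using primeideal_van[OF sub] by (intro conjI bexI)
qed

lemma Xi_van:
  assumes "\<xi> \<in> Xi"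
  shows "zero_locus (van \<xi>) = \<xi>" "prime_codim poly_ring (van \<xi>) = 2"
proof -
  obtain \<tau>1 \<tau>2 where x: "plane (nv \<tau>1) (nv \<tau>2)" "\<xi> = flat {nv \<tau>1, nv \<tau>2}" using XiE[OF assms] .
  show "zero_locus (van \<xi>) = \<xi>" unfolding x(2) by (rule plane.zero_locus_van_flat[OF x(1)])
  show "prime_codim poly_ring (van \<xi>) = 2" unfolding x(2) by (rule plane.prime_codim_van_flat[OF x(1)])
qed

text \<open>Primes and subspaces correspond through \<open>van\<close> and
  \<open>zero_locus\<close>. A member of \<open>Xi\<close> whose ideal is not associated carries no
  circle and contributes an empty sum.\<close>

lemma sum_associated_primes:
  fixes f :: "(real ^ 'n option) set \<Rightarrow> (real ^ 'n) set graph \<Rightarrow> real"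
  shows "(\<Sum>Q | Q \<in> associated_primes poly_ring (coker_N P l bd r) \<and> prime_codim poly_ring Q = 2.
      \<Sum>\<psi>\<in>circle_components (G (zero_locus Q)). f (zero_locus Q) \<psi>) = (\<Sum>\<omega>\<in>Om. f (fst \<omega>) (snd \<omega>))"
    (is "sum ?g ?A = _")
proof -
  define Y where "Y = {\<xi> \<in> Xi. van \<xi> \<in> ?A}"
  have inj: "inj_on van Y"
  proof (rule inj_onI)
    fix \<xi> \<xi>' assume y: "\<xi> \<in> Y" "\<xi>' \<in> Y" and eq: "van \<xi> = van \<xi>'"
    have "\<xi> \<in> Xi" "\<xi>' \<in> Xi" using y by (simp_all add: Y_def)
    then show "\<xi> = \<xi>'" using Xi_van(1) eq by metis
  qed
  have A: "?A = van ` Y"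
  proof (intro equalityI subsetI)
    fix Q assume Q: "Q \<in> ?A"
    then obtain \<xi> where \<xi>: "\<xi> \<in> Xi" "Q = van \<xi>" using associated_prime_Xi[of Q] by blast
    then have "\<xi> \<in> Y" unfolding Y_def using Q by blast
    then show "Q \<in> van ` Y" using \<xi>(2) by (intro image_eqI)
  next
    fix Q assume "Q \<in> van ` Y"
    then obtain \<xi> where "\<xi> \<in> Y" "Q = van \<xi>" by (elim imageE)
    then show "Q \<in> ?A" unfolding Y_def by blast
  qed
  have "sum ?g ?A = (\<Sum>\<xi>\<in>Y. ?g (van \<xi>))" unfolding A by (subst sum.reindex[OF inj]) (simp only: o_def)
  also have "\<dots> = (\<Sum>\<xi>\<in>Y. \<Sum>\<psi>\<in>circle_components (G \<xi>). f \<xi> \<psi>)"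
  proof (rule sum.cong[OF refl])
    fix \<xi> assume "\<xi> \<in> Y"
    then have "zero_locus (van \<xi>) = \<xi>" using Xi_van(1) by (simp add: Y_def)
    then show "?g (van \<xi>) = (\<Sum>\<psi>\<in>circle_components (G \<xi>). f \<xi> \<psi>)" by (simp only:)
  qed
  also have "\<dots> = (\<Sum>\<xi>\<in>Xi. \<Sum>\<psi>\<in>circle_components (G \<xi>). f \<xi> \<psi>)"
  proof (rule sum.mono_neutral_left[OF finite_Xi])
    show "Y \<subseteq> Xi" by (auto simp: Y_def)
    show "\<forall>\<xi>\<in>Xi - Y. (\<Sum>\<psi>\<in>circle_components (G \<xi>). f \<xi> \<psi>) = 0"
    proof
      fix \<xi> assume \<xi>: "\<xi> \<in> Xi - Y"
      have "\<psi> \<notin> circle_components (G \<xi>)" for \<psi>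
      proof
        assume "\<psi> \<in> circle_components (G \<xi>)"
        then have "(\<xi>, \<psi>) \<in> Om" using \<xi> by simp
        from circle_associated_prime[OF this] have "van \<xi> \<in> associated_primes poly_ring (coker_N P l bd r)" by simp
        then have "\<xi> \<in> Y" unfolding Y_def using \<xi> Xi_van(2) by simp
        then show False using \<xi> by simp
      qed
      then have "circle_components (G \<xi>) = {}" by blast
      then show "(\<Sum>\<psi>\<in>circle_components (G \<xi>). f \<xi> \<psi>) = 0" by (simp only: sum.empty)
    qed
  qed
  also have "\<dots> = (\<Sum>(\<xi>, \<psi>)\<in>Om. f \<xi> \<psi>)"
    by (rule sum.Sigma) (simp_all add: finite_Xi finite_circle_components)
  finally show ?thesis unfolding case_prod_beta .
qed

text \<open>All functions involved are eventually polynomial, so the growth estimate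
  \<open>small_codim_Sk\<close> becomes an equality of coefficients.\<close>

theorem hilbert_coeff_splines:
  assumes d: "2 \<le> CARD('n)"
  shows "hilbert_coeff (CARD('n) - 2) (splines P l r) =
      (real (card C) - real (card W))
          * hilbert_coeff (CARD('n) - 2) (ring_gmodule :: ('n option mpoly, 'n option mpoly) gmodule)
      + real (card W)
          * hilbert_coeff (CARD('n) - 2)
              (twist ring_gmodule (- int r - 1) :: ('n option mpoly, 'n option mpoly) gmodule)
      + (\<Sum>\<omega>\<in>Om. hilbert_coeff (CARD('n) - 2) (quot_gmodule ring_gmodule (J \<omega>)))"
proof -
  let ?m = "CARD('n) - 2"
  let ?R = "\<lambda>k. real (dim (forms (int k) :: 'n option mpoly set))"
  let ?T = "\<lambda>k. real (dim (forms (rk (int k)) :: 'n option mpoly set))"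
  have evR: "evpoly ?R" by (rule evpoly_forms)
  \<comment> \<open>Subtraction of natural numbers matches the integer degree only from k = r + 1
    on, which is enough for an eventual statement.\<close>
  have evT: "evpoly ?T" by (rule evpoly_cong[OF evpoly_shift[OF evR, of "r + 1"], of "r + 1"]) (simp add: of_nat_diff)
  have "evpoly (\<lambda>k. real (card W) * ?R k - real (dim (Sk (int k))))"
    by (rule evpoly_diff[OF evpoly_mult_left[OF evR] evpoly_dim_gfam[OF finite_W gfam_Sk]])
  then have evS: "evpoly (\<lambda>k. codim W Sk (int k))"
    by (rule evpoly_cong) (simp add: codim_def dim_free_forms[OF finite_W])
  obtain pR where pR: "\<forall>\<^sub>F k in sequentially. ?R k = poly pR (real k)" using evR unfolding evpoly_def by (elim exE)
  obtain pT where pT: "\<forall>\<^sub>F k in sequentially. ?T k = poly pT (real k)" using evT unfolding evpoly_def by (elim exE)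
  obtain pS where pS: "\<forall>\<^sub>F k in sequentially. codim W Sk (int k) = poly pS (real k)" using evS unfolding evpoly_def by (elim exE)
  have "\<forall>\<omega>\<in>Om. \<exists>p. \<forall>\<^sub>F k in sequentially. ideal_codim (J \<omega>) (int k) = poly p (real k)"
    using evpoly_ideal_codim[OF ideal_J] unfolding evpoly_def by (intro ballI)
  from bchoice[OF this] obtain pJ where
    pJ: "\<forall>\<omega>\<in>Om. \<forall>\<^sub>F k in sequentially. ideal_codim (J \<omega>) (int k) = poly (pJ \<omega>) (real k)" by (elim exE)
  have all: "\<forall>\<^sub>F k in sequentially. \<forall>\<omega>\<in>Om. ideal_codim (J \<omega>) (int k) = poly (pJ \<omega>) (real k)"
    by (rule eventually_ball_finite[OF finite_Om pJ])
  have hR: "hilbert_coeff ?m (ring_gmodule :: ('n option mpoly, 'n option mpoly) gmodule) = coeff pR ?m"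
    using pR by (intro hilbert_coeff_eventually) (simp only: hilbert_function_ring)
  have hT: "hilbert_coeff ?m (twist ring_gmodule (- int r - 1) :: ('n option mpoly, 'n option mpoly) gmodule) = coeff pT ?m"
  proof (rule hilbert_coeff_eventually)
    have "- int r - 1 + int k = rk (int k)" for k by simp
    then show "\<forall>\<^sub>F k in sequentially. real (hilbert_function (twist ring_gmodule (- int r - 1)
        :: ('n option mpoly, 'n option mpoly) gmodule) (int k)) = poly pT (real k)"
      using pT by (simp only: hilbert_function_twist_ring)
  qed
  have hJ: "hilbert_coeff ?m (quot_gmodule ring_gmodule (J \<omega>)) = coeff (pJ \<omega>) ?m" if "\<omega> \<in> Om" for \<omega>
    by (rule hilbert_coeff_eventually) (simp only: hilbert_function_quot_ring[OF ideal_J[OF that]] bspec[OF pJ that])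
  let ?p = "Polynomial.smult (real (card C) - real (card W)) pR + Polynomial.smult (real (card W)) pT + pS"
  have "hilbert_coeff ?m (splines P l r) = coeff ?p ?m"
  proof (rule hilbert_coeff_eventually)
    show "\<forall>\<^sub>F k in sequentially. real (hilbert_function (splines P l r) (int k)) = poly ?p (real k)"
      using pR pT pS
    proof eventually_elim
      case (elim k)
      then show ?case unfolding hilbert_function_splines by (simp only: poly_add poly_smult)
    qed
  qed
  moreover have "coeff pS ?m = (\<Sum>\<omega>\<in>Om. coeff (pJ \<omega>) ?m)"
  proof -
    let ?q = "pS - (\<Sum>\<omega>\<in>Om. pJ \<omega>)"
    have "\<forall>\<^sub>F k in sequentially. codim W Sk (int k) - (\<Sum>\<omega>\<in>Om. ideal_codim (J \<omega>) (int k)) = poly ?q (real k)"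
      using pS all
    proof eventually_elim
      case (elim k)
      have "(\<Sum>\<omega>\<in>Om. ideal_codim (J \<omega>) (int k)) = (\<Sum>\<omega>\<in>Om. poly (pJ \<omega>) (real k))"
        by (rule sum.cong[OF refl]) (rule bspec[OF elim(2)])
      then show ?case by (simp only: elim(1) poly_diff poly_sum)
    qed
    then have "coeff ?q ?m = 0" by (rule small_poly_coeff[OF small_codim_Sk[OF d]]) simp
    then show ?thesis by (simp add: coeff_sum)
  qed
  moreover have "(\<Sum>\<omega>\<in>Om. hilbert_coeff ?m (quot_gmodule ring_gmodule (J \<omega>))) = (\<Sum>\<omega>\<in>Om. coeff (pJ \<omega>) ?m)"
    by (rule sum.cong[OF refl hJ])
  ultimately show ?thesis unfolding hR hT by (simp only: coeff_add coeff_smult)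
qed

end

theorem corollary3p11:
  fixes P :: "(real ^ 'n) set set"
    and l :: "(real ^ 'n) set \<Rightarrow> 'n option mpoly"
    and bd :: "(real ^ 'n) set \<Rightarrow> (real ^ 'n) set \<Rightarrow> 'n option mpoly"
    and r d :: nat
  defines "d \<equiv> CARD('n)"
  assumes "2 \<le> d"
    and "polyhedral_complex P" and "cells P \<noteq> {}" and "hereditary P"
    and "wall_forms P l" and "boundary_matrix P bd"
  shows "hilbert_coeff (d - 2) (splines P l r) =
      (real (card (cells P)) - real (card (interior_walls P)))
          * hilbert_coeff (d - 2) (ring_gmodule :: ('n option mpoly, 'n option mpoly) gmodule)
      + real (card (interior_walls P))
          * hilbert_coeff (d - 2)
              (twist ring_gmodule (- int r - 1) :: ('n option mpoly, 'n option mpoly) gmodule)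
      + (\<Sum>Q | Q \<in> associated_primes poly_ring (coker_N P l bd r) \<and> prime_codim poly_ring Q = 2.
           \<Sum>\<psi>\<in>circle_components (span_graph P l (zero_locus Q)).
             hilbert_coeff (d - 2) (quot_gmodule ring_gmodule (edge_ideal P l r (zero_locus Q) \<psi>)))"
proof -
  interpret spline_complex P l bd r by unfold_locales (fact assms)+
  have d: "2 \<le> CARD('n)" using assms by simp
  show ?thesis
    unfolding d_def hilbert_coeff_splines[OF d]
      sum_associated_primes[of "\<lambda>\<xi> \<psi>. hilbert_coeff (CARD('n) - 2) (quot_gmodule ring_gmodule (edge_ideal P l r \<xi> \<psi>))"] ..
qed

end
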